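(* Let $n\ge1$. For every group $G=G(m,p,n)$, the invariant subring $O_q(\mathsf{k}^{*2n})^G$ of the quantum torus is a Galois order over $\Gamma=\mathsf{k}[x_1^{\pm1},\dots,x_n^{\pm1}]^G$ in $(\mathsf{k}(x_1,\dots,x_n)*\mathbb{Z}^n)^G$. Moreover, $O_q(\mathsf{k}^{*2n})^G$ is free as a left $\Gamma$-module and free as a right $\Gamma$-module.
   Context: $\mathsf{k}$ is an algebraically closed field of characteristic $0$; all rings are $\mathsf{k}$-algebras; $q\in\mathsf{k}$ is nonzero and not a root of unity. Quantum torus: the quantum plane is $\mathsf{k}_q[x,y]=\mathsf{k}\langle x,y\mid yx=qxy\rangle$, and $O_q(\mathsf{k}^{2n})=\mathsf{k}_q[x_1,y_1]\otimes_{\mathsf{k}}\cdots\otimes_{\mathsf{k}}\mathsf{k}_q[x_n,y_n]$. The quantum torus $O_q(\mathsf{k}^{*2n})$ is the localization of $O_q(\mathsf{k}^{2n})$ by $x_1,\dots,x_n,y_1,\dots,y_n$. It is isomorphic to $\mathsf{k}[x_1^{\pm1},\dots,x_n^{\pm1}]*\mathbb{Z}^n$ via $x_i\mapsto x_i$, $y_i\mapsto\epsilon_i$, where $\epsilon_1,\dots,\epsilon_n$ is a basis of $\mathbb{Z}^n$ acting by $\epsilon_i(x_i)=qx_i$, $\epsilon_i(x_j)=x_j$ for $j\neq i$; via this map it is regarded as a subring of $\mathsf{k}(x_1,\dots,x_n)*\mathbb{Z}^n$. Group and action: $G_m\subset\mathsf{k}^*$ is the group of $m$-th roots of unity. For $m\ge1$,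 $n\ge1$, $p>0$ with $p\mid m$, $A(m,p,n)=\{(h_1,\dots,h_n)\in G_m^{n}\mid(h_1\cdots h_n)^{m/p}=1\}$ and $G(m,p,n)=A(m,p,n)\rtimes S_n$, with $S_n$ permuting the entries. An element $h=(g,\pi)$ acts by algebra automorphisms with $h(x_i)=g_ix_{\pi(i)}$, $h(y_i)=y_{\pi(i)}$; on $\mathsf{k}(x_1,\dots,x_n)*\mathbb{Z}^n$ it acts by $h(x_i)=g_ix_{\pi(i)}$, $h(\epsilon_i)=\epsilon_{\pi(i)}$ (conjugation action on $\mathbb{Z}^n$). Galois orders: Let $\Gamma$ be a commutative domain with field of fractions $K$, $L$ a finite Galois extension of $K$ with Galois group $G=\mathrm{Gal}(L/K)$, and $\mathfrak{M}\subset\mathrm{Aut}_{\mathsf{k}}L$ a monoid such that any $m,m'\in\mathfrak{M}$ with the same restriction to $K$ are equal, and on which $G$ acts by conjugation. $L*\mathfrak{M}$ is the skew monoid ring ($m\ell=m(\ell)m$), with $G$ acting by $g(\ell m)=g(\ell)\,(gmg^{-1})$. A finitely generated $\Gamma$-ring $U$ with $\Gamma\subset U\subset(L*\mathfrak{M})^G$ is a Galois ring over $\Gamma$ if $KU=UK=(L*\mathfrak{M})^G$. It is a right (left) Galois order over $\Gamma$ in $(L*\mathfrak{M})^G$ if moreover for every finite-dimensional right (left) $K$-subspace $W\subset(L*\mathfrak{M})^G$, $W\cap U$ is a finitely generated right (left) $\Gamma$-module; it is a Galois order if it is both a left and a right Galois order. Here $L=\mathsf{k}(x_1,\dots,x_n)$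 and $\mathfrak{M}=\mathbb{Z}^n$. *)

theory Defs
  imports
    "HOL-Algebra.Algebra"
    "HOL-Algebra.Algebraic_Closure_Type"
    "HOL-Computational_Algebra.Fraction_Field"
    "HOL-Library.Poly_Mapping"
begin

section \<open>Modules inside a ring\<close>

text \<open>
  For a subset \<open>S\<close> of a ring \<open>A\<close>, \<open>left_span A S E\<close> is the additive subgroup \<open>S E\<close> generated by
  the products \<open>s e\<close>. If \<open>S\<close> is a subring, this is the left \<open>S\<close>-submodule generated by \<open>E\<close>.
\<close>

definition left_span :: "('a, 'b) ring_scheme \<Rightarrow> 'a set \<Rightarrow> 'a set \<Rightarrow> 'a set" where
  "left_span A S E = generate (add_monoid A) (S <#>\<^bsub>A\<^esub> E)"

definition right_span :: "('a, 'b) ring_scheme \<Rightarrow> 'a set \<Rightarrow> 'a set \<Rightarrow> 'a set" where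
  "right_span A S E = generate (add_monoid A) (E <#>\<^bsub>A\<^esub> S)"

definition left_free :: "('a, 'b) ring_scheme \<Rightarrow> 'a set \<Rightarrow> 'a set \<Rightarrow> bool" where
  "left_free A S M \<longleftrightarrow> (\<exists>B \<subseteq> M. left_span A S B = M \<and>
     (\<forall>F c. finite F \<and> F \<subseteq> B \<and> c \<in> F \<rightarrow> S \<and> (\<Oplus>\<^bsub>A\<^esub>b\<in>F. c b \<otimes>\<^bsub>A\<^esub> b) = \<zero>\<^bsub>A\<^esub>
        \<longrightarrow> (\<forall>b\<in>F. c b = \<zero>\<^bsub>A\<^esub>)))"

definition right_free :: "('a, 'b) ring_scheme \<Rightarrow> 'a set \<Rightarrow> 'a set \<Rightarrow> bool" where
  "right_free A S M \<longleftrightarrow> (\<exists>B \<subseteq> M. right_span A S B = M \<and>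
     (\<forall>F c. finite F \<and> F \<subseteq> B \<and> c \<in> F \<rightarrow> S \<and> (\<Oplus>\<^bsub>A\<^esub>b\<in>F. b \<otimes>\<^bsub>A\<^esub> c b) = \<zero>\<^bsub>A\<^esub>
        \<longrightarrow> (\<forall>b\<in>F. c b = \<zero>\<^bsub>A\<^esub>)))"


section \<open>Galois orders\<close>

text \<open>
  The field \<open>L\<close> is a type of class \<open>field\<close>, seen as the record \<open>ring_of_type_algebra\<close>; subfields
  and subrings of it are sets.
  The extension \<open>L/K\<close> is finite Galois if it is finite-dimensional and \<open>K\<close> is the fixed field of
  its automorphism group.
\<close>

definition Aut_over :: "'l::field set \<Rightarrow> ('l \<Rightarrow> 'l) set" where
  "Aut_over K = {\<sigma> \<in> ring_iso ring_of_type_algebra ring_of_type_algebra. \<forall>x\<in>K. \<sigma> x = x}"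

definition finite_Galois :: "'l::field set \<Rightarrow> bool" where
  "finite_Galois K \<longleftrightarrow> subfield K ring_of_type_algebra \<and>
     ring.finite_dimension ring_of_type_algebra K UNIV \<and>
     {x. \<forall>\<sigma>\<in>Aut_over K. \<sigma> x = x} = K"

definition fractions :: "'l::field set \<Rightarrow> 'l set" where
  "fractions \<Gamma> = {a / b | a b. a \<in> \<Gamma> \<and> b \<in> \<Gamma> \<and> b \<noteq> 0}"

text \<open>
  Elements of the skew monoid ring \<open>L * M\<close> are the finitely supported functions \<open>M \<rightarrow> L\<close>, the
  function \<open>f\<close> standing for the sum of all \<open>f a \<cdot> a\<close>; the product is determined by
  \<open>(\<ell> a) (\<ell>' b) = \<ell> a(\<ell>') (a \<circ> b)\<close>.
\<close>

definition skew_ring :: "('l::field \<Rightarrow> 'l) set \<Rightarrow> (('l \<Rightarrow> 'l) \<Rightarrow> 'l) ring" where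
  "skew_ring M =
    \<lparr> carrier = {f. finite {a. f a \<noteq> 0} \<and> {a. f a \<noteq> 0} \<subseteq> M},
      monoid.mult = (\<lambda>f g c. \<Sum>a | f a \<noteq> 0. \<Sum>b | g b \<noteq> 0. if a \<circ> b = c then f a * a (g b) else 0),
      one = (\<lambda>a. if a = id then 1 else 0),
      ring.zero = (\<lambda>a. 0),
      add = (\<lambda>f g a. f a + g a) \<rparr>"

definition skew_monom :: "'l::field \<Rightarrow> ('l \<Rightarrow> 'l) \<Rightarrow> ('l \<Rightarrow> 'l) \<Rightarrow> 'l" where
  "skew_monom l a = (\<lambda>b. if b = a then l else 0)"

abbreviation skew_const :: "'l::field \<Rightarrow> ('l \<Rightarrow> 'l) \<Rightarrow> 'l" where
  "skew_const l \<equiv> skew_monom l id"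

text \<open>The action \<open>g(\<ell> a) = g(\<ell>) (g a g\<^sup>-\<^sup>1)\<close>, written on coefficient functions.\<close>

definition skew_act :: "('l \<Rightarrow> 'l) \<Rightarrow> (('l \<Rightarrow> 'l) \<Rightarrow> 'l) \<Rightarrow> ('l::field \<Rightarrow> 'l) \<Rightarrow> 'l" where
  "skew_act g f = (\<lambda>a. g (f (inv_into UNIV g \<circ> a \<circ> g)))"

definition skew_invariants :: "('l::field \<Rightarrow> 'l) set \<Rightarrow> ('l \<Rightarrow> 'l) set \<Rightarrow> (('l \<Rightarrow> 'l) \<Rightarrow> 'l) set" where
  "skew_invariants G M = {f \<in> carrier (skew_ring M). \<forall>g\<in>G. skew_act g f = f}"

text \<open>
  \<open>k\<close> is the ground field inside \<open>L\<close>. The field \<open>K\<close> of fractions of \<open>\<Gamma>\<close> is formed inside \<open>L\<close>.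
\<close>

definition Galois_data ::
  "'l::field set \<Rightarrow> 'l set \<Rightarrow> ('l \<Rightarrow> 'l) set \<Rightarrow> ('l \<Rightarrow> 'l) set \<Rightarrow> bool" where
  "Galois_data k \<Gamma> G M \<longleftrightarrow>
     subfield k ring_of_type_algebra \<and> subring \<Gamma> ring_of_type_algebra \<and> k \<subseteq> \<Gamma> \<and>
     finite_Galois (fractions \<Gamma>) \<and> G = Aut_over (fractions \<Gamma>) \<and>
     M \<subseteq> Aut_over k \<and> id \<in> M \<and> (\<forall>a\<in>M. \<forall>b\<in>M. a \<circ> b \<in> M) \<and>
     (\<forall>a\<in>M. \<forall>b\<in>M. (\<forall>x\<in>fractions \<Gamma>. a x = b x) \<longrightarrow> a = b) \<and>
     (\<forall>g\<in>G. \<forall>a\<in>M. g \<circ> a \<circ> inv_into UNIV g \<in> M)"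

definition Galois_ring ::
  "'l::field set \<Rightarrow> 'l set \<Rightarrow> ('l \<Rightarrow> 'l) set \<Rightarrow> ('l \<Rightarrow> 'l) set \<Rightarrow> (('l \<Rightarrow> 'l) \<Rightarrow> 'l) set \<Rightarrow> bool" where
  "Galois_ring k \<Gamma> G M U \<longleftrightarrow>
     Galois_data k \<Gamma> G M \<and>
     subring U (skew_ring M) \<and> skew_const ` \<Gamma> \<subseteq> U \<and> U \<subseteq> skew_invariants G M \<and>
     (\<exists>F. finite F \<and> F \<subseteq> U \<and> U = generate_ring (skew_ring M) (skew_const ` \<Gamma> \<union> F)) \<and>
     left_span (skew_ring M) (skew_const ` fractions \<Gamma>) U = skew_invariants G M \<and>
     right_span (skew_ring M) (skew_const ` fractions \<Gamma>) U = skew_invariants G M"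

definition left_Galois_order ::
  "'l::field set \<Rightarrow> 'l set \<Rightarrow> ('l \<Rightarrow> 'l) set \<Rightarrow> ('l \<Rightarrow> 'l) set \<Rightarrow> (('l \<Rightarrow> 'l) \<Rightarrow> 'l) set \<Rightarrow> bool" where
  "left_Galois_order k \<Gamma> G M U \<longleftrightarrow> Galois_ring k \<Gamma> G M U \<and>
     (\<forall>E. finite E \<and> E \<subseteq> skew_invariants G M \<longrightarrow>
       (let W = left_span (skew_ring M) (skew_const ` fractions \<Gamma>) E in
        \<exists>F. finite F \<and> F \<subseteq> W \<inter> U \<and> W \<inter> U = left_span (skew_ring M) (skew_const ` \<Gamma>) F))"

definition right_Galois_order ::
  "'l::field set \<Rightarrow> 'l set \<Rightarrow> ('l \<Rightarrow> 'l) set \<Rightarrow> ('l \<Rightarrow> 'l) set \<Rightarrow> (('l \<Rightarrow> 'l) \<Rightarrow> 'l) set \<Rightarrow> bool" where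
  "right_Galois_order k \<Gamma> G M U \<longleftrightarrow> Galois_ring k \<Gamma> G M U \<and>
     (\<forall>E. finite E \<and> E \<subseteq> skew_invariants G M \<longrightarrow>
       (let W = right_span (skew_ring M) (skew_const ` fractions \<Gamma>) E in
        \<exists>F. finite F \<and> F \<subseteq> W \<inter> U \<and> W \<inter> U = right_span (skew_ring M) (skew_const ` \<Gamma>) F))"

definition Galois_order ::
  "'l::field set \<Rightarrow> 'l set \<Rightarrow> ('l \<Rightarrow> 'l) set \<Rightarrow> ('l \<Rightarrow> 'l) set \<Rightarrow> (('l \<Rightarrow> 'l) \<Rightarrow> 'l) set \<Rightarrow> bool" where
  "Galois_order k \<Gamma> G M U \<longleftrightarrow> left_Galois_order k \<Gamma> G M U \<and> right_Galois_order k \<Gamma> G M U"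


section \<open>The group \<open>G(m,p,n)\<close>\<close>

text \<open>
  The indices \<open>1,\<dots>,n\<close> are the elements of a finite type \<open>'n\<close>, so \<open>n = CARD('n)\<close>. The product is
  the one for which \<open>h(x\<^sub>i) = g\<^sub>i x\<^bsub>\<pi>(i)\<^esub>\<close>, \<open>h = (g, \<pi>)\<close>, is a left action.
\<close>

definition Gmp :: "nat \<Rightarrow> nat \<Rightarrow> (('n::finite \<Rightarrow> 'k::field) \<times> ('n \<Rightarrow> 'n)) monoid" where
  "Gmp m p =
    \<lparr> carrier = {(g, \<pi>). (\<forall>i. g i ^ m = 1) \<and> (\<Prod>i\<in>UNIV. g i) ^ (m div p) = 1 \<and> bij \<pi>},
      monoid.mult = (\<lambda>(g, \<pi>) (g', \<pi>'). (\<lambda>i. g' i * g (\<pi>' i), \<pi> \<circ> \<pi>')),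
      one = (\<lambda>i. 1, id) \<rparr>"

lemma group_Gmp:
  assumes "m \<ge> 1"
  shows "group (Gmp m p :: (('n::finite \<Rightarrow> 'k::field) \<times> ('n \<Rightarrow> 'n)) monoid)"
    (is "group ?G")
proof (rule groupI)
  show "\<one>\<^bsub>?G\<^esub> \<in> carrier ?G" by (simp add: Gmp_def)
next
  fix h h' :: "('n \<Rightarrow> 'k) \<times> ('n \<Rightarrow> 'n)"
  assume "h \<in> carrier ?G" "h' \<in> carrier ?G"
  moreover obtain g \<pi> g' \<pi>' where "h = (g, \<pi>)" "h' = (g', \<pi>')" by fastforce
  moreover have "(\<Prod>i\<in>UNIV. g (\<pi>' i)) = (\<Prod>i\<in>UNIV. g i)" if "bij \<pi>'"
    using that by (rule prod.reindex_bij_betw)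
  ultimately show "h \<otimes>\<^bsub>?G\<^esub> h' \<in> carrier ?G"
    by (auto simp: Gmp_def power_mult_distrib prod.distrib intro: bij_comp)
next
  fix x y z :: "('n \<Rightarrow> 'k) \<times> ('n \<Rightarrow> 'n)"
  show "x \<otimes>\<^bsub>?G\<^esub> y \<otimes>\<^bsub>?G\<^esub> z = x \<otimes>\<^bsub>?G\<^esub> (y \<otimes>\<^bsub>?G\<^esub> z)"
    by (simp add: Gmp_def case_prod_beta comp_assoc mult_ac)
next
  fix h :: "('n \<Rightarrow> 'k) \<times> ('n \<Rightarrow> 'n)"
  show "\<one>\<^bsub>?G\<^esub> \<otimes>\<^bsub>?G\<^esub> h = h" by (simp add: Gmp_def case_prod_beta)
next
  fix h :: "('n \<Rightarrow> 'k) \<times> ('n \<Rightarrow> 'n)"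
  assume h: "h \<in> carrier ?G"
  obtain g \<pi> where [simp]: "h = (g, \<pi>)" by fastforce
  have g: "\<And>i. g i ^ m = 1" and b: "bij \<pi>" and pr: "(\<Prod>i\<in>UNIV. g i) ^ (m div p) = 1"
    using h by (auto simp: Gmp_def)
  have nz: "g i \<noteq> 0" for i using g[of i] assms by (auto simp: power_0_left)
  define g' where "g' i = inverse (g (inv_into UNIV \<pi> i))" for i
  have "(\<Prod>i\<in>UNIV. g (inv_into UNIV \<pi> i)) = (\<Prod>i\<in>UNIV. g i)"
    using bij_imp_bij_inv[OF b] by (rule prod.reindex_bij_betw)
  hence "(\<Prod>i\<in>UNIV. g' i) ^ (m div p) = 1"
    using pr prod_inversef[of "\<lambda>i. g (inv_into UNIV \<pi> i)" UNIV]
    by (simp add: g'_def power_inverse o_def)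
  hence carr: "(g', inv_into UNIV \<pi>) \<in> carrier ?G"
    using g bij_imp_bij_inv[OF b] by (simp add: Gmp_def g'_def power_inverse)
  have "(g', inv_into UNIV \<pi>) \<otimes>\<^bsub>?G\<^esub> h = \<one>\<^bsub>?G\<^esub>"
    using b nz by (simp add: Gmp_def g'_def bij_is_inj)
  with carr show "\<exists>y\<in>carrier ?G. y \<otimes>\<^bsub>?G\<^esub> h = \<one>\<^bsub>?G\<^esub>" by blast
qed


section \<open>Rational functions and their skew group ring\<close>

text \<open>
  The field \<open>k(x\<^sub>1,\<dots>,x\<^sub>n)\<close>. The linear order on the index type \<open>'n\<close> only serves to
  make the polynomials an instance of \<open>idom\<close>; it is unrelated to the action of \<open>S\<^sub>n\<close>.
\<close>

type_synonym ('n, 'k) ratfun = "(('n \<Rightarrow>\<^sub>0 nat) \<Rightarrow>\<^sub>0 'k) fract"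

definition rf_const :: "'k::field \<Rightarrow> ('n::{finite, linorder}, 'k) ratfun" where
  "rf_const c = Fract (Poly_Mapping.single 0 c) 1"

definition rf_var :: "'n::{finite, linorder} \<Rightarrow> ('n, 'k::field) ratfun" where
  "rf_var i = Fract (Poly_Mapping.single (Poly_Mapping.single i 1) 1) 1"

abbreviation rf_consts :: "('n::{finite, linorder}, 'k::field) ratfun set" where
  "rf_consts \<equiv> rf_const ` UNIV"

text \<open>For nonzero \<open>c\<^sub>i\<close> and a permutation \<open>\<pi>\<close>, the \<open>k\<close>-automorphism with \<open>x\<^sub>i \<mapsto> c\<^sub>i x\<^bsub>\<pi>(i)\<^esub>\<close>.\<close>

definition monomial_aut ::
  "('n \<Rightarrow> 'k) \<times> ('n \<Rightarrow> 'n) \<Rightarrow> ('n::{finite, linorder}, 'k::field) ratfun \<Rightarrow> ('n, 'k) ratfun" where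
  "monomial_aut = (\<lambda>(c, \<pi>). THE \<sigma>. \<sigma> \<in> Aut_over rf_consts \<and>
     (\<forall>i. \<sigma> (rf_var i) = rf_const (c i) * rf_var (\<pi> i)))"

text \<open>
  The group \<open>\<int>\<^sup>n\<close> as a group of automorphisms: \<open>a\<close> acts by \<open>x\<^sub>i \<mapsto> q\<^bsup>a\<^sub>i\<^esup> x\<^sub>i\<close>. This is faithful because
  \<open>q\<close> is not a root of unity.
\<close>

definition q_shifts ::
  "'k::field \<Rightarrow> (('n::{finite, linorder}, 'k) ratfun \<Rightarrow> ('n, 'k) ratfun) set" where
  "q_shifts q = {monomial_aut (\<lambda>i. q powi a i, id) | a :: 'n \<Rightarrow> int. True}"

definition eps ::
  "'k::field \<Rightarrow> 'n::{finite, linorder} \<Rightarrow> ('n, 'k) ratfun \<Rightarrow> ('n, 'k) ratfun" where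
  "eps q i = monomial_aut (\<lambda>j. if j = i then q else 1, id)"

definition laurent :: "('n::{finite, linorder}, 'k::field) ratfun set" where
  "laurent = generate_ring ring_of_type_algebra
     (rf_consts \<union> rf_var ` UNIV \<union> (\<lambda>i. inverse (rf_var i)) ` UNIV)"

definition laurent_invariants ::
  "(('n::{finite, linorder} \<Rightarrow> 'k::field) \<times> ('n \<Rightarrow> 'n)) set \<Rightarrow> ('n, 'k) ratfun set" where
  "laurent_invariants H = {f \<in> laurent. \<forall>h\<in>H. monomial_aut h f = f}"


section \<open>The quantum torus\<close>

text \<open>
  The free algebra \<open>k\<langle>'g\<rangle>\<close>: finitely supported functions on words, with the concatenation
  product.
\<close>

definition free_algebra :: "('g list \<Rightarrow> 'k::field) ring" where
  "free_algebra =
    \<lparr> carrier = {f. finite {w. f w \<noteq> 0}},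
      monoid.mult = (\<lambda>f g w. \<Sum>i\<le>length w. f (take i w) * g (drop i w)),
      one = (\<lambda>w. if w = [] then 1 else 0),
      ring.zero = (\<lambda>w. 0),
      add = (\<lambda>f g w. f w + g w) \<rparr>"

definition word :: "'k::field \<Rightarrow> 'g list \<Rightarrow> 'g list \<Rightarrow> 'k" where
  "word c w = (\<lambda>u. if u = w then c else 0)"

text \<open>
  The quantum torus is presented by the generators \<open>x\<^sub>i, y\<^sub>i\<close> and formal inverses of them. The
  relations \<open>plane\<close> define the \<open>n\<close> quantum planes, the relations \<open>tensor\<close> say that different
  tensor factors commute, and the relations \<open>inv_right\<close> and \<open>inv_left\<close> localize at the generators.
\<close>

datatype 'n gen = GX 'n | GY 'n | GXinv 'n | GYinv 'n

inductive_set torus_relators :: "'k::field \<Rightarrow> ('n gen list \<Rightarrow> 'k) set" for q :: 'k where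
  plane: "word 1 [GY i, GX i] \<ominus>\<^bsub>free_algebra\<^esub> word q [GX i, GY i] \<in> torus_relators q"
| tensor: "i \<noteq> j \<Longrightarrow> u \<in> {GX i, GY i} \<Longrightarrow> v \<in> {GX j, GY j} \<Longrightarrow>
    word 1 [u, v] \<ominus>\<^bsub>free_algebra\<^esub> word 1 [v, u] \<in> torus_relators q"
| inv_right: "(u, u') \<in> {(GX i, GXinv i), (GY i, GYinv i)} \<Longrightarrow>
    word 1 [u, u'] \<ominus>\<^bsub>free_algebra\<^esub> word 1 [] \<in> torus_relators q"
| inv_left: "(u, u') \<in> {(GX i, GXinv i), (GY i, GYinv i)} \<Longrightarrow>
    word 1 [u', u] \<ominus>\<^bsub>free_algebra\<^esub> word 1 [] \<in> torus_relators q"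

definition torus_ideal :: "'k::field \<Rightarrow> ('n gen list \<Rightarrow> 'k) set" where
  "torus_ideal q = Idl\<^bsub>free_algebra\<^esub> (torus_relators q)"

definition quantum_torus :: "'k::field \<Rightarrow> ('n gen list \<Rightarrow> 'k) set ring" where
  "quantum_torus q = free_algebra Quot (torus_ideal q)"

definition torus_gen :: "'k::field \<Rightarrow> 'n gen \<Rightarrow> ('n gen list \<Rightarrow> 'k) set" where
  "torus_gen q u = torus_ideal q +>\<^bsub>free_algebra\<^esub> word 1 [u]"

definition torus_const :: "'k::field \<Rightarrow> 'k \<Rightarrow> ('n gen list \<Rightarrow> 'k) set" where
  "torus_const q c = torus_ideal q +>\<^bsub>free_algebra\<^esub> word c []"

text \<open>
  The algebra automorphism by which \<open>h = (g, \<pi>)\<close> acts. It is determined by the values on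
  \<open>x\<^sub>i\<close> and \<open>y\<^sub>i\<close>, since these and their inverses generate; \<open>extensional\<close> only fixes it outside
  the carrier.
\<close>

definition torus_act ::
  "'k::field \<Rightarrow> ('n \<Rightarrow> 'k) \<times> ('n \<Rightarrow> 'n) \<Rightarrow> ('n gen list \<Rightarrow> 'k) set \<Rightarrow> ('n gen list \<Rightarrow> 'k) set" where
  "torus_act q = (\<lambda>(g, \<pi>). THE \<alpha>.
     \<alpha> \<in> ring_iso (quantum_torus q) (quantum_torus q) \<inter> extensional (carrier (quantum_torus q)) \<and>
     (\<forall>c. \<alpha> (torus_const q c) = torus_const q c) \<and>
     (\<forall>i. \<alpha> (torus_gen q (GX i)) =
            torus_const q (g i) \<otimes>\<^bsub>quantum_torus q\<^esub> torus_gen q (GX (\<pi> i))) \<and>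
     (\<forall>i. \<alpha> (torus_gen q (GY i)) = torus_gen q (GY (\<pi> i))))"

definition torus_invariants ::
  "'k::field \<Rightarrow> (('n \<Rightarrow> 'k) \<times> ('n \<Rightarrow> 'n)) set \<Rightarrow> ('n gen list \<Rightarrow> 'k) set set" where
  "torus_invariants q H = {u \<in> carrier (quantum_torus q). \<forall>h\<in>H. torus_act q h u = u}"

text \<open>
  The embedding \<open>x\<^sub>i \<mapsto> x\<^sub>i\<close>, \<open>y\<^sub>i \<mapsto> \<epsilon>\<^sub>i\<close> of \<open>k\<close>-algebras by which the quantum torus is regarded as a
  subring of \<open>k(x\<^sub>1,\<dots>,x\<^sub>n) * \<int>\<^sup>n\<close>.
\<close>

definition torus_embedding ::
  "'k::field \<Rightarrow> ('n::{finite, linorder} gen list \<Rightarrow> 'k) set \<Rightarrow>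
   (('n, 'k) ratfun \<Rightarrow> ('n, 'k) ratfun) \<Rightarrow> ('n, 'k) ratfun" where
  "torus_embedding q = (THE \<phi>.
     \<phi> \<in> ring_hom (quantum_torus q) (skew_ring (q_shifts q)) \<inter>
        extensional (carrier (quantum_torus q)) \<and>
     inj_on \<phi> (carrier (quantum_torus q)) \<and>
     (\<forall>c. \<phi> (torus_const q c) = skew_const (rf_const c)) \<and>
     (\<forall>i. \<phi> (torus_gen q (GX i)) = skew_const (rf_var i)) \<and>
     (\<forall>i. \<phi> (torus_gen q (GY i)) = skew_monom 1 (eps q i)))"

end

theory Submission imports Defs "HOL-Library.Function_Algebras" begin

text \<open>
  Write \<open>z\<^sub>i = x\<^sub>i\<^sup>m\<close> and \<open>w = (x\<^sub>1 \<cdots> x\<^sub>n)\<^bsup>m/p\<^esup>\<close>. The image \<open>U\<close> of the invariants of the quantum torus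
  in the skew group ring consists of the finitely supported families \<open>f\<close> of Laurent polynomials,
  indexed by \<open>v \<in> \<int>\<^sup>n\<close>, that are compatible with the group: the diagonal matrices fix every
  coefficient, and a permutation \<open>\<pi>\<close> maps the coefficient at \<open>v \<circ> \<pi>\<close> to the one at \<open>v\<close>
  (\<open>embedded_torus_inv\<close>). In particular the coefficient at \<open>v\<close> is invariant under the stabilizer
  of \<open>v\<close>, which is a Young subgroup of \<open>S\<^sub>n\<close>.

  The commutative heart of the proof is that such coefficients have canonical coordinates. The
  Laurent polynomials invariant under the diagonal matrices form the ring \<open>\<Gamma>[z\<^sub>1, \<dots>, z\<^sub>n]\<close>, and
  \<open>\<Gamma>\<close> is generated over the constants by \<open>w\<close>, \<open>w\<^sup>-\<^sup>1\<close> and the elementary symmetric functions of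
  the \<open>z\<^sub>i\<close> (\<open>Gam_eq_Gam_gen\<close>), so it is Noetherian. An element of \<open>\<Gamma>[z]\<close> that is invariant under the
  stabilizer of \<open>v\<close> has a unique expansion \<open>\<Sum> r\<^sub>\<phi> z\<^sup>\<phi>\<close> with \<open>r\<^sub>\<phi> \<in> \<Gamma>\<close>, where \<open>\<phi>\<^sub>i\<close> is at most the number
  of \<open>j\<close> with \<open>v\<^sub>j > v\<^sub>i\<close> (\<open>expansion\<close>, \<open>expansion_unique\<close>). For \<open>v\<close> with distinct entries this is
  Artin's basis of staircase monomials. The merit of these exponents is that they are permuted
  together with \<open>v\<close>: the coordinates of a family in \<open>U\<close> are constant on the \<open>S\<^sub>n\<close>-orbits of the
  pairs \<open>(v, \<phi>)\<close>, and so the orbit sums \<open>beta\<close> form a basis of \<open>U\<close> over \<open>\<Gamma>\<close>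
  (\<open>lspan_beta\<close>, \<open>beta_independent\<close>). This is the left freeness.

  The order condition follows. A subspace \<open>W\<close> of finite dimension has bounded support, hence
  \<open>W \<inter> U\<close> lies in the span of finitely many basis elements, and \<open>\<Gamma>\<close> is Noetherian
  (\<open>left_order\<close>). Everything on the right side is carried over from the left by the
  anti-automorphism \<open>l a \<mapsto> a\<^sup>-\<^sup>1 l\<close> of the skew group ring, which fixes \<open>\<Gamma>\<close> and preserves \<open>U\<close>.

  That \<open>U\<close> is finitely generated is an argument of Hilbert type. After multiplication by a power of
  \<open>y\<^sub>1 \<cdots> y\<^sub>n\<close> only nonnegative exponents of \<open>y\<close> occur. A monomial of large degree contains some
  \<open>y\<^sub>i\<^sup>n\<close>, which the identity \<open>\<Prod>\<^sub>j (y\<^sub>i - y\<^sub>j) = 0\<close> turns into a combination of lower powers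
  of \<open>y\<^sub>i\<close> with coefficients the elementary symmetric functions of the \<open>y\<^sub>j\<close>; averaging over the group
  makes the other factors invariant (\<open>positive_part_generated\<close>). The elements of small degree are
  spanned by finitely many \<open>beta\<close>.

  The Galois data come from the same functions: \<open>K\<close>, the field of fractions of \<open>\<Gamma>\<close>, is
  the fixed field of the group, and an automorphism over \<open>K\<close> permutes the roots \<open>z\<^sub>i\<close> of
  \<open>\<Prod> (t - z\<^sub>i)\<close> and fixes \<open>w\<close>, which forces it to be in the group (\<open>Aut_over_K0\<close>). The passage from the
  quantum torus, given by generators and relations, to the skew group ring needs that the relations
  generate the whole kernel (\<open>kernel_eq\<close>): up to scalars they reduce a word to its degrees in the
  \<open>x\<close> and the \<open>y\<close>, and the images of words of distinct degrees are independent.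
\<close>

section \<open>Subrings of a commutative ring\<close>

definition subr :: "'a::comm_ring_1 set \<Rightarrow> bool" where
  "subr S \<longleftrightarrow> 1 \<in> S \<and> (\<forall>x\<in>S. \<forall>y\<in>S. x - y \<in> S \<and> x * y \<in> S)"

lemma subr_1: "subr S \<Longrightarrow> 1 \<in> S" by (simp add: subr_def)
lemma subr_0: "subr S \<Longrightarrow> 0 \<in> S" by (metis subr_def diff_self)
lemma subr_diff: "subr S \<Longrightarrow> x \<in> S \<Longrightarrow> y \<in> S \<Longrightarrow> x - y \<in> S" by (simp add: subr_def)
lemma subr_mult: "subr S \<Longrightarrow> x \<in> S \<Longrightarrow> y \<in> S \<Longrightarrow> x * y \<in> S" by (simp add: subr_def)
lemma subr_uminus: "subr S \<Longrightarrow> x \<in> S \<Longrightarrow> - x \<in> S" by (metis subr_0 subr_diff diff_0)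
lemma subr_add: "subr S \<Longrightarrow> x \<in> S \<Longrightarrow> y \<in> S \<Longrightarrow> x + y \<in> S"
  by (metis subr_uminus subr_diff diff_minus_eq_add)
lemma subr_sum: "subr S \<Longrightarrow> (\<And>i. i \<in> A \<Longrightarrow> f i \<in> S) \<Longrightarrow> sum f A \<in> S"
  by (induction A rule: infinite_finite_induct) (auto simp: subr_0 subr_add)
lemma subr_prod: "subr S \<Longrightarrow> (\<And>i. i \<in> A \<Longrightarrow> f i \<in> S) \<Longrightarrow> prod f A \<in> S"
  by (induction A rule: infinite_finite_induct) (auto simp: subr_1 subr_mult)
lemma subr_power: "subr S \<Longrightarrow> x \<in> S \<Longrightarrow> x ^ k \<in> S"
  by (induction k) (auto simp: subr_1 subr_mult)

inductive_set adjoin :: "'a::comm_ring_1 set \<Rightarrow> 'a set \<Rightarrow> 'a set" for S B where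
  base: "s \<in> S \<Longrightarrow> s \<in> adjoin S B"
| gen: "b \<in> B \<Longrightarrow> b \<in> adjoin S B"
| add: "x \<in> adjoin S B \<Longrightarrow> y \<in> adjoin S B \<Longrightarrow> x + y \<in> adjoin S B"
| mult: "x \<in> adjoin S B \<Longrightarrow> y \<in> adjoin S B \<Longrightarrow> x * y \<in> adjoin S B"

lemma subr_adjoin: "subr S \<Longrightarrow> subr (adjoin S B)"
proof -
  assume S: "subr S"
  have "x - y \<in> adjoin S B" if "x \<in> adjoin S B" "y \<in> adjoin S B" for x y
  proof -
    have "- 1 \<in> adjoin S B" using S by (intro adjoin.base) (simp add: subr_1 subr_uminus)
    hence "x + (- 1) * y \<in> adjoin S B" using that by (intro adjoin.add adjoin.mult)
    thus ?thesis by simp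
  qed
  thus ?thesis using S unfolding subr_def by (auto intro: adjoin.intros)
qed

lemma adjoin_least: "subr T \<Longrightarrow> S \<subseteq> T \<Longrightarrow> B \<subseteq> T \<Longrightarrow> adjoin S B \<subseteq> T"
proof
  fix x assume "subr T" "S \<subseteq> T" "B \<subseteq> T" "x \<in> adjoin S B"
  from this(4,1-3) show "x \<in> T"
    by (induction rule: adjoin.induct) (auto simp: subr_add subr_mult)
qed

lemma adjoin_insert: "subr S \<Longrightarrow> adjoin S (insert b B) \<subseteq> adjoin (adjoin S {b}) B"
  by (rule adjoin_least) (auto intro: adjoin.intros subr_adjoin)

section \<open>Staircase monomials\<close>

text \<open>
  The exponents below a staircase: the exponent at the last variable of the list is \<open>0\<close>, at the
  one before it at most \<open>1\<close>, and so on.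
\<close>
fun stair :: "'n list \<Rightarrow> ('n \<Rightarrow> nat) set" where
  "stair [] = {\<lambda>_. 0}"
| "stair (i # xs) = (\<lambda>(c, \<phi>). \<phi>(i := c)) ` ({..length xs} \<times> stair xs)"

lemma finite_stair: "finite (stair xs)" by (induction xs) auto

lemma stair_outside: "\<phi> \<in> stair xs \<Longrightarrow> j \<notin> set xs \<Longrightarrow> \<phi> j = 0"
  by (induction xs arbitrary: \<phi>) auto

lemma inj_stair:
  assumes "i \<notin> set xs"
  shows "inj_on (\<lambda>(c, \<phi>). \<phi>(i := c)) ({..length xs} \<times> stair xs)"
proof (rule inj_onI, clarify)
  fix c \<phi> c' \<phi>' assume a: "\<phi> \<in> stair xs" "\<phi>' \<in> stair xs" "\<phi>(i := c) = \<phi>'(i := c')"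
  have "\<phi> = (\<phi>(i := c))(i := 0)" using stair_outside[OF a(1) assms] by auto
  also have "\<dots> = \<phi>'" using a(3) stair_outside[OF a(2) assms] by auto
  finally show "c = c' \<and> \<phi> = \<phi>'" using a(3) by (metis fun_upd_same)
qed

lemma sum_stair:
  assumes "i \<notin> set xs"
  shows "sum F (stair (i # xs)) = (\<Sum>c\<le>length xs. \<Sum>\<phi>\<in>stair xs. F (\<phi>(i := c)))"
  using sum.reindex[OF inj_stair[OF assms], of F]
  by (simp add: sum.cartesian_product split_beta)

text \<open>
  An index has at most as many indices of larger value as there are indices behind it in a list
  sorted by value, so the bounds by the numbers of larger values fit below the staircase.
\<close>
lemma stairI:
  fixes v :: "'n \<Rightarrow> 'b::linorder"
  assumes "distinct xs" "sorted (map v xs)"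
    "\<And>i. i \<in> set xs \<Longrightarrow> \<phi> i \<le> card {j \<in> set xs. v j > v i}" "\<And>i. i \<notin> set xs \<Longrightarrow> \<phi> i = 0"
  shows "\<phi> \<in> stair xs"
  using assms
proof (induction xs arbitrary: \<phi>)
  case Nil
  then show ?case by auto
next
  case (Cons i xs)
  have "\<phi>(i := 0) \<in> stair xs"
  proof (rule Cons.IH)
    fix k assume k: "k \<in> set xs"
    have "{j \<in> set (i # xs). v j > v k} = {j \<in> set xs. v j > v k}"
      using Cons.prems(2) k by (auto simp: leD)
    thus "(\<phi>(i := 0)) k \<le> card {j \<in> set xs. v j > v k}"
      using Cons.prems(3)[of k] k by auto
  qed (use Cons.prems in auto)
  moreover have "\<phi> i \<le> length xs"
  proof -
    have "\<phi> i \<le> card {j \<in> set (i # xs). v j > v i}" using Cons.prems(3) by simp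
    also have "\<dots> \<le> card (set xs)" by (rule card_mono) auto
    also have "\<dots> \<le> length xs" by (rule card_length)
    finally show ?thesis .
  qed
  ultimately show ?case
    by (auto intro!: image_eqI[where x = "(\<phi> i, \<phi>(i := 0))"])
qed

text \<open>
  Independence of the staircase monomials by counting roots. The hypothesis is that a combination
  vanishes at all tuples of distinct points of a set \<open>Z\<close> with as many points as variables. If the
  first variable is given the value \<open>a\<close>, the other variables run over the distinct tuples of
  \<open>Z - {a}\<close>, and induction kills the coefficients, which are polynomials in \<open>a\<close> of degree less than
  \<open>card Z\<close>.
\<close>
lemma stair_independent:
  fixes c :: "('n \<Rightarrow> nat) \<Rightarrow> 'l::field"
  assumes "distinct xs" "finite Z" "card Z = length xs"
    "\<And>t. inj_on t (set xs) \<Longrightarrow> t ` set xs \<subseteq> Z \<Longrightarrow> (\<Sum>\<phi>\<in>stair xs. c \<phi> * (\<Prod>j\<in>set xs. t j ^ \<phi> j)) = 0"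
    "\<phi> \<in> stair xs"
  shows "c \<phi> = 0"
  using assms
proof (induction xs arbitrary: Z c \<phi>)
  case Nil
  then show ?case by auto
next
  case (Cons i xs)
  have i: "i \<notin> set xs" and d: "distinct xs" using Cons.prems by auto
  obtain e \<psi> where e: "e \<le> length xs" and \<psi>: "\<psi> \<in> stair xs" and \<phi>: "\<phi> = \<psi>(i := e)"
    using Cons.prems(5) by auto
  \<comment> \<open>The combined coefficients at \<open>a\<close> satisfy the hypothesis for \<open>Z - {a}\<close> and the remaining variables.\<close>
  have *: "(\<Sum>b\<le>length xs. c (\<psi>(i := b)) * a ^ b) = 0" if a: "a \<in> Z" for a
  proof (rule Cons.IH[of "Z - {a}" "\<lambda>\<psi>. \<Sum>b\<le>length xs. c (\<psi>(i := b)) * a ^ b"])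
    fix t :: "'n \<Rightarrow> 'l" assume t: "inj_on t (set xs)" "t ` set xs \<subseteq> Z - {a}"
    let ?t = "t(i := a)"
    have "inj_on ?t (set (i # xs))" "?t ` set (i # xs) \<subseteq> Z"
      using t a i by (auto simp: inj_on_def)
    from Cons.prems(4)[OF this]
    have "0 = (\<Sum>b\<le>length xs. \<Sum>\<psi>\<in>stair xs. c (\<psi>(i := b)) * (\<Prod>j\<in>set (i#xs). ?t j ^ (\<psi>(i := b)) j))"
      by (simp only: sum_stair[OF i])
    also have "\<dots> = (\<Sum>b\<le>length xs. \<Sum>\<psi>\<in>stair xs. c (\<psi>(i := b)) * a ^ b * (\<Prod>j\<in>set xs. t j ^ \<psi> j))"
    proof (intro sum.cong refl)
      fix b \<psi>
      have "(\<Prod>j\<in>set xs. ?t j ^ (\<psi>(i := b)) j) = (\<Prod>j\<in>set xs. t j ^ \<psi> j)"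
        using i by (intro prod.cong) auto
      thus "c (\<psi>(i := b)) * (\<Prod>j\<in>set (i#xs). ?t j ^ (\<psi>(i := b)) j) =
        c (\<psi>(i := b)) * a ^ b * (\<Prod>j\<in>set xs. t j ^ \<psi> j)"
        using i by simp
    qed
    also have "\<dots> = (\<Sum>\<psi>\<in>stair xs. \<Sum>b\<le>length xs. c (\<psi>(i := b)) * a ^ b * (\<Prod>j\<in>set xs. t j ^ \<psi> j))"
      by (rule sum.swap)
    finally show "(\<Sum>\<psi>\<in>stair xs. (\<Sum>b\<le>length xs. c (\<psi>(i := b)) * a ^ b) * (\<Prod>j\<in>set xs. t j ^ \<psi> j)) = 0"
      by (simp add: sum_distrib_right)
  qed (use Cons.prems a d \<psi> in auto)
  \<comment> \<open>A polynomial of degree at most \<open>length xs\<close> with one root more.\<close>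
  define P where "P = (\<Sum>b\<le>length xs. monom (c (\<psi>(i := b))) b)"
  have "P = 0"
  proof (rule ccontr)
    assume "P \<noteq> 0"
    have "Z \<subseteq> {a. poly P a = 0}" using * by (auto simp: P_def poly_sum poly_monom)
    hence "card Z \<le> card {a. poly P a = 0}"
      by (rule card_mono[OF poly_roots_finite[OF \<open>P \<noteq> 0\<close>]])
    also have "\<dots> \<le> degree P" by (rule card_poly_roots_bound[OF \<open>P \<noteq> 0\<close>])
    also have "\<dots> \<le> length xs" unfolding P_def
      by (intro degree_sum_le) (auto intro: order_trans[OF degree_monom_le])
    finally show False using Cons.prems(3) by simp
  qed
  hence "coeff P e = 0" by simp
  hence "c (\<psi>(i := e)) = 0" using e by (simp add: P_def coeff_sum)
  thus ?case unfolding \<phi> .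
qed

text \<open>
  The monic equation \<open>E(z) = 0\<close> expresses \<open>z\<^bsup>N+1\<^esup>\<close> by lower powers, so the span of the powers up to
  \<open>N\<close> is closed under multiplication by \<open>S\<close> and by \<open>z\<close>.
\<close>
lemma powers_span:
  fixes z :: "'a::comm_ring_1"
  assumes S: "subr S" and E: "degree E \<le> Suc N" "coeff E (Suc N) = 1" "\<And>k. coeff E k \<in> S" "poly E z = 0"
    and f: "f \<in> adjoin S {z}"
  shows "\<exists>s. (\<forall>d\<le>N. s d \<in> S) \<and> f = (\<Sum>d\<le>N. s d * z ^ d)"
proof -
  define A where "A = {(\<Sum>d\<le>N. s d * z ^ d) | s. \<forall>d\<le>N. s d \<in> S}"
  have addA: "x + y \<in> A" if "x \<in> A" "y \<in> A" for x y
  proof -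
    from that obtain s t where "\<forall>d\<le>N. s d \<in> S" "\<forall>d\<le>N. t d \<in> S"
      "x = (\<Sum>d\<le>N. s d * z ^ d)" "y = (\<Sum>d\<le>N. t d * z ^ d)" by (auto simp: A_def)
    thus ?thesis unfolding A_def using S
      by (auto intro!: exI[of _ "\<lambda>d. s d + t d"] simp: subr_add sum.distrib distrib_right)
  qed
  have scale: "r * x \<in> A" if "r \<in> S" "x \<in> A" for r x
  proof -
    from that obtain s where "\<forall>d\<le>N. s d \<in> S" "x = (\<Sum>d\<le>N. s d * z ^ d)" by (auto simp: A_def)
    thus ?thesis unfolding A_def using S that
      by (auto intro!: exI[of _ "\<lambda>d. r * s d"] simp: subr_mult sum_distrib_left mult_ac)
  qed
  have pow: "z ^ d \<in> A" if "d \<le> N" for d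
    unfolding A_def using that S
    by (auto intro!: exI[of _ "\<lambda>e. if e = d then 1 else 0"] simp: subr_0 subr_1 if_distrib[of "\<lambda>x. x * _"] cong: if_cong)
  have sumA: "finite B \<Longrightarrow> (\<And>d. d \<in> B \<Longrightarrow> g d \<in> A) \<Longrightarrow> sum g B \<in> A" for g :: "nat \<Rightarrow> 'a" and B
  proof (induction B rule: finite_induct)
    case empty
    show ?case using scale[OF subr_0[OF S] pow[of 0]] by simp
  qed (auto simp: addA)
  have top: "z ^ Suc N \<in> A"
  proof -
    have "0 = (\<Sum>k\<le>degree E. coeff E k * z ^ k)" using E(4) by (simp add: poly_altdef)
    also have "\<dots> = (\<Sum>k\<le>Suc N. coeff E k * z ^ k)"
      using E(1) by (intro sum.mono_neutral_left) (auto simp: coeff_eq_0)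
    also have "\<dots> = (\<Sum>k\<le>N. coeff E k * z ^ k) + z ^ Suc N" using E(2) by simp
    finally have "z ^ Suc N = (\<Sum>k\<le>N. (- coeff E k) * z ^ k)"
      by (simp add: sum_negf eq_neg_iff_add_eq_0 add.commute)
    also have "\<dots> \<in> A" using E(3) S pow by (intro sumA scale) (auto intro: subr_uminus)
    finally show ?thesis .
  qed
  have zA: "z * x \<in> A" if "x \<in> A" for x
  proof -
    from that obtain s where s: "\<forall>d\<le>N. s d \<in> S" "x = (\<Sum>d\<le>N. s d * z ^ d)" by (auto simp: A_def)
    have "z * x = (\<Sum>d\<le>N. s d * z ^ Suc d)" by (simp add: s(2) sum_distrib_left mult_ac)
    also have "\<dots> \<in> A"
    proof (intro sumA)
      fix d assume "d \<in> {..N}"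
      hence "z ^ Suc d \<in> A" using top pow[of "Suc d"] by (cases "d = N") auto
      thus "s d * z ^ Suc d \<in> A" using s(1) \<open>d \<in> {..N}\<close> by (intro scale) auto
    qed simp
    finally show ?thesis .
  qed
  have "f * x \<in> A" if "x \<in> A" for x
    using f that
  proof (induction arbitrary: x rule: adjoin.induct)
    case (base s)
    then show ?case by (simp add: scale)
  next
    case (gen b)
    then show ?case by (simp add: zA)
  next
    case (add f g)
    then show ?case by (simp add: distrib_right addA)
  next
    case (mult f g)
    then show ?case by (simp add: mult.assoc)
  qed
  from this[OF pow[of 0]] show ?thesis by (auto simp: A_def)
qed

text \<open>
  Synthetic division: the coefficients of the quotient are computed from the top down as
  \<open>e\<^sub>k = c\<^bsub>k+1\<^esub> + z e\<^bsub>k+1\<^esub>\<close>, without any division.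
\<close>
lemma quotient_coeffs:
  fixes E :: "'a::comm_ring_1 poly"
  assumes "subr S" "z \<in> S" "\<And>k. coeff ([:- z, 1:] * E) k \<in> S"
  shows "coeff E k \<in> S"
proof -
  have eq: "coeff E k = coeff ([:- z, 1:] * E) (Suc k) + z * coeff E (Suc k)" for k
    by (simp add: mult_pCons_left)
  have "k \<le> Suc (degree E) \<Longrightarrow> coeff E k \<in> S"
  proof (induction k rule: inc_induct)
    case base
    then show ?case using assms(1) by (simp add: coeff_eq_0 subr_0)
  next
    case (step k)
    then show ?case using assms by (subst eq) (simp add: subr_add subr_mult del: mult_pCons_left)
  qed
  thus ?thesis using assms(1) by (cases "k \<le> Suc (degree E)") (auto simp: coeff_eq_0 subr_0)
qed

lemma monic_prod_linear:
  fixes z :: "'n \<Rightarrow> 'a::{comm_ring_1}"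
  assumes "finite A"
  shows "degree (\<Prod>i\<in>A. [:- z i, 1:]) \<le> card A \<and> coeff (\<Prod>i\<in>A. [:- z i, 1:]) (card A) = 1"
  using assms
proof (induction A rule: finite_induct)
  case (insert i A)
  have "degree ([:- z i, 1:] * (\<Prod>i\<in>A. [:- z i, 1:])) \<le> 1 + card A"
    using insert by (intro order_trans[OF degree_mult_le] add_mono) (auto split: if_splits)
  moreover have "coeff (\<Prod>i\<in>A. [:- z i, 1:]) (Suc (card A)) = 0"
    using insert by (intro coeff_eq_0) auto
  ultimately show ?case using insert by (simp add: mult_pCons_left)
qed auto

text \<open>
  The variables are eliminated one at a time. The first one is a root of the full product, of degree
  the number of variables. The product of the remaining linear factors, which has the remaining
  variables as roots, has its coefficients in \<open>S[z\<^sub>i]\<close> by synthetic division, and has one degree less;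
  this is where the staircase comes from.
\<close>
lemma stair_span:
  fixes z :: "'n \<Rightarrow> 'a::comm_ring_1"
  assumes "distinct xs" "subr S" "\<And>k. coeff (\<Prod>i\<in>set xs. [:- z i, 1:]) k \<in> S" "f \<in> adjoin S (z ` set xs)"
  shows "\<exists>r. (\<forall>\<phi>\<in>stair xs. r \<phi> \<in> S) \<and> f = (\<Sum>\<phi>\<in>stair xs. r \<phi> * (\<Prod>j\<in>set xs. z j ^ \<phi> j))"
  using assms
proof (induction xs arbitrary: S f)
  case Nil
  have "adjoin S {} \<subseteq> S" using Nil by (intro adjoin_least) auto
  with Nil show ?case by auto
next
  case (Cons i xs)
  have i: "i \<notin> set xs" and d: "distinct xs" using Cons.prems by auto
  define S' where "S' = adjoin S {z i}"
  let ?E = "\<Prod>i\<in>set (i#xs). [:- z i, 1:]" and ?E' = "\<Prod>i\<in>set xs. [:- z i, 1:]"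
  have E: "?E = [:- z i, 1:] * ?E'" using i by simp
  have S': "subr S'" unfolding S'_def by (rule subr_adjoin) fact
  have SS': "S \<subseteq> S'" by (auto simp: S'_def intro: adjoin.base)
  have "coeff ?E' k \<in> S'" for k
  proof (rule quotient_coeffs[OF S'])
    show "z i \<in> S'" by (auto simp: S'_def intro: adjoin.gen)
    show "coeff ([:- z i, 1:] * ?E') k \<in> S'" for k using Cons.prems(3)[of k] SS' unfolding E by blast
  qed
  moreover have "f \<in> adjoin S' (z ` set xs)"
    using Cons.prems adjoin_insert[of S "z i" "z ` set xs"] by (auto simp: S'_def)
  ultimately obtain r where r: "\<forall>\<phi>\<in>stair xs. r \<phi> \<in> S'"
    "f = (\<Sum>\<phi>\<in>stair xs. r \<phi> * (\<Prod>j\<in>set xs. z j ^ \<phi> j))"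
    using Cons.IH[OF d S'] by blast
  have "\<forall>\<phi>\<in>stair xs. \<exists>s. (\<forall>d\<le>length xs. s d \<in> S) \<and> r \<phi> = (\<Sum>d\<le>length xs. s d * z i ^ d)"
  proof
    fix \<phi> assume "\<phi> \<in> stair xs"
    have c: "card (set (i#xs)) = Suc (length xs)" using Cons.prems(1) distinct_card[of "i#xs"] by simp
    show "\<exists>s. (\<forall>d\<le>length xs. s d \<in> S) \<and> r \<phi> = (\<Sum>d\<le>length xs. s d * z i ^ d)"
    proof (rule powers_span[where E = ?E])
      show "degree ?E \<le> Suc (length xs)" "coeff ?E (Suc (length xs)) = 1"
        using monic_prod_linear[of "set (i#xs)" z] unfolding c by auto
      show "poly ?E (z i) = 0" unfolding E by simp
    qed (use Cons.prems r \<open>\<phi> \<in> stair xs\<close> in \<open>auto simp: S'_def\<close>)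
  qed
  then obtain s where s: "\<forall>\<phi>\<in>stair xs. (\<forall>d\<le>length xs. s \<phi> d \<in> S) \<and> r \<phi> = (\<Sum>d\<le>length xs. s \<phi> d * z i ^ d)"
    by metis
  \<comment> \<open>The exponent at \<open>i\<close> selects the power of \<open>z\<^sub>i\<close>; the other exponents form a smaller staircase.\<close>
  define r' where "r' \<phi> = s (\<phi>(i := 0)) (\<phi> i)" for \<phi>
  have r'_eq: "r' (\<phi>(i := d)) = s \<phi> d" if "\<phi> \<in> stair xs" for \<phi> d
  proof -
    have "\<phi>(i := 0) = \<phi>" using stair_outside[OF that i] by auto
    thus ?thesis by (simp add: r'_def)
  qed
  have "(\<Sum>\<phi>\<in>stair (i#xs). r' \<phi> * (\<Prod>j\<in>set (i#xs). z j ^ \<phi> j)) =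
     (\<Sum>d\<le>length xs. \<Sum>\<phi>\<in>stair xs. s \<phi> d * (z i ^ d * (\<Prod>j\<in>set xs. z j ^ \<phi> j)))"
    unfolding sum_stair[OF i]
  proof (intro sum.cong refl)
    fix d \<phi> assume "\<phi> \<in> stair xs"
    moreover have "(\<Prod>j\<in>set xs. z j ^ (\<phi>(i := d)) j) = (\<Prod>j\<in>set xs. z j ^ \<phi> j)"
      using i by (intro prod.cong) auto
    ultimately show "r' (\<phi>(i := d)) * (\<Prod>j\<in>set (i#xs). z j ^ (\<phi>(i := d)) j) =
        s \<phi> d * (z i ^ d * (\<Prod>j\<in>set xs. z j ^ \<phi> j))"
      using i by (simp add: r'_eq)
  qed
  also have "\<dots> = (\<Sum>\<phi>\<in>stair xs. \<Sum>d\<le>length xs. s \<phi> d * (z i ^ d * (\<Prod>j\<in>set xs. z j ^ \<phi> j)))"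
    by (rule sum.swap)
  also have "\<dots> = (\<Sum>\<phi>\<in>stair xs. r \<phi> * (\<Prod>j\<in>set xs. z j ^ \<phi> j))"
    using s by (intro sum.cong refl) (simp add: sum_distrib_right sum_distrib_left mult_ac)
  finally have "f = (\<Sum>\<phi>\<in>stair (i#xs). r' \<phi> * (\<Prod>j\<in>set (i#xs). z j ^ \<phi> j))" using r(2) by simp
  moreover have "\<forall>\<phi>\<in>stair (i#xs). r' \<phi> \<in> S" using s r'_eq by auto
  ultimately show ?case by (intro exI[of _ r'] conjI)
qed

section \<open>Noetherian subrings\<close>

text \<open>
  The scalar multiplication is a parameter, so that ideals of a subring and modules of functions are
  instances of one notion.
\<close>
definition submod :: "('a::comm_ring_1 \<Rightarrow> 'b::ab_group_add \<Rightarrow> 'b) \<Rightarrow> 'a set \<Rightarrow> 'b set \<Rightarrow> bool" where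
  "submod sc S N \<longleftrightarrow> 0 \<in> N \<and> (\<forall>x\<in>N. \<forall>y\<in>N. x + y \<in> N) \<and> (\<forall>s\<in>S. \<forall>x\<in>N. sc s x \<in> N)"

text \<open>One coefficient for each element of \<open>F\<close>; the sum is meaningful for finite \<open>F\<close>.\<close>
definition lin :: "('a::comm_ring_1 \<Rightarrow> 'b::ab_group_add \<Rightarrow> 'b) \<Rightarrow> 'a set \<Rightarrow> 'b set \<Rightarrow> 'b set" where
  "lin sc S F = {(\<Sum>f\<in>F. sc (c f) f) | c. \<forall>f\<in>F. c f \<in> S}"

definition fg :: "('a::comm_ring_1 \<Rightarrow> 'b::ab_group_add \<Rightarrow> 'b) \<Rightarrow> 'a set \<Rightarrow> 'b set \<Rightarrow> bool" where
  "fg sc S N \<longleftrightarrow> (\<exists>F. finite F \<and> F \<subseteq> N \<and> N \<subseteq> lin sc S F)"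

definition noeth :: "'a::comm_ring_1 set \<Rightarrow> bool" where
  "noeth S \<longleftrightarrow> (\<forall>I. I \<subseteq> S \<longrightarrow> submod (*) S I \<longrightarrow> fg (*) S I)"

lemma submod_0: "submod sc S N \<Longrightarrow> 0 \<in> N" by (simp add: submod_def)
lemma submod_add: "submod sc S N \<Longrightarrow> x \<in> N \<Longrightarrow> y \<in> N \<Longrightarrow> x + y \<in> N" by (simp add: submod_def)
lemma submod_scale: "submod sc S N \<Longrightarrow> s \<in> S \<Longrightarrow> x \<in> N \<Longrightarrow> sc s x \<in> N" by (simp add: submod_def)
lemma submod_sum:
  assumes "submod sc S N" "\<And>i. i \<in> A \<Longrightarrow> f i \<in> N"
  shows "sum f A \<in> N"
  using assms(2)
proof (induction A rule: infinite_finite_induct)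
  case (insert x A)
  then show ?case using submod_add[OF assms(1), of "f x" "sum f A"] by simp
qed (simp_all add: submod_0[OF assms(1)])

lemma submod_diff:
  assumes "Modules.module sc" "subr S" "submod sc S N" "x \<in> N" "y \<in> N"
  shows "x - y \<in> N"
proof -
  interpret Modules.module sc by fact
  have "sc (- 1) y \<in> N" by (rule submod_scale[OF assms(3) _ assms(5)]) (intro subr_uminus subr_1 assms(2))
  hence "x + sc (- 1) y \<in> N" by (rule submod_add[OF assms(3,4)])
  thus ?thesis by simp
qed

lemma lin_least:
  assumes "submod sc S N" "F \<subseteq> N"
  shows "lin sc S F \<subseteq> N"
  unfolding lin_def using assms(2)
  by (auto intro!: submod_sum[OF assms(1)] submod_scale[OF assms(1)])

lemma submod_lin:
  assumes "Modules.module sc" "subr S"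
  shows "submod sc S (lin sc S F)"
proof -
  interpret Modules.module sc by fact
  show ?thesis
  proof (unfold submod_def, intro conjI ballI)
    have "0 = (\<Sum>f\<in>F. sc 0 f)" by simp
    thus "0 \<in> lin sc S F" unfolding lin_def using subr_0[OF assms(2)]
      by (intro CollectI exI[of _ "\<lambda>_. 0"]) simp
  next
    fix x y assume "x \<in> lin sc S F" "y \<in> lin sc S F"
    then obtain c d where *: "\<forall>f\<in>F. c f \<in> S" "\<forall>f\<in>F. d f \<in> S"
      "x = (\<Sum>f\<in>F. sc (c f) f)" "y = (\<Sum>f\<in>F. sc (d f) f)" unfolding lin_def by blast
    have "x + y = (\<Sum>f\<in>F. sc (c f + d f) f)" by (simp add: * scale_left_distrib sum.distrib)
    moreover have "\<forall>f\<in>F. c f + d f \<in> S" using * subr_add[OF assms(2)] by blast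
    ultimately show "x + y \<in> lin sc S F" unfolding lin_def
      by (intro CollectI exI[of _ "\<lambda>f. c f + d f"] conjI)
  next
    fix s x assume s: "s \<in> S" and "x \<in> lin sc S F"
    then obtain c where *: "\<forall>f\<in>F. c f \<in> S" "x = (\<Sum>f\<in>F. sc (c f) f)" unfolding lin_def by blast
    have "sc s x = (\<Sum>f\<in>F. sc (s * c f) f)" by (simp add: * scale_sum_right)
    moreover have "\<forall>f\<in>F. s * c f \<in> S" using * s subr_mult[OF assms(2)] by blast
    ultimately show "sc s x \<in> lin sc S F" unfolding lin_def
      by (intro CollectI exI[of _ "\<lambda>f. s * c f"] conjI)
  qed
qed

lemma lin_incl:
  assumes "Modules.module sc" "subr S" "finite F"
  shows "F \<subseteq> lin sc S F"
proof
  interpret Modules.module sc by fact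
  fix f assume "f \<in> F"
  have "(\<Sum>g\<in>F. sc (if g = f then 1 else 0) g) = (\<Sum>g\<in>F. if g = f then g else 0)"
    by (intro sum.cong) auto
  also have "\<dots> = f" using \<open>f \<in> F\<close> assms(3) by simp
  finally show "f \<in> lin sc S F" unfolding lin_def using assms(2)
    by (auto intro!: exI[of _ "\<lambda>g. if g = f then 1 else 0"] simp: subr_0 subr_1)
qed

lemma lin_mono:
  assumes "Modules.module sc" "subr S" "finite F'" "F \<subseteq> F'"
  shows "lin sc S F \<subseteq> lin sc S F'"
  using assms lin_incl[OF assms(1-3)] by (intro lin_least submod_lin) auto

lemma lin_insert:
  assumes "Modules.module sc" "finite B" "b \<notin> B" "x \<in> lin sc S (insert b B)"
  shows "\<exists>c\<in>S. \<exists>y\<in>lin sc S B. x = sc c b + y"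
  using assms(2-4) by (auto simp: lin_def)

lemma module_mult: "Modules.module ((*) :: 'a::comm_ring_1 \<Rightarrow> 'a \<Rightarrow> 'a)"
  by unfold_locales (auto simp: algebra_simps)

text \<open>
  Submodules of finitely generated modules over a Noetherian ring, by induction on the number of
  generators: the coefficients that the generator \<open>b\<close> takes in \<open>N\<close> form an ideal, and generators of
  this ideal, lifted to \<open>N\<close>, reduce an element of \<open>N\<close> to one in the span of the other generators.
\<close>
lemma fg_submod:
  assumes "Modules.module sc" "subr S" "noeth S" "finite B" "submod sc S N" "N \<subseteq> lin sc S B"
  shows "fg sc S N"
  using assms(4-6)
proof (induction B arbitrary: N rule: finite_induct)
  case empty
  hence "N \<subseteq> {0}" by (auto simp: lin_def)
  thus ?case unfolding fg_def by (intro exI[of _ "{}"]) (auto simp: lin_def)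
next
  case (insert b B)
  interpret Modules.module sc by fact
  note N = \<open>submod sc S N\<close>
  have subB: "submod sc S (lin sc S B)" by (rule submod_lin[OF assms(1,2)])
  define I where "I = {c \<in> S. \<exists>y\<in>lin sc S B. sc c b + y \<in> N}"
  have "submod (*) S I"
  proof (unfold submod_def, intro conjI ballI)
    have "sc 0 b + 0 \<in> N" using N by (simp add: submod_def)
    moreover have "0 \<in> lin sc S B" using subB by (simp add: submod_def)
    ultimately show "0 \<in> I" using subr_0[OF assms(2)] unfolding I_def by blast
  next
    fix c d assume "c \<in> I" "d \<in> I"
    then obtain y z where *: "c \<in> S" "d \<in> S" "y \<in> lin sc S B" "z \<in> lin sc S B" "sc c b + y \<in> N" "sc d b + z \<in> N"
      by (auto simp: I_def)
    have "sc (c + d) b + (y + z) \<in> N" using submod_add[OF N *(5,6)] by (simp add: scale_left_distrib add_ac)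
    thus "c + d \<in> I" using * subr_add[OF assms(2)] submod_add[OF subB] by (auto simp: I_def)
  next
    fix s c assume "s \<in> S" "c \<in> I"
    then obtain y where *: "c \<in> S" "y \<in> lin sc S B" "sc c b + y \<in> N" by (auto simp: I_def)
    have "sc (s * c) b + sc s y \<in> N"
      using submod_scale[OF N \<open>s \<in> S\<close> *(3)] by (simp add: scale_right_distrib)
    thus "s * c \<in> I" using * \<open>s \<in> S\<close> subr_mult[OF assms(2)] submod_scale[OF subB] by (auto simp: I_def)
  qed
  moreover have "I \<subseteq> S" by (auto simp: I_def)
  ultimately obtain F where F: "finite F" "F \<subseteq> I" "I \<subseteq> lin (*) S F"
    using assms(3) by (auto simp: noeth_def fg_def)
  have "\<forall>c\<in>F. \<exists>n. n \<in> N \<and> n - sc c b \<in> lin sc S B"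
  proof
    fix c assume "c \<in> F"
    then obtain y where "y \<in> lin sc S B" "sc c b + y \<in> N" using F by (auto simp: I_def)
    thus "\<exists>n. n \<in> N \<and> n - sc c b \<in> lin sc S B" by (intro exI[of _ "sc c b + y"]) auto
  qed
  then obtain n where n: "\<And>c. c \<in> F \<Longrightarrow> n c \<in> N" "\<And>c. c \<in> F \<Longrightarrow> n c - sc c b \<in> lin sc S B"
    by metis
  have "submod sc S (N \<inter> lin sc S B)" using N subB by (auto simp: submod_def)
  then obtain F' where F': "finite F'" "F' \<subseteq> N \<inter> lin sc S B" "N \<inter> lin sc S B \<subseteq> lin sc S F'"
    using insert.IH[of "N \<inter> lin sc S B"] by (auto simp: fg_def)
  let ?G = "n ` F \<union> F'"
  have G: "finite ?G" using F F' by auto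
  note subG = submod_lin[OF assms(1,2), of ?G]
  have "N \<subseteq> lin sc S ?G"
  proof
    fix x assume x: "x \<in> N"
    then obtain c y where c: "c \<in> S" "y \<in> lin sc S B" "x = sc c b + y"
      using lin_insert[OF assms(1) insert.hyps(1,2)] insert.prems(2) by blast
    hence "c \<in> I" using x by (auto simp: I_def)
    then obtain d where d: "\<forall>f\<in>F. d f \<in> S" "c = (\<Sum>f\<in>F. d f * f)" using F(3) by (auto simp: lin_def)
    let ?w = "\<Sum>f\<in>F. sc (d f) (n f)"
    have w: "?w \<in> N" "?w \<in> lin sc S ?G"
      using d n(1) lin_incl[OF assms(1,2) G] by (auto intro!: submod_sum[OF N] submod_scale[OF N] submod_sum[OF subG] submod_scale[OF subG])
    have "x - ?w = y - (\<Sum>f\<in>F. sc (d f) (n f - sc f b))"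
      by (simp add: c(3) d(2) scale_right_diff_distrib sum_subtractf scale_sum_left)
    moreover have "(\<Sum>f\<in>F. sc (d f) (n f - sc f b)) \<in> lin sc S B"
      using d n(2) by (intro submod_sum[OF subB] submod_scale[OF subB]) auto
    ultimately have "x - ?w \<in> N \<inter> lin sc S B"
      using submod_diff[OF assms(1,2) N x w(1)] submod_diff[OF assms(1,2) subB c(2)] by auto
    hence "x - ?w \<in> lin sc S ?G" using F'(3) lin_mono[OF assms(1,2) G, of F'] by blast
    from submod_add[OF subG this w(2)] show "x \<in> lin sc S ?G" by simp
  qed
  moreover have "?G \<subseteq> N" using n F' by auto
  ultimately show ?case using G unfolding fg_def by blast
qed

lemma adjoin_single_poly:
  assumes "subr S" "x \<in> adjoin S {t}"
  shows "\<exists>P. (\<forall>k. coeff P k \<in> S) \<and> x = poly P t"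
  using assms(2)
proof (induction rule: adjoin.induct)
  case (base s)
  then show ?case using assms(1) by (intro exI[of _ "[:s:]"]) (auto simp: coeff_pCons subr_0 split: nat.split)
next
  case (gen b)
  then show ?case using assms(1) by (intro exI[of _ "[:0, 1:]"]) (auto simp: coeff_pCons subr_0 subr_1 split: nat.split)
next
  case (add x y)
  then obtain P Q where "\<forall>k. coeff P k \<in> S" "x = poly P t" "\<forall>k. coeff Q k \<in> S" "y = poly Q t" by auto
  then show ?case using assms(1) by (intro exI[of _ "P + Q"]) (auto simp: subr_add)
next
  case (mult x y)
  then obtain P Q where "\<forall>k. coeff P k \<in> S" "x = poly P t" "\<forall>k. coeff Q k \<in> S" "y = poly Q t" by auto
  then show ?case using assms(1)
    by (intro exI[of _ "P * Q"]) (auto simp: coeff_mult intro!: subr_sum subr_mult)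
qed

lemma poly_in_adjoin:
  assumes "subr S" "\<And>k. coeff P k \<in> S"
  shows "poly P t \<in> adjoin S {t}"
  unfolding poly_altdef using subr_adjoin[OF assms(1), of "{t}"] assms(2)
  by (intro subr_sum subr_mult subr_power) (auto intro: adjoin.intros)

text \<open>
  Hilbert's basis theorem for a homomorphic image of the polynomial ring: an ideal of \<open>S[t]\<close> is
  replaced by the polynomials over \<open>S\<close> whose value at \<open>t\<close> belongs to it. The ideals of the coefficients
  in degree \<open>d\<close> of the members of degree at most \<open>d\<close> increase with \<open>d\<close> and become stationary; finitely
  many members suffice to cancel leading terms.
\<close>
lemma noeth_adjoin_single:
  fixes S :: "'a::comm_ring_1 set"
  assumes S: "subr S" and "noeth S"
  shows "noeth (adjoin S {t})"
  unfolding noeth_def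
proof (intro allI impI)
  fix I assume I: "I \<subseteq> adjoin S {t}" "submod (*) (adjoin S {t}) I"
  note mod = module_mult[where 'a = 'a]
  note St = subr_adjoin[OF S, of "{t}"]
  define I' where "I' = {P. (\<forall>k. coeff P k \<in> S) \<and> poly P t \<in> I}"
  have I'0: "0 \<in> I'" using S I by (auto simp: I'_def subr_0 submod_def)
  have I'add: "P + Q \<in> I'" if "P \<in> I'" "Q \<in> I'" for P Q
    using that S I by (auto simp: I'_def subr_add submod_def)
  have I'diff: "P - Q \<in> I'" if "P \<in> I'" "Q \<in> I'" for P Q
    using that S submod_diff[OF mod St I(2)] by (auto simp: I'_def subr_diff)
  have I'mult: "R * P \<in> I'" if "\<And>k. coeff R k \<in> S" "P \<in> I'" for P R
    using that S submod_scale[OF I(2) poly_in_adjoin[OF S that(1)], of "poly P t"]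
    by (auto simp: I'_def coeff_mult intro!: subr_sum subr_mult)
  have I'sum: "sum g A \<in> I'" if "\<And>x. x \<in> A \<Longrightarrow> g x \<in> I'" for g :: "'a \<Rightarrow> 'a poly" and A
    using that by (induction A rule: infinite_finite_induct) (auto simp: I'0 I'add)
  have mon: "coeff (monom s n) k \<in> S" if "s \<in> S" for s n k using that S by (simp add: coeff_monom subr_0)
  \<comment> \<open>The leading coefficients, with zero coefficients admitted to make them an ideal.\<close>
  define J where "J d = {coeff P d | P. P \<in> I' \<and> degree P \<le> d}" for d
  have JS: "J d \<subseteq> S" for d by (auto simp: J_def I'_def)
  have Jsuc: "J d \<subseteq> J (Suc d)" for d
  proof
    fix c assume "c \<in> J d"
    then obtain P where P: "P \<in> I'" "degree P \<le> d" "c = coeff P d" by (auto simp: J_def)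
    have "monom 1 1 * P \<in> I'" using P subr_1[OF S] mon by (intro I'mult) auto
    moreover have "degree (monom 1 1 * P) \<le> Suc d"
      using P degree_mult_le[of "monom 1 1" P] degree_monom_le[of "1::'a" 1] by linarith
    moreover have "c = coeff (monom 1 1 * P) (Suc d)" using P by (simp add: coeff_monom_mult)
    ultimately show "c \<in> J (Suc d)" unfolding J_def by blast
  qed
  have Jmono: "J d \<subseteq> J e" if "d \<le> e" for d e using Jsuc that by (rule lift_Suc_mono_le)
  have Jadd: "c + c' \<in> J d" if "c \<in> J d" "c' \<in> J d" for c c' d
  proof -
    from that obtain P Q where "P \<in> I'" "degree P \<le> d" "c = coeff P d" "Q \<in> I'" "degree Q \<le> d" "c' = coeff Q d"
      by (auto simp: J_def)
    thus ?thesis unfolding J_def using I'add by (auto intro!: exI[of _ "P + Q"] degree_add_le)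
  qed
  have Jscale: "s * c \<in> J d" if "c \<in> J d" "s \<in> S" for c s d
  proof -
    from that obtain P where "P \<in> I'" "degree P \<le> d" "c = coeff P d" by (auto simp: J_def)
    moreover have "monom s 0 * P \<in> I'" using that mon \<open>P \<in> I'\<close> by (intro I'mult) auto
    ultimately show ?thesis unfolding J_def
      by (auto intro!: exI[of _ "smult s P"] simp: monom_0 intro: order_trans[OF degree_smult_le])
  qed
  have J0: "0 \<in> J d" for d unfolding J_def using I'0 by (auto intro!: exI[of _ 0])
  have subJ: "submod (*) S (J d)" for d using Jadd Jscale J0 by (auto simp: submod_def)
  have "submod (*) S (\<Union>d. J d)"
  proof (unfold submod_def, intro conjI ballI)
    fix c c' assume "c \<in> (\<Union>d. J d)" "c' \<in> (\<Union>d. J d)"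
    then obtain d e where "c \<in> J d" "c' \<in> J e" by auto
    hence "c \<in> J (max d e)" "c' \<in> J (max d e)" using Jmono[of _ "max d e"] by (meson max.cobounded1 max.cobounded2 subsetD)+
    thus "c + c' \<in> (\<Union>d. J d)" using Jadd by blast
  qed (use J0 Jscale in blast)+
  moreover have "(\<Union>d. J d) \<subseteq> S" using JS by auto
  ultimately obtain F where F: "finite F" "F \<subseteq> (\<Union>d. J d)" "(\<Union>d. J d) \<subseteq> lin (*) S F"
    using assms(2) unfolding noeth_def fg_def by meson
  have "\<exists>D. F \<subseteq> J D"
    using F(1,2)
  proof (induction F rule: finite_induct)
    case (insert x F)
    then obtain D d where "F \<subseteq> J D" "x \<in> J d" by auto
    hence "insert x F \<subseteq> J (max d D)" using Jmono[of d "max d D"] Jmono[of D "max d D"] by auto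
    thus ?case by blast
  qed auto
  then obtain D where D: "F \<subseteq> J D" by blast
  have JD: "J e \<subseteq> J D" for e using F(3) lin_least[OF subJ D] by blast
  have "\<forall>d. \<exists>F. finite F \<and> F \<subseteq> J d \<and> J d \<subseteq> lin (*) S F"
    using assms(2) subJ JS unfolding noeth_def fg_def by blast
  then obtain H where H: "\<And>d. finite (H d)" "\<And>d. H d \<subseteq> J d" "\<And>d. J d \<subseteq> lin (*) S (H d)" by metis
  have "\<forall>d. \<forall>c\<in>H d. \<exists>P. P \<in> I' \<and> degree P \<le> d \<and> coeff P d = c"
    using H(2) unfolding J_def by blast
  then obtain p where p: "\<And>d c. c \<in> H d \<Longrightarrow> p d c \<in> I' \<and> degree (p d c) \<le> d \<and> coeff (p d c) d = c"
    by metis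
  define B where "B = (\<Union>d\<le>D. (\<lambda>c. poly (p d c) t) ` H d)"
  have B: "finite B" "B \<subseteq> I" using H(1) p by (auto simp: B_def I'_def)
  note subB = submod_lin[OF mod St, of B]
  have main: "poly P t \<in> lin (*) (adjoin S {t}) B" if "P \<in> I'" "degree P \<le> n" for P n
    using that
  proof (induction n arbitrary: P rule: less_induct)
    case (less n)
    note P = less.prems
    \<comment> \<open>Beyond the stationary degree, members of degree \<open>D\<close> are multiplied by powers of the variable.\<close>
    define e where "e = min n D"
    have "coeff P n \<in> J n" using P by (auto simp: J_def)
    hence "coeff P n \<in> J e" using JD[of n] by (auto simp: e_def min_def)
    hence "coeff P n \<in> lin (*) S (H e)" using H(3) by blast
    then obtain d where d: "\<forall>f\<in>H e. d f \<in> S" "coeff P n = (\<Sum>f\<in>H e. d f * f)"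
      unfolding lin_def by blast
    define Q where "Q = (\<Sum>f\<in>H e. monom (d f) (n - e) * p e f)"
    have "Q \<in> I'" unfolding Q_def using d p mon by (intro I'sum I'mult) auto
    have "degree Q \<le> n" unfolding Q_def
    proof (intro degree_sum_le H(1))
      fix f assume "f \<in> H e"
      hence "degree (monom (d f) (n - e)) + degree (p e f) \<le> (n - e) + e"
        using p degree_monom_le by (intro add_mono) auto
      thus "degree (monom (d f) (n - e) * p e f) \<le> n"
        using degree_mult_le[of "monom (d f) (n - e)" "p e f"] by (auto simp: e_def)
    qed
    have "coeff Q n = coeff P n" unfolding d(2) Q_def coeff_sum
    proof (intro sum.cong refl)
      fix f assume "f \<in> H e"
      thus "coeff (monom (d f) (n - e) * p e f) n = d f * f"
        using p[of f e] by (auto simp: coeff_monom_mult e_def)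
    qed
    have "poly Q t = (\<Sum>f\<in>H e. (d f * t ^ (n - e)) * poly (p e f) t)"
      by (simp add: Q_def poly_sum poly_monom)
    also have "\<dots> \<in> lin (*) (adjoin S {t}) B"
    proof (intro submod_sum[OF subB] submod_scale[OF subB])
      fix f assume f: "f \<in> H e"
      show "d f * t ^ (n - e) \<in> adjoin S {t}"
        using f d(1) by (intro subr_mult[OF St] subr_power[OF St]) (auto intro: adjoin.intros)
      have "poly (p e f) t \<in> B" using f by (auto simp: B_def e_def)
      thus "poly (p e f) t \<in> lin (*) (adjoin S {t}) B" using lin_incl[OF mod St B(1)] by blast
    qed
    finally have Q: "poly Q t \<in> lin (*) (adjoin S {t}) B" .
    have "poly (P - Q) t \<in> lin (*) (adjoin S {t}) B"
    proof (cases "P - Q = 0")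
      case True
      then show ?thesis using subB by (simp add: submod_def)
    next
      case False
      have "degree (P - Q) \<le> n" using P \<open>degree Q \<le> n\<close> by (intro degree_diff_le)
      moreover have "degree (P - Q) \<noteq> n"
        using False \<open>coeff Q n = coeff P n\<close> by (metis coeff_diff diff_self leading_coeff_0_iff)
      ultimately show ?thesis using I'diff[OF P(1) \<open>Q \<in> I'\<close>] by (intro less.IH[of "degree (P - Q)"]) auto
    qed
    from submod_add[OF subB this Q] show "poly P t \<in> lin (*) (adjoin S {t}) B" by simp
  qed
  have "I \<subseteq> lin (*) (adjoin S {t}) B"
  proof
    fix x assume "x \<in> I"
    then obtain P where "\<forall>k. coeff P k \<in> S" "x = poly P t" using adjoin_single_poly[OF S] I(1) by blast
    thus "x \<in> lin (*) (adjoin S {t}) B" using main[of P "degree P"] \<open>x \<in> I\<close> by (auto simp: I'_def)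
  qed
  thus "fg (*) (adjoin S {t}) I" using B unfolding fg_def by blast
qed

lemma noeth_adjoin:
  assumes "finite B" "subr S" "noeth S"
  shows "noeth (adjoin S B)"
  using assms
proof (induction B arbitrary: S rule: finite_induct)
  case empty
  have "adjoin S {} = S" using empty adjoin_least[of S S "{}"] by (auto intro: adjoin.base)
  thus ?case using empty by simp
next
  case (insert b B)
  have "adjoin S (insert b B) = adjoin (adjoin S {b}) B"
  proof
    show "adjoin (adjoin S {b}) B \<subseteq> adjoin S (insert b B)"
      using insert.prems by (intro adjoin_least subr_adjoin) (auto intro: adjoin.intros)
  qed (rule adjoin_insert[OF insert.prems(1)])
  thus ?case using insert noeth_adjoin_single subr_adjoin by metis
qed

lemma noeth_field:
  fixes S :: "'a::field set"
  assumes "subr S" "\<And>x. x \<in> S \<Longrightarrow> inverse x \<in> S"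
  shows "noeth S"
  unfolding noeth_def
proof (intro allI impI)
  fix I assume I: "I \<subseteq> S" "submod (*) S I"
  show "fg (*) S I"
  proof (cases "I \<subseteq> {0}")
    case True
    thus ?thesis unfolding fg_def lin_def by (intro exI[of _ "{}"]) auto
  next
    case False
    then obtain x where x: "x \<in> I" "x \<noteq> 0" by auto
    have "y \<in> lin (*) S {x}" if "y \<in> I" for y
      using that x I assms unfolding lin_def
      by (auto intro!: exI[of _ "\<lambda>_. y * inverse x"] subr_mult)
    thus ?thesis using x unfolding fg_def by (intro exI[of _ "{x}"]) auto
  qed
qed

section \<open>Field automorphisms\<close>

abbreviation ivf :: "('a \<Rightarrow> 'b) \<Rightarrow> 'b \<Rightarrow> 'a" where "ivf \<equiv> inv_into UNIV"

definition is_aut :: "('l::field \<Rightarrow> 'l) \<Rightarrow> bool" where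
  "is_aut \<sigma> \<longleftrightarrow> bij \<sigma> \<and> (\<forall>x y. \<sigma> (x + y) = \<sigma> x + \<sigma> y) \<and> (\<forall>x y. \<sigma> (x * y) = \<sigma> x * \<sigma> y)"

context
  fixes \<sigma> :: "'l::field \<Rightarrow> 'l"
  assumes \<sigma>: "is_aut \<sigma>"
begin
lemma aut_add: "\<sigma> (x + y) = \<sigma> x + \<sigma> y" using \<sigma> by (simp add: is_aut_def)
lemma aut_mult: "\<sigma> (x * y) = \<sigma> x * \<sigma> y" using \<sigma> by (simp add: is_aut_def)
lemma aut_bij: "bij \<sigma>" using \<sigma> by (simp add: is_aut_def)
lemma aut_0: "\<sigma> 0 = 0" using aut_add[of 0 0] by (metis add_cancel_left_left add_0)
lemma aut_eq_0_iff: "\<sigma> x = 0 \<longleftrightarrow> x = 0"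
  by (metis aut_0 bij_is_inj[OF aut_bij] inj_eq)
lemma aut_1: "\<sigma> 1 = 1"
  using aut_mult[of 1 1] aut_eq_0_iff[of 1] by simp
lemma aut_uminus: "\<sigma> (- x) = - \<sigma> x"
  using aut_add[of x "- x"] aut_0 by (simp add: eq_neg_iff_add_eq_0 add.commute)
lemma aut_diff: "\<sigma> (x - y) = \<sigma> x - \<sigma> y"
  using aut_add[of x "- y"] by (simp add: aut_uminus)
lemma aut_inverse: "\<sigma> (inverse x) = inverse (\<sigma> x)"
proof (cases "x = 0")
  case False
  hence "\<sigma> (inverse x) * \<sigma> x = 1" by (metis aut_mult aut_1 left_inverse)
  thus ?thesis by (metis inverse_unique mult.commute)
qed (simp add: aut_0)
lemma aut_divide: "\<sigma> (x / y) = \<sigma> x / \<sigma> y" by (simp add: divide_inverse aut_mult aut_inverse)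
lemma aut_sum: "\<sigma> (sum f A) = (\<Sum>i\<in>A. \<sigma> (f i))"
  by (induction A rule: infinite_finite_induct) (auto simp: aut_0 aut_add)
lemma aut_prod: "\<sigma> (prod f A) = (\<Prod>i\<in>A. \<sigma> (f i))"
  by (induction A rule: infinite_finite_induct) (auto simp: aut_1 aut_mult)
lemma aut_power: "\<sigma> (x ^ k) = \<sigma> x ^ k"
  by (induction k) (auto simp: aut_1 aut_mult)
lemma aut_powi: "\<sigma> (x powi k) = \<sigma> x powi k"
  by (simp add: power_int_def aut_power aut_inverse)
lemma aut_ivf_left: "ivf \<sigma> (\<sigma> x) = x" by (simp add: bij_is_inj[OF aut_bij])
lemma aut_ivf_right: "\<sigma> (ivf \<sigma> x) = x" by (simp add: bij_is_surj[OF aut_bij] surj_f_inv_f)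
lemma aut_ivf_comp: "ivf \<sigma> \<circ> \<sigma> = id" "\<sigma> \<circ> ivf \<sigma> = id"
  by (auto simp: fun_eq_iff aut_ivf_left aut_ivf_right)
lemma is_aut_ivf: "is_aut (ivf \<sigma>)"
  unfolding is_aut_def
proof (intro conjI allI)
  show "bij (ivf \<sigma>)" by (rule bij_imp_bij_inv[OF aut_bij])
  show "ivf \<sigma> (x + y) = ivf \<sigma> x + ivf \<sigma> y" for x y by (metis aut_add aut_ivf_left aut_ivf_right)
  show "ivf \<sigma> (x * y) = ivf \<sigma> x * ivf \<sigma> y" for x y by (metis aut_mult aut_ivf_left aut_ivf_right)
qed
lemma aut_ivf_ivf: "ivf (ivf \<sigma>) = \<sigma>" by (rule inv_inv_eq[OF aut_bij])
end

lemma is_aut_id: "is_aut id" by (simp add: is_aut_def)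
lemma is_aut_comp: "is_aut \<sigma> \<Longrightarrow> is_aut \<tau> \<Longrightarrow> is_aut (\<sigma> \<circ> \<tau>)"
  by (auto simp: is_aut_def bij_comp)
lemma ivf_comp: "is_aut \<sigma> \<Longrightarrow> is_aut \<tau> \<Longrightarrow> ivf (\<sigma> \<circ> \<tau>) = ivf \<tau> \<circ> ivf \<sigma>"
  by (simp add: o_inv_distrib aut_bij)

lemma comp_ivf_eq:
  assumes "is_aut \<sigma>"
  shows "\<sigma> \<circ> \<tau> = \<rho> \<longleftrightarrow> \<tau> = ivf \<sigma> \<circ> \<rho>" "\<tau> \<circ> \<sigma> = \<rho> \<longleftrightarrow> \<tau> = \<rho> \<circ> ivf \<sigma>"
  using aut_ivf_comp[OF assms] by (metis comp_assoc comp_id id_comp)+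

lemma inj_comp:
  assumes "is_aut c"
  shows "inj_on (\<lambda>a::'l::field \<Rightarrow> 'l. c \<circ> a) A"
proof (rule inj_onI)
  fix a b :: "'l \<Rightarrow> 'l" assume "c \<circ> a = c \<circ> b"
  hence "a = ivf c \<circ> (c \<circ> b)" using comp_ivf_eq(1)[OF assms, of a "c \<circ> b"] by simp
  thus "a = b" using comp_ivf_eq(1)[OF assms, of b "c \<circ> b"] by simp
qed

lemma Aut_over_iff: "\<sigma> \<in> Aut_over K \<longleftrightarrow> is_aut \<sigma> \<and> (\<forall>x\<in>K. \<sigma> x = x)"
  using aut_1[of \<sigma>]
  by (auto simp: Aut_over_def ring_iso_def ring_hom_def ring_of_type_algebra_def is_aut_def)

section \<open>The skew group ring\<close>

lemma sum_fun_apply: "sum f A x = (\<Sum>i\<in>A. f i x)"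
  by (induction A rule: infinite_finite_induct) auto

definition fscale :: "'l::comm_ring_1 \<Rightarrow> ('x \<Rightarrow> 'l) \<Rightarrow> 'x \<Rightarrow> 'l" where
  "fscale c f = (\<lambda>a. c * f a)"

lemma fscale_apply [simp]: "fscale c f a = c * f a" by (simp add: fscale_def)

lemma module_fscale: "Modules.module (fscale :: 'l::comm_ring_1 \<Rightarrow> ('x \<Rightarrow> 'l) \<Rightarrow> 'x \<Rightarrow> 'l)"
  by unfold_locales (auto simp: fun_eq_iff algebra_simps)

text \<open>
  Only monoids \<open>M\<close> that are groups occur below. Inverses make the product a single sum over the support
  of the first factor, and they are what the anti-automorphism \<open>iota\<close> needs.
\<close>
locale skew_group =
  fixes M :: "('l::field \<Rightarrow> 'l) set"
  assumes M_id: "id \<in> M" and M_comp: "a \<in> M \<Longrightarrow> b \<in> M \<Longrightarrow> a \<circ> b \<in> M"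
    and M_inv: "a \<in> M \<Longrightarrow> ivf a \<in> M" and M_aut: "a \<in> M \<Longrightarrow> is_aut a"
begin

abbreviation "R \<equiv> skew_ring M"
abbreviation supp :: "(('l \<Rightarrow> 'l) \<Rightarrow> 'l) \<Rightarrow> ('l \<Rightarrow> 'l) set" where "supp f \<equiv> {a. f a \<noteq> 0}"

lemma carrier_iff: "f \<in> carrier R \<longleftrightarrow> finite (supp f) \<and> supp f \<subseteq> M"
  by (simp add: skew_ring_def)

lemma zero_eq: "\<zero>\<^bsub>R\<^esub> = 0" by (simp add: skew_ring_def zero_fun_def)
lemma add_eq: "f \<oplus>\<^bsub>R\<^esub> g = f + g" by (simp add: skew_ring_def plus_fun_def)
lemma one_eq: "\<one>\<^bsub>R\<^esub> = skew_const 1" by (simp add: skew_ring_def skew_monom_def)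

lemma mult_eq:
  assumes "f \<in> carrier R" "g \<in> carrier R" "finite A" "supp f \<subseteq> A" "A \<subseteq> M"
  shows "(f \<otimes>\<^bsub>R\<^esub> g) c = (\<Sum>a\<in>A. f a * a (g (ivf a \<circ> c)))"
proof -
  have "(f \<otimes>\<^bsub>R\<^esub> g) c = (\<Sum>a\<in>supp f. \<Sum>b\<in>supp g. if a \<circ> b = c then f a * a (g b) else 0)"
    by (simp add: skew_ring_def)
  also have "\<dots> = (\<Sum>a\<in>supp f. f a * a (g (ivf a \<circ> c)))"
  proof (intro sum.cong refl)
    fix a assume "a \<in> supp f"
    hence a: "is_aut a" using assms(1) M_aut carrier_iff by blast
    have "(\<Sum>b\<in>supp g. if a \<circ> b = c then f a * a (g b) else 0) =
          (\<Sum>b\<in>supp g. if b = ivf a \<circ> c then f a * a (g b) else 0)"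
      by (simp add: comp_ivf_eq(1)[OF a])
    also have "\<dots> = f a * a (g (ivf a \<circ> c))"
      using assms(2) by (subst sum.delta) (auto simp: carrier_iff aut_0[OF a])
    finally show "(\<Sum>b\<in>supp g. if a \<circ> b = c then f a * a (g b) else 0) = f a * a (g (ivf a \<circ> c))" .
  qed
  also have "\<dots> = (\<Sum>a\<in>A. f a * a (g (ivf a \<circ> c)))"
    using assms by (intro sum.mono_neutral_left) auto
  finally show ?thesis .
qed

lemma mult_eq': "f \<in> carrier R \<Longrightarrow> g \<in> carrier R \<Longrightarrow> (f \<otimes>\<^bsub>R\<^esub> g) c = (\<Sum>a\<in>supp f. f a * a (g (ivf a \<circ> c)))"
  by (rule mult_eq) (auto simp: carrier_iff)

lemma carrier_supset: "finite A \<Longrightarrow> A \<subseteq> M \<Longrightarrow> supp f \<subseteq> A \<Longrightarrow> f \<in> carrier R"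
  by (auto simp: carrier_iff intro: finite_subset)

lemma mult_supp:
  assumes "f \<in> carrier R" "g \<in> carrier R"
  shows "supp (f \<otimes>\<^bsub>R\<^esub> g) \<subseteq> (\<lambda>(a, b). a \<circ> b) ` (supp f \<times> supp g)"
proof
  fix c assume "c \<in> supp (f \<otimes>\<^bsub>R\<^esub> g)"
  hence "(\<Sum>a\<in>supp f. f a * a (g (ivf a \<circ> c))) \<noteq> 0" using mult_eq'[OF assms] by simp
  then obtain a where a: "a \<in> supp f" "f a * a (g (ivf a \<circ> c)) \<noteq> 0" by (meson sum.not_neutral_contains_not_neutral)
  have aut: "is_aut a" using a assms M_aut carrier_iff by blast
  have "ivf a \<circ> c \<in> supp g" using a aut_0[OF aut] by auto
  moreover have "c = a \<circ> (ivf a \<circ> c)" using comp_ivf_eq(1)[OF aut] by metis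
  ultimately show "c \<in> (\<lambda>(a, b). a \<circ> b) ` (supp f \<times> supp g)" using a(1)
    by (intro image_eqI[where x = "(a, ivf a \<circ> c)"]) auto
qed

lemma R_mult:
  assumes "f \<in> carrier R" "g \<in> carrier R"
  shows "f \<otimes>\<^bsub>R\<^esub> g \<in> carrier R"
proof (rule carrier_supset[OF _ _ mult_supp[OF assms]])
  show "finite ((\<lambda>(a, b). a \<circ> b) ` (supp f \<times> supp g))" using assms by (auto simp: carrier_iff)
  show "(\<lambda>(a, b). a \<circ> b) ` (supp f \<times> supp g) \<subseteq> M" using assms M_comp by (auto simp: carrier_iff)
qed

lemma R_add: "f \<in> carrier R \<Longrightarrow> g \<in> carrier R \<Longrightarrow> f + g \<in> carrier R"
  by (rule carrier_supset[of "supp f \<union> supp g"]) (auto simp: carrier_iff)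

lemma R_uminus: "f \<in> carrier R \<Longrightarrow> - f \<in> carrier R"
  by (simp add: carrier_iff)

lemma R_fscale: "f \<in> carrier R \<Longrightarrow> fscale c f \<in> carrier R"
  by (rule carrier_supset[of "supp f"]) (auto simp: carrier_iff)

lemma R_zero: "0 \<in> carrier R" by (simp add: carrier_iff)

lemma R_sum: "(\<And>i. i \<in> A \<Longrightarrow> f i \<in> carrier R) \<Longrightarrow> sum f A \<in> carrier R"
  by (induction A rule: infinite_finite_induct) (auto simp: R_zero R_add)

lemma R_monom: "a \<in> M \<Longrightarrow> skew_monom l a \<in> carrier R"
  by (rule carrier_supset[of "{a}"]) (auto simp: skew_monom_def)

lemma R_monom_mult:
  assumes "f \<in> carrier R" "a \<in> M"
  shows "skew_monom l a \<otimes>\<^bsub>R\<^esub> f = (\<lambda>c. l * a (f (ivf a \<circ> c)))"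
proof
  fix c
  have "(skew_monom l a \<otimes>\<^bsub>R\<^esub> f) c = (\<Sum>a'\<in>{a}. skew_monom l a a' * a' (f (ivf a' \<circ> c)))"
    by (rule mult_eq[OF R_monom[OF assms(2)] assms(1)]) (use assms(2) in \<open>auto simp: skew_monom_def\<close>)
  thus "(skew_monom l a \<otimes>\<^bsub>R\<^esub> f) c = l * a (f (ivf a \<circ> c))" by (simp add: skew_monom_def)
qed

lemma const_mult: "f \<in> carrier R \<Longrightarrow> skew_const l \<otimes>\<^bsub>R\<^esub> f = fscale l f"
  by (simp add: R_monom_mult M_id fun_eq_iff)

lemma R_mult_monom:
  assumes "f \<in> carrier R" "b \<in> M"
  shows "f \<otimes>\<^bsub>R\<^esub> skew_monom l b = (\<lambda>c. f (c \<circ> ivf b) * (c \<circ> ivf b) l)"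
proof
  fix c
  have b: "is_aut b" by (rule M_aut) fact
  have "(f \<otimes>\<^bsub>R\<^esub> skew_monom l b) c = (\<Sum>a\<in>supp f. f a * a (skew_monom l b (ivf a \<circ> c)))"
    by (rule mult_eq') (use assms R_monom in auto)
  also have "\<dots> = (\<Sum>a\<in>supp f. if a = c \<circ> ivf b then f a * a l else 0)"
  proof (intro sum.cong refl)
    fix a assume "a \<in> supp f"
    hence a: "is_aut a" using assms(1) M_aut carrier_iff by blast
    have "ivf a \<circ> c = b \<longleftrightarrow> a = c \<circ> ivf b"
      using comp_ivf_eq(1)[OF a, of b c] comp_ivf_eq(2)[OF b, of a c] by metis
    thus "f a * a (skew_monom l b (ivf a \<circ> c)) = (if a = c \<circ> ivf b then f a * a l else 0)"
      by (auto simp: skew_monom_def aut_0[OF a])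
  qed
  also have "\<dots> = f (c \<circ> ivf b) * (c \<circ> ivf b) l"
    using assms by (subst sum.delta) (auto simp: carrier_iff)
  finally show "(f \<otimes>\<^bsub>R\<^esub> skew_monom l b) c = f (c \<circ> ivf b) * (c \<circ> ivf b) l" .
qed

lemma mult_const: "f \<in> carrier R \<Longrightarrow> f \<otimes>\<^bsub>R\<^esub> skew_const l = (\<lambda>c. f c * c l)"
  using R_mult_monom[of f id l] M_id by simp

lemma monom_mult_monom:
  assumes "a \<in> M" "b \<in> M"
  shows "skew_monom l a \<otimes>\<^bsub>R\<^esub> skew_monom l' b = skew_monom (l * a l') (a \<circ> b)"
proof -
  note a = M_aut[OF assms(1)]
  show ?thesis unfolding R_monom_mult[OF R_monom[OF assms(2)] assms(1)]
  proof
    fix c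
    have "ivf a \<circ> c = b \<longleftrightarrow> c = a \<circ> b" using comp_ivf_eq(1)[OF a, of b c] by metis
    thus "l * a (skew_monom l' b (ivf a \<circ> c)) = skew_monom (l * a l') (a \<circ> b) c"
      by (simp add: skew_monom_def aut_0[OF a])
  qed
qed

lemma R_assoc:
  assumes "f \<in> carrier R" "g \<in> carrier R" "h \<in> carrier R"
  shows "(f \<otimes>\<^bsub>R\<^esub> g) \<otimes>\<^bsub>R\<^esub> h = f \<otimes>\<^bsub>R\<^esub> (g \<otimes>\<^bsub>R\<^esub> h)"
proof
  fix c
  define D where "D = (\<lambda>(a, b). a \<circ> b) ` (supp f \<times> supp g)"
  have D: "finite D" "D \<subseteq> M" using assms M_comp by (auto simp: D_def carrier_iff)
  have "((f \<otimes>\<^bsub>R\<^esub> g) \<otimes>\<^bsub>R\<^esub> h) c = (\<Sum>d\<in>D. (f \<otimes>\<^bsub>R\<^esub> g) d * d (h (ivf d \<circ> c)))"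
    using mult_supp[OF assms(1,2)] D
    by (intro mult_eq R_mult assms) (auto simp: D_def)
  also have "\<dots> = (\<Sum>a\<in>supp f. \<Sum>d\<in>D. f a * a (g (ivf a \<circ> d)) * d (h (ivf d \<circ> c)))"
    by (subst sum.swap) (simp add: mult_eq'[OF assms(1,2)] sum_distrib_right)
  also have "\<dots> = (\<Sum>a\<in>supp f. f a * a ((g \<otimes>\<^bsub>R\<^esub> h) (ivf a \<circ> c)))"
  proof (intro sum.cong refl)
    fix a assume af: "a \<in> supp f"
    hence "a \<in> M" using assms(1) carrier_iff by blast
    note a = M_aut[OF this]
    have "(\<Sum>d\<in>D. f a * a (g (ivf a \<circ> d)) * d (h (ivf d \<circ> c))) =
      (\<Sum>d\<in>(\<lambda>b. a \<circ> b) ` supp g. f a * a (g (ivf a \<circ> d)) * d (h (ivf d \<circ> c)))"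
    proof (rule sum.mono_neutral_right[OF D(1)])
      show "(\<lambda>b. a \<circ> b) ` supp g \<subseteq> D" using af by (auto simp: D_def)
      show "\<forall>d\<in>D - (\<lambda>b. a \<circ> b) ` supp g. f a * a (g (ivf a \<circ> d)) * d (h (ivf d \<circ> c)) = 0"
      proof
        fix d assume d: "d \<in> D - (\<lambda>b. a \<circ> b) ` supp g"
        have "d = a \<circ> (ivf a \<circ> d)" using comp_ivf_eq(1)[OF a] by metis
        hence "g (ivf a \<circ> d) = 0" using d by blast
        thus "f a * a (g (ivf a \<circ> d)) * d (h (ivf d \<circ> c)) = 0" by (simp add: aut_0[OF a])
      qed
    qed
    also have "\<dots> = (\<Sum>b\<in>supp g. f a * a (g (ivf a \<circ> (a \<circ> b))) * (a \<circ> b) (h (ivf (a \<circ> b) \<circ> c)))"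
      by (subst sum.reindex) (auto simp: inj_on_def comp_ivf_eq(1)[OF a] o_def[of a] fun_eq_iff intro: injD[OF bij_is_inj[OF aut_bij[OF a]]])
    also have "\<dots> = (\<Sum>b\<in>supp g. f a * a (g b * b (h (ivf b \<circ> (ivf a \<circ> c)))))"
    proof (intro sum.cong refl)
      fix b assume "b \<in> supp g"
      hence "b \<in> M" using assms(2) carrier_iff by blast
      note b = M_aut[OF this]
      have "ivf a \<circ> (a \<circ> b) = b" using comp_ivf_eq(1)[OF a] by metis
      thus "f a * a (g (ivf a \<circ> (a \<circ> b))) * (a \<circ> b) (h (ivf (a \<circ> b) \<circ> c)) = f a * a (g b * b (h (ivf b \<circ> (ivf a \<circ> c))))"
        by (simp add: ivf_comp[OF a b] aut_mult[OF a] comp_assoc)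
    qed
    also have "\<dots> = f a * a ((g \<otimes>\<^bsub>R\<^esub> h) (ivf a \<circ> c))"
      by (simp add: mult_eq'[OF assms(2,3)] aut_sum[OF a] sum_distrib_left)
    finally show "(\<Sum>d\<in>D. f a * a (g (ivf a \<circ> d)) * d (h (ivf d \<circ> c))) = f a * a ((g \<otimes>\<^bsub>R\<^esub> h) (ivf a \<circ> c))" .
  qed
  also have "\<dots> = (f \<otimes>\<^bsub>R\<^esub> (g \<otimes>\<^bsub>R\<^esub> h)) c"
    by (rule mult_eq'[symmetric]) (use assms R_mult in auto)
  finally show "((f \<otimes>\<^bsub>R\<^esub> g) \<otimes>\<^bsub>R\<^esub> h) c = (f \<otimes>\<^bsub>R\<^esub> (g \<otimes>\<^bsub>R\<^esub> h)) c" .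
qed

lemma mult_add_right:
  assumes "f \<in> carrier R" "g \<in> carrier R" "h \<in> carrier R"
  shows "f \<otimes>\<^bsub>R\<^esub> (g + h) = f \<otimes>\<^bsub>R\<^esub> g + f \<otimes>\<^bsub>R\<^esub> h"
proof
  fix c
  have aut: "is_aut a" if "a \<in> supp f" for a using that assms(1) M_aut carrier_iff by blast
  show "(f \<otimes>\<^bsub>R\<^esub> (g + h)) c = (f \<otimes>\<^bsub>R\<^esub> g + f \<otimes>\<^bsub>R\<^esub> h) c"
    using assms by (auto simp: mult_eq' R_add aut_add[OF aut] distrib_left sum.distrib[symmetric] intro!: sum.cong)
qed

lemma mult_add_left:
  assumes "f \<in> carrier R" "g \<in> carrier R" "h \<in> carrier R"
  shows "(f + g) \<otimes>\<^bsub>R\<^esub> h = f \<otimes>\<^bsub>R\<^esub> h + g \<otimes>\<^bsub>R\<^esub> h"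
proof
  fix c
  let ?A = "supp f \<union> supp g"
  have A: "finite ?A" "?A \<subseteq> M" "supp (f + g) \<subseteq> ?A" using assms by (auto simp: carrier_iff)
  show "((f + g) \<otimes>\<^bsub>R\<^esub> h) c = (f \<otimes>\<^bsub>R\<^esub> h + g \<otimes>\<^bsub>R\<^esub> h) c"
  proof -
    have "((f + g) \<otimes>\<^bsub>R\<^esub> h) c = (\<Sum>a\<in>?A. (f + g) a * a (h (ivf a \<circ> c)))"
      by (rule mult_eq) (use assms A R_add in auto)
    moreover have "(f \<otimes>\<^bsub>R\<^esub> h) c = (\<Sum>a\<in>?A. f a * a (h (ivf a \<circ> c)))"
      by (rule mult_eq) (use assms A in auto)
    moreover have "(g \<otimes>\<^bsub>R\<^esub> h) c = (\<Sum>a\<in>?A. g a * a (h (ivf a \<circ> c)))"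
      by (rule mult_eq) (use assms A in auto)
    ultimately show ?thesis by (simp add: distrib_right sum.distrib)
  qed
qed

lemma ring_R: "ring R"
proof (rule ringI)
  show "abelian_group R"
  proof (rule abelian_groupI)
    fix f assume f: "f \<in> carrier R"
    show "\<exists>g\<in>carrier R. g \<oplus>\<^bsub>R\<^esub> f = \<zero>\<^bsub>R\<^esub>"
      using R_uminus[OF f] by (intro bexI[of _ "- f"]) (auto simp: add_eq zero_eq)
  qed (auto simp: add_eq zero_eq R_add R_zero add_ac)
  show "Group.monoid R"
  proof (rule monoidI)
    fix f assume f: "f \<in> carrier R"
    show "\<one>\<^bsub>R\<^esub> \<otimes>\<^bsub>R\<^esub> f = f" "f \<otimes>\<^bsub>R\<^esub> \<one>\<^bsub>R\<^esub> = f"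
    proof -
      show "\<one>\<^bsub>R\<^esub> \<otimes>\<^bsub>R\<^esub> f = f" using f by (simp add: one_eq const_mult fun_eq_iff)
      have "f c * c 1 = f c" for c
        using f aut_1[OF M_aut[of c]] by (cases "f c = 0") (auto simp: carrier_iff)
      thus "f \<otimes>\<^bsub>R\<^esub> \<one>\<^bsub>R\<^esub> = f" using f by (simp add: one_eq mult_const fun_eq_iff del: mult_cancel_left1 mult_cancel_left2 mult_cancel_right1 mult_cancel_right2 mult_eq_self_implies_10)
    qed
  qed (auto simp: R_mult R_assoc one_eq R_monom M_id)
qed (auto simp: add_eq mult_add_left mult_add_right)

lemma a_inv_eq: "f \<in> carrier R \<Longrightarrow> \<ominus>\<^bsub>R\<^esub> f = - f"
proof -
  assume f: "f \<in> carrier R"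
  interpret ring R by (rule ring_R)
  have "(- f) \<oplus>\<^bsub>R\<^esub> f = \<zero>\<^bsub>R\<^esub>" by (simp add: add_eq zero_eq)
  thus ?thesis using f R_uminus[OF f] by (metis minus_equality)
qed

lemma finsum_eq:
  assumes "\<And>b. b \<in> F \<Longrightarrow> f b \<in> carrier R"
  shows "(\<Oplus>\<^bsub>R\<^esub>b\<in>F. f b) = sum f F"
proof -
  interpret ring R by (rule ring_R)
  show ?thesis using assms
  proof (induction F rule: infinite_finite_induct)
    case (insert x F)
    then show ?case by (subst finsum_insert) (auto simp: add_eq)
  qed (auto simp: zero_eq)
qed

section \<open>Left spans\<close>

text \<open>
  Finite combinations of a possibly infinite set, in the pointwise form; \<open>left_span_eq\<close> identifies them
  with the additive subgroup of products.
\<close>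
definition lspan :: "'l set \<Rightarrow> (('l \<Rightarrow> 'l) \<Rightarrow> 'l) set \<Rightarrow> (('l \<Rightarrow> 'l) \<Rightarrow> 'l) set" where
  "lspan S E = (\<Union>F\<in>{F. finite F \<and> F \<subseteq> E}. lin fscale S F)"

lemma submod_lspan:
  assumes "subr S"
  shows "submod fscale S (lspan S E)"
proof (unfold submod_def, intro conjI ballI)
  note * = submod_lin[OF module_fscale assms]
  show "0 \<in> lspan S E" unfolding lspan_def using submod_0[OF *[of "{}"]] by blast
  show "fscale s x \<in> lspan S E" if "s \<in> S" "x \<in> lspan S E" for s x
    using that submod_scale[OF *] unfolding lspan_def by blast
  show "x + y \<in> lspan S E" if "x \<in> lspan S E" "y \<in> lspan S E" for x y
  proof -
    from that obtain F F' where F: "finite F" "F \<subseteq> E" "x \<in> lin fscale S F" "finite F'" "F' \<subseteq> E" "y \<in> lin fscale S F'"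
      unfolding lspan_def by blast
    hence "x \<in> lin fscale S (F \<union> F')" "y \<in> lin fscale S (F \<union> F')"
      using lin_mono[OF module_fscale assms, of "F \<union> F'"] by auto
    hence "x + y \<in> lin fscale S (F \<union> F')" by (rule submod_add[OF *])
    thus ?thesis unfolding lspan_def using F by blast
  qed
qed

lemma lspan_incl:
  assumes "subr S"
  shows "E \<subseteq> lspan S E"
proof
  fix e assume "e \<in> E"
  moreover have "e \<in> lin fscale S {e}" using lin_incl[OF module_fscale assms, of "{e}"] by simp
  ultimately show "e \<in> lspan S E" unfolding lspan_def by (intro UN_I[of "{e}"]) auto
qed

lemma lspan_least: "submod fscale S N \<Longrightarrow> E \<subseteq> N \<Longrightarrow> lspan S E \<subseteq> N"
  unfolding lspan_def using lin_least[of fscale S N] by blast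

lemma lspan_finite: "subr S \<Longrightarrow> finite E \<Longrightarrow> lspan S E = lin fscale S E"
  unfolding lspan_def using lin_mono[OF module_fscale, of S E] by blast

lemma left_span_eq:
  assumes S: "subr S" and E: "E \<subseteq> carrier R"
  shows "left_span R (skew_const ` S) E = lspan S E"
proof
  interpret ring R by (rule ring_R)
  have prod: "skew_const ` S <#>\<^bsub>R\<^esub> E = {fscale s e | s e. s \<in> S \<and> e \<in> E}"
    using E const_mult unfolding set_mult_def by (auto; metis subsetD)
  note sub = submod_lspan[OF S, of E]
  have lc: "lspan S E \<subseteq> carrier R"
    using E by (intro lspan_least) (auto simp: submod_def R_zero R_add R_fscale)
  show "left_span R (skew_const ` S) E \<subseteq> lspan S E"
  proof
    fix x assume "x \<in> left_span R (skew_const ` S) E"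
    hence "x \<in> generate (add_monoid R) (skew_const ` S <#>\<^bsub>R\<^esub> E)" by (simp add: left_span_def)
    thus "x \<in> lspan S E"
    proof (induction rule: generate.induct)
      case one
      then show ?case using submod_0[OF sub] by (simp add: zero_eq zero_fun_def)
    next
      case (incl h)
      then show ?case using prod lspan_incl[OF S, of E] submod_scale[OF sub] by auto
    next
      case (inv h)
      then obtain s e where h: "h = fscale s e" "s \<in> S" "e \<in> E" using prod by auto
      have "inv\<^bsub>add_monoid R\<^esub> h = - h"
        using a_inv_eq[of h] h E R_fscale by (auto simp: a_inv_def)
      also have "\<dots> = fscale (- s) e" by (simp add: h fun_eq_iff)
      also have "\<dots> \<in> lspan S E" using h lspan_incl[OF S, of E] subr_uminus[OF S]
        by (intro submod_scale[OF sub]) auto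
      finally show ?case .
    next
      case (eng h1 h2)
      then show ?case using submod_add[OF sub] by (simp add: add_eq plus_fun_def)
    qed
  qed
  define T where "T = left_span R (skew_const ` S) E"
  have sc: "fscale t e \<in> T" if "t \<in> S" "e \<in> E" for t e
    unfolding T_def left_span_def prod using that by (intro generate.incl) blast
  have "submod fscale S (T)"
  proof (unfold submod_def, intro conjI ballI)
    show "0 \<in> T"
      unfolding T_def left_span_def using generate.one[of "add_monoid R"] by (simp add: zero_eq)
    show add: "x + y \<in> T"
      if "x \<in> T" "y \<in> T" for x y
      using that generate.eng[of x "add_monoid R" _ y] unfolding T_def left_span_def by (simp add: add_eq)
    fix s x assume s: "s \<in> S" and x: "x \<in> T"
    have "x \<in> generate (add_monoid R) (skew_const ` S <#>\<^bsub>R\<^esub> E)" using x by (simp add: T_def left_span_def)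
    thus "fscale s x \<in> T"
    proof (induction rule: generate.induct)
      case one
      have "fscale s 0 = 0" by (simp add: fun_eq_iff)
      then show ?case unfolding T_def left_span_def using generate.one[of "add_monoid R"]
        by (simp add: zero_eq zero_fun_def)
    next
      case (incl h)
      then obtain t e where h: "h = fscale t e" "t \<in> S" "e \<in> E" using prod by auto
      have "fscale s h = fscale (s * t) e" by (simp add: h fun_eq_iff)
      then show ?case using sc[OF subr_mult[OF S s h(2)] h(3)] by (simp only:)
    next
      case (inv h)
      then obtain t e where h: "h = fscale t e" "t \<in> S" "e \<in> E" using prod by auto
      have "inv\<^bsub>add_monoid R\<^esub> h = - h"
        using a_inv_eq[of h] h E R_fscale by (auto simp: a_inv_def)
      hence "fscale s (inv\<^bsub>add_monoid R\<^esub> h) = fscale (s * (- t)) e" by (simp add: h fun_eq_iff)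
      then show ?case using sc[OF subr_mult[OF S s subr_uminus[OF S h(2)]] h(3)] by (simp only:)
    next
      case (eng h1 h2)
      have "fscale s (h1 + h2) = fscale s h1 + fscale s h2" by (simp add: fun_eq_iff distrib_left)
      then show ?case using add[OF eng.IH] by (simp add: add_eq plus_fun_def)
    qed
  qed
  moreover have "E \<subseteq> T"
  proof
    fix e assume "e \<in> E"
    have "e = fscale 1 e" by (simp add: fun_eq_iff)
    thus "e \<in> T" using sc[OF subr_1[OF S] \<open>e \<in> E\<close>] by (simp only:)
  qed
  ultimately show "lspan S E \<subseteq> left_span R (skew_const ` S) E" unfolding T_def by (rule lspan_least)
qed

section \<open>The anti-automorphism inverting the group elements\<close>

text \<open>The coefficient function of \<open>\<Sum> a\<^sup>-\<^sup>1 f(a) = \<Sum> a\<^sup>-\<^sup>1(f(a)) a\<^sup>-\<^sup>1\<close>.\<close>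
definition iota :: "(('l \<Rightarrow> 'l) \<Rightarrow> 'l) \<Rightarrow> ('l \<Rightarrow> 'l) \<Rightarrow> 'l" where
  "iota f = (\<lambda>a. if a \<in> M then a (f (ivf a)) else 0)"

lemma iota_closed:
  assumes "f \<in> carrier R"
  shows "iota f \<in> carrier R"
proof (rule carrier_supset[of "ivf ` supp f"])
  show "supp (iota f) \<subseteq> ivf ` supp f"
  proof
    fix a assume "a \<in> supp (iota f)"
    hence a: "a \<in> M" "a (f (ivf a)) \<noteq> 0" by (auto simp: iota_def split: if_splits)
    hence "f (ivf a) \<noteq> 0" using aut_0[OF M_aut] by metis
    thus "a \<in> ivf ` supp f" using aut_ivf_ivf[OF M_aut[OF a(1)]] by force
  qed
qed (use assms M_inv in \<open>auto simp: carrier_iff\<close>)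

lemma iota_iota: "f \<in> carrier R \<Longrightarrow> iota (iota f) = f"
proof
  fix a assume f: "f \<in> carrier R"
  show "iota (iota f) a = f a"
  proof (cases "a \<in> M")
    case True
    then show ?thesis using M_inv aut_ivf_ivf[OF M_aut[OF True]] aut_ivf_right[OF M_aut[OF True]]
      by (simp add: iota_def)
  next
    case False
    then show ?thesis using f by (auto simp: iota_def carrier_iff)
  qed
qed

lemma iota_add: "iota (f + g) = iota f + iota g"
  by (auto simp: iota_def fun_eq_iff aut_add[OF M_aut])

lemma iota_0: "iota 0 = 0"
  by (auto simp: iota_def fun_eq_iff aut_0[OF M_aut])

lemma iota_sum: "iota (sum f A) = (\<Sum>i\<in>A. iota (f i))"
proof -
  interpret additive iota by unfold_locales (rule iota_add)
  show ?thesis by (rule sum)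
qed

lemma iota_monom: "a \<in> M \<Longrightarrow> iota (skew_monom l a) = skew_monom (ivf a l) (ivf a)"
proof
  fix b assume a: "a \<in> M"
  show "iota (skew_monom l a) b = skew_monom (ivf a l) (ivf a) b"
  proof (cases "b \<in> M")
    case True
    have "ivf b = a \<longleftrightarrow> b = ivf a"
      using aut_ivf_ivf[OF M_aut[OF True]] aut_ivf_ivf[OF M_aut[OF a]] by auto
    then show ?thesis using True by (auto simp: iota_def skew_monom_def aut_0[OF M_aut])
  next
    case False
    then show ?thesis using M_inv[OF a] by (auto simp: iota_def skew_monom_def)
  qed
qed

lemma iota_const: "iota (skew_const l) = skew_const l"
  using iota_monom[OF M_id] by (simp add: inv_id[unfolded id_def] id_def)

text \<open>
  On monomials, \<open>l a l' b = l a(l') a b\<close> is sent to \<open>b\<^sup>-\<^sup>1 a\<^sup>-\<^sup>1 l a(l') = b\<^sup>-\<^sup>1 l' a\<^sup>-\<^sup>1 l\<close>, because the field is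
  commutative. In terms of coefficient functions, both sides at \<open>c\<close> are sums over the support of \<open>f\<close>,
  matched by \<open>b = c a\<close>.
\<close>
lemma iota_mult:
  assumes "f \<in> carrier R" "g \<in> carrier R"
  shows "iota (f \<otimes>\<^bsub>R\<^esub> g) = iota g \<otimes>\<^bsub>R\<^esub> iota f"
proof
  fix c
  show "iota (f \<otimes>\<^bsub>R\<^esub> g) c = (iota g \<otimes>\<^bsub>R\<^esub> iota f) c"
  proof (cases "c \<in> M")
    case True
    note c = M_aut[OF True]
    have "iota (f \<otimes>\<^bsub>R\<^esub> g) c = (\<Sum>a\<in>supp f. c (f a) * (c \<circ> a) (g (ivf a \<circ> ivf c)))"
      using True by (simp add: iota_def mult_eq'[OF assms] aut_sum[OF c] aut_mult[OF c])
    also have "\<dots> = (\<Sum>b\<in>(\<lambda>a. c \<circ> a) ` supp f. iota g b * b (iota f (ivf b \<circ> c)))"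
    proof (subst sum.reindex)
      show "inj_on (\<lambda>a. c \<circ> a) (supp f)" by (rule inj_comp[OF c])
      show "(\<Sum>a\<in>supp f. c (f a) * (c \<circ> a) (g (ivf a \<circ> ivf c))) =
        sum ((\<lambda>b. iota g b * b (iota f (ivf b \<circ> c))) \<circ> (\<lambda>a. c \<circ> a)) (supp f)"
      proof (rule sum.cong[OF refl])
        fix a assume "a \<in> supp f"
        hence aM: "a \<in> M" using assms(1) carrier_iff by blast
        note a = M_aut[OF aM]
        have 1: "ivf (c \<circ> a) \<circ> c = ivf a"
          unfolding ivf_comp[OF c a] by (rule ext) (simp add: aut_ivf_left[OF c])
        have 2: "iota g (c \<circ> a) = (c \<circ> a) (g (ivf a \<circ> ivf c))"
          using M_comp[OF True aM] by (simp only: iota_def if_True ivf_comp[OF c a])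
        have 3: "iota f (ivf a) = ivf a (f a)"
          using M_inv[OF aM] by (simp only: iota_def if_True aut_ivf_ivf[OF a])
        show "c (f a) * (c \<circ> a) (g (ivf a \<circ> ivf c)) =
           ((\<lambda>b. iota g b * b (iota f (ivf b \<circ> c))) \<circ> (\<lambda>a. c \<circ> a)) a"
          unfolding o_apply[of _ "\<lambda>a. c \<circ> a"] 1 2 3 by (simp add: aut_ivf_right[OF a] mult.commute)
      qed
    qed
    also have "\<dots> = (\<Sum>b\<in>supp (iota g). iota g b * b (iota f (ivf b \<circ> c)))"
    proof -
      have fin: "finite ((\<lambda>a. c \<circ> a) ` supp f)" "finite (supp (iota g))"
        using assms(1) iota_closed[OF assms(2)] by (auto simp: carrier_iff)
      have "iota g b * b (iota f (ivf b \<circ> c)) = 0" if "b \<notin> (\<lambda>a. c \<circ> a) ` supp f" "b \<in> M" for b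
      proof -
        note b = M_aut[OF that(2)]
        have "f (ivf (ivf b \<circ> c)) = 0"
        proof (rule ccontr)
          assume "f (ivf (ivf b \<circ> c)) \<noteq> 0"
          moreover have "ivf (ivf b \<circ> c) = ivf c \<circ> b" using ivf_comp[OF is_aut_ivf[OF b] c] aut_ivf_ivf[OF b] by simp
          moreover have "c \<circ> (ivf c \<circ> b) = b" using comp_ivf_eq(1)[OF c] by metis
          ultimately show False using that(1) by (metis (mono_tags, lifting) image_eqI mem_Collect_eq)
        qed
        thus ?thesis using that(2) True M_comp M_inv
          by (simp add: iota_def aut_0[OF c] aut_0[OF b] aut_0[OF is_aut_ivf[OF b]])
      qed
      moreover have "supp (iota g) \<subseteq> M" by (auto simp: iota_def)
      moreover have "(\<lambda>a. c \<circ> a) ` supp f \<subseteq> M" using assms(1) True M_comp by (auto simp: carrier_iff)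
      ultimately show ?thesis using fin
        by (intro sum.mono_neutral_cong) auto
    qed
    also have "\<dots> = (iota g \<otimes>\<^bsub>R\<^esub> iota f) c"
      by (rule mult_eq'[symmetric]) (use assms iota_closed in auto)
    finally show ?thesis .
  next
    case False
    have "iota g \<otimes>\<^bsub>R\<^esub> iota f \<in> carrier R" using assms by (intro R_mult iota_closed)
    then show ?thesis using False by (auto simp: iota_def carrier_iff)
  qed
qed

text \<open>
  Since \<open>iota\<close> fixes the constants and reverses products, right spans are images of left spans. All
  statements about right modules are deduced from those about left modules in this way.
\<close>
lemma right_span_eq:
  assumes S: "subr S" and E: "E \<subseteq> carrier R"
  shows "right_span R (skew_const ` S) E = iota ` lspan S (iota ` E)"
proof -
  interpret ring R by (rule ring_R)
  have iE: "iota ` E \<subseteq> carrier R" using E iota_closed by auto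
  interpret gh: group_hom "add_monoid R" "add_monoid R" iota
  proof (intro group_hom.intro group_hom_axioms.intro homI)
    show "group (add_monoid R)" "group (add_monoid R)" by (rule add.is_group)+
    show "iota x \<in> carrier (add_monoid R)" if "x \<in> carrier (add_monoid R)" for x
      using that iota_closed by simp
    show "iota (x \<otimes>\<^bsub>add_monoid R\<^esub> y) = iota x \<otimes>\<^bsub>add_monoid R\<^esub> iota y" for x y
      using iota_add[of x y] add_eq[of x y] add_eq[of "iota x" "iota y"] by simp
  qed
  have "iota ` (skew_const ` S <#>\<^bsub>R\<^esub> iota ` E) = E <#>\<^bsub>R\<^esub> skew_const ` S"
  proof -
    have "iota (skew_const s \<otimes>\<^bsub>R\<^esub> iota e) = e \<otimes>\<^bsub>R\<^esub> skew_const s" if "e \<in> E" for s e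
    proof -
      have e: "e \<in> carrier R" using that E by blast
      show ?thesis
        using iota_mult[OF R_monom[OF M_id] iota_closed[OF e]] by (simp only: iota_iota[OF e] iota_const)
    qed
    thus ?thesis unfolding set_mult_def by (simp add: image_UN) blast
  qed
  moreover have "skew_const ` S <#>\<^bsub>R\<^esub> iota ` E \<subseteq> carrier R"
    using iE R_mult R_monom M_id by (auto simp: set_mult_def)
  ultimately have "right_span R (skew_const ` S) E = iota ` left_span R (skew_const ` S) (iota ` E)"
    unfolding right_span_def left_span_def using gh.generate_img[of "skew_const ` S <#>\<^bsub>R\<^esub> iota ` E"] by simp
  thus ?thesis using left_span_eq[OF S iE] by simp
qed

section \<open>The action of automorphisms normalizing the group\<close>

lemma act_closed:
  assumes g: "is_aut g" "\<And>a. a \<in> M \<Longrightarrow> g \<circ> a \<circ> ivf g \<in> M" and f: "f \<in> carrier R"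
  shows "skew_act g f \<in> carrier R"
proof (rule carrier_supset[of "(\<lambda>a. g \<circ> a \<circ> ivf g) ` supp f"])
  show "supp (skew_act g f) \<subseteq> (\<lambda>a. g \<circ> a \<circ> ivf g) ` supp f"
  proof
    fix a assume "a \<in> supp (skew_act g f)"
    hence "f (ivf g \<circ> a \<circ> g) \<noteq> 0" using aut_0[OF g(1)] by (auto simp: skew_act_def)
    moreover have "a = g \<circ> (ivf g \<circ> a \<circ> g) \<circ> ivf g" by (auto simp: fun_eq_iff aut_ivf_right[OF g(1)])
    ultimately show "a \<in> (\<lambda>a. g \<circ> a \<circ> ivf g) ` supp f" by blast
  qed
qed (use f g in \<open>auto simp: carrier_iff\<close>)

lemma act_add: "is_aut g \<Longrightarrow> skew_act g (f + f') = skew_act g f + skew_act g f'"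
  by (simp add: skew_act_def fun_eq_iff aut_add)

lemma act_sum: "is_aut g \<Longrightarrow> skew_act g (sum f A) = (\<Sum>i\<in>A. skew_act g (f i))"
proof -
  assume g: "is_aut g"
  interpret additive "skew_act g" by unfold_locales (rule act_add[OF g])
  show ?thesis by (rule sum)
qed

lemma act_comp: "is_aut g \<Longrightarrow> is_aut h \<Longrightarrow> skew_act g (skew_act h f) = skew_act (g \<circ> h) f"
  by (simp add: skew_act_def fun_eq_iff ivf_comp comp_assoc)

lemma act_monom:
  assumes "is_aut g"
  shows "skew_act g (skew_monom l a) = skew_monom (g l) (g \<circ> a \<circ> ivf g)"
proof
  fix b
  have "ivf g \<circ> b \<circ> g = a \<longleftrightarrow> b = g \<circ> a \<circ> ivf g"
  proof -
    have "ivf g \<circ> b \<circ> g = a \<longleftrightarrow> ivf g \<circ> b = a \<circ> ivf g" by (rule comp_ivf_eq(2)[OF assms])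
    also have "\<dots> \<longleftrightarrow> b = g \<circ> (a \<circ> ivf g)" using comp_ivf_eq(1)[OF assms, of "a \<circ> ivf g" b] by metis
    finally show ?thesis by (simp add: comp_assoc)
  qed
  thus "skew_act g (skew_monom l a) b = skew_monom (g l) (g \<circ> a \<circ> ivf g) b"
    by (auto simp: skew_act_def skew_monom_def aut_0[OF assms])
qed

lemma act_mult:
  assumes g: "is_aut g" "\<And>a. a \<in> M \<Longrightarrow> g \<circ> a \<circ> ivf g \<in> M" and f: "f \<in> carrier R" "f' \<in> carrier R"
  shows "skew_act g (f \<otimes>\<^bsub>R\<^esub> f') = skew_act g f \<otimes>\<^bsub>R\<^esub> skew_act g f'"
proof
  fix c
  let ?k = "\<lambda>a. g \<circ> a \<circ> ivf g"
  have "skew_act g (f \<otimes>\<^bsub>R\<^esub> f') c = (\<Sum>a\<in>supp f. g (f a) * g (a (f' (ivf a \<circ> (ivf g \<circ> c \<circ> g)))))"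
    by (simp add: skew_act_def mult_eq'[OF f] aut_sum[OF g(1)] aut_mult[OF g(1)])
  also have "\<dots> = (\<Sum>a\<in>?k ` supp f. skew_act g f a * a (skew_act g f' (ivf a \<circ> c)))"
  proof (subst sum.reindex)
    show "inj_on ?k (supp f)"
    proof (rule inj_onI)
      fix a b assume "?k a = ?k b"
      hence "ivf g \<circ> ?k a \<circ> g = ivf g \<circ> ?k b \<circ> g" by simp
      thus "a = b" by (simp add: fun_eq_iff aut_ivf_left[OF g(1)])
    qed
    show "(\<Sum>a\<in>supp f. g (f a) * g (a (f' (ivf a \<circ> (ivf g \<circ> c \<circ> g))))) =
      sum ((\<lambda>a. skew_act g f a * a (skew_act g f' (ivf a \<circ> c))) \<circ> ?k) (supp f)"
    proof (rule sum.cong[OF refl])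
      fix a assume "a \<in> supp f"
      hence "a \<in> M" using f(1) carrier_iff by blast
      note a = M_aut[OF this]
      have 1: "ivf (?k a) = g \<circ> ivf a \<circ> ivf g"
        using ivf_comp[OF is_aut_comp[OF g(1) a] is_aut_ivf[OF g(1)]] ivf_comp[OF g(1) a] aut_ivf_ivf[OF g(1)]
        by (simp add: comp_assoc)
      have 2: "ivf g \<circ> ?k a \<circ> g = a" by (simp add: fun_eq_iff aut_ivf_left[OF g(1)])
      have 3: "ivf g \<circ> (ivf (?k a) \<circ> c) \<circ> g = ivf a \<circ> (ivf g \<circ> c \<circ> g)"
        unfolding 1 by (simp add: fun_eq_iff aut_ivf_left[OF g(1)])
      show "g (f a) * g (a (f' (ivf a \<circ> (ivf g \<circ> c \<circ> g)))) =
         ((\<lambda>a. skew_act g f a * a (skew_act g f' (ivf a \<circ> c))) \<circ> ?k) a"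
        unfolding skew_act_def o_apply[of _ ?k] 2 3 by (simp add: aut_ivf_left[OF g(1)])
    qed
  qed
  also have "\<dots> = (skew_act g f \<otimes>\<^bsub>R\<^esub> skew_act g f') c"
  proof (rule mult_eq[symmetric])
    show "supp (skew_act g f) \<subseteq> ?k ` supp f"
    proof
      fix a assume "a \<in> supp (skew_act g f)"
      hence "f (ivf g \<circ> a \<circ> g) \<noteq> 0" using aut_0[OF g(1)] by (auto simp: skew_act_def)
      moreover have "a = ?k (ivf g \<circ> a \<circ> g)" by (auto simp: fun_eq_iff aut_ivf_right[OF g(1)])
      ultimately show "a \<in> ?k ` supp f" by blast
    qed
  qed (use f g act_closed in \<open>auto simp: carrier_iff\<close>)
  finally show "skew_act g (f \<otimes>\<^bsub>R\<^esub> f') c = (skew_act g f \<otimes>\<^bsub>R\<^esub> skew_act g f') c" .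
qed

end

section \<open>Monomial automorphisms of the field of rational functions\<close>

text \<open>Evaluation of a polynomial at the point \<open>t\<close>, the coefficients being mapped by \<open>\<kappa>\<close>.\<close>
definition evalp :: "('k::field \<Rightarrow> 'r::comm_ring_1) \<Rightarrow> ('n::finite \<Rightarrow> 'r) \<Rightarrow> (('n \<Rightarrow>\<^sub>0 nat) \<Rightarrow>\<^sub>0 'k) \<Rightarrow> 'r" where
  "evalp \<kappa> t p = (\<Sum>e\<in>Poly_Mapping.keys p. \<kappa> (Poly_Mapping.lookup p e) * (\<Prod>i\<in>UNIV. t i ^ Poly_Mapping.lookup e i))"

lemma poly_decomp: "p = (\<Sum>e\<in>Poly_Mapping.keys p. Poly_Mapping.single e (Poly_Mapping.lookup p e))"
proof (rule poly_mapping_eqI)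
  fix k
  show "Poly_Mapping.lookup p k = Poly_Mapping.lookup (\<Sum>e\<in>Poly_Mapping.keys p. Poly_Mapping.single e (Poly_Mapping.lookup p e)) k"
    by (simp add: lookup_sum lookup_single when_def in_keys_iff)
qed

definition is_hom :: "('a::comm_ring_1 \<Rightarrow> 'b::comm_ring_1) \<Rightarrow> bool" where
  "is_hom h \<longleftrightarrow> (\<forall>x y. h (x + y) = h x + h y) \<and> (\<forall>x y. h (x * y) = h x * h y) \<and> h 1 = 1"

lemma hom_add: "is_hom h \<Longrightarrow> h (x + y) = h x + h y" by (simp add: is_hom_def)
lemma hom_mult: "is_hom h \<Longrightarrow> h (x * y) = h x * h y" by (simp add: is_hom_def)
lemma hom_1: "is_hom h \<Longrightarrow> h 1 = 1" by (simp add: is_hom_def)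
lemma hom_0: "is_hom h \<Longrightarrow> h 0 = 0" by (metis is_hom_def add_cancel_right_right)
lemma hom_uminus: "is_hom h \<Longrightarrow> h (- x) = - h x"
  by (metis hom_add hom_0 add.right_inverse add_eq_0_iff)
lemma hom_diff: "is_hom h \<Longrightarrow> h (x - y) = h x - h y"
  using hom_add[of h x "- y"] hom_uminus[of h y] by simp
lemma hom_sum:
  assumes "is_hom h"
  shows "h (sum f A) = (\<Sum>i\<in>A. h (f i))"
  by (induction A rule: infinite_finite_induct) (auto simp: hom_0[OF assms] hom_add[OF assms])
lemma hom_prod:
  assumes "is_hom h"
  shows "h (prod f A) = (\<Prod>i\<in>A. h (f i))"
  by (induction A rule: infinite_finite_induct) (auto simp: hom_1[OF assms] hom_mult[OF assms])
lemma hom_power: "is_hom h \<Longrightarrow> h (x ^ k) = h x ^ k"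
  by (induction k) (auto simp: hom_1 hom_mult)
lemma hom_comp: "is_hom h \<Longrightarrow> is_hom g \<Longrightarrow> is_hom (h \<circ> g)" by (simp add: is_hom_def)
abbreviation cst :: "'k::field \<Rightarrow> ('n::{finite, linorder} \<Rightarrow>\<^sub>0 nat) \<Rightarrow>\<^sub>0 'k" where "cst c \<equiv> Poly_Mapping.single 0 c"
abbreviation var :: "'n::{finite, linorder} \<Rightarrow> ('n \<Rightarrow>\<^sub>0 nat) \<Rightarrow>\<^sub>0 'k::field" where
  "var i \<equiv> Poly_Mapping.single (Poly_Mapping.single i 1) 1"

lemma single_power: "(Poly_Mapping.single k (1::'k::field)) ^ n = Poly_Mapping.single (\<Sum>_\<in>{..<n}. k) 1"
  by (induction n) (auto simp: mult_single add.commute)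

lemma prod_single:
  "(\<Prod>i\<in>A. Poly_Mapping.single (f i) (1::'k::field)) = Poly_Mapping.single (\<Sum>i\<in>A. f i) 1"
  for f :: "'i \<Rightarrow> 'e::comm_monoid_add"
  by (induction A rule: infinite_finite_induct) (auto simp: mult_single)

lemma exponent_decomp: "(\<Sum>i\<in>UNIV. \<Sum>_\<in>{..<Poly_Mapping.lookup e i}. Poly_Mapping.single i (1::nat)) = e"
  for e :: "'n::finite \<Rightarrow>\<^sub>0 nat"
  by (rule poly_mapping_eqI) (simp add: lookup_sum lookup_single when_def if_distrib[of "\<lambda>x. _ * x"] cong: if_cong)

lemma monomial_decomp:
  "Poly_Mapping.single e c = cst c * (\<Prod>i\<in>UNIV. var i ^ Poly_Mapping.lookup e i)"
  for e :: "'n::{finite, linorder} \<Rightarrow>\<^sub>0 nat" and c :: "'k::field"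
  by (simp add: single_power prod_single exponent_decomp[simplified] mult_single)

text \<open>
  The universal property of the polynomial ring in its uniqueness part: a homomorphism is determined
  by the constants and the variables.
\<close>
lemma hom_eq_evalp:
  fixes h :: "(('n::{finite, linorder} \<Rightarrow>\<^sub>0 nat) \<Rightarrow>\<^sub>0 'k::field) \<Rightarrow> 'r::comm_ring_1"
  assumes "is_hom h"
  shows "h p = evalp (\<lambda>c. h (cst c)) (\<lambda>i. h (var i)) p"
proof -
  have "h p = (\<Sum>e\<in>Poly_Mapping.keys p. h (Poly_Mapping.single e (Poly_Mapping.lookup p e)))"
    by (subst (1) poly_decomp) (rule hom_sum[OF assms])
  thus ?thesis
    by (subst (asm) monomial_decomp) (simp add: evalp_def hom_mult[OF assms] hom_prod[OF assms] hom_power[OF assms])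
qed

lemma is_hom_cst: "is_hom (cst :: 'k::field \<Rightarrow> ('n::{finite, linorder} \<Rightarrow>\<^sub>0 nat) \<Rightarrow>\<^sub>0 'k)"
  by (simp add: is_hom_def single_add mult_single)

context
  fixes \<kappa> :: "'k::field \<Rightarrow> 'r::comm_ring_1" and t :: "'n::{finite, linorder} \<Rightarrow> 'r"
  assumes \<kappa>: "is_hom \<kappa>"
begin

lemma evalp_superset:
  assumes "finite E" "Poly_Mapping.keys p \<subseteq> E"
  shows "evalp \<kappa> t p = (\<Sum>e\<in>E. \<kappa> (Poly_Mapping.lookup p e) * (\<Prod>i\<in>UNIV. t i ^ Poly_Mapping.lookup e i))"
  unfolding evalp_def using assms
  by (intro sum.mono_neutral_left) (auto simp: in_keys_iff hom_0[OF \<kappa>])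

lemma evalp_add: "evalp \<kappa> t (p + q) = evalp \<kappa> t p + evalp \<kappa> t q"
proof -
  let ?E = "Poly_Mapping.keys p \<union> Poly_Mapping.keys q"
  have "Poly_Mapping.keys (p + q) \<subseteq> ?E" by (rule keys_add)
  thus ?thesis
    using evalp_superset[of ?E p] evalp_superset[of ?E q] evalp_superset[of ?E "p + q"]
    by (simp add: lookup_add hom_add[OF \<kappa>] distrib_right sum.distrib)
qed

lemma evalp_sum: "evalp \<kappa> t (sum f A) = (\<Sum>i\<in>A. evalp \<kappa> t (f i))"
proof -
  interpret additive "evalp \<kappa> t" by unfold_locales (rule evalp_add)
  show ?thesis by (rule sum)
qed

lemma evalp_single: "evalp \<kappa> t (Poly_Mapping.single e c) = \<kappa> c * (\<Prod>i\<in>UNIV. t i ^ Poly_Mapping.lookup e i)"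
  using evalp_superset[of "{e}" "Poly_Mapping.single e c"] by simp

lemma evalp_cst: "evalp \<kappa> t (cst c) = \<kappa> c" by (simp add: evalp_single)

lemma evalp_var: "evalp \<kappa> t (var i) = t i"
proof -
  have "(\<Prod>j\<in>UNIV. t j ^ Poly_Mapping.lookup (Poly_Mapping.single i 1) j) = (\<Prod>j\<in>UNIV. if j = i then t i else 1)"
    by (intro prod.cong) (auto simp: lookup_single when_def)
  thus ?thesis by (simp add: evalp_single hom_1[OF \<kappa>])
qed

lemma evalp_mult: "evalp \<kappa> t (p * q) = evalp \<kappa> t p * evalp \<kappa> t q"
proof -
  let ?s = "\<lambda>p e. Poly_Mapping.single e (Poly_Mapping.lookup p e)"
  have single: "evalp \<kappa> t (Poly_Mapping.single e c * Poly_Mapping.single e' c') =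
     evalp \<kappa> t (Poly_Mapping.single e c) * evalp \<kappa> t (Poly_Mapping.single e' c')" for e e' c c'
    by (simp add: mult_single evalp_single hom_mult[OF \<kappa>] lookup_add power_add prod.distrib mult_ac)
  have "evalp \<kappa> t (p * q) = evalp \<kappa> t ((\<Sum>e\<in>Poly_Mapping.keys p. ?s p e) * (\<Sum>e\<in>Poly_Mapping.keys q. ?s q e))"
    by (simp only: poly_decomp[symmetric])
  also have "\<dots> = (\<Sum>e\<in>Poly_Mapping.keys p. evalp \<kappa> t (?s p e)) * (\<Sum>e\<in>Poly_Mapping.keys q. evalp \<kappa> t (?s q e))"
    by (simp add: sum_product evalp_sum single)
  also have "\<dots> = evalp \<kappa> t p * evalp \<kappa> t q" by (simp only: evalp_sum[symmetric] poly_decomp[symmetric])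
  finally show ?thesis .
qed

lemma is_hom_evalp: "is_hom (evalp \<kappa> t)"
proof -
  have "evalp \<kappa> t 1 = 1" using evalp_cst[of 1] by (simp add: hom_1[OF \<kappa>])
  thus ?thesis by (simp add: is_hom_def evalp_add evalp_mult)
qed

end

abbreviation tof :: "'a::idom \<Rightarrow> 'a fract" where "tof p \<equiv> Fract p 1"

lemma is_hom_tof: "is_hom (tof :: 'a::idom \<Rightarrow> 'a fract)"
  by (simp add: is_hom_def One_fract_def)

lemma tof_eq_0_iff: "tof p = 0 \<longleftrightarrow> p = 0" by (simp add: Zero_fract_def eq_fract)

lemma rf_const_eq: "rf_const c = tof (cst c)" by (simp add: rf_const_def)
lemma rf_var_eq: "rf_var i = tof (var i)" by (simp add: rf_var_def)

lemma is_hom_rf_const: "is_hom (rf_const :: 'k::field \<Rightarrow> ('n::{finite, linorder}, 'k) ratfun)"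
  using hom_comp[OF is_hom_tof is_hom_cst] by (simp add: rf_const_eq[abs_def] o_def)

lemmas rf_const_add = hom_add[OF is_hom_rf_const]
lemmas rf_const_mult = hom_mult[OF is_hom_rf_const]
lemmas rf_const_1 [simp] = hom_1[OF is_hom_rf_const]
lemmas rf_const_0 [simp] = hom_0[OF is_hom_rf_const]
lemmas rf_const_uminus = hom_uminus[OF is_hom_rf_const]
lemmas rf_const_power = hom_power[OF is_hom_rf_const]
lemmas rf_const_prod = hom_prod[OF is_hom_rf_const]
lemma rf_const_eq_0_iff [simp]: "rf_const c = 0 \<longleftrightarrow> c = 0"
  by (metis rf_const_eq tof_eq_0_iff single_zero lookup_single_eq)

lemma rf_const_eq_iff: "rf_const c = rf_const d \<longleftrightarrow> c = d"
  using rf_const_eq_0_iff[of "c - d"] by (simp add: hom_diff[OF is_hom_rf_const])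

lemma rf_const_inverse:
  "rf_const (inverse c) = (inverse (rf_const c) :: ('n::{finite, linorder}, 'k::field) ratfun)"
proof (cases "c = 0")
  case False
  hence "rf_const c * rf_const (inverse c) = (1 :: ('n, 'k) ratfun)"
    by (simp add: rf_const_mult[symmetric])
  thus ?thesis by (metis inverse_unique)
qed simp

lemma rf_const_powi: "rf_const (c powi k) = rf_const c powi k"
  by (simp add: power_int_def rf_const_power rf_const_inverse)

lemma rf_var_nonzero [simp]: "rf_var i \<noteq> 0"
  using tof_eq_0_iff[of "var i"] by (metis rf_var_eq single_zero lookup_single_eq zero_neq_one)

lemma tof_eval:
  "tof p = evalp rf_const rf_var (p :: ('n::{finite, linorder} \<Rightarrow>\<^sub>0 nat) \<Rightarrow>\<^sub>0 'k::field)"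
  using hom_eq_evalp[OF is_hom_tof, of p] by (simp add: rf_const_eq[abs_def] rf_var_eq[abs_def])

lemma aut_unique:
  fixes \<sigma> \<tau> :: "('n::{finite, linorder}, 'k::field) ratfun \<Rightarrow> ('n, 'k) ratfun"
  assumes "is_aut \<sigma>" "is_aut \<tau>" "\<And>c. \<sigma> (rf_const c) = \<tau> (rf_const c)" "\<And>i. \<sigma> (rf_var i) = \<tau> (rf_var i)"
  shows "\<sigma> = \<tau>"
proof
  fix x :: "('n, 'k) ratfun"
  have *: "\<sigma> (tof p) = \<tau> (tof p)" for p
    unfolding tof_eval evalp_def
    by (simp add: aut_sum[OF assms(1)] aut_mult[OF assms(1)] aut_prod[OF assms(1)] aut_power[OF assms(1)]
        aut_sum[OF assms(2)] aut_mult[OF assms(2)] aut_prod[OF assms(2)] aut_power[OF assms(2)] assms(3,4))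
  obtain a b where "x = Fract a b" "b \<noteq> 0" by (cases x)
  hence x: "x = tof a / tof b" by simp
  show "\<sigma> x = \<tau> x" unfolding x by (simp only: aut_divide[OF assms(1)] aut_divide[OF assms(2)] *)
qed

text \<open>
  An automorphism of a domain extends to its field of fractions; a representative is chosen for each
  fraction and the result shown not to depend on it.
\<close>
lemma fract_extend:
  fixes h :: "'a::idom \<Rightarrow> 'a"
  assumes h: "is_hom h" and "bij h"
  shows "\<exists>\<sigma>. is_aut \<sigma> \<and> (\<forall>a. \<sigma> (tof a) = tof (h a))"
proof -
  have inj: "h a = h b \<longleftrightarrow> a = b" for a b using bij_is_inj[OF assms(2)] by (auto simp: inj_eq)
  have nz: "h b \<noteq> 0 \<longleftrightarrow> b \<noteq> 0" for b using inj[of b 0] by (simp add: hom_0[OF h])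
  define \<sigma> where "\<sigma> x = (SOME y. \<exists>a b. b \<noteq> 0 \<and> x = Fract a b \<and> y = Fract (h a) (h b))" for x
  have \<sigma>: "\<sigma> (Fract a b) = Fract (h a) (h b)" if "b \<noteq> 0" for a b
  proof -
    have "\<exists>a' b'. b' \<noteq> 0 \<and> Fract a b = Fract a' b' \<and> \<sigma> (Fract a b) = Fract (h a') (h b')"
      unfolding \<sigma>_def
      by (rule someI_ex[of "\<lambda>y. \<exists>a' b'. b' \<noteq> 0 \<and> Fract a b = Fract a' b' \<and> y = Fract (h a') (h b')"]) (use that in blast)
    then obtain a' b' where *: "b' \<noteq> 0" "Fract a b = Fract a' b'" "\<sigma> (Fract a b) = Fract (h a') (h b')" by blast
    have "a * b' = a' * b" using * that by (simp add: eq_fract)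
    hence "h a * h b' = h a' * h b" by (metis hom_mult[OF h])
    thus ?thesis using *(1,3) that by (simp add: eq_fract nz)
  qed
  have "is_aut \<sigma>"
    unfolding is_aut_def
  proof (intro conjI allI bijI injI)
    fix x y :: "'a fract"
    obtain a b where x: "x = Fract a b" "b \<noteq> 0" by (cases x)
    obtain c d where y: "y = Fract c d" "d \<noteq> 0" by (cases y)
    show "\<sigma> (x + y) = \<sigma> x + \<sigma> y" using x y by (simp add: \<sigma> nz hom_add[OF h] hom_mult[OF h])
    show "\<sigma> (x * y) = \<sigma> x * \<sigma> y" using x y by (simp add: \<sigma> nz hom_mult[OF h])
    show "x = y" if "\<sigma> x = \<sigma> y"
    proof -
      have "h (a * d) = h (c * b)" using that x y by (simp add: \<sigma> nz eq_fract hom_mult[OF h])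
      thus ?thesis using x y by (simp add: inj eq_fract)
    qed
  next
    show "surj \<sigma>"
    proof (rule surjI)
      fix x :: "'a fract"
      obtain a b where x: "x = Fract a b" "b \<noteq> 0" by (cases x)
      have s: "h (inv_into UNIV h a) = a" for a using bij_is_surj[OF assms(2)] by (rule surj_f_inv_f)
      have "inv_into UNIV h b \<noteq> 0" using nz[of "inv_into UNIV h b"] s x by simp
      thus "\<sigma> ((\<lambda>x. SOME y. \<sigma> y = x) x) = x" using \<sigma>[of "inv_into UNIV h b" "inv_into UNIV h a"] s x
        by (intro someI[of "\<lambda>y. \<sigma> y = x" "Fract (inv_into UNIV h a) (inv_into UNIV h b)"]) simp
    qed
  qed
  moreover have "\<sigma> (tof a) = tof (h a)" for a using \<sigma>[of 1 a] by (simp add: hom_1[OF h])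
  ultimately show ?thesis by blast
qed

definition subst_poly :: "('n \<Rightarrow> 'k) \<times> ('n \<Rightarrow> 'n) \<Rightarrow> (('n::{finite, linorder} \<Rightarrow>\<^sub>0 nat) \<Rightarrow>\<^sub>0 'k::field) \<Rightarrow> (('n \<Rightarrow>\<^sub>0 nat) \<Rightarrow>\<^sub>0 'k)" where
  "subst_poly = (\<lambda>(c, \<pi>). evalp cst (\<lambda>i. cst (c i) * var (\<pi> i)))"

lemma subst_poly_inverse:
  assumes "\<And>i. c' (\<pi> i) * c i = 1" "\<And>i. \<pi>' (\<pi> i) = i"
  shows "subst_poly (c', \<pi>') (subst_poly (c, \<pi>) p) = p"
proof -
  note hom = is_hom_evalp[OF is_hom_cst]
  have "is_hom (subst_poly (c', \<pi>') \<circ> subst_poly (c, \<pi>))"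
    unfolding subst_poly_def by (auto intro!: hom_comp hom)
  from hom_eq_evalp[OF this, of p] have "subst_poly (c', \<pi>') (subst_poly (c, \<pi>) p) = evalp cst (\<lambda>i. cst (c i) * (cst (c' (\<pi> i)) * var (\<pi>' (\<pi> i)))) p"
    by (simp add: subst_poly_def evalp_cst[OF is_hom_cst] evalp_var[OF is_hom_cst, simplified] evalp_mult[OF is_hom_cst])
  also have "(\<lambda>i. cst (c i) * (cst (c' (\<pi> i)) * var (\<pi>' (\<pi> i)))) = var"
    using assms by (simp add: fun_eq_iff mult_single mult.commute)
  also have "evalp cst var p = p" using hom_eq_evalp[of "\<lambda>p. p" p] by (simp add: is_hom_def)
  finally show ?thesis .
qed

text \<open>
  The automorphism is given by a definite description, so existence and uniqueness have to be
  proved: the substitution \<open>x\<^sub>i \<mapsto> c\<^sub>i x\<^bsub>\<pi>(i)\<^esub>\<close> of polynomials is invertible and extends to fractions.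
\<close>
lemma monomial_aut_ex:
  fixes c :: "'n::{finite, linorder} \<Rightarrow> 'k::field"
  assumes c: "\<And>i. c i \<noteq> 0" and \<pi>: "bij \<pi>"
  shows "monomial_aut (c, \<pi>) \<in> Aut_over rf_consts \<and> (\<forall>i. monomial_aut (c, \<pi>) (rf_var i) = rf_const (c i) * rf_var (\<pi> i))"
proof -
  define \<pi>' where "\<pi>' = inv_into UNIV \<pi>"
  have \<pi>': "\<pi>' (\<pi> i) = i" "\<pi> (\<pi>' i) = i" for i
    using \<pi> by (simp_all add: \<pi>'_def bij_is_inj bij_is_surj surj_f_inv_f)
  define c' where "c' i = inverse (c (\<pi>' i))" for i
  let ?h = "subst_poly (c, \<pi>)" and ?h' = "subst_poly (c', \<pi>')"
  have 1: "?h' (?h p) = p" for p by (rule subst_poly_inverse) (simp_all add: c'_def \<pi>' c)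
  have 2: "?h (?h' p) = p" for p by (rule subst_poly_inverse) (simp_all add: c'_def \<pi>' c)
  have "bij ?h" using 1 2 by (intro o_bij[of ?h']) (auto simp: fun_eq_iff)
  moreover have "is_hom ?h" by (simp add: subst_poly_def is_hom_evalp[OF is_hom_cst])
  ultimately obtain \<sigma> where \<sigma>: "is_aut \<sigma>" "\<And>a. \<sigma> (tof a) = tof (?h a)" using fract_extend by blast
  have "\<sigma> \<in> Aut_over rf_consts"
    using \<sigma> by (auto simp: Aut_over_iff rf_const_eq subst_poly_def evalp_cst[OF is_hom_cst])
  moreover have "\<sigma> (rf_var i) = rf_const (c i) * rf_var (\<pi> i)" for i
    unfolding rf_var_eq \<sigma>(2) by (simp add: subst_poly_def evalp_var[OF is_hom_cst, simplified] rf_const_eq)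
  ultimately have "\<sigma> \<in> Aut_over rf_consts \<and> (\<forall>i. \<sigma> (rf_var i) = rf_const (c i) * rf_var (\<pi> i))" by blast
  moreover have "\<tau> = \<sigma>" if "\<tau> \<in> Aut_over rf_consts \<and> (\<forall>i. \<tau> (rf_var i) = rf_const (c i) * rf_var (\<pi> i))" for \<tau>
    using that calculation by (intro aut_unique) (auto simp: Aut_over_iff)
  ultimately show ?thesis
    unfolding monomial_aut_def prod.case by (rule theI)
qed

lemma monomial_aut_unique:
  fixes c :: "'n::{finite, linorder} \<Rightarrow> 'k::field"
  assumes "\<And>i. c i \<noteq> 0" "bij \<pi>" "is_aut \<sigma>" "\<And>a. \<sigma> (rf_const a) = rf_const a" "\<And>i. \<sigma> (rf_var i) = rf_const (c i) * rf_var (\<pi> i)"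
  shows "\<sigma> = monomial_aut (c, \<pi>)"
  using monomial_aut_ex[OF assms(1,2)] assms(3-5) by (intro aut_unique) (auto simp: Aut_over_iff)

section \<open>Laurent polynomials\<close>

definition xm :: "('n \<Rightarrow> int) \<Rightarrow> ('n::{finite, linorder}, 'k::field) ratfun" where
  "xm v = (\<Prod>i\<in>UNIV. rf_var i powi v i)"

lemma xm_nonzero [simp]: "xm v \<noteq> 0" by (simp add: xm_def)
lemma xm_0 [simp]: "xm (\<lambda>i. 0) = 1" by (simp add: xm_def)
lemma xm_add: "xm (\<lambda>i. v i + w i) = xm v * xm w" by (simp add: xm_def power_int_add prod.distrib)
lemma xm_single: "xm (\<lambda>j. if j = i then k else 0) = rf_var i powi k"
proof -
  have "xm (\<lambda>j. if j = i then k else 0) = (\<Prod>j\<in>UNIV. if j = i then rf_var i powi k else 1)"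
    unfolding xm_def by (intro prod.cong) auto
  thus ?thesis by simp
qed

context
  fixes c :: "'n::{finite, linorder} \<Rightarrow> 'k::field" and \<pi> :: "'n \<Rightarrow> 'n"
  assumes c: "\<And>i. c i \<noteq> 0" and \<pi>: "bij \<pi>"
begin
lemma monomial_aut_aut: "is_aut (monomial_aut (c, \<pi>))"
  using monomial_aut_ex[OF c \<pi>] by (simp add: Aut_over_iff)
lemma monomial_aut_const: "monomial_aut (c, \<pi>) (rf_const a) = rf_const a"
  using monomial_aut_ex[OF c \<pi>] by (simp add: Aut_over_iff)
lemma monomial_aut_var: "monomial_aut (c, \<pi>) (rf_var i) = rf_const (c i) * rf_var (\<pi> i)"
  using monomial_aut_ex[OF c \<pi>] by simp
lemma monomial_aut_xm: "monomial_aut (c, \<pi>) (xm v) = rf_const (\<Prod>i\<in>UNIV. c i powi v i) * xm (v \<circ> inv_into UNIV \<pi>)"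
proof -
  have "(\<Prod>i\<in>UNIV. (rf_var (\<pi> i) :: ('n, 'k) ratfun) powi v i) = (\<Prod>j\<in>UNIV. rf_var j powi v (inv_into UNIV \<pi> j))"
    by (rule prod.reindex_bij_witness[of _ "inv_into UNIV \<pi>" \<pi>])
      (use \<pi> in \<open>auto simp: bij_is_inj bij_is_surj surj_f_inv_f\<close>)
  thus ?thesis
    by (simp add: xm_def aut_prod[OF monomial_aut_aut] aut_powi[OF monomial_aut_aut] monomial_aut_var
        power_int_mult_distrib prod.distrib rf_const_prod rf_const_powi)
qed
end

lemma monomial_aut_comp:
  fixes c c' :: "'n::{finite, linorder} \<Rightarrow> 'k::field"
  assumes "\<And>i. c i \<noteq> 0" "bij \<pi>" "\<And>i. c' i \<noteq> 0" "bij \<pi>'"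
  shows "monomial_aut (c, \<pi>) \<circ> monomial_aut (c', \<pi>') = monomial_aut (\<lambda>i. c' i * c (\<pi>' i), \<pi> \<circ> \<pi>')"
proof (rule monomial_aut_unique)
  note a = monomial_aut_aut[OF assms(1,2)] and b = monomial_aut_aut[OF assms(3,4)]
  show "is_aut (monomial_aut (c, \<pi>) \<circ> monomial_aut (c', \<pi>'))" by (rule is_aut_comp[OF a b])
  show "(monomial_aut (c, \<pi>) \<circ> monomial_aut (c', \<pi>')) (rf_const x) = rf_const x" for x
    by (simp add: monomial_aut_const[OF assms(1,2)] monomial_aut_const[OF assms(3,4)])
  show "(monomial_aut (c, \<pi>) \<circ> monomial_aut (c', \<pi>')) (rf_var i) = rf_const (c' i * c (\<pi>' i)) * rf_var ((\<pi> \<circ> \<pi>') i)" for i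
    by (simp add: monomial_aut_const[OF assms(1,2)] monomial_aut_var[OF assms(1,2)] monomial_aut_var[OF assms(3,4)]
       aut_mult[OF a] rf_const_mult)
qed (use assms in \<open>auto intro: bij_comp\<close>)

lemma monomial_aut_id: "monomial_aut (\<lambda>i. 1, id) = (id :: ('n::{finite, linorder}, 'k::field) ratfun \<Rightarrow> _)"
  by (rule monomial_aut_unique[symmetric]) (auto simp: is_aut_id)

definition lpolys :: "('n::{finite, linorder}, 'k::field) ratfun set" where
  "lpolys = {(\<Sum>v\<in>V. rf_const (c v) * xm v) | V c. finite V}"

lemma lpolysI: "finite V \<Longrightarrow> f = (\<Sum>v\<in>V. rf_const (c v) * xm v) \<Longrightarrow> f \<in> lpolys"
  by (auto simp: lpolys_def)

lemma lpolys_monom: "rf_const c * xm v \<in> lpolys"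
  by (rule lpolysI[of "{v}" _ "\<lambda>_. c"]) auto

lemma lpolys_add:
  assumes "f \<in> lpolys" "g \<in> lpolys"
  shows "f + g \<in> lpolys"
proof -
  obtain V c W d where V: "finite V" "f = (\<Sum>v\<in>V. rf_const (c v) * xm v)"
    and W: "finite W" "g = (\<Sum>v\<in>W. rf_const (d v) * xm v)"
    using assms by (auto simp: lpolys_def)
  define c' where "c' v = (if v \<in> V then c v else 0)" for v
  define d' where "d' v = (if v \<in> W then d v else 0)" for v
  have "f = (\<Sum>v\<in>V \<union> W. rf_const (c' v) * xm v)"
    unfolding V(2) by (rule sum.mono_neutral_cong_left) (use V W in \<open>auto simp: c'_def\<close>)
  moreover have "g = (\<Sum>v\<in>V \<union> W. rf_const (d' v) * xm v)"
    unfolding W(2) by (rule sum.mono_neutral_cong_left) (use V W in \<open>auto simp: d'_def\<close>)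
  ultimately have "f + g = (\<Sum>v\<in>V \<union> W. rf_const (c' v + d' v) * xm v)"
    by (simp add: rf_const_add distrib_right sum.distrib)
  thus ?thesis using V W by (intro lpolysI[of "V \<union> W"]) auto
qed

lemma lpolys_sum: "(\<And>i. i \<in> A \<Longrightarrow> f i \<in> lpolys) \<Longrightarrow> sum f A \<in> lpolys"
  using lpolysI[of "{}" 0]
  by (induction A rule: infinite_finite_induct) (auto simp: lpolys_add)

lemma lpolys_mult:
  assumes "f \<in> lpolys" "g \<in> lpolys"
  shows "f * g \<in> lpolys"
proof -
  obtain V c W d where V: "finite V" "f = (\<Sum>v\<in>V. rf_const (c v) * xm v)"
    and W: "finite W" "g = (\<Sum>v\<in>W. rf_const (d v) * xm v)"
    using assms by (auto simp: lpolys_def)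
  have "f * g = (\<Sum>v\<in>V. \<Sum>w\<in>W. rf_const (c v * d w) * xm (\<lambda>i. v i + w i))"
    unfolding V(2) W(2) sum_product by (simp add: rf_const_mult xm_add mult_ac)
  also have "\<dots> \<in> lpolys" by (intro lpolys_sum lpolys_monom)
  finally show ?thesis .
qed

lemma subr_lpolys: "subr (lpolys :: ('n::{finite, linorder}, 'k::field) ratfun set)"
proof -
  have 1: "(1 :: ('n, 'k) ratfun) \<in> lpolys" using lpolys_monom[of 1 "\<lambda>_. 0"] by simp
  have "x - y \<in> lpolys" if "x \<in> lpolys" "y \<in> lpolys" for x y :: "('n, 'k) ratfun"
    using lpolys_add[OF that(1) lpolys_mult[OF lpolys_monom[of "- 1" "\<lambda>_. 0"] that(2)]]
    by (simp add: rf_const_uminus)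
  thus ?thesis using 1 by (auto simp: subr_def intro: lpolys_mult)
qed

lemma ring_of_type_simps [simp]:
  "carrier ring_of_type_algebra = UNIV" "\<one>\<^bsub>ring_of_type_algebra\<^esub> = 1" "\<zero>\<^bsub>ring_of_type_algebra\<^esub> = 0"
  "x \<otimes>\<^bsub>ring_of_type_algebra\<^esub> y = x * y" "x \<oplus>\<^bsub>ring_of_type_algebra\<^esub> y = x + y"
  by (simp_all add: ring_of_type_algebra_def)

lemma ring_of_type_uminus [simp]: "\<ominus>\<^bsub>ring_of_type_algebra\<^esub> x = - (x :: 'a::comm_ring_1)"
proof -
  interpret ring "ring_of_type_algebra :: 'a ring" by (rule ring_from_type_algebra)
  show ?thesis by (rule minus_equality) auto
qed

lemma subring_type_iff: "subring S (ring_of_type_algebra :: 'a::comm_ring_1 ring) \<longleftrightarrow> subr S"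
proof
  interpret ring "ring_of_type_algebra :: 'a ring" by (rule ring_from_type_algebra)
  assume S: "subring S (ring_of_type_algebra :: 'a ring)"
  show "subr S" unfolding subr_def
    using subringE(3)[OF S] subringE(6)[OF S] subringE(7)[OF S] subringE(5)[OF S]
    by (metis diff_conv_add_uminus ring_of_type_simps(2,4,5) ring_of_type_uminus)
next
  interpret ring "ring_of_type_algebra :: 'a ring" by (rule ring_from_type_algebra)
  assume "subr S"
  thus "subring S (ring_of_type_algebra :: 'a ring)"
    by (intro subringI) (auto simp: subr_1 subr_uminus subr_mult subr_add)
qed

text \<open>
  Sums of Laurent monomials form a subring containing the generators, and every Laurent monomial is a
  product of generators.
\<close>
lemma laurent_eq: "(laurent :: ('n::{finite, linorder}, 'k::field) ratfun set) = lpolys"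
proof
  let ?R = "ring_of_type_algebra :: ('n, 'k) ratfun ring"
  interpret ring ?R by (rule ring_from_type_algebra)
  have xp: "rf_var i powi k \<in> lpolys" for i :: 'n and k
    using lpolys_monom[of 1 "\<lambda>j. if j = i then k else 0"] by (simp add: xm_single)
  show "laurent \<subseteq> (lpolys :: ('n, 'k) ratfun set)"
    unfolding laurent_def
  proof (rule generate_ring_min_subring1)
    show "subring lpolys ?R" using subr_lpolys by (simp add: subring_type_iff)
    have "rf_const c \<in> lpolys" for c :: 'k using lpolys_monom[of c "\<lambda>_. 0"] by simp
    thus "rf_consts \<union> rf_var ` UNIV \<union> (\<lambda>i. inverse (rf_var i)) ` UNIV \<subseteq> (lpolys :: ('n, 'k) ratfun set)"
      using xp[of _ 1] xp[of _ "- 1"] by (auto simp: power_int_minus)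
  qed auto
  have S: "subr (laurent :: ('n, 'k) ratfun set)"
    unfolding laurent_def subring_type_iff[symmetric] by (rule generate_ring_is_subring) auto
  have g: "rf_const c \<in> laurent" "rf_var i \<in> laurent" "inverse (rf_var i) \<in> laurent" for c :: 'k and i :: 'n
    unfolding laurent_def by (auto intro: generate_ring.incl)
  show "lpolys \<subseteq> (laurent :: ('n, 'k) ratfun set)"
    unfolding lpolys_def xm_def power_int_def
    by (auto intro!: subr_sum[OF S] subr_mult[OF S] subr_prod[OF S] subr_power[OF S] g)
qed

text \<open>
  Multiplication by a power of \<open>x\<^sub>1 \<cdots> x\<^sub>n\<close> turns the Laurent monomials into monomials of the polynomial
  ring, where the coefficients can be read off.
\<close>
lemma xm_independent:
  fixes c :: "('n::{finite, linorder} \<Rightarrow> int) \<Rightarrow> 'k::field"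
  assumes "finite V" "(\<Sum>v\<in>V. rf_const (c v) * xm v) = 0" "v \<in> V"
  shows "c v = 0"
proof -
  \<comment> \<open>Added to the entries, it makes all exponents in \<open>V\<close> nonnegative.\<close>
  define N where "N = (\<Sum>v\<in>V. \<Sum>i\<in>UNIV. \<bar>v i\<bar>)"
  have N: "v i + N \<ge> 0" if "v \<in> V" for v i
  proof -
    have 1: "\<bar>v i\<bar> \<le> (\<Sum>i\<in>UNIV. \<bar>v i\<bar>)" by (rule member_le_sum) auto
    have "(\<Sum>i\<in>UNIV. \<bar>v i\<bar>) \<le> N" unfolding N_def using assms(1) that by (intro member_le_sum) (auto intro: sum_nonneg)
    with 1 show ?thesis by linarith
  qed
  define e where "e v = (\<Sum>i\<in>UNIV. Poly_Mapping.single i (nat (v i + N)))" for v :: "'n \<Rightarrow> int"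
  have le: "Poly_Mapping.lookup (e v) i = nat (v i + N)" for v i
    by (simp add: e_def lookup_sum lookup_single when_def)
  have xe: "xm v * xm (\<lambda>i. N) = tof (Poly_Mapping.single (e v) 1 :: ('n \<Rightarrow>\<^sub>0 nat) \<Rightarrow>\<^sub>0 'k)" if "v \<in> V" for v
  proof -
    have "tof (Poly_Mapping.single (e v) 1 :: ('n \<Rightarrow>\<^sub>0 nat) \<Rightarrow>\<^sub>0 'k) = (\<Prod>i\<in>UNIV. rf_var i ^ nat (v i + N))"
      unfolding tof_eval evalp_single[OF is_hom_rf_const] le by simp
    also have "\<dots> = xm (\<lambda>i. v i + N)" unfolding xm_def
      by (intro prod.cong refl) (use N[OF that] in \<open>auto simp: power_int_def\<close>)
    finally show ?thesis by (simp add: xm_add)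
  qed
  have "tof (\<Sum>v\<in>V. Poly_Mapping.single (e v) (c v)) = (\<Sum>v\<in>V. rf_const (c v) * tof (Poly_Mapping.single (e v) 1))"
    unfolding hom_sum[OF is_hom_tof] rf_const_eq by (simp add: mult_single)
  also have "\<dots> = (\<Sum>v\<in>V. rf_const (c v) * xm v) * xm (\<lambda>i. N)"
    unfolding sum_distrib_right by (intro sum.cong refl) (simp add: xe[symmetric] mult_ac del: mult_fract)
  also have "\<dots> = 0" using assms(2) by simp
  finally have "(\<Sum>v\<in>V. Poly_Mapping.single (e v) (c v)) = 0" by (simp only: tof_eq_0_iff)
  hence "Poly_Mapping.lookup (\<Sum>v\<in>V. Poly_Mapping.single (e v) (c v)) (e v) = 0" by simp
  hence "(\<Sum>w\<in>V. if e w = e v then c w else 0) = 0" by (simp add: lookup_sum lookup_single when_def)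
  also have "(\<Sum>w\<in>V. if e w = e v then c w else 0) = (\<Sum>w\<in>V. if w = v then c w else 0)"
  proof (intro sum.cong refl)
    fix w assume "w \<in> V"
    have "w = v" if "e w = e v"
    proof
      fix i
      have "nat (w i + N) = nat (v i + N)" using that le by metis
      thus "w i = v i" using N[OF \<open>w \<in> V\<close>, of i] N[OF assms(3), of i] by linarith
    qed
    thus "(if e w = e v then c w else 0) = (if w = v then c w else 0)" by auto
  qed
  also have "\<dots> = c v" using assms by simp
  finally show ?thesis .
qed

lemma monomial_aut_lpolys:
  fixes c :: "'n::{finite, linorder} \<Rightarrow> 'k::field"
  assumes "\<And>i. c i \<noteq> 0" "bij \<pi>" "f \<in> lpolys"
  shows "monomial_aut (c, \<pi>) f \<in> lpolys"
proof -
  note a = monomial_aut_aut[OF assms(1,2)]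
  obtain V d where "f = (\<Sum>v\<in>V. rf_const (d v) * xm v)" using assms(3) by (auto simp: lpolys_def)
  hence "monomial_aut (c, \<pi>) f = (\<Sum>v\<in>V. rf_const (d v * (\<Prod>i\<in>UNIV. c i powi v i)) * xm (v \<circ> inv_into UNIV \<pi>))"
    by (simp add: aut_sum[OF a] aut_mult[OF a] monomial_aut_const[OF assms(1,2)] monomial_aut_xm[OF assms(1,2)]
       rf_const_mult mult_ac)
  also have "\<dots> \<in> lpolys" by (intro lpolys_sum lpolys_monom)
  finally show ?thesis .
qed

section \<open>The group of shifts\<close>

type_synonym ('n, 'k) skew = "(('n, 'k) ratfun \<Rightarrow> ('n, 'k) ratfun) \<Rightarrow> ('n, 'k) ratfun"

locale q_torus =
  fixes q :: "'k::field" and idx :: "'n::{finite, linorder} itself"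
  assumes q_nonzero: "q \<noteq> 0" and q_not_root: "\<And>j::nat. j > 0 \<Longrightarrow> q ^ j \<noteq> 1"
begin

lemma q_powi_eq_1_iff: "q powi k = 1 \<longleftrightarrow> k = 0"
proof
  assume *: "q powi k = 1"
  show "k = 0"
  proof (rule ccontr)
    assume "k \<noteq> 0"
    hence "q ^ nat \<bar>k\<bar> = 1"
      using * by (cases "k > 0") (auto simp: power_int_def power_inverse inverse_eq_1_iff)
    with q_not_root[of "nat \<bar>k\<bar>"] \<open>k \<noteq> 0\<close> show False by simp
  qed
qed simp

text \<open>
  The automorphism \<open>x\<^sub>i \<mapsto> q\<^bsup>v\<^sub>i\<^esup> x\<^sub>i\<close>, that is the element \<open>v\<close> of \<open>\<int>\<^sup>n\<close>; the map is injective because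
  \<open>q\<close> is not a root of unity.
\<close>
definition sh :: "('n \<Rightarrow> int) \<Rightarrow> ('n, 'k) ratfun \<Rightarrow> ('n, 'k) ratfun" where
  "sh v = monomial_aut (\<lambda>i. q powi v i, id)"

lemma sh_aut: "is_aut (sh v)"
  unfolding sh_def by (rule monomial_aut_aut) (auto simp: q_nonzero)
lemma sh_const: "sh v (rf_const c) = rf_const c"
  unfolding sh_def by (rule monomial_aut_const) (auto simp: q_nonzero)
lemma sh_var: "sh v (rf_var i) = rf_const (q powi v i) * rf_var i"
  unfolding sh_def by (subst monomial_aut_var) (auto simp: q_nonzero)
lemma sh_xm: "sh v (xm w) = rf_const (\<Prod>i\<in>UNIV. q powi (v i * w i)) * xm w"
  unfolding sh_def by (subst monomial_aut_xm) (auto simp: q_nonzero power_int_mult)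
lemma sh_lpolys: "f \<in> lpolys \<Longrightarrow> sh v f \<in> lpolys"
  unfolding sh_def by (rule monomial_aut_lpolys) (auto simp: q_nonzero)

lemma sh_add: "sh v \<circ> sh w = sh (\<lambda>i. v i + w i)"
  unfolding sh_def
  by (subst monomial_aut_comp) (auto simp: q_nonzero power_int_add mult.commute)

lemma sh_0: "sh (\<lambda>i. 0) = id" by (simp add: sh_def monomial_aut_id)

lemma sh_uminus: "ivf (sh v) = sh (\<lambda>i. - v i)"
proof -
  have "sh v \<circ> sh (\<lambda>i. - v i) = id" by (simp add: sh_add sh_0)
  thus ?thesis using comp_ivf_eq(1)[OF sh_aut] by (metis comp_id)
qed

lemma sh_eq_iff: "sh v = sh w \<longleftrightarrow> v = w"
proof
  assume eq: "sh v = sh w"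
  show "v = w"
  proof
    fix i
    have "rf_const (q powi v i) * rf_var i = (rf_const (q powi w i) * rf_var i :: ('n, 'k) ratfun)"
      using sh_var[of v i] sh_var[of w i] eq by simp
    hence "q powi v i = q powi w i" by (simp add: rf_const_eq_iff)
    hence "q powi (v i - w i) = 1" using q_nonzero by (simp add: power_int_diff)
    thus "v i = w i" by (simp add: q_powi_eq_1_iff)
  qed
qed simp

abbreviation "M \<equiv> q_shifts q :: (('n, 'k) ratfun \<Rightarrow> ('n, 'k) ratfun) set"

lemma M_eq: "M = range sh" by (auto simp: q_shifts_def sh_def)

lemma sh_in_M: "sh v \<in> M" by (simp add: M_eq)

sublocale skew_group M
proof
  show "id \<in> M" using sh_in_M[of "\<lambda>i. 0"] by (simp add: sh_0)
  show "a \<circ> b \<in> M" if "a \<in> M" "b \<in> M" for a b using that by (auto simp: M_eq sh_add)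
  show "ivf a \<in> M" if "a \<in> M" for a using that by (auto simp: M_eq sh_uminus)
  show "is_aut a" if "a \<in> M" for a using that sh_aut by (auto simp: M_eq)
qed

lemma eps_eq: "eps q i = sh (\<lambda>j. if j = i then 1 else 0)"
  unfolding eps_def sh_def by (intro arg_cong[where f = monomial_aut]) auto

end

section \<open>The free algebra\<close>

lemma fa_carrier_iff: "f \<in> carrier free_algebra \<longleftrightarrow> finite {w. f w \<noteq> 0}"
  by (simp add: free_algebra_def)
lemma fa_zero: "\<zero>\<^bsub>free_algebra\<^esub> = 0" by (simp add: free_algebra_def zero_fun_def)
lemma fa_add: "f \<oplus>\<^bsub>free_algebra\<^esub> g = f + g" by (simp add: free_algebra_def plus_fun_def)
lemma fa_one: "\<one>\<^bsub>free_algebra\<^esub> = word 1 []" by (simp add: free_algebra_def word_def)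
lemma fa_mult: "(f \<otimes>\<^bsub>free_algebra\<^esub> g) w = (\<Sum>i\<le>length w. f (take i w) * g (drop i w))"
  by (simp add: free_algebra_def)

lemma fa_add_closed: "f \<in> carrier free_algebra \<Longrightarrow> g \<in> carrier free_algebra \<Longrightarrow> f + g \<in> carrier free_algebra"
  unfolding fa_carrier_iff by (rule finite_subset[of _ "{w. f w \<noteq> 0} \<union> {w. g w \<noteq> 0}"]) auto

lemma fa_uminus_closed: "f \<in> carrier free_algebra \<Longrightarrow> - f \<in> carrier free_algebra"
  by (simp add: fa_carrier_iff)

lemma fa_mult_closed:
  assumes "f \<in> carrier free_algebra" "g \<in> carrier free_algebra"
  shows "f \<otimes>\<^bsub>free_algebra\<^esub> g \<in> carrier free_algebra"
  unfolding fa_carrier_iff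
proof (rule finite_subset)
  show "{w. (f \<otimes>\<^bsub>free_algebra\<^esub> g) w \<noteq> 0} \<subseteq> (\<lambda>(u, v). u @ v) ` ({w. f w \<noteq> 0} \<times> {w. g w \<noteq> 0})"
  proof
    fix w assume "w \<in> {w. (f \<otimes>\<^bsub>free_algebra\<^esub> g) w \<noteq> 0}"
    hence "(\<Sum>i\<le>length w. f (take i w) * g (drop i w)) \<noteq> 0" by (simp add: fa_mult)
    then obtain i where "f (take i w) * g (drop i w) \<noteq> 0" by (meson sum.not_neutral_contains_not_neutral)
    thus "w \<in> (\<lambda>(u, v). u @ v) ` ({w. f w \<noteq> 0} \<times> {w. g w \<noteq> 0})"
      by (intro image_eqI[where x = "(take i w, drop i w)"]) auto
  qed
qed (use assms in \<open>simp add: fa_carrier_iff\<close>)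

lemma word_closed: "word c w \<in> carrier free_algebra"
  unfolding fa_carrier_iff by (rule finite_subset[of _ "{w}"]) (auto simp: word_def)

lemma word_mult: "word c u \<otimes>\<^bsub>free_algebra\<^esub> word d v = word (c * d) (u @ v)"
proof
  fix w
  have "(word c u \<otimes>\<^bsub>free_algebra\<^esub> word d v) w =
    (\<Sum>i\<le>length w. if i = length u then (if w = u @ v then c * d else 0) else 0)"
    unfolding fa_mult
  proof (rule sum.cong[OF refl])
    fix i assume i: "i \<in> {..length w}"
    have "take i w = u \<and> drop i w = v \<longleftrightarrow> i = length u \<and> w = u @ v"
      using i by (metis append_eq_conv_conj append_take_drop_id atMost_iff length_take min.absorb2)
    moreover have "word c u (take i w) * word d v (drop i w) = (if take i w = u \<and> drop i w = v then c * d else 0)"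
      by (simp add: word_def)
    ultimately show "word c u (take i w) * word d v (drop i w) =
        (if i = length u then (if w = u @ v then c * d else 0) else 0)"
      by (simp only:) simp
  qed
  also have "\<dots> = word (c * d) (u @ v) w" by (auto simp: word_def)
  finally show "(word c u \<otimes>\<^bsub>free_algebra\<^esub> word d v) w = word (c * d) (u @ v) w" .
qed

lemma fa_assoc:
  fixes f g h :: "'a list \<Rightarrow> 'k::field"
  shows "(f \<otimes>\<^bsub>free_algebra\<^esub> g) \<otimes>\<^bsub>free_algebra\<^esub> h = f \<otimes>\<^bsub>free_algebra\<^esub> (g \<otimes>\<^bsub>free_algebra\<^esub> h)"
proof
  fix w :: "'a list"
  let ?n = "length w"
  have "((f \<otimes>\<^bsub>free_algebra\<^esub> g) \<otimes>\<^bsub>free_algebra\<^esub> h) w =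
    (\<Sum>i\<le>?n. \<Sum>j\<le>i. f (take j w) * g (take (i - j) (drop j w)) * h (drop i w))"
    unfolding fa_mult sum_distrib_right
    by (intro sum.cong refl) (auto simp: min_def drop_take)
  also have "\<dots> = (\<Sum>(i, j)\<in>(SIGMA i:{..?n}. {..i}). f (take j w) * g (take (i - j) (drop j w)) * h (drop i w))"
    by (subst sum.Sigma) auto
  also have "\<dots> = (\<Sum>(j, k)\<in>(SIGMA j:{..?n}. {..?n - j}). f (take j w) * (g (take k (drop j w)) * h (drop k (drop j w))))"
    by (rule sum.reindex_bij_witness[of _ "\<lambda>(j, k). (j + k, j)" "\<lambda>(i, j). (j, i - j)"])
      (auto simp: mult.assoc add.commute)
  also have "\<dots> = (\<Sum>j\<le>?n. \<Sum>k\<le>?n - j. f (take j w) * (g (take k (drop j w)) * h (drop k (drop j w))))"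
    by (subst sum.Sigma) auto
  also have "\<dots> = (f \<otimes>\<^bsub>free_algebra\<^esub> (g \<otimes>\<^bsub>free_algebra\<^esub> h)) w"
    unfolding fa_mult sum_distrib_left by simp
  finally show "((f \<otimes>\<^bsub>free_algebra\<^esub> g) \<otimes>\<^bsub>free_algebra\<^esub> h) w = (f \<otimes>\<^bsub>free_algebra\<^esub> (g \<otimes>\<^bsub>free_algebra\<^esub> h)) w" .
qed

lemma fa_one_mult: "word 1 [] \<otimes>\<^bsub>free_algebra\<^esub> f = f"
proof
  fix w
  have "(word 1 [] \<otimes>\<^bsub>free_algebra\<^esub> f) w = (\<Sum>i\<le>length w. if i = 0 then f w else 0)"
    unfolding fa_mult by (rule sum.cong[OF refl]) (auto simp: word_def)
  thus "(word 1 [] \<otimes>\<^bsub>free_algebra\<^esub> f) w = f w" by simp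
qed

lemma fa_mult_one: "f \<otimes>\<^bsub>free_algebra\<^esub> word 1 [] = f"
proof
  fix w
  have "(f \<otimes>\<^bsub>free_algebra\<^esub> word 1 []) w = (\<Sum>i\<le>length w. if i = length w then f w else 0)"
    unfolding fa_mult by (rule sum.cong[OF refl]) (auto simp: word_def)
  thus "(f \<otimes>\<^bsub>free_algebra\<^esub> word 1 []) w = f w" by simp
qed

lemma ring_fa: "ring (free_algebra :: ('g list \<Rightarrow> 'k::field) ring)"
proof (rule ringI)
  let ?F = "free_algebra :: ('g list \<Rightarrow> 'k::field) ring"
  show "abelian_group ?F"
  proof (rule abelian_groupI)
    fix f assume f: "f \<in> carrier ?F"
    show "\<exists>g\<in>carrier ?F. g \<oplus>\<^bsub>?F\<^esub> f = \<zero>\<^bsub>?F\<^esub>"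
      using fa_uminus_closed[OF f] by (intro bexI[of _ "- f"]) (auto simp: fa_add fa_zero)
  next
    show "\<zero>\<^bsub>?F\<^esub> \<in> carrier ?F" by (simp add: fa_zero fa_carrier_iff)
  qed (auto simp: fa_add fa_zero fa_add_closed add_ac)
  show "Group.monoid ?F"
    by (rule monoidI) (auto simp: fa_mult_closed fa_assoc fa_one word_closed fa_one_mult fa_mult_one)
  show "(x \<oplus>\<^bsub>?F\<^esub> y) \<otimes>\<^bsub>?F\<^esub> z = x \<otimes>\<^bsub>?F\<^esub> z \<oplus>\<^bsub>?F\<^esub> y \<otimes>\<^bsub>?F\<^esub> z" for x y z
    by (rule ext) (simp add: fa_add fa_mult distrib_right sum.distrib)
  show "z \<otimes>\<^bsub>?F\<^esub> (x \<oplus>\<^bsub>?F\<^esub> y) = z \<otimes>\<^bsub>?F\<^esub> x \<oplus>\<^bsub>?F\<^esub> z \<otimes>\<^bsub>?F\<^esub> y" for x y z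
    by (rule ext) (simp add: fa_add fa_mult distrib_left sum.distrib)
qed

lemma fa_a_inv: "f \<in> carrier free_algebra \<Longrightarrow> \<ominus>\<^bsub>free_algebra\<^esub> f = - (f :: 'g list \<Rightarrow> 'k::field)"
proof -
  assume f: "f \<in> carrier (free_algebra :: ('g list \<Rightarrow> 'k) ring)"
  interpret ring "free_algebra :: ('g list \<Rightarrow> 'k) ring" by (rule ring_fa)
  have "(- f) \<oplus>\<^bsub>free_algebra\<^esub> f = \<zero>\<^bsub>free_algebra\<^esub>" by (simp add: fa_add fa_zero)
  thus ?thesis using f fa_uminus_closed[OF f] by (metis minus_equality)
qed

lemma fa_minus:
  "f \<in> carrier free_algebra \<Longrightarrow> g \<in> carrier free_algebra \<Longrightarrow> f \<ominus>\<^bsub>free_algebra\<^esub> g = f - (g :: 'g list \<Rightarrow> 'k::field)"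
  by (simp add: a_minus_def fa_a_inv fa_add)

lemma fa_induct [consumes 1, case_names zero add]:
  assumes "f \<in> carrier free_algebra" "P 0"
    "\<And>f c w. f \<in> carrier free_algebra \<Longrightarrow> P f \<Longrightarrow> P (f + word c w)"
  shows "P f"
proof -
  have "P f" if "finite W" "{w. f w \<noteq> 0} \<subseteq> W" for f W
    using that
  proof (induction W arbitrary: f rule: finite_induct)
    case empty
    hence "f = 0" by (auto simp: fun_eq_iff)
    with assms(2) show ?case by (simp only:)
  next
    case (insert w W)
    define g where "g = f(w := 0)"
    have g: "{w. g w \<noteq> 0} \<subseteq> W" using insert.prems by (auto simp: g_def)
    have f: "f = g + word (f w) w" by (auto simp: g_def word_def fun_eq_iff)
    have "P (g + word (f w) w)"
      by (rule assms(3)[OF _ insert.IH[OF g]]) (use g insert.hyps in \<open>auto simp: fa_carrier_iff intro: finite_subset\<close>)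
    thus ?case by (subst f)
  qed
  from this[of "{w. f w \<noteq> 0}"] assms(1) show ?thesis by (auto simp: fa_carrier_iff)
qed

section \<open>The quantum torus\<close>

fun xdeg :: "'n gen \<Rightarrow> 'n \<Rightarrow> int" where
  "xdeg (GX i) j = (if j = i then 1 else 0)"
| "xdeg (GXinv i) j = (if j = i then - 1 else 0)"
| "xdeg (GY i) j = 0"
| "xdeg (GYinv i) j = 0"

fun ydeg :: "'n gen \<Rightarrow> 'n \<Rightarrow> int" where
  "ydeg (GX i) j = 0"
| "ydeg (GXinv i) j = 0"
| "ydeg (GY i) j = (if j = i then 1 else 0)"
| "ydeg (GYinv i) j = (if j = i then - 1 else 0)"

fun gen_inv :: "'n gen \<Rightarrow> 'n gen" where
  "gen_inv (GX i) = GXinv i"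
| "gen_inv (GXinv i) = GX i"
| "gen_inv (GY i) = GYinv i"
| "gen_inv (GYinv i) = GY i"

definition xdeg_word :: "'n gen list \<Rightarrow> 'n \<Rightarrow> int" where "xdeg_word w = (\<lambda>j. \<Sum>u\<leftarrow>w. xdeg u j)"
definition ydeg_word :: "'n gen list \<Rightarrow> 'n \<Rightarrow> int" where "ydeg_word w = (\<lambda>j. \<Sum>u\<leftarrow>w. ydeg u j)"

lemma xdeg_word_simps [simp]: "xdeg_word [] = (\<lambda>j. 0)" "xdeg_word (u # w) = (\<lambda>j. xdeg u j + xdeg_word w j)" "xdeg_word (w @ w') = (\<lambda>j. xdeg_word w j + xdeg_word w' j)"
  by (auto simp: xdeg_word_def)
lemma ydeg_word_simps [simp]: "ydeg_word [] = (\<lambda>j. 0)" "ydeg_word (u # w) = (\<lambda>j. ydeg u j + ydeg_word w j)" "ydeg_word (w @ w') = (\<lambda>j. ydeg_word w j + ydeg_word w' j)"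
  by (auto simp: ydeg_word_def)

lemma gen_inv_deg [simp]: "xdeg (gen_inv u) j = - xdeg u j" "ydeg (gen_inv u) j = - ydeg u j"
  by (cases u; simp)+

lemma xdeg_word_neg: "xdeg_word w i < 0 \<Longrightarrow> GXinv i \<in> set w"
proof (induction w)
  case (Cons u w)
  then show ?case by (cases u) (auto split: if_splits)
qed simp
lemma xdeg_word_pos: "xdeg_word w i > 0 \<Longrightarrow> GX i \<in> set w"
proof (induction w)
  case (Cons u w)
  then show ?case by (cases u) (auto split: if_splits)
qed simp
lemma ydeg_word_neg: "ydeg_word w i < 0 \<Longrightarrow> GYinv i \<in> set w"
proof (induction w)
  case (Cons u w)
  then show ?case by (cases u) (auto split: if_splits)
qed simp
lemma ydeg_word_pos: "ydeg_word w i > 0 \<Longrightarrow> GY i \<in> set w"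
proof (induction w)
  case (Cons u w)
  then show ?case by (cases u) (auto split: if_splits)
qed simp

text \<open>If the degrees of a word vanish, its first letter must be compensated by its inverse further on.\<close>
lemma gen_inv_occurs:
  assumes "xdeg_word (u # w) = (\<lambda>j. 0)" "ydeg_word (u # w) = (\<lambda>j. 0)"
  shows "gen_inv u \<in> set w"
proof (cases u)
  case (GX i)
  thus ?thesis using fun_cong[OF assms(1), of i] xdeg_word_neg[of w i] by simp
next
  case (GY i)
  thus ?thesis using fun_cong[OF assms(2), of i] ydeg_word_neg[of w i] by simp
next
  case (GXinv i)
  thus ?thesis using fun_cong[OF assms(1), of i] xdeg_word_pos[of w i] by simp
next
  case (GYinv i)
  thus ?thesis using fun_cong[OF assms(2), of i] ydeg_word_pos[of w i] by simp
qed

lemma exists_word: "\<exists>w. xdeg_word w = v \<and> ydeg_word w = u"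
  for v u :: "'n::finite \<Rightarrow> int"
proof -
  have pos: "xdeg_word (replicate k g) = (\<lambda>j. int k * xdeg g j) \<and> ydeg_word (replicate k g) = (\<lambda>j. int k * ydeg g j)" for k and g :: "'n gen"
    by (induction k) (auto simp: algebra_simps)
  have "\<exists>w. xdeg_word w = (\<lambda>j. if j \<in> A then v j else 0) \<and> ydeg_word w = (\<lambda>j. if j \<in> A then u j else 0)" if "finite A" for A
    using that
  proof (induction A rule: finite_induct)
    case empty
    show ?case by (intro exI[of _ "[]"]) auto
  next
    case (insert i A)
    then obtain w where w: "xdeg_word w = (\<lambda>j. if j \<in> A then v j else 0)" "ydeg_word w = (\<lambda>j. if j \<in> A then u j else 0)" by blast
    define gx where "gx = (if v i \<ge> 0 then GX i else GXinv i)"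
    define gy where "gy = (if u i \<ge> 0 then GY i else GYinv i)"
    define w' where "w' = replicate (nat \<bar>v i\<bar>) gx @ replicate (nat \<bar>u i\<bar>) gy @ w"
    have "xdeg_word w' = (\<lambda>j. if j \<in> insert i A then v j else 0)" "ydeg_word w' = (\<lambda>j. if j \<in> insert i A then u j else 0)"
      using insert.hyps by (auto simp: w'_def w pos gx_def gy_def fun_eq_iff)
    thus ?case by blast
  qed
  from this[of UNIV] show ?thesis by simp
qed

context q_torus
begin

abbreviation "FA \<equiv> free_algebra :: ('n gen list \<Rightarrow> 'k) ring"
abbreviation "TI \<equiv> torus_ideal q :: ('n gen list \<Rightarrow> 'k) set"
abbreviation "T \<equiv> quantum_torus q :: ('n gen list \<Rightarrow> 'k) set ring"

definition letter_value :: "'n gen \<Rightarrow> ('n, 'k) skew" where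
  "letter_value u = skew_monom (xm (xdeg u)) (sh (ydeg u))"

primrec word_value :: "'n gen list \<Rightarrow> ('n, 'k) skew" where
  "word_value [] = skew_const 1"
| "word_value (u # w) = letter_value u \<otimes>\<^bsub>R\<^esub> word_value w"

text \<open>The scalar that arises when \<open>y\<^sup>a\<close> is moved past \<open>x\<^sup>b\<close>.\<close>
definition q_pairing :: "('n \<Rightarrow> int) \<Rightarrow> ('n \<Rightarrow> int) \<Rightarrow> 'k" where
  "q_pairing a b = (\<Prod>i\<in>UNIV. q powi (a i * b i))"

lemma q_pairing_nonzero: "q_pairing a b \<noteq> 0" by (simp add: q_pairing_def q_nonzero)

lemma monom_product:
  "skew_monom (rf_const c * xm v) (sh a) \<otimes>\<^bsub>R\<^esub> skew_monom (rf_const d * xm w) (sh b) =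
   skew_monom (rf_const (c * d * q_pairing a w) * xm (\<lambda>i. v i + w i)) (sh (\<lambda>i. a i + b i))"
  unfolding monom_mult_monom[OF sh_in_M sh_in_M] sh_add
  by (simp add: aut_mult[OF sh_aut] sh_const sh_xm q_pairing_def rf_const_mult xm_add mult_ac)

lemma word_value_form: "\<exists>c. c \<noteq> 0 \<and> word_value w = skew_monom (rf_const c * xm (xdeg_word w)) (sh (ydeg_word w))"
proof (induction w)
  case Nil
  show ?case by (intro exI[of _ 1]) (simp add: sh_0 id_def)
next
  case (Cons u w)
  then obtain c where c: "c \<noteq> 0" "word_value w = skew_monom (rf_const c * xm (xdeg_word w)) (sh (ydeg_word w))" by blast
  have "word_value (u # w) = skew_monom (rf_const 1 * xm (xdeg u)) (sh (ydeg u)) \<otimes>\<^bsub>R\<^esub> skew_monom (rf_const c * xm (xdeg_word w)) (sh (ydeg_word w))"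
    by (simp add: c(2) letter_value_def)
  also note monom_product
  finally show ?case using c(1) q_pairing_nonzero by (intro exI[of _ "c * q_pairing (ydeg u) (xdeg_word w)"]) simp
qed

lemma word_value_closed: "word_value w \<in> carrier R"
  using word_value_form[of w] R_monom[OF sh_in_M] by metis

lemma letter_value_closed: "letter_value u \<in> carrier R" unfolding letter_value_def by (rule R_monom[OF sh_in_M])

lemma word_value_append: "word_value (w @ w') = word_value w \<otimes>\<^bsub>R\<^esub> word_value w'"
proof (induction w)
  case Nil
  interpret ring R by (rule ring_R)
  show ?case using word_value_closed[of w'] l_one[of "word_value w'"] by (simp add: one_eq)
next
  case (Cons u w)
  then show ?case by (simp add: R_assoc letter_value_closed word_value_closed)
qed

lemma word_value_single: "word_value [u] = letter_value u"
proof -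
  interpret ring R by (rule ring_R)
  show ?thesis using r_one[OF letter_value_closed[of u]] by (simp add: one_eq)
qed

lemma fscale_mult_left: "f \<in> carrier R \<Longrightarrow> g \<in> carrier R \<Longrightarrow> fscale s f \<otimes>\<^bsub>R\<^esub> g = fscale s (f \<otimes>\<^bsub>R\<^esub> g)"
  by (simp only: const_mult[symmetric] R_mult R_assoc[OF R_monom[OF M_id]])

lemma word_value_fscale: "g \<in> carrier R \<Longrightarrow> word_value w \<otimes>\<^bsub>R\<^esub> fscale (rf_const s) g = fscale (rf_const s) (word_value w \<otimes>\<^bsub>R\<^esub> g)"
proof -
  assume g: "g \<in> carrier R"
  obtain c where c: "word_value w = skew_monom (rf_const c * xm (xdeg_word w)) (sh (ydeg_word w))" using word_value_form by blast
  show ?thesis unfolding c R_monom_mult[OF g sh_in_M] R_monom_mult[OF R_fscale[OF g] sh_in_M]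
    by (rule ext) (simp add: aut_mult[OF sh_aut] sh_const mult_ac)
qed

text \<open>
  The homomorphism from the free algebra with \<open>x\<^sub>i \<mapsto> x\<^sub>i\<close> and \<open>y\<^sub>i \<mapsto> \<epsilon>\<^sub>i\<close> that induces the embedding of the
  quantum torus.
\<close>
definition \<Phi> :: "('n gen list \<Rightarrow> 'k) \<Rightarrow> ('n, 'k) skew" where
  "\<Phi> f = (\<Sum>w | f w \<noteq> 0. fscale (rf_const (f w)) (word_value w))"

lemma fscale_0: "fscale 0 g = 0" by (simp add: fun_eq_iff)

lemma \<Phi>_superset:
  assumes "finite W" "{w. f w \<noteq> 0} \<subseteq> W"
  shows "\<Phi> f = (\<Sum>w\<in>W. fscale (rf_const (f w)) (word_value w))"
  unfolding \<Phi>_def by (rule sum.mono_neutral_left[OF assms]) (simp add: fscale_0)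

lemma \<Phi>_word: "\<Phi> (word c w) = fscale (rf_const c) (word_value w)"
  by (subst \<Phi>_superset[of "{w}"]) (auto simp: word_def)

lemma \<Phi>_closed: "\<Phi> f \<in> carrier R"
  unfolding \<Phi>_def by (intro R_sum R_fscale word_value_closed)

lemma \<Phi>_0: "\<Phi> 0 = 0" by (simp add: \<Phi>_def)

lemma \<Phi>_add:
  assumes "f \<in> carrier FA" "g \<in> carrier FA"
  shows "\<Phi> (f + g) = \<Phi> f + \<Phi> g"
proof -
  let ?W = "{w. f w \<noteq> 0} \<union> {w. g w \<noteq> 0}"
  have W: "finite ?W" using assms by (simp add: fa_carrier_iff)
  have "\<Phi> (f + g) = (\<Sum>w\<in>?W. fscale (rf_const ((f + g) w)) (word_value w))" by (rule \<Phi>_superset[OF W]) auto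
  also have "\<dots> = (\<Sum>w\<in>?W. fscale (rf_const (f w)) (word_value w) + fscale (rf_const (g w)) (word_value w))"
    by (intro sum.cong refl ext) (simp add: rf_const_add distrib_right)
  also have "\<dots> = \<Phi> f + \<Phi> g"
    unfolding sum.distrib using \<Phi>_superset[OF W, of f] \<Phi>_superset[OF W, of g] by simp
  finally show ?thesis .
qed

lemma \<Phi>_mult:
  assumes "f \<in> carrier FA" "g \<in> carrier FA"
  shows "\<Phi> (f \<otimes>\<^bsub>FA\<^esub> g) = \<Phi> f \<otimes>\<^bsub>R\<^esub> \<Phi> g"
proof -
  interpret F: ring FA by (rule ring_fa)
  interpret R: ring R by (rule ring_R)
  have wvar: "\<Phi> (word c u \<otimes>\<^bsub>FA\<^esub> word d v) = \<Phi> (word c u) \<otimes>\<^bsub>R\<^esub> \<Phi> (word d v)" for c d u v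
    unfolding word_mult \<Phi>_word word_value_append
    by (simp add: fscale_mult_left word_value_closed R_fscale word_value_fscale) (simp add: fun_eq_iff rf_const_mult mult_ac)
  have wg: "\<Phi> (word c u \<otimes>\<^bsub>FA\<^esub> g) = \<Phi> (word c u) \<otimes>\<^bsub>R\<^esub> \<Phi> g" if "g \<in> carrier FA" for c u g
    using that
  proof (induction rule: fa_induct)
    case zero
    show ?case using F.r_null[OF word_closed, of c u] R.r_null[OF \<Phi>_closed] by (simp only: fa_zero zero_eq \<Phi>_0)
  next
    case (add g d v)
    have "\<Phi> (word c u \<otimes>\<^bsub>FA\<^esub> (g + word d v)) = \<Phi> (word c u \<otimes>\<^bsub>FA\<^esub> g + word c u \<otimes>\<^bsub>FA\<^esub> word d v)"
      using F.r_distr[OF add.hyps word_closed[of d v] word_closed[of c u]] by (simp only: fa_add)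
    also have "\<dots> = \<Phi> (word c u \<otimes>\<^bsub>FA\<^esub> g) + \<Phi> (word c u \<otimes>\<^bsub>FA\<^esub> word d v)"
      by (intro \<Phi>_add fa_mult_closed word_closed add.hyps)
    also have "\<dots> = \<Phi> (word c u) \<otimes>\<^bsub>R\<^esub> (\<Phi> g + \<Phi> (word d v))"
      unfolding wvar add.IH by (rule mult_add_right[symmetric]; rule \<Phi>_closed)
    also have "\<dots> = \<Phi> (word c u) \<otimes>\<^bsub>R\<^esub> \<Phi> (g + word d v)"
      by (simp only: \<Phi>_add[OF add.hyps word_closed])
    finally show ?case .
  qed
  show ?thesis using assms(1)
  proof (induction rule: fa_induct)
    case zero
    show ?case using F.l_null[OF assms(2)] R.l_null[OF \<Phi>_closed] by (simp only: fa_zero zero_eq \<Phi>_0)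
  next
    case (add f c u)
    have "\<Phi> ((f + word c u) \<otimes>\<^bsub>FA\<^esub> g) = \<Phi> (f \<otimes>\<^bsub>FA\<^esub> g + word c u \<otimes>\<^bsub>FA\<^esub> g)"
      using F.l_distr[OF add.hyps word_closed assms(2), of c u] by (simp only: fa_add)
    also have "\<dots> = \<Phi> (f \<otimes>\<^bsub>FA\<^esub> g) + \<Phi> (word c u \<otimes>\<^bsub>FA\<^esub> g)"
      by (intro \<Phi>_add fa_mult_closed word_closed add.hyps assms)
    also have "\<dots> = (\<Phi> f + \<Phi> (word c u)) \<otimes>\<^bsub>R\<^esub> \<Phi> g"
      unfolding wg[OF assms(2)] add.IH by (rule mult_add_left[symmetric]; rule \<Phi>_closed)
    also have "\<dots> = \<Phi> (f + word c u) \<otimes>\<^bsub>R\<^esub> \<Phi> g"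
      by (simp only: \<Phi>_add[OF add.hyps word_closed])
    finally show ?case .
  qed
qed

lemma \<Phi>_hom: "ring_hom_ring FA R \<Phi>"
proof (rule ring_hom_ringI2)
  show "\<Phi> \<in> ring_hom FA R"
  proof (rule ring_hom_memI)
    show "\<Phi> \<one>\<^bsub>FA\<^esub> = \<one>\<^bsub>R\<^esub>" unfolding fa_one \<Phi>_word one_eq by (simp add: fun_eq_iff)
  qed (simp_all only: \<Phi>_closed \<Phi>_mult fa_add add_eq \<Phi>_add)
qed (rule ring_fa ring_R)+

lemma \<Phi>_minus: "f \<in> carrier FA \<Longrightarrow> g \<in> carrier FA \<Longrightarrow> \<Phi> (f \<ominus>\<^bsub>FA\<^esub> g) = \<Phi> f - \<Phi> g"
  using \<Phi>_add[of "f - g" g] fa_add_closed[of f "- g"] fa_uminus_closed[of g] by (simp add: fa_minus eq_diff_eq)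

lemma relator_closed: "r \<in> torus_relators q \<Longrightarrow> r \<in> carrier FA"
proof -
  interpret F: ring FA by (rule ring_fa)
  show "r \<in> torus_relators q \<Longrightarrow> r \<in> carrier FA"
    by (induction rule: torus_relators.induct) (intro F.minus_closed word_closed)+
qed

lemma q_pairing_single:
  "q_pairing (\<lambda>j. if j = i then s else 0) (\<lambda>j. if j = i' then t else 0) = (if i = i' then q powi (s * t) else 1)"
proof -
  have "q_pairing (\<lambda>j. if j = i then s else 0) (\<lambda>j. if j = i' then t else 0) =
    (\<Prod>j\<in>UNIV. if j = i then (if i = i' then q powi (s * t) else 1) else 1)"
    unfolding q_pairing_def by (intro prod.cong) auto
  thus ?thesis by simp
qed

lemma q_pairing_zero: "q_pairing (\<lambda>j. 0) b = 1" "q_pairing a (\<lambda>j. 0) = 1" by (simp_all add: q_pairing_def)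

lemma deg_fun:
  "xdeg (GX i) = (\<lambda>j. if j = i then 1 else 0)" "xdeg (GXinv i) = (\<lambda>j. if j = i then - 1 else 0)"
  "xdeg (GY i) = (\<lambda>j. 0)" "xdeg (GYinv i) = (\<lambda>j. 0)"
  "ydeg (GY i) = (\<lambda>j. if j = i then 1 else 0)" "ydeg (GYinv i) = (\<lambda>j. if j = i then - 1 else 0)"
  "ydeg (GX i) = (\<lambda>j. 0)" "ydeg (GXinv i) = (\<lambda>j. 0)"
  by (auto simp: fun_eq_iff)

lemma word_value_two:
  "word_value [u, v] = skew_monom (rf_const (q_pairing (ydeg u) (xdeg v)) * xm (\<lambda>i. xdeg u i + xdeg v i)) (sh (\<lambda>i. ydeg u i + ydeg v i))"
proof -
  have "word_value [u, v] = letter_value u \<otimes>\<^bsub>R\<^esub> letter_value v" using word_value_single[of v] by simp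
  thus ?thesis unfolding letter_value_def using monom_product[of 1 "xdeg u" "ydeg u" 1 "xdeg v" "ydeg v"] by simp
qed

lemma fscale_monom: "fscale s (skew_monom l a) = skew_monom (s * l) a"
  by (simp add: fun_eq_iff skew_monom_def)

lemma \<Phi>_relator: "r \<in> torus_relators q \<Longrightarrow> \<Phi> r = 0"
proof (induction rule: torus_relators.induct)
  case (plane i)
  show ?case unfolding \<Phi>_minus[OF word_closed word_closed] \<Phi>_word word_value_two fscale_monom deg_fun q_pairing_single q_pairing_zero
    by simp
next
  case (tensor i j u v)
  have "q_pairing (ydeg u) (xdeg v) = 1" "q_pairing (ydeg v) (xdeg u) = 1"
    using tensor by (auto simp: deg_fun q_pairing_single q_pairing_zero)
  then show ?case unfolding \<Phi>_minus[OF word_closed word_closed] \<Phi>_word word_value_two fscale_monom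
    by (simp add: add.commute)
next
  case (inv_right u u' i)
  have "q_pairing (ydeg u) (xdeg u') = 1" "(\<lambda>i. xdeg u i + xdeg u' i) = (\<lambda>j. 0)" "(\<lambda>i. ydeg u i + ydeg u' i) = (\<lambda>j. 0)"
    using inv_right by (auto simp: deg_fun q_pairing_zero)
  then show ?case unfolding \<Phi>_minus[OF word_closed word_closed] \<Phi>_word word_value_two fscale_monom
    by (simp add: sh_0 fscale_monom)
next
  case (inv_left u u' i)
  have "q_pairing (ydeg u') (xdeg u) = 1" "(\<lambda>i. xdeg u' i + xdeg u i) = (\<lambda>j. 0)" "(\<lambda>i. ydeg u' i + ydeg u i) = (\<lambda>j. 0)"
    using inv_left by (auto simp: deg_fun q_pairing_zero)
  then show ?case unfolding \<Phi>_minus[OF word_closed word_closed] \<Phi>_word word_value_two fscale_monom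
    by (simp add: sh_0 fscale_monom)
qed

lemma TI_ideal: "ideal TI FA"
proof -
  interpret F: ring FA by (rule ring_fa)
  show ?thesis unfolding torus_ideal_def by (rule F.genideal_ideal) (use relator_closed in blast)
qed

lemma relator_in_TI: "r \<in> torus_relators q \<Longrightarrow> r \<in> TI"
proof -
  interpret F: ring FA by (rule ring_fa)
  show "r \<in> torus_relators q \<Longrightarrow> r \<in> TI"
    unfolding torus_ideal_def using F.genideal_self[of "torus_relators q"] relator_closed by blast
qed

lemma TI_subset_kernel: "TI \<subseteq> a_kernel FA R \<Phi>"
proof -
  interpret F: ring FA by (rule ring_fa)
  interpret h: ring_hom_ring FA R \<Phi> by (rule \<Phi>_hom)
  show ?thesis unfolding torus_ideal_def
  proof (rule F.genideal_minimal[OF h.kernel_is_ideal])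
    show "torus_relators q \<subseteq> a_kernel FA R \<Phi>"
      using relator_closed \<Phi>_relator unfolding a_kernel_def' by (auto simp: zero_eq)
  qed
qed

definition torus_class :: "('n gen list \<Rightarrow> 'k) \<Rightarrow> ('n gen list \<Rightarrow> 'k) set" where "torus_class f = TI +>\<^bsub>FA\<^esub> f"

lemma torus_class_hom: "ring_hom_ring FA T torus_class"
proof -
  interpret ideal TI FA by (rule TI_ideal)
  show ?thesis using rcos_ring_hom_ring by (simp add: quantum_torus_def torus_class_def[abs_def])
qed

lemma torus_class_eq_iff: "f \<in> carrier FA \<Longrightarrow> g \<in> carrier FA \<Longrightarrow> torus_class f = torus_class g \<longleftrightarrow> f \<ominus>\<^bsub>FA\<^esub> g \<in> TI"
proof -
  interpret F: ring FA by (rule ring_fa)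
  show "f \<in> carrier FA \<Longrightarrow> g \<in> carrier FA \<Longrightarrow> torus_class f = torus_class g \<longleftrightarrow> f \<ominus>\<^bsub>FA\<^esub> g \<in> TI"
    unfolding torus_class_def using F.quotient_eq_iff_same_a_r_cos[OF TI_ideal] by blast
qed

text \<open>Equality of words in the quantum torus up to a nonzero scalar.\<close>
definition wsim :: "'n gen list \<Rightarrow> 'n gen list \<Rightarrow> bool" where
  "wsim w w' \<longleftrightarrow> (\<exists>c. c \<noteq> 0 \<and> torus_class (word 1 w) = torus_class (word c w'))"

lemma torus_class_mult: "torus_class (word c w) \<otimes>\<^bsub>T\<^esub> torus_class (word d w') = torus_class (word (c * d) (w @ w'))"
proof -
  interpret h: ring_hom_ring FA T torus_class by (rule torus_class_hom)
  show ?thesis using h.hom_mult[OF word_closed word_closed, of c w d w'] by (simp only: word_mult)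
qed

lemma torus_class_scale: "torus_class (word c w) = torus_class (word d w') \<Longrightarrow> torus_class (word (e * c) w) = torus_class (word (e * d) w')"
  using torus_class_mult[of e "[]" c w] torus_class_mult[of e "[]" d w'] by simp

lemma wsim_refl: "wsim w w" unfolding wsim_def by (intro exI[of _ 1]) simp

lemma wsim_sym: "wsim w w' \<Longrightarrow> wsim w' w"
proof -
  assume "wsim w w'"
  then obtain c where c: "c \<noteq> 0" "torus_class (word 1 w) = torus_class (word c w')" by (auto simp: wsim_def)
  have "torus_class (word (inverse c) w) = torus_class (word 1 w')" using torus_class_scale[OF c(2), of "inverse c"] c(1) by simp
  thus ?thesis unfolding wsim_def using c(1) by (intro exI[of _ "inverse c"]) simp
qed

lemma wsim_trans: "wsim w w' \<Longrightarrow> wsim w' w'' \<Longrightarrow> wsim w w''"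
proof -
  assume "wsim w w'" "wsim w' w''"
  then obtain c d where c: "c \<noteq> 0" "torus_class (word 1 w) = torus_class (word c w')" and d: "d \<noteq> 0" "torus_class (word 1 w') = torus_class (word d w'')"
    by (auto simp: wsim_def)
  have "torus_class (word c w') = torus_class (word (c * d) w'')" using torus_class_scale[OF d(2), of c] by simp
  thus ?thesis unfolding wsim_def using c d by (intro exI[of _ "c * d"]) simp
qed

lemma wsim_cong: "wsim w w' \<Longrightarrow> wsim (u @ w @ v) (u @ w' @ v)"
proof -
  assume "wsim w w'"
  then obtain c where c: "c \<noteq> 0" "torus_class (word 1 w) = torus_class (word c w')" by (auto simp: wsim_def)
  have "torus_class (word 1 u) \<otimes>\<^bsub>T\<^esub> (torus_class (word 1 w) \<otimes>\<^bsub>T\<^esub> torus_class (word 1 v)) = torus_class (word 1 u) \<otimes>\<^bsub>T\<^esub> (torus_class (word c w') \<otimes>\<^bsub>T\<^esub> torus_class (word 1 v))"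
    by (simp only: c(2))
  thus ?thesis unfolding wsim_def using c(1) by (intro exI[of _ c]) (simp add: torus_class_mult)
qed

lemma wsim_relator: "word 1 w \<ominus>\<^bsub>FA\<^esub> word c w' \<in> torus_relators q \<Longrightarrow> c \<noteq> 0 \<Longrightarrow> wsim w w'"
  unfolding wsim_def using torus_class_eq_iff[OF word_closed word_closed] relator_in_TI by blast

lemma wsim_inv: "wsim [u, gen_inv u] []"
proof (cases u)
  case (GX i)
  thus ?thesis using wsim_relator[OF torus_relators.inv_right[of "GX i" "GXinv i" i q]] by simp
next
  case (GY i)
  thus ?thesis using wsim_relator[OF torus_relators.inv_right[of "GY i" "GYinv i" i q]] by simp
next
  case (GXinv i)
  thus ?thesis using wsim_relator[OF torus_relators.inv_left[of "GX i" "GXinv i" i q]] by simp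
next
  case (GYinv i)
  thus ?thesis using wsim_relator[OF torus_relators.inv_left[of "GY i" "GYinv i" i q]] by simp
qed

lemma gen_inv_inv [simp]: "gen_inv (gen_inv u) = u" by (cases u) auto

lemma wsim_inv': "wsim [gen_inv u, u] []"
  using wsim_inv[of "gen_inv u"] by simp

lemma wsim_commute_inv: "wsim [u, v] [v, u] \<Longrightarrow> wsim [gen_inv u, v] [v, gen_inv u]"
proof -
  assume uv: "wsim [u, v] [v, u]"
  have "wsim [gen_inv u, v] [gen_inv u, v, u, gen_inv u]"
    using wsim_sym[OF wsim_cong[OF wsim_inv[of u], of "[gen_inv u, v]" "[]"]] by simp
  moreover have "wsim [gen_inv u, v, u, gen_inv u] [gen_inv u, u, v, gen_inv u]"
    using wsim_sym[OF wsim_cong[OF uv, of "[gen_inv u]" "[gen_inv u]"]] by simp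
  moreover have "wsim [gen_inv u, u, v, gen_inv u] [v, gen_inv u]"
    using wsim_cong[OF wsim_inv'[of u], of "[]" "[v, gen_inv u]"] by simp
  ultimately show ?thesis by (meson wsim_trans)
qed

lemma wsim_commute_base:
  assumes "u \<in> {GX i, GY i}" "v \<in> {GX j, GY j}"
  shows "wsim [u, v] [v, u]"
proof (cases "i = j")
  case False
  have "word 1 [u, v] \<ominus>\<^bsub>FA\<^esub> word 1 [v, u] \<in> torus_relators q"
    by (rule torus_relators.tensor[OF False assms])
  thus ?thesis by (rule wsim_relator) simp
next
  case True
  have "wsim [GY i, GX i] [GX i, GY i]"
    by (rule wsim_relator[OF torus_relators.plane q_nonzero])
  with True show ?thesis using assms wsim_sym wsim_refl by auto
qed

text \<open>
  Any two letters commute up to a scalar. For the letters \<open>x\<^sub>i\<close> and \<open>y\<^sub>i\<close> this is a relation or trivial; inverting a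
  letter preserves it.
\<close>
lemma wsim_commute: "wsim [u, v] [v, u]"
proof -
  have base: "\<exists>u0 i. u0 \<in> {GX i, GY i} \<and> (u = u0 \<or> u = gen_inv u0)" for u :: "'n gen"
    by (cases u) (auto intro: exI[of _ "GX _"] exI[of _ "GY _"])
  obtain u0 i where u: "u0 \<in> {GX i, GY i}" "u = u0 \<or> u = gen_inv u0" using base by blast
  obtain v0 j where v: "v0 \<in> {GX j, GY j}" "v = v0 \<or> v = gen_inv v0" using base by blast
  have "wsim [u0, v0] [v0, u0]" by (rule wsim_commute_base[OF u(1) v(1)])
  hence "wsim [u, v0] [v0, u]" using u(2) wsim_commute_inv by blast
  hence "wsim [v0, u] [u, v0]" by (rule wsim_sym)
  hence "wsim [v, u] [u, v]" using v(2) wsim_commute_inv by blast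
  thus ?thesis by (rule wsim_sym)
qed

lemma wsim_move: "wsim (u # w) (w @ [u])"
proof (induction w)
  case Nil
  show ?case by (simp add: wsim_refl)
next
  case (Cons v w)
  have "wsim (u # v # w) (v # u # w)" using wsim_cong[OF wsim_commute[of u v], of "[]" w] by simp
  moreover have "wsim (v # u # w) (v # w @ [u])" using wsim_cong[OF Cons, of "[v]" "[]"] by simp
  ultimately show ?case using wsim_trans by simp
qed

text \<open>The first letter is moved through the word to an occurrence of its inverse and cancelled.\<close>
lemma wsim_degree_zero: "xdeg_word w = (\<lambda>j. 0) \<Longrightarrow> ydeg_word w = (\<lambda>j. 0) \<Longrightarrow> wsim w []"
proof (induction "length w" arbitrary: w rule: less_induct)
  case less
  show ?case
  proof (cases w)
    case Nil
    thus ?thesis by (simp add: wsim_refl)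
  next
    case (Cons u w1)
    have "gen_inv u \<in> set w1" by (rule gen_inv_occurs) (use less.prems Cons in simp_all)
    then obtain w2 w3 where w1: "w1 = w2 @ gen_inv u # w3" by (auto simp: in_set_conv_decomp)
    have "wsim (u # w2 @ gen_inv u # w3) (w2 @ [u] @ gen_inv u # w3)"
      using wsim_cong[OF wsim_move[of u w2], of "[]" "gen_inv u # w3"] by simp
    moreover have "wsim (w2 @ [u] @ gen_inv u # w3) (w2 @ w3)"
      using wsim_cong[OF wsim_inv[of u], of w2 w3] by simp
    moreover have "wsim (w2 @ w3) []"
    proof (rule less.hyps)
      show "length (w2 @ w3) < length w" by (simp add: Cons w1)
      show "xdeg_word (w2 @ w3) = (\<lambda>j. 0)" "ydeg_word (w2 @ w3) = (\<lambda>j. 0)"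
        using less.prems by (auto simp: Cons w1 fun_eq_iff algebra_simps)
    qed
    ultimately show ?thesis unfolding Cons w1 using wsim_trans by blast
  qed
qed

lemma wsim_same_degree:
  assumes "xdeg_word w = xdeg_word w'" "ydeg_word w = ydeg_word w'"
  shows "wsim w w'"
proof -
  let ?v = "rev (map gen_inv w')"
  have deg: "xdeg_word ?v = (\<lambda>j. - xdeg_word w' j)" "ydeg_word ?v = (\<lambda>j. - ydeg_word w' j)"
    by (induction w') (auto simp: fun_eq_iff)
  have "wsim (w @ ?v) []" "wsim (?v @ w') []"
    using assms by (intro wsim_degree_zero; simp add: deg)+
  hence "wsim (w @ ?v @ w') w'" "wsim (w @ ?v @ w') w"
    using wsim_cong[of "w @ ?v" "[]" "[]" w'] wsim_cong[of "?v @ w'" "[]" w "[]"] by simp_all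
  thus ?thesis using wsim_sym wsim_trans by blast
qed

text \<open>
  Induction on the number of words in \<open>f\<close>. Two words of the same degrees are proportional modulo the
  relations, so one of them can be removed. If all degrees are distinct, the images of the words are
  scalar multiples of distinct \<open>x\<^sup>v y\<^sup>u\<close>, which are independent.
\<close>
lemma kernel_subset_TI:
  assumes "f \<in> carrier FA" "\<Phi> f = 0"
  shows "f \<in> TI"
  using assms
proof (induction "card {w. f w \<noteq> 0}" arbitrary: f rule: less_induct)
  case less
  interpret F: ring FA by (rule ring_fa)
  interpret J: ideal TI FA by (rule TI_ideal)
  let ?S = "{w. f w \<noteq> 0}"
  have fin: "finite ?S" using less.prems by (simp add: fa_carrier_iff)
  show ?case
  proof (cases "\<exists>w\<in>?S. \<exists>w'\<in>?S. w \<noteq> w' \<and> xdeg_word w = xdeg_word w' \<and> ydeg_word w = ydeg_word w'")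
    case True
    then obtain w w' where w: "w \<in> ?S" "w' \<in> ?S" "w \<noteq> w'" "xdeg_word w = xdeg_word w'" "ydeg_word w = ydeg_word w'" by blast
    obtain c where c: "torus_class (word 1 w) = torus_class (word c w')" using wsim_same_degree[OF w(4,5)] by (auto simp: wsim_def)
    hence "torus_class (word (f w) w) = torus_class (word (f w * c) w')" using torus_class_scale[OF c, of "f w"] by simp
    hence r: "word (f w) w \<ominus>\<^bsub>FA\<^esub> word (f w * c) w' \<in> TI" by (simp add: torus_class_eq_iff[OF word_closed word_closed])
    define r where "r = word (f w) w \<ominus>\<^bsub>FA\<^esub> word (f w * c) w'"
    have rTI: "r \<in> TI" using r by (simp add: r_def)
    hence rc: "r \<in> carrier FA" and r0: "\<Phi> r = 0" using TI_subset_kernel by (auto simp: a_kernel_def' zero_eq)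
    define g where "g = f \<ominus>\<^bsub>FA\<^esub> r"
    have g_eq: "g = f - r" using less.prems rc by (simp add: g_def fa_minus)
    have r_eq: "r = word (f w) w - word (f w * c) w'" unfolding r_def by (rule fa_minus[OF word_closed word_closed])
    have "{w. g w \<noteq> 0} \<subseteq> ?S - {w}"
      using w(2,3) by (auto simp: g_eq r_eq word_def split: if_splits)
    hence "card {w. g w \<noteq> 0} < card ?S" using fin w(1)
      by (metis (no_types, lifting) card_Diff1_less card_mono finite_Diff le_less_trans)
    moreover have "g \<in> carrier FA" using less.prems rc by (simp add: g_def)
    moreover have "\<Phi> g = 0" unfolding g_def using \<Phi>_minus[OF less.prems(1) rc] less.prems(2) r0 by simp
    ultimately have "g \<in> TI" by (rule less.hyps)
    hence "g \<oplus>\<^bsub>FA\<^esub> r \<in> TI" using rTI by (rule J.a_closed)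
    thus ?thesis by (simp add: fa_add g_eq)
  next
    case False
    obtain c where c: "\<And>w. c w \<noteq> 0" "\<And>w. word_value w = skew_monom (rf_const (c w) * xm (xdeg_word w)) (sh (ydeg_word w))"
      using word_value_form by metis
    have "f w = 0" for w
    proof (rule ccontr)
      assume "f w \<noteq> 0"
      let ?S' = "{w' \<in> ?S. ydeg_word w' = ydeg_word w}"
      have inj: "inj_on xdeg_word ?S'"
      proof (rule inj_onI)
        fix x y assume a: "x \<in> ?S'" "y \<in> ?S'" "xdeg_word x = xdeg_word y"
        hence "x \<in> ?S" "y \<in> ?S" "ydeg_word x = ydeg_word y" by simp_all
        with False a(3) show "x = y" by blast
      qed
      \<comment> \<open>The coefficients indexed by degrees instead of words, as \<open>xm_independent\<close> requires.\<close>
      define d where "d v = (let w' = the_inv_into ?S' xdeg_word v in f w' * c w')" for v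
      have d_eq: "d (xdeg_word w') = f w' * c w'" if "w' \<in> ?S'" for w'
        by (simp only: d_def Let_def the_inv_into_f_f[OF inj that])
      have "0 = \<Phi> f (sh (ydeg_word w))" using less.prems(2) by simp
      also have "\<dots> = (\<Sum>w'\<in>?S. rf_const (f w') * word_value w' (sh (ydeg_word w)))"
        by (simp add: \<Phi>_def sum_fun_apply)
      also have "\<dots> = (\<Sum>w'\<in>?S'. rf_const (f w' * c w') * xm (xdeg_word w'))"
        by (rule sum.mono_neutral_cong_right[OF fin]) (auto simp: c(2) skew_monom_def sh_eq_iff rf_const_mult)
      also have "\<dots> = (\<Sum>v\<in>xdeg_word ` ?S'. rf_const (d v) * xm v)"
        unfolding sum.reindex[OF inj] o_apply by (rule sum.cong[OF refl]) (simp only: d_eq)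
      finally have "(\<Sum>v\<in>xdeg_word ` ?S'. rf_const (d v) * xm v) = (0 :: ('n, 'k) ratfun)" by simp
      hence "d (xdeg_word w) = 0" by (rule xm_independent[rotated]) (use fin \<open>f w \<noteq> 0\<close> in auto)
      moreover have "d (xdeg_word w) = f w * c w"
        by (rule d_eq) (use \<open>f w \<noteq> 0\<close> in simp)
      ultimately show False using \<open>f w \<noteq> 0\<close> c(1) by simp
    qed
    hence "f = \<zero>\<^bsub>FA\<^esub>" by (simp add: fa_zero fun_eq_iff)
    thus ?thesis using J.zero_closed by simp
  qed
qed

lemma kernel_eq: "a_kernel FA R \<Phi> = TI"
  using kernel_subset_TI TI_subset_kernel by (auto simp: a_kernel_def' zero_eq)

lemma T_eq: "T = FA Quot (a_kernel FA R \<Phi>)" by (simp add: quantum_torus_def kernel_eq)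

lemma ring_T: "ring T"
proof -
  interpret ideal TI FA by (rule TI_ideal)
  show ?thesis unfolding quantum_torus_def by (rule quotient_is_ring)
qed

lemma T_carrier: "carrier T = torus_class ` carrier FA"
  by (auto simp: quantum_torus_def FactRing_def A_RCOSETS_def' torus_class_def)

lemma torus_class_in_T: "f \<in> carrier FA \<Longrightarrow> torus_class f \<in> carrier T" by (simp add: T_carrier)

definition emb :: "('n gen list \<Rightarrow> 'k) set \<Rightarrow> ('n, 'k) skew" where
  "emb = restrict (\<lambda>Z. the_elem (\<Phi> ` Z)) (carrier T)"

lemma emb_extensional: "emb \<in> extensional (carrier T)" by (simp add: emb_def)

lemma emb_torus_class: "f \<in> carrier FA \<Longrightarrow> emb (torus_class f) = \<Phi> f"
proof -
  assume f: "f \<in> carrier FA"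
  interpret h: ring_hom_ring FA R \<Phi> by (rule \<Phi>_hom)
  have "the_elem (\<Phi> ` (a_kernel FA R \<Phi> +>\<^bsub>FA\<^esub> f)) = \<Phi> f" by (rule h.the_elem_simp[OF f])
  thus ?thesis using torus_class_in_T[OF f] by (simp add: emb_def torus_class_def kernel_eq)
qed

lemma emb_hom: "emb \<in> ring_hom T R"
proof -
  interpret h: ring_hom_ring FA R \<Phi> by (rule \<Phi>_hom)
  interpret T: ring T by (rule ring_T)
  have *: "(\<lambda>Z. the_elem (\<Phi> ` Z)) \<in> ring_hom T R" unfolding T_eq by (rule h.the_elem_hom)
  show ?thesis
    by (rule ring_hom_memI)
      (use ring_hom_closed[OF *] ring_hom_mult[OF *] ring_hom_add[OF *] ring_hom_one[OF *] in \<open>auto simp: emb_def\<close>)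
qed

lemma emb_inj: "inj_on emb (carrier T)"
proof (rule inj_onI)
  interpret h: ring_hom_ring FA R \<Phi> by (rule \<Phi>_hom)
  fix Z Y assume a: "Z \<in> carrier T" "Y \<in> carrier T" "emb Z = emb Y"
  show "Z = Y"
    by (rule h.the_elem_inj) (use a in \<open>auto simp: emb_def T_eq[symmetric]\<close>)
qed

lemma torus_gen_eq: "torus_gen q u = torus_class (word 1 [u])" by (simp add: torus_gen_def torus_class_def)
lemma torus_const_eq: "torus_const q c = torus_class (word c [])" by (simp add: torus_const_def torus_class_def)

lemma emb_gen: "emb (torus_gen q u) = letter_value u"
  unfolding torus_gen_eq emb_torus_class[OF word_closed] \<Phi>_word word_value_single by (simp add: fun_eq_iff)
lemma emb_const: "emb (torus_const q c) = skew_const (rf_const c)"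
  unfolding torus_const_eq emb_torus_class[OF word_closed] \<Phi>_word by (simp add: fscale_monom)

lemma letter_value_GX: "letter_value (GX i) = skew_const (rf_var i)"
  by (simp add: letter_value_def deg_fun sh_0 xm_single)
lemma letter_value_GY: "letter_value (GY i) = skew_monom 1 (eps q i)"
  by (simp add: letter_value_def deg_fun eps_eq)

lemma gen_inverse:
  "torus_gen q u \<otimes>\<^bsub>T\<^esub> torus_gen q (gen_inv u) = \<one>\<^bsub>T\<^esub>"
proof -
  interpret T: ring T by (rule ring_T)
  have in_T: "torus_gen q u \<in> carrier T" for u unfolding torus_gen_eq by (rule torus_class_in_T[OF word_closed])
  have "emb (torus_gen q u \<otimes>\<^bsub>T\<^esub> torus_gen q (gen_inv u)) = letter_value u \<otimes>\<^bsub>R\<^esub> letter_value (gen_inv u)"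
    by (simp only: ring_hom_mult[OF emb_hom in_T in_T] emb_gen)
  also have "\<dots> = word_value [u, gen_inv u]" using word_value_single[of "gen_inv u"] by simp
  also have "\<dots> = \<one>\<^bsub>R\<^esub>"
  proof -
    have "q_pairing (ydeg u) (xdeg (gen_inv u)) = 1" by (cases u) (auto simp: deg_fun q_pairing_zero)
    moreover have "(\<lambda>i. xdeg u i + xdeg (gen_inv u) i) = (\<lambda>j. 0)" "(\<lambda>i. ydeg u i + ydeg (gen_inv u) i) = (\<lambda>j. 0)"
      by auto
    ultimately show ?thesis unfolding word_value_two one_eq by (simp add: sh_0)
  qed
  also have "\<dots> = emb \<one>\<^bsub>T\<^esub>" using ring_hom_one[OF emb_hom] by simp
  finally show ?thesis by (rule inj_onD[OF emb_inj]) (use in_T in auto)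
qed

text \<open>The values at \<open>x\<^sub>i\<close> and \<open>y\<^sub>i\<close> determine those at their inverses, because inverses in a ring are unique.\<close>
lemma hom_unique:
  assumes S: "ring S" and h: "h \<in> ring_hom T S" "h' \<in> ring_hom T S"
    and c: "\<And>c. h (torus_const q c) = h' (torus_const q c)"
    and x: "\<And>i. h (torus_gen q (GX i)) = h' (torus_gen q (GX i))"
    and y: "\<And>i. h (torus_gen q (GY i)) = h' (torus_gen q (GY i))"
    and Z: "Z \<in> carrier T"
  shows "h Z = h' Z"
proof -
  interpret S: ring S by fact
  interpret T: ring T by (rule ring_T)
  interpret h: ring_hom_ring FA T torus_class by (rule torus_class_hom)
  have in_T: "torus_gen q u \<in> carrier T" for u unfolding torus_gen_eq by (rule torus_class_in_T[OF word_closed])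
  have inv: "h (torus_gen q (gen_inv u)) = h' (torus_gen q (gen_inv u))"
    if "h (torus_gen q u) = h' (torus_gen q u)" for u
  proof (rule S.inv_unique)
    show "h (torus_gen q (gen_inv u)) \<otimes>\<^bsub>S\<^esub> h (torus_gen q u) = \<one>\<^bsub>S\<^esub>"
      using gen_inverse[of "gen_inv u"] ring_hom_mult[OF h(1) in_T in_T, of "gen_inv u" u] ring_hom_one[OF h(1)] by simp
    show "h (torus_gen q u) \<otimes>\<^bsub>S\<^esub> h' (torus_gen q (gen_inv u)) = \<one>\<^bsub>S\<^esub>"
      using gen_inverse[of u] ring_hom_mult[OF h(2) in_T in_T, of u "gen_inv u"] ring_hom_one[OF h(2)] that by simp
  qed (use ring_hom_closed[OF h(1) in_T] ring_hom_closed[OF h(2) in_T] in auto)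
  have gen: "h (torus_gen q u) = h' (torus_gen q u)" for u
    using x y inv[of "GX _"] inv[of "GY _"] by (cases u) auto
  have w1: "h (torus_class (word 1 w)) = h' (torus_class (word 1 w))" for w
  proof (induction w)
    case Nil
    show ?case using c[of 1] by (simp add: torus_const_eq)
  next
    case (Cons u w)
    have "torus_class (word 1 (u # w)) = torus_class (word 1 [u]) \<otimes>\<^bsub>T\<^esub> torus_class (word 1 w)" by (simp add: torus_class_mult)
    thus ?case using gen[of u] Cons ring_hom_mult[OF h(1) torus_class_in_T[OF word_closed] torus_class_in_T[OF word_closed]]
        ring_hom_mult[OF h(2) torus_class_in_T[OF word_closed] torus_class_in_T[OF word_closed]]
      by (simp add: torus_gen_eq)
  qed
  have cw: "h (torus_class (word c w)) = h' (torus_class (word c w))" for c w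
  proof -
    have "torus_class (word c w) = torus_class (word c []) \<otimes>\<^bsub>T\<^esub> torus_class (word 1 w)" by (simp add: torus_class_mult)
    thus ?thesis using assms(4)[of c] w1[of w] ring_hom_mult[OF h(1) torus_class_in_T[OF word_closed] torus_class_in_T[OF word_closed]]
        ring_hom_mult[OF h(2) torus_class_in_T[OF word_closed] torus_class_in_T[OF word_closed]]
      by (simp add: torus_const_eq)
  qed
  obtain f where f: "f \<in> carrier FA" "Z = torus_class f" using Z T_carrier by auto
  have "h (torus_class f) = h' (torus_class f)" using f(1)
  proof (induction rule: fa_induct)
    case zero
    have "(0 :: 'n gen list \<Rightarrow> 'k) = word 0 []" by (simp add: word_def fun_eq_iff)
    show ?case unfolding \<open>0 = word 0 []\<close> by (rule cw)
  next
    case (add f c w)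
    have "torus_class (f + word c w) = torus_class f \<oplus>\<^bsub>T\<^esub> torus_class (word c w)"
      using h.hom_add[OF add.hyps word_closed] by (simp add: fa_add)
    thus ?case using add.IH cw[of c w] ring_hom_add[OF h(1) torus_class_in_T[OF add.hyps] torus_class_in_T[OF word_closed]]
        ring_hom_add[OF h(2) torus_class_in_T[OF add.hyps] torus_class_in_T[OF word_closed]] by (simp only:)
  qed
  thus ?thesis by (simp add: f(2))
qed

text \<open>
  The embedding is defined as the unique homomorphism with given values; \<open>emb\<close> is one by
  \<open>kernel_eq\<close>, and \<open>hom_unique\<close> shows that there is no other.
\<close>
lemma torus_embedding_eq: "torus_embedding q = emb"
  unfolding torus_embedding_def
proof (rule the_equality)
  show "emb \<in> ring_hom T R \<inter> extensional (carrier T) \<and> inj_on emb (carrier T) \<and>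
     (\<forall>c. emb (torus_const q c) = skew_const (rf_const c)) \<and>
     (\<forall>i. emb (torus_gen q (GX i)) = skew_const (rf_var i)) \<and>
     (\<forall>i. emb (torus_gen q (GY i)) = skew_monom 1 (eps q i))"
    using emb_hom emb_inj emb_extensional by (auto simp: emb_const emb_gen letter_value_GX letter_value_GY)
next
  fix \<phi>
  assume \<phi>: "\<phi> \<in> ring_hom T R \<inter> extensional (carrier T) \<and> inj_on \<phi> (carrier T) \<and>
     (\<forall>c. \<phi> (torus_const q c) = skew_const (rf_const c)) \<and>
     (\<forall>i. \<phi> (torus_gen q (GX i)) = skew_const (rf_var i)) \<and>
     (\<forall>i. \<phi> (torus_gen q (GY i)) = skew_monom 1 (eps q i))"
  show "\<phi> = emb"
  proof (rule extensionalityI)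
    show "\<phi> \<in> extensional (carrier T)" using \<phi> by blast
    show "emb \<in> extensional (carrier T)" by (simp add: emb_def)
    show "\<phi> Z = emb Z" if "Z \<in> carrier T" for Z
      by (rule hom_unique[OF ring_R _ emb_hom _ _ _ that]) (use \<phi> in \<open>auto simp: emb_const emb_gen letter_value_GX letter_value_GY\<close>)
  qed
qed

text \<open>The skew group ring over the Laurent polynomials, which is the image of the quantum torus.\<close>
definition laurent_skew :: "('n, 'k) skew set" where
  "laurent_skew = {f \<in> carrier R. \<forall>a. f a \<in> lpolys}"

text \<open>Up to a nonzero scalar, every \<open>x\<^sup>v y\<^sup>u\<close> is the image of a word with these degrees.\<close>
lemma emb_image: "emb ` carrier T = laurent_skew"
proof
  show "emb ` carrier T \<subseteq> laurent_skew"
  proof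
    fix g assume "g \<in> emb ` carrier T"
    then obtain f where f: "f \<in> carrier FA" "g = \<Phi> f" using emb_torus_class by (auto simp: T_carrier)
    have "word_value w a \<in> lpolys" for w a
    proof -
      obtain c where "word_value w = skew_monom (rf_const c * xm (xdeg_word w)) (sh (ydeg_word w))" using word_value_form by blast
      thus ?thesis using lpolys_monom subr_0[OF subr_lpolys] by (auto simp: skew_monom_def)
    qed
    moreover have "rf_const c \<in> lpolys" for c using lpolys_monom[of c "\<lambda>_. 0"] by simp
    ultimately have "\<Phi> f a \<in> lpolys" for a
      unfolding \<Phi>_def sum_fun_apply by (intro lpolys_sum) (auto intro: lpolys_mult)
    thus "g \<in> laurent_skew" using f \<Phi>_closed by (simp add: laurent_skew_def)
  qed
next
  show "laurent_skew \<subseteq> emb ` carrier T"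
  proof
    fix g assume g: "g \<in> laurent_skew"
    have im: "emb ` carrier T = \<Phi> ` carrier FA" using emb_torus_class by (force simp: T_carrier)
    have add: "x + y \<in> \<Phi> ` carrier FA" if "x \<in> \<Phi> ` carrier FA" "y \<in> \<Phi> ` carrier FA" for x y
    proof -
      from that obtain f f' where "f \<in> carrier FA" "x = \<Phi> f" "f' \<in> carrier FA" "y = \<Phi> f'" by blast
      thus ?thesis using \<Phi>_add[of f f'] fa_add_closed[of f f'] by (intro image_eqI[of _ _ "f + f'"]) (simp_all only:)
    qed
    have zero: "0 \<in> \<Phi> ` carrier FA"
      using \<Phi>_0 by (intro image_eqI[of _ _ 0]) (auto simp: fa_carrier_iff)
    have sum: "finite A \<Longrightarrow> (\<And>i. i \<in> A \<Longrightarrow> F i \<in> \<Phi> ` carrier FA) \<Longrightarrow> sum F A \<in> \<Phi> ` carrier FA" for F A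
    proof (induction A rule: finite_induct)
      case empty
      show ?case using zero by (simp only: sum.empty)
    next
      case (insert x A)
      have "F x + sum F A \<in> \<Phi> ` carrier FA" by (rule add) (use insert in auto)
      thus ?case by (simp only: sum.insert[OF insert.hyps])
    qed
    have mono: "skew_monom (rf_const c * xm v) (sh u) \<in> \<Phi> ` carrier FA" for c v u
    proof -
      obtain w where w: "xdeg_word w = v" "ydeg_word w = u" using exists_word by blast
      obtain d where d: "d \<noteq> 0" "word_value w = skew_monom (rf_const d * xm (xdeg_word w)) (sh (ydeg_word w))" using word_value_form by blast
      have "\<Phi> (word (c / d) w) = skew_monom (rf_const c * xm v) (sh u)"
        using d(1) by (simp add: \<Phi>_word d(2) fscale_monom w rf_const_mult[symmetric] mult.assoc[symmetric])
      thus ?thesis using word_closed[of "c / d" w] by (intro image_eqI[of _ _ "word (c / d) w"]) (simp_all only:)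
    qed
    have mono': "skew_monom l (sh u) \<in> \<Phi> ` carrier FA" if l: "l \<in> lpolys" for l u
    proof -
      obtain V c where V: "finite V" "l = (\<Sum>v\<in>V. rf_const (c v) * xm v)" using l by (auto simp: lpolys_def)
      have "skew_monom l (sh u) = (\<Sum>v\<in>V. skew_monom (rf_const (c v) * xm v) (sh u))"
        by (rule ext) (simp add: sum_fun_apply skew_monom_def V(2))
      thus ?thesis using sum[OF V(1)] mono by simp
    qed
    have "g = (\<Sum>a\<in>supp g. skew_monom (g a) a)"
    proof
      fix b
      show "g b = (\<Sum>a\<in>supp g. skew_monom (g a) a) b"
        using g by (simp add: sum_fun_apply skew_monom_def laurent_skew_def carrier_iff)
    qed
    also have "\<dots> \<in> \<Phi> ` carrier FA"
    proof (rule sum)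
      show "finite (supp g)" using g by (simp add: laurent_skew_def carrier_iff)
      show "skew_monom (g a) a \<in> \<Phi> ` carrier FA" if "a \<in> supp g" for a
      proof -
        have "a \<in> M" using that g by (auto simp: laurent_skew_def carrier_iff)
        then obtain u where "a = sh u" by (auto simp: M_eq)
        thus ?thesis using mono' g by (simp add: laurent_skew_def)
      qed
    qed
    finally show "g \<in> emb ` carrier T" by (simp add: im)
  qed
qed

lemma conj_sh:
  assumes c: "\<And>i. c i \<noteq> 0" and \<pi>: "bij \<pi>"
  shows "monomial_aut (c, \<pi>) \<circ> sh v \<circ> ivf (monomial_aut (c, \<pi>)) = sh (v \<circ> ivf \<pi>)"
proof -
  let ?h = "monomial_aut (c, \<pi>)"
  have h: "is_aut ?h" by (rule monomial_aut_aut[OF c \<pi>])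
  have "?h \<circ> sh v = sh (v \<circ> ivf \<pi>) \<circ> ?h"
  proof (rule aut_unique)
    show "is_aut (?h \<circ> sh v)" by (rule is_aut_comp[OF h sh_aut])
    show "is_aut (sh (v \<circ> ivf \<pi>) \<circ> ?h)" by (rule is_aut_comp[OF sh_aut h])
    show "(?h \<circ> sh v) (rf_const a) = (sh (v \<circ> ivf \<pi>) \<circ> ?h) (rf_const a)" for a
      by (simp add: sh_const monomial_aut_const[OF c \<pi>])
    show "(?h \<circ> sh v) (rf_var i) = (sh (v \<circ> ivf \<pi>) \<circ> ?h) (rf_var i)" for i
      using \<pi> by (simp add: sh_var sh_const monomial_aut_const[OF c \<pi>] monomial_aut_var[OF c \<pi>] aut_mult[OF h]
          aut_mult[OF sh_aut] bij_is_inj mult_ac)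
  qed
  from this[symmetric] show ?thesis by (rule iffD1[OF comp_ivf_eq(2)[OF h], symmetric])
qed

lemma ivf_monomial_aut:
  assumes c: "\<And>i. c i \<noteq> 0" and \<pi>: "bij \<pi>"
  shows "ivf (monomial_aut (c, \<pi>)) = monomial_aut (\<lambda>i. inverse (c (ivf \<pi> i)), ivf \<pi>)"
proof -
  have b: "bij (ivf \<pi>)" by (rule bij_imp_bij_inv[OF \<pi>])
  have "monomial_aut (c, \<pi>) \<circ> monomial_aut (\<lambda>i. inverse (c (ivf \<pi> i)), ivf \<pi>) =
      monomial_aut (\<lambda>i. inverse (c (ivf \<pi> i)) * c (ivf \<pi> i), \<pi> \<circ> ivf \<pi>)"
    by (rule monomial_aut_comp[OF c \<pi> _ b]) (simp add: c)
  moreover have "(\<lambda>i. inverse (c (ivf \<pi> i)) * c (ivf \<pi> i)) = (\<lambda>i. 1)" using c by simp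
  moreover have "\<pi> \<circ> ivf \<pi> = id" using \<pi> by (simp add: fun_eq_iff bij_is_surj surj_f_inv_f)
  ultimately have "monomial_aut (c, \<pi>) \<circ> monomial_aut (\<lambda>i. inverse (c (ivf \<pi> i)), ivf \<pi>) = id"
    by (simp only: monomial_aut_id)
  from iffD1[OF comp_ivf_eq(1)[OF monomial_aut_aut[OF c \<pi>]] this] show ?thesis by simp
qed

lemma monomial_aut_normalizes:
  assumes "\<And>i. c i \<noteq> 0" "bij \<pi>" "a \<in> M"
  shows "monomial_aut (c, \<pi>) \<circ> a \<circ> ivf (monomial_aut (c, \<pi>)) \<in> M"
  using conj_sh[OF assms(1,2)] assms(3) by (auto simp: M_eq)

lemma act_laurent_skew:
  assumes "\<And>i. c i \<noteq> 0" "bij \<pi>" "f \<in> laurent_skew"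
  shows "skew_act (monomial_aut (c, \<pi>)) f \<in> laurent_skew"
  using act_closed[OF monomial_aut_aut[OF assms(1,2)] monomial_aut_normalizes[OF assms(1,2)], of f]
    monomial_aut_lpolys[OF assms(1,2)] assms(3)
  by (simp add: laurent_skew_def skew_act_def)

text \<open>
  The action on the quantum torus is given by a definite description. The action on the skew group
  ring preserves the image of the embedding; transported back it is an automorphism with the
  required values on generators, and \<open>hom_unique\<close> identifies it with the described one.
\<close>
lemma torus_act_emb:
  assumes c: "\<And>i. c i \<noteq> 0" and \<pi>: "bij \<pi>" and Z: "Z \<in> carrier T"
  shows "torus_act q (c, \<pi>) Z \<in> carrier T"
    and "emb (torus_act q (c, \<pi>) Z) = skew_act (monomial_aut (c, \<pi>)) (emb Z)"
proof -
  let ?h = "monomial_aut (c, \<pi>)"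
  interpret T: ring T by (rule ring_T)
  have h: "is_aut ?h" by (rule monomial_aut_aut[OF c \<pi>])
  have hn: "?h \<circ> a \<circ> ivf ?h \<in> M" if "a \<in> M" for a by (rule monomial_aut_normalizes[OF c \<pi> that])
  have bij: "bij_betw emb (carrier T) laurent_skew" unfolding bij_betw_def using emb_inj emb_image by blast
  have embR: "emb Z \<in> carrier R" if "Z \<in> carrier T" for Z using ring_hom_closed[OF emb_hom that] .
  define \<alpha> where "\<alpha> = restrict (\<lambda>Z. inv_into (carrier T) emb (skew_act ?h (emb Z))) (carrier T)"
  have LSi: "skew_act ?h (emb Z) \<in> laurent_skew" if "Z \<in> carrier T" for Z
    using that emb_image by (intro act_laurent_skew c \<pi>) blast
  have \<alpha>T: "\<alpha> Z \<in> carrier T" if "Z \<in> carrier T" for Z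
    using LSi[OF that] that emb_image inv_into_into[of _ emb "carrier T"] by (simp add: \<alpha>_def)
  have emb\<alpha>: "emb (\<alpha> Z) = skew_act ?h (emb Z)" if "Z \<in> carrier T" for Z
    using LSi[OF that] that emb_image f_inv_into_f[of _ emb "carrier T"] by (simp add: \<alpha>_def)
  have eqI: "Z = Y" if "Z \<in> carrier T" "Y \<in> carrier T" "emb Z = emb Y" for Z Y
    by (rule inj_onD[OF emb_inj that(3,1,2)])
  have \<alpha>_hom: "\<alpha> \<in> ring_hom T T"
  proof (rule ring_hom_memI)
    fix Z Y assume XY: "Z \<in> carrier T" "Y \<in> carrier T"
    show "\<alpha> (Z \<otimes>\<^bsub>T\<^esub> Y) = \<alpha> Z \<otimes>\<^bsub>T\<^esub> \<alpha> Y"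
      by (rule eqI) (use XY \<alpha>T in \<open>simp_all add: emb\<alpha> ring_hom_mult[OF emb_hom] act_mult[OF h hn] embR\<close>)
    show "\<alpha> (Z \<oplus>\<^bsub>T\<^esub> Y) = \<alpha> Z \<oplus>\<^bsub>T\<^esub> \<alpha> Y"
      by (rule eqI) (use XY \<alpha>T in \<open>simp_all add: emb\<alpha> ring_hom_add[OF emb_hom] add_eq act_add[OF h]\<close>)
  next
    show "\<alpha> \<one>\<^bsub>T\<^esub> = \<one>\<^bsub>T\<^esub>"
    proof (rule eqI)
      have "skew_act ?h (skew_const 1) = skew_const 1"
        using act_monom[OF h, of 1 id] aut_ivf_comp[OF h] aut_1[OF h] by simp
      thus "emb (\<alpha> \<one>\<^bsub>T\<^esub>) = emb \<one>\<^bsub>T\<^esub>" using ring_hom_one[OF emb_hom] by (simp add: emb\<alpha> one_eq)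
    qed (use \<alpha>T in auto)
  qed (rule \<alpha>T)
  have \<alpha>_bij: "bij_betw \<alpha> (carrier T) (carrier T)"
    unfolding bij_betw_def
  proof
    show "inj_on \<alpha> (carrier T)"
    proof (rule inj_onI)
      fix Z Y assume a: "Z \<in> carrier T" "Y \<in> carrier T" "\<alpha> Z = \<alpha> Y"
      hence "skew_act ?h (emb Z) = skew_act ?h (emb Y)" using emb\<alpha> by metis
      hence "skew_act (ivf ?h) (skew_act ?h (emb Z)) = skew_act (ivf ?h) (skew_act ?h (emb Y))" by simp
      hence "emb Z = emb Y"
        unfolding act_comp[OF is_aut_ivf[OF h] h] aut_ivf_comp[OF h] by (simp add: skew_act_def)
      thus "Z = Y" using a eqI by blast
    qed
    show "\<alpha> ` carrier T = carrier T"
    proof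
      show "carrier T \<subseteq> \<alpha> ` carrier T"
      proof
        fix Y assume Y: "Y \<in> carrier T"
        have b: "bij (ivf \<pi>)" by (rule bij_imp_bij_inv[OF \<pi>])
        have "emb Y \<in> laurent_skew" using Y emb_image by blast
        hence "skew_act (ivf ?h) (emb Y) \<in> laurent_skew"
          unfolding ivf_monomial_aut[OF c \<pi>] by (intro act_laurent_skew[OF _ b]) (simp_all add: c)
        then obtain Z where Z: "Z \<in> carrier T" "emb Z = skew_act (ivf ?h) (emb Y)"
          unfolding emb_image[symmetric] by (rule imageE) simp
        have "emb (\<alpha> Z) = emb Y"
          unfolding emb\<alpha>[OF Z(1)] Z(2) act_comp[OF h is_aut_ivf[OF h]] aut_ivf_comp[OF h] by (simp add: skew_act_def)
        hence "Y = \<alpha> Z" using eqI[OF \<alpha>T[OF Z(1)] Y] by simp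
        thus "Y \<in> \<alpha> ` carrier T" using Z(1) by blast
      qed
    qed (use \<alpha>T in blast)
  qed
  have in_T: "torus_gen q u \<in> carrier T" "torus_const q a \<in> carrier T" for u a
    unfolding torus_gen_eq torus_const_eq by (rule torus_class_in_T[OF word_closed])+
  have idc: "?h \<circ> id \<circ> ivf ?h = id" using aut_ivf_comp[OF h] by simp
  have \<alpha>_const: "\<alpha> (torus_const q a) = torus_const q a" for a
    by (rule eqI)
      (use in_T \<alpha>T in \<open>simp_all add: emb\<alpha> emb_const act_monom[OF h] idc[simplified] monomial_aut_const[OF c \<pi>]\<close>)
  have \<alpha>_x: "\<alpha> (torus_gen q (GX i)) = torus_const q (c i) \<otimes>\<^bsub>T\<^esub> torus_gen q (GX (\<pi> i))" for i
    by (rule eqI)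
      (use in_T \<alpha>T in \<open>simp_all add: emb\<alpha> emb_const emb_gen letter_value_GX act_monom[OF h] idc[simplified] monomial_aut_var[OF c \<pi>]
         ring_hom_mult[OF emb_hom] monom_mult_monom M_id\<close>)
  have \<alpha>_y: "\<alpha> (torus_gen q (GY i)) = torus_gen q (GY (\<pi> i))" for i
  proof (rule eqI)
    have "(\<lambda>j. if j = i then 1 else (0::int)) \<circ> ivf \<pi> = (\<lambda>j. if j = \<pi> i then 1 else 0)"
      using \<pi> by (auto simp: fun_eq_iff bij_is_inj bij_is_surj surj_f_inv_f)
    hence "?h \<circ> eps q i \<circ> ivf ?h = eps q (\<pi> i)" unfolding eps_eq conj_sh[OF c \<pi>] by simp
    thus "emb (\<alpha> (torus_gen q (GY i))) = emb (torus_gen q (GY (\<pi> i)))"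
      using in_T by (simp add: emb\<alpha> emb_gen letter_value_GY act_monom[OF h] aut_1[OF h])
  qed (use in_T \<alpha>T in auto)
  have "torus_act q (c, \<pi>) = \<alpha>"
    unfolding torus_act_def prod.case
  proof (rule the_equality)
    show "\<alpha> \<in> ring_iso T T \<inter> extensional (carrier T) \<and>
     (\<forall>c. \<alpha> (torus_const q c) = torus_const q c) \<and>
     (\<forall>i. \<alpha> (torus_gen q (GX i)) = torus_const q (c i) \<otimes>\<^bsub>T\<^esub> torus_gen q (GX (\<pi> i))) \<and>
     (\<forall>i. \<alpha> (torus_gen q (GY i)) = torus_gen q (GY (\<pi> i)))"
      using \<alpha>_hom \<alpha>_bij \<alpha>_const \<alpha>_x \<alpha>_y by (auto simp: ring_iso_def) (simp add: \<alpha>_def)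
  next
    fix \<beta>
    assume \<beta>: "\<beta> \<in> ring_iso T T \<inter> extensional (carrier T) \<and>
     (\<forall>c. \<beta> (torus_const q c) = torus_const q c) \<and>
     (\<forall>i. \<beta> (torus_gen q (GX i)) = torus_const q (c i) \<otimes>\<^bsub>T\<^esub> torus_gen q (GX (\<pi> i))) \<and>
     (\<forall>i. \<beta> (torus_gen q (GY i)) = torus_gen q (GY (\<pi> i)))"
    show "\<beta> = \<alpha>"
    proof (rule extensionalityI)
      show "\<beta> \<in> extensional (carrier T)" using \<beta> by blast
      show "\<alpha> \<in> extensional (carrier T)" by (simp add: \<alpha>_def)
      show "\<beta> Z = \<alpha> Z" if "Z \<in> carrier T" for Z
        by (rule hom_unique[OF ring_T _ \<alpha>_hom _ _ _ that]) (use \<beta> in \<open>auto simp: ring_iso_def \<alpha>_const \<alpha>_x \<alpha>_y\<close>)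
    qed
  qed
  thus "torus_act q (c, \<pi>) Z \<in> carrier T" "emb (torus_act q (c, \<pi>) Z) = skew_act ?h (emb Z)"
    using emb\<alpha>[OF Z] \<alpha>T[OF Z] by simp_all
qed

theorem embedded_invariants:
  assumes "\<And>g \<pi>. (g, \<pi>) \<in> H \<Longrightarrow> (\<forall>i. g i \<noteq> 0) \<and> bij \<pi>"
  shows "torus_embedding q ` torus_invariants q H = {f \<in> laurent_skew. \<forall>h\<in>H. skew_act (monomial_aut h) f = f}"
proof -
  have act: "torus_act q h Z = Z \<longleftrightarrow> skew_act (monomial_aut h) (emb Z) = emb Z"
    if "h \<in> H" "Z \<in> carrier T" for h Z
  proof -
    obtain g \<pi> where h: "h = (g, \<pi>)" by fastforce
    have g: "\<And>i. g i \<noteq> 0" "bij \<pi>" using assms that(1) h by auto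
    note * = torus_act_emb[OF g that(2)]
    show ?thesis unfolding h *(2)[symmetric] using inj_onD[OF emb_inj, of "torus_act q (g, \<pi>) Z" Z] *(1) that(2) by auto
  qed
  have "emb ` {Z \<in> carrier T. \<forall>h\<in>H. torus_act q h Z = Z} = {f \<in> emb ` carrier T. \<forall>h\<in>H. skew_act (monomial_aut h) f = f}"
    using act by blast
  thus ?thesis unfolding torus_embedding_eq torus_invariants_def emb_image .
qed

end

section \<open>Roots of unity\<close>

lemma card_roots_of_unity:
  assumes "m \<ge> 1"
  shows "card {x :: 'k::{alg_closed_field, field_char_0}. x ^ m = 1} = m"
proof -
  define P :: "'k poly" where "P = monom 1 m - 1"
  have c0: "coeff P m = 1" using assms by (simp add: P_def coeff_1)
  have P0: "P \<noteq> 0" using c0 by auto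
  have "degree P \<le> m" unfolding P_def by (intro degree_diff_le degree_monom_le) simp
  moreover have "degree P \<ge> m" using c0 by (intro le_degree) simp
  ultimately have deg: "degree P = m" by simp
  obtain A where A: "size A = m" "P = (\<Prod>x\<in>#A. [:- x, 1:])"
    using alg_closed_imp_factorization[OF P0] by (auto simp: deg c0)
  have root: "poly P x = x ^ m - 1" for x by (simp add: P_def poly_monom)
  have y_degree_le: "poly (pderiv P) x = of_nat m * x ^ (m - 1)" for x
    by (simp add: P_def pderiv_diff pderiv_monom poly_monom pderiv_1)
  have "count A x \<le> 1" for x
  proof (rule ccontr)
    assume "\<not> count A x \<le> 1"
    hence "x \<in># A" "x \<in># A - {#x#}" by (auto simp: count_greater_zero_iff[symmetric] simp del: count_greater_zero_iff)
    then obtain B where "A = add_mset x (add_mset x B)" by (metis insert_DiffM)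
    hence "P = [:- x, 1:] * ([:- x, 1:] * (\<Prod>y\<in>#B. [:- y, 1:]))" by (simp only: A(2) image_mset_add_mset prod_mset.add_mset)
    then obtain Q where Q: "P = [:- x, 1:] * ([:- x, 1:] * Q)" by blast
    have "poly P x = 0" "poly (pderiv P) x = 0" unfolding Q pderiv_mult by simp_all
    moreover from this(1) have "x \<noteq> 0" using assms by (auto simp: root power_0_left)
    ultimately show False using assms by (simp add: y_degree_le)
  qed
  hence "size A \<le> (\<Sum>x\<in>set_mset A. 1)" unfolding size_multiset_overloaded_eq by (intro sum_mono) simp
  moreover have "set_mset A = {x. x ^ m = 1}"
  proof -
    have "x \<in># A \<longleftrightarrow> poly P x = 0" for x
      unfolding A(2) by (induction A) auto
    thus ?thesis by (auto simp: root)
  qed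
  ultimately have "m \<le> card {x :: 'k. x ^ m = 1}" using A(1) by simp
  moreover have "{x. poly P x = 0} = {x. x ^ m = 1}" by (simp add: root)
  hence "card {x :: 'k. x ^ m = 1} \<le> m" using card_poly_roots_bound[OF P0] deg by simp
  ultimately show ?thesis by simp
qed

lemma roots_of_unity_bound:
  assumes "m \<ge> 1"
  shows "finite {x :: 'l::field. x ^ m = 1} \<and> card {x :: 'l. x ^ m = 1} \<le> m"
proof -
  define P :: "'l poly" where "P = monom 1 m - 1"
  have c0: "coeff P m = 1" using assms by (simp add: P_def coeff_1)
  have P0: "P \<noteq> 0" using c0 by auto
  have "degree P \<le> m" unfolding P_def by (intro degree_diff_le degree_monom_le) simp
  moreover have "{x. poly P x = 0} = {x. x ^ m = 1}" by (simp add: P_def poly_monom)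
  ultimately show ?thesis using card_poly_roots_bound[OF P0] poly_roots_finite[OF P0] by simp
qed

text \<open>
  The equation \<open>y\<^sup>m = 1\<close> has at most \<open>m\<close> solutions in the field of rational functions, and the
  constants already supply \<open>m\<close>.
\<close>
lemma root_of_unity_const:
  assumes "m \<ge> 1" "y ^ m = (1 :: ('n::{finite, linorder}, 'k::{alg_closed_field, field_char_0}) ratfun)"
  shows "\<exists>c. c ^ m = 1 \<and> y = rf_const c"
proof -
  let ?A = "{x :: 'k. x ^ m = 1}" and ?B = "{x :: ('n, 'k) ratfun. x ^ m = 1}"
  have sub: "rf_const ` ?A \<subseteq> ?B" by (auto simp: rf_const_power[symmetric])
  have "card (rf_const ` ?A :: ('n, 'k) ratfun set) = m"
    using card_roots_of_unity[OF assms(1)] by (subst card_image) (auto simp: inj_on_def rf_const_eq_iff)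
  hence "rf_const ` ?A = ?B"
    using roots_of_unity_bound[OF assms(1), where 'l = "('n, 'k) ratfun"] sub by (intro card_seteq) auto
  thus ?thesis using assms(2) by blast
qed

lemma dvd_of_roots:
  assumes "m \<ge> 1" "\<And>x :: 'k::{alg_closed_field, field_char_0}. x ^ m = 1 \<Longrightarrow> x powi a = 1"
  shows "int m dvd a"
proof (rule ccontr)
  assume *: "\<not> int m dvd a"
  \<comment> \<open>Otherwise the \<open>m\<close>-th roots of unity would all be roots of \<open>t\<^sup>r - 1\<close>, whose degree is too small.\<close>
  define r where "r = nat (a mod int m)"
  have r: "r \<ge> 1" "r < m" using * assms(1) by (auto simp: r_def dvd_eq_mod_eq_0 order_le_neq_trans nat_less_iff zero_less_mult_iff)
  have "x ^ r = 1" if "x ^ m = 1" for x :: 'k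
  proof -
    have x0: "x \<noteq> 0" using that assms(1) by (auto simp: power_0_left)
    have "a = int m * (a div int m) + int r" using assms(1) by (simp add: r_def)
    hence "x powi a = (x powi int m) powi (a div int m) * x powi int r"
      using x0 by (metis power_int_add power_int_mult)
    thus ?thesis using assms(2)[OF that] that by (simp add: power_int_def[of x "int _"])
  qed
  hence "{x :: 'k. x ^ m = 1} \<subseteq> {x. x ^ r = 1}" by auto
  hence "card {x :: 'k. x ^ m = 1} \<le> card {x :: 'k. x ^ r = 1}"
    using roots_of_unity_bound[OF r(1), where 'l = 'k] by (intro card_mono) auto
  also have "\<dots> \<le> r" using roots_of_unity_bound[OF r(1), where 'l = 'k] by simp
  finally show False using card_roots_of_unity[OF assms(1), where 'k = 'k] r(2) by simp
qed

section \<open>The group and its invariants\<close>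

locale gmp = q_torus q idx
  for q :: "'k::{alg_closed_field, field_char_0}" and idx :: "'n::{finite, linorder} itself" +
  fixes m p :: nat
  assumes m_pos: "m \<ge> 1" and p_pos: "p > 0" and p_dvd: "p dvd m"
begin

abbreviation H :: "(('n \<Rightarrow> 'k) \<times> ('n \<Rightarrow> 'n)) set" where "H \<equiv> carrier (Gmp m p)"
abbreviation ma :: "('n \<Rightarrow> 'k) \<times> ('n \<Rightarrow> 'n) \<Rightarrow> ('n, 'k) ratfun \<Rightarrow> ('n, 'k) ratfun" where "ma \<equiv> monomial_aut"

lemma H_iff: "(g, \<pi>) \<in> H \<longleftrightarrow> (\<forall>i. g i ^ m = 1) \<and> (\<Prod>i\<in>UNIV. g i) ^ (m div p) = 1 \<and> bij \<pi>"
  by (simp add: Gmp_def)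

lemma H_nonzero: "(g, \<pi>) \<in> H \<Longrightarrow> g i \<noteq> 0"
  using m_pos by (auto simp: H_iff power_0_left dest!: spec[of _ i])

lemma H_bij: "(g, \<pi>) \<in> H \<Longrightarrow> bij \<pi>" by (simp add: H_iff)

lemma perm_in_H: "bij \<pi> \<Longrightarrow> (\<lambda>i. 1, \<pi>) \<in> H" by (simp add: H_iff)

lemma H_aut: "h \<in> H \<Longrightarrow> is_aut (ma h)"
  using monomial_aut_aut[of "fst h" "snd h"] H_nonzero H_bij by (metis prod.collapse)

lemma H_const: "h \<in> H \<Longrightarrow> ma h (rf_const c) = rf_const c"
  using monomial_aut_const[of "fst h" "snd h"] H_nonzero H_bij by (metis prod.collapse)

lemma H_var: "(g, \<pi>) \<in> H \<Longrightarrow> ma (g, \<pi>) (rf_var i) = rf_const (g i) * rf_var (\<pi> i)"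
  using H_nonzero H_bij by (intro monomial_aut_var) blast+

lemma H_lpolys: "h \<in> H \<Longrightarrow> f \<in> lpolys \<Longrightarrow> ma h f \<in> lpolys"
  using monomial_aut_lpolys[of "fst h" "snd h" f] H_nonzero H_bij by (metis prod.collapse)

lemma H_comp: "(g, \<pi>) \<in> H \<Longrightarrow> (g', \<pi>') \<in> H \<Longrightarrow> ma (g, \<pi>) \<circ> ma (g', \<pi>') = ma (\<lambda>i. g' i * g (\<pi>' i), \<pi> \<circ> \<pi>')"
  using H_nonzero H_bij by (intro monomial_aut_comp) blast+

lemma H_mult: "(g, \<pi>) \<in> H \<Longrightarrow> (g', \<pi>') \<in> H \<Longrightarrow> (\<lambda>i. g' i * g (\<pi>' i), \<pi> \<circ> \<pi>') \<in> H"
proof -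
  interpret group "Gmp m p :: (('n \<Rightarrow> 'k) \<times> ('n \<Rightarrow> 'n)) monoid" by (rule group_Gmp[OF m_pos])
  show "(g, \<pi>) \<in> H \<Longrightarrow> (g', \<pi>') \<in> H \<Longrightarrow> (\<lambda>i. g' i * g (\<pi>' i), \<pi> \<circ> \<pi>') \<in> H"
    using m_closed[of "(g, \<pi>)" "(g', \<pi>')"] by (simp add: Gmp_def)
qed

definition Gal :: "(('n, 'k) ratfun \<Rightarrow> ('n, 'k) ratfun) set" where "Gal = ma ` H"

lemma Gal_aut: "\<sigma> \<in> Gal \<Longrightarrow> is_aut \<sigma>" using H_aut by (auto simp: Gal_def)

lemma Gal_comp:
  assumes "\<sigma> \<in> Gal" "\<tau> \<in> Gal" shows "\<sigma> \<circ> \<tau> \<in> Gal"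
proof -
  obtain g \<pi> g' \<pi>' where h: "(g, \<pi>) \<in> H" "\<sigma> = ma (g, \<pi>)" "(g', \<pi>') \<in> H" "\<tau> = ma (g', \<pi>')"
    using assms by (auto simp: Gal_def)
  show ?thesis unfolding h(2,4) H_comp[OF h(1,3)] Gal_def using H_mult[OF h(1,3)] by blast
qed

lemma Gal_id: "id \<in> Gal"
  unfolding Gal_def using perm_in_H[OF bij_id] monomial_aut_id[where 'k = 'k and 'n = 'n] by (metis image_eqI)

lemma Gal_inv:
  assumes "\<sigma> \<in> Gal" shows "ivf \<sigma> \<in> Gal"
proof -
  interpret group "Gmp m p :: (('n \<Rightarrow> 'k) \<times> ('n \<Rightarrow> 'n)) monoid" by (rule group_Gmp[OF m_pos])
  obtain g \<pi> where h: "(g, \<pi>) \<in> H" "\<sigma> = ma (g, \<pi>)" using assms by (auto simp: Gal_def)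
  obtain g' \<pi>' where h': "inv\<^bsub>Gmp m p\<^esub> (g, \<pi>) = (g', \<pi>')" by fastforce
  have H': "(g', \<pi>') \<in> H" using inv_closed[OF h(1)] h' by simp
  have "(g, \<pi>) \<otimes>\<^bsub>Gmp m p\<^esub> (g', \<pi>') = \<one>\<^bsub>Gmp m p\<^esub>" using r_inv[OF h(1)] h' by simp
  hence "(\<lambda>i. g' i * g (\<pi>' i), \<pi> \<circ> \<pi>') = (\<lambda>i. 1, id)" by (simp add: Gmp_def)
  hence "ma (g, \<pi>) \<circ> ma (g', \<pi>') = id" unfolding H_comp[OF h(1) H'] by (simp only: monomial_aut_id)
  from iffD1[OF comp_ivf_eq(1)[OF H_aut[OF h(1)]] this] have "ma (g', \<pi>') = ivf \<sigma>" by (simp add: h(2))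
  thus ?thesis using H' by (metis Gal_def image_eqI)
qed

lemma H_finite: "finite H"
proof -
  have sub: "H \<subseteq> {g. \<forall>i. (i \<in> UNIV \<longrightarrow> g i \<in> {x. x ^ m = 1}) \<and> (i \<notin> UNIV \<longrightarrow> g i = 0)} \<times> UNIV"
    by (auto simp: H_iff)
  have fin: "finite {g :: 'n \<Rightarrow> 'k. \<forall>i. (i \<in> UNIV \<longrightarrow> g i \<in> {x. x ^ m = 1}) \<and> (i \<notin> UNIV \<longrightarrow> g i = 0)}"
    using roots_of_unity_bound[OF m_pos, where 'l = 'k] by (intro finite_set_of_finite_funs) auto
  show ?thesis by (rule finite_subset[OF sub finite_cartesian_product[OF fin finite]])
qed

lemma Gal_finite: "finite Gal" by (simp add: Gal_def H_finite)

definition Gam :: "('n, 'k) ratfun set" where "Gam = laurent_invariants H"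

text \<open>By \<open>fractions_Gam\<close> this is the field of fractions of \<open>\<Gamma>\<close>.\<close>
definition K0 :: "('n, 'k) ratfun set" where "K0 = {f. \<forall>\<sigma>\<in>Gal. \<sigma> f = f}"

lemma Gam_eq: "Gam = lpolys \<inter> K0"
  by (auto simp: Gam_def laurent_invariants_def laurent_eq K0_def Gal_def)

lemma K0I: "(\<And>g \<pi>. (g, \<pi>) \<in> H \<Longrightarrow> ma (g, \<pi>) f = f) \<Longrightarrow> f \<in> K0" by (auto simp: K0_def Gal_def)
lemma K0D: "f \<in> K0 \<Longrightarrow> h \<in> H \<Longrightarrow> ma h f = f" by (auto simp: K0_def Gal_def)

lemma subr_K0: "subr K0"
  using aut_1[OF Gal_aut] by (auto simp: subr_def K0_def aut_diff[OF Gal_aut] aut_mult[OF Gal_aut])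
lemma K0_inverse: "f \<in> K0 \<Longrightarrow> inverse f \<in> K0" by (auto simp: K0_def aut_inverse[OF Gal_aut])
lemma K0_divide: "f \<in> K0 \<Longrightarrow> g \<in> K0 \<Longrightarrow> f / g \<in> K0" by (auto simp: K0_def aut_divide[OF Gal_aut])
lemma K0_const: "rf_const c \<in> K0" by (rule K0I) (rule H_const)
lemma subr_Gam: "subr Gam" using subr_lpolys subr_K0 by (auto simp: Gam_eq subr_def)
lemma lpolys_const: "rf_const c \<in> lpolys" using lpolys_monom[of c "\<lambda>_. 0"] by simp
lemma lpolys_var: "rf_var i powi k \<in> lpolys"
  using lpolys_monom[of 1 "\<lambda>j. if j = i then k else 0"] by (simp add: xm_single)
lemma Gam_const: "rf_const c \<in> Gam" by (simp add: Gam_eq lpolys_const K0_const)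

lemma tof_lpolys: "tof f \<in> (lpolys :: ('n, 'k) ratfun set)"
  unfolding tof_eval evalp_def using lpolys_var[of _ 1]
  by (intro lpolys_sum subr_mult[OF subr_lpolys] subr_prod[OF subr_lpolys] subr_power[OF subr_lpolys] lpolys_const) simp

text \<open>The norm, the product of all conjugates, is an invariant multiple.\<close>
lemma norm_multiple:
  assumes "v \<in> lpolys" "v \<noteq> 0"
  shows "\<exists>w\<in>lpolys. v * w \<in> Gam \<and> v * w \<noteq> 0"
proof (intro bexI conjI)
  define w where "w = (\<Prod>\<sigma>\<in>Gal - {id}. \<sigma> v)"
  have vw: "v * w = (\<Prod>\<sigma>\<in>Gal. \<sigma> v)"
    unfolding w_def using prod.remove[OF Gal_finite Gal_id, of "\<lambda>\<sigma>. \<sigma> v"] by simp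
  have l: "\<sigma> v \<in> lpolys" if "\<sigma> \<in> Gal" for \<sigma> using that H_lpolys assms(1) by (auto simp: Gal_def)
  show w: "w \<in> lpolys" unfolding w_def by (intro subr_prod[OF subr_lpolys] l) simp
  have "\<tau> (\<Prod>\<sigma>\<in>Gal. \<sigma> v) = (\<Prod>\<sigma>\<in>Gal. \<sigma> v)" if \<tau>: "\<tau> \<in> Gal" for \<tau>
  proof -
    note t = Gal_aut[OF \<tau>]
    have "\<tau> (\<Prod>\<sigma>\<in>Gal. \<sigma> v) = (\<Prod>\<sigma>\<in>Gal. (\<tau> \<circ> \<sigma>) v)" by (simp add: aut_prod[OF t])
    also have "\<dots> = (\<Prod>\<sigma>\<in>Gal. \<sigma> v)"
    proof (rule prod.reindex_bij_witness[of _ "\<lambda>\<sigma>. ivf \<tau> \<circ> \<sigma>" "\<lambda>\<sigma>. \<tau> \<circ> \<sigma>"])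
      show "ivf \<tau> \<circ> (\<tau> \<circ> \<sigma>) = \<sigma>" for \<sigma> by (rule ext) (simp add: aut_ivf_left[OF t])
      show "\<tau> \<circ> (ivf \<tau> \<circ> \<sigma>) = \<sigma>" for \<sigma> by (rule ext) (simp add: aut_ivf_right[OF t])
    qed (use \<tau> Gal_comp Gal_inv in auto)
    finally show ?thesis .
  qed
  hence "v * w \<in> K0" unfolding vw by (simp add: K0_def)
  thus "v * w \<in> Gam" using subr_mult[OF subr_lpolys assms(1) w] by (simp add: Gam_eq)
  show "v * w \<noteq> 0" unfolding vw using assms(2) aut_eq_0_iff[OF Gal_aut] Gal_finite by simp
qed

lemma ratfun_quotient: "\<exists>u\<in>lpolys. \<exists>N\<in>Gam. N \<noteq> 0 \<and> f = u / N"
proof -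
  obtain a b where "f = Fract a b" "b \<noteq> 0" by (cases f)
  hence f: "f = tof a / tof b" by simp
  have b: "tof b \<noteq> (0 :: ('n, 'k) ratfun)" using \<open>b \<noteq> 0\<close> by (simp only: tof_eq_0_iff not_False_eq_True)
  obtain w where w: "w \<in> lpolys" "tof b * w \<in> Gam" "tof b * w \<noteq> 0" using norm_multiple[OF tof_lpolys b] by blast
  have "f = (tof a * w) / (tof b * w)" unfolding f using w(3) by (simp del: mult_fract divide_fract)
  thus ?thesis using w subr_mult[OF subr_lpolys tof_lpolys w(1)] by blast
qed

lemma fractions_Gam: "fractions Gam = K0"
proof
  show "fractions Gam \<subseteq> K0" by (auto simp: fractions_def Gam_eq intro: K0_divide)
  show "K0 \<subseteq> fractions Gam"
  proof
    fix f assume f: "f \<in> K0"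
    obtain u N where u: "u \<in> lpolys" "N \<in> Gam" "N \<noteq> 0" "f = u / N" using ratfun_quotient by blast
    have "u = f * N" using u by simp
    hence "u \<in> K0" using subr_mult[OF subr_K0 f, of N] u(2) by (simp add: Gam_eq)
    hence "u \<in> Gam" using u(1) by (simp add: Gam_eq)
    thus "f \<in> fractions Gam" unfolding fractions_def using u by blast
  qed
qed

section \<open>The variables \<open>x\<^sub>i\<^sup>m\<close>\<close>

definition zvar :: "'n \<Rightarrow> ('n, 'k) ratfun" where "zvar i = rf_var i ^ m"
definition wvar :: "('n, 'k) ratfun" where "wvar = (\<Prod>i\<in>UNIV. rf_var i) ^ (m div p)"

text \<open>Its coefficients are, up to sign, the elementary symmetric functions of the \<open>z\<^sub>i\<close>.\<close>
definition zpoly :: "('n, 'k) ratfun poly" where "zpoly = (\<Prod>i\<in>UNIV. [:- zvar i, 1:])"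

lemma zvar_nonzero [simp]: "zvar i \<noteq> 0" by (simp add: zvar_def)
lemma wvar_nonzero [simp]: "wvar \<noteq> 0" by (simp add: wvar_def)
lemma zvar_lpolys: "zvar i \<in> lpolys" using lpolys_var[of i "int m"] by (simp add: zvar_def)

lemma H_zvar: "(g, \<pi>) \<in> H \<Longrightarrow> ma (g, \<pi>) (zvar i) = zvar (\<pi> i)"
  by (simp add: zvar_def aut_power[OF H_aut] H_var power_mult_distrib rf_const_power[symmetric] H_iff)

lemma H_wvar: "(g, \<pi>) \<in> H \<Longrightarrow> ma (g, \<pi>) wvar = wvar"
proof -
  assume h: "(g, \<pi>) \<in> H"
  have "(\<Prod>i\<in>UNIV. rf_var (\<pi> i)) = (\<Prod>i\<in>UNIV. rf_var i :: ('n, 'k) ratfun)"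
    by (rule prod.reindex_bij_betw[OF H_bij[OF h]])
  thus ?thesis using h
    by (simp add: wvar_def aut_power[OF H_aut] aut_prod[OF H_aut] H_var prod.distrib power_mult_distrib
       rf_const_prod[symmetric] rf_const_power[symmetric] H_iff)
qed

lemma xm_inj: "xm v = (xm w :: ('n, 'k) ratfun) \<Longrightarrow> v = w"
proof (rule ccontr)
  assume eq: "xm v = (xm w :: ('n, 'k) ratfun)" and ne: "v \<noteq> w"
  have "(\<Sum>u\<in>{v, w}. rf_const (if u = v then 1 else - 1) * xm u) = (0 :: ('n, 'k) ratfun)"
    using ne eq by (simp add: rf_const_uminus)
  from xm_independent[OF _ this, of v] show False by simp
qed

lemma zvar_xm: "zvar i = xm (\<lambda>j. if j = i then int m else 0)" by (simp add: xm_single zvar_def)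

lemma zvar_inj: "zvar i = zvar j \<longleftrightarrow> i = j"
proof
  assume "zvar i = zvar j"
  hence "(\<lambda>k. if k = i then int m else 0) = (\<lambda>k. if k = j then int m else 0)" unfolding zvar_xm by (rule xm_inj)
  from fun_cong[OF this, of i] show "i = j" using m_pos by (auto split: if_splits)
qed simp

lemma coeff_aut:
  fixes f :: "'b \<Rightarrow> 'a::field"
  assumes "is_aut \<sigma>" "finite A"
  shows "\<sigma> (coeff (\<Prod>i\<in>A. [:- f i, 1:]) k) = coeff (\<Prod>i\<in>A. [:- \<sigma> (f i), 1:]) k"
  using assms(2)
proof (induction A arbitrary: k rule: finite_induct)
  case empty
  show ?case using assms(1) by (simp add: aut_0 aut_1)
next
  case (insert a A)
  have eq: "coeff (\<Prod>i\<in>insert a A. [:- f i, 1:]) k =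
      - f a * coeff (\<Prod>i\<in>A. [:- f i, 1:]) k + (if k = 0 then 0 else coeff (\<Prod>i\<in>A. [:- f i, 1:]) (k - 1))" for f :: "'b \<Rightarrow> 'a"
    using insert.hyps by (simp add: mult_pCons_left coeff_pCons split: nat.split)
  show ?case unfolding eq using assms(1) insert.IH by (simp add: aut_add aut_diff aut_mult aut_uminus aut_0)
qed

lemma zpoly_coeff_Gam: "coeff zpoly k \<in> Gam"
proof -
  have "coeff zpoly k \<in> K0"
  proof (rule K0I)
    fix g \<pi> assume h: "(g, \<pi>) \<in> H"
    have "(\<Prod>i\<in>UNIV. [:- zvar (\<pi> i), 1:]) = (\<Prod>i\<in>UNIV. [:- zvar i, 1:])"
      by (rule prod.reindex_bij_betw[OF H_bij[OF h]])
    thus "ma (g, \<pi>) (coeff zpoly k) = coeff zpoly k"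
      unfolding zpoly_def by (simp add: coeff_aut[OF H_aut[OF h]] H_zvar[OF h])
  qed
  moreover have "coeff zpoly k \<in> lpolys"
  proof -
    have "\<forall>k. coeff (\<Prod>i\<in>A. [:- zvar i, 1:]) k \<in> lpolys" if "finite A" for A
      using that
    proof (induction A rule: finite_induct)
      case empty
      have "(0 :: ('n, 'k) ratfun) \<in> lpolys" "(1 :: ('n, 'k) ratfun) \<in> lpolys"
        using subr_0[OF subr_lpolys] subr_1[OF subr_lpolys] by auto
      then show ?case by (simp add: coeff_1)
    next
      case (insert a A)
      thus ?case using zvar_lpolys[of a] subr_0[OF subr_lpolys]
        by (auto simp: mult_pCons_left coeff_pCons split: nat.split
          intro!: subr_add[OF subr_lpolys] subr_diff[OF subr_lpolys] subr_mult[OF subr_lpolys] subr_uminus[OF subr_lpolys])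
    qed
    thus ?thesis by (simp add: zpoly_def)
  qed
  ultimately show ?thesis by (simp add: Gam_eq)
qed

lemma prod_powi: "(\<Prod>i\<in>A. f i) powi k = (\<Prod>i\<in>A. f i powi k :: 'a::field)"
  by (induction A rule: infinite_finite_induct) (auto simp: power_int_mult_distrib)

lemma wvar_Gam: "wvar powi k \<in> Gam"
proof -
  have "wvar powi k \<in> K0" by (rule K0I) (simp add: aut_powi[OF H_aut] H_wvar)
  moreover have "wvar = xm (\<lambda>_. int (m div p))" by (simp add: wvar_def xm_def prod_power_distrib)
  hence "wvar powi k = xm (\<lambda>_. int (m div p) * k)" by (simp add: xm_def prod_powi power_int_mult)
  hence "wvar powi k \<in> lpolys" using lpolys_monom[of 1] by simp
  ultimately show ?thesis by (simp add: Gam_eq)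
qed

text \<open>
  An automorphism over the fixed field fixes the coefficients of \<open>zpoly\<close>, hence permutes its roots
  \<open>z\<^sub>i = x\<^sub>i\<^sup>m\<close>; so it is monomial in the \<open>x\<^sub>i\<close>, with \<open>m\<close>-th roots of unity as coefficients. That it fixes
  \<open>wvar\<close> is the remaining condition for \<open>G(m,p,n)\<close>.
\<close>
theorem Aut_over_K0: "Aut_over K0 = Gal"
proof
  show "Gal \<subseteq> Aut_over K0" using Gal_aut by (auto simp: Aut_over_iff K0_def)
  show "Aut_over K0 \<subseteq> Gal"
  proof
    fix \<sigma> assume "\<sigma> \<in> Aut_over K0"
    hence s: "is_aut \<sigma>" and fx: "\<And>x. x \<in> K0 \<Longrightarrow> \<sigma> x = x" by (auto simp: Aut_over_iff)
    have fixG: "\<sigma> x = x" if "x \<in> Gam" for x using fx that by (simp add: Gam_eq)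
    have "\<exists>c j. c ^ m = 1 \<and> \<sigma> (rf_var i) = rf_const c * rf_var j" for i
    proof -
      have "poly zpoly (zvar i) = 0" by (auto simp: zpoly_def poly_prod)
      hence "\<sigma> (\<Sum>k\<le>degree zpoly. coeff zpoly k * zvar i ^ k) = 0" by (simp add: poly_altdef aut_0[OF s])
      hence "poly zpoly (\<sigma> (zvar i)) = 0"
        by (simp add: poly_altdef aut_sum[OF s] aut_mult[OF s] aut_power[OF s] fixG[OF zpoly_coeff_Gam])
      then obtain j where "\<sigma> (zvar i) = zvar j" by (auto simp: zpoly_def poly_prod)
      hence "(\<sigma> (rf_var i) / rf_var j) ^ m = 1" by (simp add: zvar_def aut_power[OF s] power_divide)
      then obtain c where "c ^ m = 1" "\<sigma> (rf_var i) / rf_var j = rf_const c" using root_of_unity_const[OF m_pos] by blast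
      thus ?thesis by (intro exI[of _ c] exI[of _ j]) (simp add: field_simps)
    qed
    then obtain c \<pi> where c: "\<And>i. c i ^ m = 1" "\<And>i. \<sigma> (rf_var i) = rf_const (c i) * rf_var (\<pi> i)" by metis
    have "\<sigma> (zvar i) = zvar (\<pi> i)" for i
      using c by (simp add: zvar_def aut_power[OF s] power_mult_distrib rf_const_power[symmetric])
    hence "inj \<pi>" using zvar_inj by (metis aut_bij[OF s] bij_is_inj injD injI)
    hence \<pi>: "bij \<pi>" by (simp add: finite_UNIV_inj_surj bij_def)
    have c0: "c i \<noteq> 0" for i using c(1)[of i] m_pos by (auto simp: power_0_left)
    have "(\<Prod>i\<in>UNIV. rf_var (\<pi> i)) = (\<Prod>i\<in>UNIV. rf_var i :: ('n, 'k) ratfun)"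
      by (rule prod.reindex_bij_betw[OF \<pi>])
    hence "\<sigma> wvar = rf_const ((\<Prod>i\<in>UNIV. c i) ^ (m div p)) * wvar"
      by (simp add: wvar_def aut_power[OF s] aut_prod[OF s] c(2) prod.distrib power_mult_distrib rf_const_prod rf_const_power)
    moreover have "\<sigma> wvar = wvar" using fixG wvar_Gam[of 1] by simp
    ultimately have "rf_const ((\<Prod>i\<in>UNIV. c i) ^ (m div p)) = (rf_const 1 :: ('n, 'k) ratfun)"
      using wvar_nonzero by (metis mult_cancel_right1 rf_const_1)
    hence "(\<Prod>i\<in>UNIV. c i) ^ (m div p) = 1" by (simp only: rf_const_eq_iff)
    hence "(c, \<pi>) \<in> H" using c(1) \<pi> by (simp add: H_iff)
    moreover have "\<sigma> = ma (c, \<pi>)"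
      by (rule monomial_aut_unique[OF c0 \<pi> s]) (simp_all add: fx K0_const c(2))
    ultimately show "\<sigma> \<in> Gal" by (simp add: Gal_def)
  qed
qed

section \<open>Invariants of the diagonal group\<close>

text \<open>The Laurent polynomials invariant under the diagonal subgroup \<open>A(m,p,n)\<close>.\<close>
definition diag_inv :: "('n, 'k) ratfun set" where
  "diag_inv = {f \<in> lpolys. \<forall>g. (g, id) \<in> H \<longrightarrow> ma (g, id) f = f}"

text \<open>The subring of \<open>\<Gamma>\<close> generated by the obvious invariants, equal to \<open>\<Gamma>\<close> by \<open>Gam_eq_Gam_gen\<close>.\<close>
definition Gam_gen :: "('n, 'k) ratfun set" where
  "Gam_gen = adjoin rf_consts (range (coeff zpoly) \<union> {wvar, inverse wvar})"

definition z_monom :: "('n \<Rightarrow> nat) \<Rightarrow> ('n, 'k) ratfun" where "z_monom \<phi> = (\<Prod>j\<in>UNIV. zvar j ^ \<phi> j)"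

lemma subr_consts: "subr (rf_consts :: ('n, 'k) ratfun set)"
  unfolding subr_def
proof (intro conjI ballI)
  show "1 \<in> (rf_consts :: ('n, 'k) ratfun set)" by (rule image_eqI[of _ _ 1]) simp_all
  fix x y :: "('n, 'k) ratfun" assume "x \<in> rf_consts" "y \<in> rf_consts"
  then obtain c d where "x = rf_const c" "y = rf_const d" by blast
  thus "x - y \<in> rf_consts" "x * y \<in> rf_consts"
    by (simp_all add: hom_diff[OF is_hom_rf_const, symmetric] rf_const_mult[symmetric])
qed

lemma subr_Gam_gen: "subr Gam_gen" unfolding Gam_gen_def by (rule subr_adjoin[OF subr_consts])

lemma Gam_gen_subset: "Gam_gen \<subseteq> Gam"
  unfolding Gam_gen_def
  using zpoly_coeff_Gam wvar_Gam[of 1] wvar_Gam[of "- 1"] Gam_const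
  by (intro adjoin_least subr_Gam) (auto simp: power_int_minus)

lemma Gam_subset_diag_inv: "Gam \<subseteq> diag_inv"
  by (auto simp: Gam_eq diag_inv_def K0D)

lemma wvar_xm: "wvar powi k = xm (\<lambda>_. int (m div p) * k)"
proof -
  have "wvar = xm (\<lambda>_. int (m div p))" by (simp add: wvar_def xm_def prod_power_distrib)
  thus ?thesis by (simp add: xm_def prod_powi power_int_mult)
qed

lemma prod_zvar: "(\<Prod>i\<in>UNIV. zvar i) = wvar ^ p"
  using p_dvd by (simp add: zvar_def wvar_def prod_power_distrib power_mult[symmetric])

text \<open>The product of all \<open>z\<^sub>i\<close> is \<open>w\<^sup>p\<close>, a unit, which provides the inverses.\<close>
lemma zvar_powi_adjoin: "zvar i powi k \<in> adjoin Gam_gen (range zvar)"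
proof -
  note S = subr_adjoin[OF subr_Gam_gen, of "range zvar"]
  have z: "zvar j \<in> adjoin Gam_gen (range zvar)" for j by (rule adjoin.gen) simp
  have "inverse wvar \<in> Gam_gen" unfolding Gam_gen_def by (rule adjoin.gen) simp
  hence w: "inverse wvar \<in> adjoin Gam_gen (range zvar)" by (rule adjoin.base)
  have e: "zvar i * (\<Prod>j\<in>UNIV - {i}. zvar j) = wvar ^ p" using prod.remove[of UNIV i zvar] prod_zvar by simp
  have "zvar i * ((\<Prod>j\<in>UNIV - {i}. zvar j) * inverse wvar ^ p) = wvar ^ p * inverse wvar ^ p"
    by (simp only: mult.assoc[symmetric] e)
  also have "\<dots> = 1" by (simp add: power_mult_distrib[symmetric])
  finally have "zvar i * ((\<Prod>j\<in>UNIV - {i}. zvar j) * inverse wvar ^ p) = 1" .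
  hence "inverse (zvar i) = (\<Prod>j\<in>UNIV - {i}. zvar j) * inverse wvar ^ p" by (rule inverse_unique)
  also have "\<dots> \<in> adjoin Gam_gen (range zvar)" using z w by (intro subr_mult[OF S] subr_prod[OF S] subr_power[OF S])
  finally show ?thesis unfolding power_int_def using z by (auto intro: subr_power[OF S])
qed

lemma m_div_p_pos: "m div p \<ge> 1" using m_pos p_pos p_dvd by (metis dvd_div_eq_0_iff less_one linorder_not_less not_one_le_zero)

text \<open>
  The monomial \<open>x\<^sup>v\<close> is invariant only if \<open>m/p\<close> divides all \<open>v\<^sub>i\<close> and \<open>m\<close> divides all differences
  \<open>v\<^sub>i - v\<^sub>j\<close>, as diagonal matrices with one or two nontrivial entries show. Then \<open>x\<^sup>v\<close> is a power of \<open>w\<close>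
  times a monomial in the \<open>z\<^sub>i\<close>.
\<close>
lemma diagonal_invariant_exponents:
  assumes "\<And>g :: 'n \<Rightarrow> 'k. (g, id) \<in> H \<Longrightarrow> (\<Prod>i\<in>UNIV. g i powi v i) = 1"
  shows "\<exists>s u. v = (\<lambda>i. int (m div p) * s + int m * u i)"
proof -
  have d1: "int (m div p) dvd v i" for i
  proof (rule dvd_of_roots[OF m_div_p_pos, where 'k = 'k])
    fix x :: 'k assume x: "x ^ (m div p) = 1"
    let ?g = "\<lambda>k. if k = i then x else 1"
    have "x ^ m = (x ^ (m div p)) ^ p" using p_dvd by (simp add: power_mult[symmetric])
    hence "x ^ m = 1" using x by simp
    hence "(?g, id) \<in> H" using x by (simp add: H_iff)
    from assms[OF this] have "(\<Prod>k\<in>UNIV. ?g k powi v k) = 1" .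
    also have "(\<Prod>k\<in>UNIV. ?g k powi v k) = (\<Prod>k\<in>UNIV. if k = i then x powi v i else 1)" by (intro prod.cong) auto
    finally show "x powi v i = 1" by simp
  qed
  have d2: "int m dvd v i - v j" if "i \<noteq> j" for i j
  proof (rule dvd_of_roots[OF m_pos, where 'k = 'k])
    fix x :: 'k assume x: "x ^ m = 1"
    hence x0: "x \<noteq> 0" using m_pos by (auto simp: power_0_left)
    let ?g = "\<lambda>k. (if k = i then x else 1) * (if k = j then inverse x else 1)"
    have "(?g, id) \<in> H" using x x0 by (simp add: H_iff prod.distrib power_mult_distrib power_inverse)
    from assms[OF this] have "(\<Prod>k\<in>UNIV. ?g k powi v k) = 1" .
    also have "(\<Prod>k\<in>UNIV. ?g k powi v k) =
        (\<Prod>k\<in>UNIV. (if k = i then x powi v i else 1) * (if k = j then inverse x powi v j else 1))"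
      by (intro prod.cong) (auto simp: power_int_mult_distrib)
    also have "\<dots> = x powi (v i - v j)"
      unfolding prod.distrib using x0 by (simp add: power_int_diff power_int_inverse divide_inverse)
    finally show "x powi (v i - v j) = 1" .
  qed
  obtain i0 :: 'n where True by simp
  obtain s where s: "v i0 = int (m div p) * s" using d1[of i0] by (auto elim: dvdE)
  have "\<exists>u. v i - v i0 = int m * u" for i using d2[of i i0] by (cases "i = i0") (auto elim: dvdE)
  then obtain u where "\<And>i. v i - v i0 = int m * u i" by metis
  hence "v = (\<lambda>i. int (m div p) * s + int m * u i)" using s by (auto simp: fun_eq_iff algebra_simps)
  thus ?thesis by blast
qed

lemma diag_inv_adjoin: "diag_inv \<subseteq> adjoin Gam_gen (range zvar)"
proof
  note S = subr_adjoin[OF subr_Gam_gen, of "range zvar"]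
  fix f assume f: "f \<in> diag_inv"
  then obtain V c where V: "finite V" "f = (\<Sum>v\<in>V. rf_const (c v) * xm v)" by (auto simp: diag_inv_def lpolys_def)
  have "rf_const (c v) * xm v \<in> adjoin Gam_gen (range zvar)" if v: "v \<in> V" for v
  proof (cases "c v = 0")
    case True
    then show ?thesis using subr_0[OF S] by simp
  next
    case False
    have "(\<Prod>i\<in>UNIV. g i powi v i) = 1" if g: "(g, id) \<in> H" for g
    proof -
      have nz: "\<And>i. g i \<noteq> 0" using H_nonzero[OF g] .
      have "ma (g, id) f = f" using f g by (simp add: diag_inv_def)
      also have "ma (g, id) f = (\<Sum>v\<in>V. rf_const (c v * (\<Prod>i\<in>UNIV. g i powi v i)) * xm v)"
        unfolding V(2) aut_sum[OF H_aut[OF g]]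
      proof (rule sum.cong[OF refl])
        fix v
        have "ma (g, id) (xm v) = rf_const (\<Prod>i\<in>UNIV. g i powi v i) * xm (v \<circ> inv_into UNIV id)"
          by (rule monomial_aut_xm) (simp_all add: nz)
        thus "ma (g, id) (rf_const (c v) * xm v) = rf_const (c v * (\<Prod>i\<in>UNIV. g i powi v i)) * xm v"
          by (simp add: aut_mult[OF H_aut[OF g]] H_const[OF g] rf_const_mult mult_ac)
      qed
      finally have "(\<Sum>v\<in>V. rf_const (c v * (\<Prod>i\<in>UNIV. g i powi v i) - c v) * xm v) = (0 :: ('n, 'k) ratfun)"
        unfolding V(2) by (simp add: hom_diff[OF is_hom_rf_const] left_diff_distrib sum_subtractf)
      from xm_independent[OF V(1) this v] show ?thesis using False by simp
    qed
    then obtain s u where vs: "v = (\<lambda>i. int (m div p) * s + int m * u i)"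
      using diagonal_invariant_exponents[of v] by blast
    have "xm (\<lambda>i. int m * u i) = (\<Prod>i\<in>UNIV. zvar i powi u i)"
      unfolding xm_def zvar_def by (intro prod.cong refl) (simp add: power_int_mult)
    hence xv: "xm v = wvar powi s * (\<Prod>i\<in>UNIV. zvar i powi u i)"
      unfolding vs xm_add wvar_xm by simp
    have "wvar \<in> Gam_gen" "inverse wvar \<in> Gam_gen" "rf_const (c v) \<in> Gam_gen"
      unfolding Gam_gen_def by (auto intro: adjoin.intros)
    hence "wvar powi s \<in> adjoin Gam_gen (range zvar)" "rf_const (c v) \<in> adjoin Gam_gen (range zvar)"
      unfolding power_int_def by (auto intro: adjoin.base subr_power[OF S])
    thus ?thesis unfolding xv by (intro subr_mult[OF S] subr_prod[OF S] zvar_powi_adjoin)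
  qed
  thus "f \<in> adjoin Gam_gen (range zvar)" unfolding V(2) by (intro subr_sum[OF S])
qed

lemma stair_expansion:
  assumes "distinct xs" "set xs = UNIV" "f \<in> diag_inv"
  shows "\<exists>r. (\<forall>\<phi>\<in>stair xs. r \<phi> \<in> Gam_gen) \<and> f = (\<Sum>\<phi>\<in>stair xs. r \<phi> * z_monom \<phi>)"
proof -
  have "coeff (\<Prod>i\<in>set xs. [:- zvar i, 1:]) k \<in> Gam_gen" for k
    unfolding assms(2) zpoly_def[symmetric] Gam_gen_def by (rule adjoin.gen) simp
  from stair_span[OF assms(1) subr_Gam_gen this, of f] diag_inv_adjoin assms(2,3) show ?thesis
    by (auto simp: z_monom_def)
qed

abbreviation perm_aut :: "('n \<Rightarrow> 'n) \<Rightarrow> ('n, 'k) ratfun \<Rightarrow> ('n, 'k) ratfun" where "perm_aut \<pi> \<equiv> ma (\<lambda>_. 1, \<pi>)"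

lemma perm_aut_aut: "bij \<pi> \<Longrightarrow> is_aut (perm_aut \<pi>)" by (rule H_aut[OF perm_in_H])
lemma perm_aut_zvar: "bij \<pi> \<Longrightarrow> perm_aut \<pi> (zvar i) = zvar (\<pi> i)" by (rule H_zvar[OF perm_in_H])
lemma perm_aut_K0: "bij \<pi> \<Longrightarrow> f \<in> K0 \<Longrightarrow> perm_aut \<pi> f = f" by (rule K0D[OF _ perm_in_H])

text \<open>
  The permutations in the group fix \<open>K0\<close> and map a vanishing combination to its values at all distinct
  tuples of the \<open>z\<^sub>i\<close>, which is what \<open>stair_independent\<close> asks for.
\<close>
lemma stair_unique:
  assumes "distinct xs" "set xs = UNIV" "\<And>\<phi>. \<phi> \<in> stair xs \<Longrightarrow> r \<phi> \<in> K0"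
    "(\<Sum>\<phi>\<in>stair xs. r \<phi> * z_monom \<phi>) = 0" "\<phi> \<in> stair xs"
  shows "r \<phi> = 0"
proof (rule stair_independent[where Z = "range zvar" and c = r and xs = xs and \<phi> = \<phi>])
  show "finite (range zvar)" by simp
  have "card (range zvar) = card (UNIV :: 'n set)" by (rule card_image) (simp add: inj_on_def zvar_inj)
  thus "card (range zvar) = length xs" using distinct_card[OF assms(1)] assms(2) by simp
  fix t :: "'n \<Rightarrow> ('n, 'k) ratfun" assume t: "inj_on t (set xs)" "t ` set xs \<subseteq> range zvar"
  have "\<forall>i. \<exists>j. t i = zvar j" using t(2) by (simp add: assms(2) image_subset_iff image_iff)
  then obtain \<pi> where \<pi>: "\<And>i. t i = zvar (\<pi> i)" by metis
  have "inj \<pi>" using t(1) by (auto simp: assms(2) \<pi> inj_def zvar_inj)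
  hence b: "bij \<pi>" by (simp add: finite_UNIV_inj_surj bij_def)
  note a = perm_aut_aut[OF b]
  have "perm_aut \<pi> (\<Sum>\<phi>\<in>stair xs. r \<phi> * z_monom \<phi>) = 0" unfolding assms(4) by (rule aut_0[OF a])
  thus "(\<Sum>\<phi>\<in>stair xs. r \<phi> * (\<Prod>j\<in>set xs. t j ^ \<phi> j)) = 0"
    by (simp add: aut_sum[OF a] aut_mult[OF a] z_monom_def aut_prod[OF a] aut_power[OF a] perm_aut_zvar[OF b]
      perm_aut_K0[OF b assms(3)] assms(2) \<pi> cong: sum.cong)
qed (use assms in auto)

lemma zero_in_stair: "(\<lambda>_. 0) \<in> stair xs"
proof (induction xs)
  case (Cons i xs)
  have "(\<lambda>_. 0) = (\<lambda>(c, \<phi>). \<phi>(i := c)) (0, (\<lambda>_. 0))" by auto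
  thus ?case using Cons by (auto intro!: image_eqI[of _ _ "(0, \<lambda>_. 0)"])
qed simp

lemma exists_enum: "\<exists>xs :: 'n list. distinct xs \<and> set xs = UNIV"
  using finite_distinct_list[of "UNIV :: 'n set"] by auto

text \<open>
  An invariant \<open>f\<close> has a staircase expansion with coefficients in the subring generated by the obvious
  invariants, and also the trivial expansion \<open>f \<cdot> 1\<close>. By uniqueness \<open>f\<close> is the constant coefficient of
  the first.
\<close>
lemma Gam_eq_Gam_gen: "Gam = Gam_gen"
proof
  show "Gam \<subseteq> Gam_gen"
  proof
    fix f assume f: "f \<in> Gam"
    obtain xs :: "'n list" where xs: "distinct xs" "set xs = UNIV" using exists_enum by blast
    obtain r where r: "\<And>\<phi>. \<phi> \<in> stair xs \<Longrightarrow> r \<phi> \<in> Gam_gen" "f = (\<Sum>\<phi>\<in>stair xs. r \<phi> * z_monom \<phi>)"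
      using stair_expansion[OF xs] f Gam_subset_diag_inv by blast
    define s where "s \<phi> = r \<phi> - (if \<phi> = (\<lambda>_. 0) then f else 0)" for \<phi>
    have "(\<Sum>\<phi>\<in>stair xs. s \<phi> * z_monom \<phi>) = f - (\<Sum>\<phi>\<in>stair xs. if \<phi> = (\<lambda>_. 0) then f * z_monom \<phi> else 0)"
      unfolding s_def left_diff_distrib sum_subtractf r(2)[symmetric] by (simp add: if_distrib[of "\<lambda>x. x * _"] cong: if_cong)
    also have "\<dots> = 0" unfolding sum.delta[OF finite_stair] using zero_in_stair[of xs] by (simp add: z_monom_def)
    finally have 0: "(\<Sum>\<phi>\<in>stair xs. s \<phi> * z_monom \<phi>) = 0" .
    have "s \<phi> \<in> K0" if "\<phi> \<in> stair xs" for \<phi>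
      unfolding s_def using r(1)[OF that] Gam_gen_subset f subr_diff[OF subr_K0] subr_0[OF subr_K0] by (auto simp: Gam_eq)
    from stair_unique[OF xs this 0 zero_in_stair] have "r (\<lambda>_. 0) = f" by (simp add: s_def)
    thus "f \<in> Gam_gen" using r(1)[OF zero_in_stair] by simp
  qed
qed (rule Gam_gen_subset)

lemma noeth_Gam: "noeth Gam"
proof -
  have "range (coeff zpoly) \<subseteq> coeff zpoly ` {..degree zpoly} \<union> {0}"
  proof
    fix y assume "y \<in> range (coeff zpoly)"
    then obtain k where "y = coeff zpoly k" by blast
    thus "y \<in> coeff zpoly ` {..degree zpoly} \<union> {0}" by (cases "k \<le> degree zpoly") (auto simp: coeff_eq_0)
  qed
  hence "finite (range (coeff zpoly))" by (rule finite_subset) simp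
  moreover have "noeth (rf_consts :: ('n, 'k) ratfun set)"
    by (rule noeth_field[OF subr_consts]) (auto simp: rf_const_inverse[symmetric])
  ultimately show ?thesis unfolding Gam_eq_Gam_gen Gam_gen_def
    by (intro noeth_adjoin subr_consts) auto
qed

section \<open>Expansion of the invariants of a Young subgroup\<close>

definition number_above :: "('n \<Rightarrow> int) \<Rightarrow> 'n \<Rightarrow> nat" where "number_above v i = card {j. v j > v i}"

text \<open>
  The exponents of the basis attached to \<open>v\<close>. In contrast to a staircase, which depends on an
  order of the variables, they are permuted together with \<open>v\<close> (\<open>box_perm\<close>), also when entries of \<open>v\<close>
  coincide.
\<close>
definition box :: "('n \<Rightarrow> int) \<Rightarrow> ('n \<Rightarrow> nat) set" where "box v = {\<phi>. \<forall>i. \<phi> i \<le> number_above v i}"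

lemma box_PiE: "box v = PiE UNIV (\<lambda>i. {..number_above v i})" by (auto simp: box_def PiE_def)
lemma finite_box: "finite (box v)" unfolding box_PiE by (rule finite_PiE) auto

definition sorted_enum :: "('n \<Rightarrow> int) \<Rightarrow> 'n list" where "sorted_enum v = sort_key v (sorted_list_of_set UNIV)"

lemma sorted_enum: "distinct (sorted_enum v)" "set (sorted_enum v) = UNIV" "sorted (map v (sorted_enum v))"
  by (simp_all add: sorted_enum_def)

lemma box_stair: "box v \<subseteq> stair (sorted_enum v)"
  by (intro subsetI stairI[OF sorted_enum(1,3)]) (auto simp: box_def number_above_def sorted_enum(2))

lemma number_above_perm: "bij \<pi> \<Longrightarrow> number_above (v \<circ> \<pi>) i = number_above v (\<pi> i)"
proof -
  assume b: "bij \<pi>"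
  have "card {j. v (\<pi> j) > v (\<pi> i)} = card (\<pi> ` {j. v (\<pi> j) > v (\<pi> i)})"
    by (rule card_image[symmetric]) (meson b bij_is_inj inj_on_subset subset_UNIV)
  also have "\<pi> ` {j. v (\<pi> j) > v (\<pi> i)} = {j. v j > v (\<pi> i)}"
    using bij_is_surj[OF b] by (auto simp: image_iff)
  finally show ?thesis by (simp add: number_above_def)
qed

lemma box_perm: "bij \<pi> \<Longrightarrow> \<phi> \<circ> \<pi> \<in> box (v \<circ> \<pi>) \<longleftrightarrow> \<phi> \<in> box v"
  using bij_is_surj[of \<pi>] by (auto simp: box_def number_above_perm) (metis surjD)

lemma expansion_unique:
  assumes "\<And>\<phi>. \<phi> \<in> box v \<Longrightarrow> r \<phi> \<in> K0" "(\<Sum>\<phi>\<in>box v. r \<phi> * z_monom \<phi>) = 0" "\<phi> \<in> box v"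
  shows "r \<phi> = 0"
proof -
  define s where "s \<phi> = (if \<phi> \<in> box v then r \<phi> else 0)" for \<phi>
  have "(\<Sum>\<phi>\<in>stair (sorted_enum v). s \<phi> * z_monom \<phi>) = (\<Sum>\<phi>\<in>box v. r \<phi> * z_monom \<phi>)"
    by (rule sum.mono_neutral_cong_right[OF finite_stair box_stair]) (auto simp: s_def)
  moreover have "s \<phi> \<in> K0" for \<phi> using assms(1) subr_0[OF subr_K0] by (simp add: s_def)
  ultimately have "s \<phi> = 0" using assms(2,3) box_stair by (intro stair_unique[OF sorted_enum(1,2), of v s \<phi>]) auto
  thus ?thesis using assms(3) by (simp add: s_def)
qed

definition above :: "('n \<Rightarrow> int) \<Rightarrow> 'n \<Rightarrow> 'n set" where "above v i = {j. v j > v i}"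

lemma sum_perm_eq_imp:
  assumes "bij \<pi>" "\<And>j. v j \<le> v (\<pi> j)"
  shows "v \<circ> \<pi> = (v :: 'n \<Rightarrow> int)"
proof -
  have "(\<Sum>j\<in>UNIV. v (\<pi> j)) = (\<Sum>j\<in>UNIV. v j)" by (rule sum.reindex_bij_betw[OF assms(1)])
  hence "(\<Sum>j\<in>UNIV. v (\<pi> j) - v j) = 0" by (simp add: sum_subtractf)
  hence "\<forall>j\<in>UNIV. v (\<pi> j) - v j = 0" using assms(2) by (subst (asm) sum_nonneg_eq_0_iff) auto
  thus ?thesis by auto
qed

lemma stab_above:
  assumes "bij \<pi>" "v \<circ> \<pi> = v"
  shows "bij_betw \<pi> (above v i) (above v i)" "above v (\<pi> i) = above v i"
proof -
  have v: "v (\<pi> j) = v j" for j using assms(2) by (metis comp_apply)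
  show "above v (\<pi> i) = above v i" by (simp add: above_def v)
  have "\<pi> ` above v i = above v i"
    using bij_is_surj[OF assms(1)] v by (auto simp: above_def image_iff) (metis surjD)
  thus "bij_betw \<pi> (above v i) (above v i)"
    unfolding bij_betw_def by (meson assms(1) bij_is_inj inj_on_subset subset_UNIV)
qed

text \<open>
  The kernel \<open>F(\<pi>) = \<Prod>\<^sub>i \<Prod> (z\<^sub>i - z\<^bsub>\<pi>(j)\<^esub>)\<close>, the inner product over the \<open>j\<close> with \<open>v\<^sub>j > v\<^sub>i\<close>, vanishes
  unless \<open>\<pi>\<close> stabilizes \<open>v\<close>: a permutation that does not must send some \<open>j\<close> to an index of smaller value. On
  the stabilizer it is constant. Hence the sum of \<open>\<pi>(f/\<Delta>) F(\<pi>)\<close> over all permutations is \<open>f\<close> times the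
  order of the stabilizer, in the manner of Lagrange interpolation; expanding \<open>F(\<pi>)\<close> in powers of the outer \<open>z\<^sub>i\<close> gives the exponents in
  the box, and the coefficients are symmetrized, hence invariant.
\<close>
lemma expansion_over_K0:
  assumes A: "\<And>g. (g, id) \<in> H \<Longrightarrow> ma (g, id) f = f"
    and stab: "\<And>\<pi>. bij \<pi> \<Longrightarrow> v \<circ> \<pi> = v \<Longrightarrow> perm_aut \<pi> f = f"
  shows "\<exists>r. (\<forall>\<phi>\<in>box v. r \<phi> \<in> K0) \<and> f = (\<Sum>\<phi>\<in>box v. r \<phi> * z_monom \<phi>)"
proof -
  define \<Delta> where "\<Delta> = (\<Prod>i\<in>UNIV. \<Prod>j\<in>above v i. zvar i - zvar j)"
  define F where "F \<pi> = (\<Prod>i\<in>UNIV. \<Prod>j\<in>above v i. zvar i - zvar (\<pi> j))" for \<pi> :: "'n \<Rightarrow> 'n"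
  define Q where "Q i \<pi> = (\<Prod>j\<in>above v i. [:- zvar (\<pi> j), 1:])" for i and \<pi> :: "'n \<Rightarrow> 'n"
  \<comment> \<open>The coefficient of \<open>z\<^sup>\<phi>\<close> in \<open>F(id)\<close>, when the outer \<open>z\<^sub>i\<close> are regarded as independent of the inner ones.\<close>
  define C where "C \<phi> = (\<Prod>i\<in>UNIV. coeff (Q i id) (\<phi> i))" for \<phi>
  define S where "S = {\<pi> :: 'n \<Rightarrow> 'n. bij \<pi>}"
  have finS: "finite S" by (rule finite_subset[OF subset_UNIV finite])
  have \<Delta>0: "\<Delta> \<noteq> 0" by (auto simp: \<Delta>_def above_def zvar_inj)
  have F0: "F \<pi> = 0" if b: "bij \<pi>" and ne: "v \<circ> \<pi> \<noteq> v" for \<pi>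
  proof -
    obtain j where "\<not> v j \<le> v (\<pi> j)" using sum_perm_eq_imp[OF b] ne by blast
    hence "j \<in> above v (\<pi> j)" by (simp add: above_def)
    thus ?thesis unfolding F_def by (auto intro!: bexI[of _ "\<pi> j"] bexI[of _ j] simp: prod_zero_iff)
  qed
  have F1: "F \<pi> = \<Delta>" "perm_aut \<pi> \<Delta> = \<Delta>" if b: "bij \<pi>" and s: "v \<circ> \<pi> = v" for \<pi>
  proof -
    have inner: "(\<Prod>j\<in>above v i. g (\<pi> j)) = (\<Prod>j\<in>above v i. g j)" for i and g :: "'n \<Rightarrow> ('n, 'k) ratfun"
      by (rule prod.reindex_bij_betw[OF stab_above(1)[OF b s]])
    show "F \<pi> = \<Delta>" unfolding F_def \<Delta>_def by (rule prod.cong[OF refl]) (rule inner)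
    have "perm_aut \<pi> \<Delta> = (\<Prod>i\<in>UNIV. \<Prod>j\<in>above v i. zvar (\<pi> i) - zvar (\<pi> j))"
      by (simp add: \<Delta>_def aut_prod[OF perm_aut_aut[OF b]] aut_diff[OF perm_aut_aut[OF b]] perm_aut_zvar[OF b])
    also have "\<dots> = (\<Prod>i\<in>UNIV. \<Prod>j\<in>above v (\<pi> i). zvar (\<pi> i) - zvar j)"
      unfolding stab_above(2)[OF b s] by (rule prod.cong[OF refl]) (rule inner)
    also have "\<dots> = \<Delta>" unfolding \<Delta>_def by (rule prod.reindex_bij_betw[OF b])
    finally show "perm_aut \<pi> \<Delta> = \<Delta>" .
  qed
  define N where "N = card {\<pi> \<in> S. v \<circ> \<pi> = v}"
  have "id \<in> {\<pi> \<in> S. v \<circ> \<pi> = v}" by (simp add: S_def)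
  hence N0: "N \<noteq> 0" using finS by (auto simp: N_def)
  have left: "(\<Sum>\<pi>\<in>S. perm_aut \<pi> (f / \<Delta>) * F \<pi>) = rf_const (of_nat N) * f"
  proof -
    have "(\<Sum>\<pi>\<in>S. perm_aut \<pi> (f / \<Delta>) * F \<pi>) = (\<Sum>\<pi>\<in>{\<pi> \<in> S. v \<circ> \<pi> = v}. f)"
    proof (rule sum.mono_neutral_cong_right[OF finS])
      fix \<pi> assume "\<pi> \<in> {\<pi> \<in> S. v \<circ> \<pi> = v}"
      hence b: "bij \<pi>" "v \<circ> \<pi> = v" by (auto simp: S_def)
      show "perm_aut \<pi> (f / \<Delta>) * F \<pi> = f"
        unfolding aut_divide[OF perm_aut_aut[OF b(1)]] F1[OF b] stab[OF b] using \<Delta>0 by simp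
    qed (use F0 in \<open>auto simp: S_def\<close>)
    also have "\<dots> = of_nat N * f" by (simp add: N_def)
    also have "of_nat N = (rf_const (of_nat N) :: ('n, 'k) ratfun)"
      by (induction N) (simp_all add: rf_const_add)
    finally show ?thesis .
  qed
  have FQ: "F \<pi> = (\<Sum>\<phi>\<in>box v. (\<Prod>i\<in>UNIV. coeff (Q i \<pi>) (\<phi> i)) * z_monom \<phi>)" for \<pi>
  proof -
    have "F \<pi> = (\<Prod>i\<in>UNIV. poly (Q i \<pi>) (zvar i))" by (simp add: F_def Q_def poly_prod)
    also have "\<dots> = (\<Prod>i\<in>UNIV. \<Sum>k\<le>number_above v i. coeff (Q i \<pi>) k * zvar i ^ k)"
    proof (rule prod.cong[OF refl])
      fix i
      have "degree (Q i \<pi>) \<le> number_above v i"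
        using monic_prod_linear[of "above v i" "\<lambda>j. zvar (\<pi> j)"] by (simp add: Q_def number_above_def above_def)
      thus "poly (Q i \<pi>) (zvar i) = (\<Sum>k\<le>number_above v i. coeff (Q i \<pi>) k * zvar i ^ k)"
        unfolding poly_altdef by (intro sum.mono_neutral_left) (auto simp: coeff_eq_0)
    qed
    also have "\<dots> = (\<Sum>\<phi>\<in>box v. \<Prod>i\<in>UNIV. coeff (Q i \<pi>) (\<phi> i) * zvar i ^ \<phi> i)"
      unfolding box_PiE by (rule prod_sum_PiE) auto
    finally show ?thesis by (simp add: prod.distrib z_monom_def)
  qed
  define r where "r \<phi> = rf_const (inverse (of_nat N)) * (\<Sum>\<pi>\<in>S. perm_aut \<pi> (f / \<Delta> * C \<phi>))" for \<phi>
  have CQ: "(\<Prod>i\<in>UNIV. coeff (Q i \<pi>) (\<phi> i)) = perm_aut \<pi> (C \<phi>)" if "\<pi> \<in> S" for \<pi> \<phi>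
  proof -
    have b: "bij \<pi>" using that by (simp add: S_def)
    show ?thesis unfolding C_def Q_def aut_prod[OF perm_aut_aut[OF b]] coeff_aut[OF perm_aut_aut[OF b] finite]
      by (simp add: perm_aut_zvar[OF b])
  qed
  have "rf_const (of_nat N) * f = (\<Sum>\<pi>\<in>S. \<Sum>\<phi>\<in>box v. perm_aut \<pi> (f / \<Delta> * C \<phi>) * z_monom \<phi>)"
    unfolding left[symmetric]
  proof (rule sum.cong[OF refl])
    fix \<pi> assume p: "\<pi> \<in> S"
    hence b: "bij \<pi>" by (simp add: S_def)
    show "perm_aut \<pi> (f / \<Delta>) * F \<pi> = (\<Sum>\<phi>\<in>box v. perm_aut \<pi> (f / \<Delta> * C \<phi>) * z_monom \<phi>)"
      unfolding FQ CQ[OF p] aut_mult[OF perm_aut_aut[OF b]] sum_distrib_left by (simp only: mult.assoc)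
  qed
  also have "\<dots> = (\<Sum>\<phi>\<in>box v. (\<Sum>\<pi>\<in>S. perm_aut \<pi> (f / \<Delta> * C \<phi>)) * z_monom \<phi>)"
    unfolding sum_distrib_right by (rule sum.swap)
  finally have eq: "rf_const (of_nat N) * f = (\<Sum>\<phi>\<in>box v. (\<Sum>\<pi>\<in>S. perm_aut \<pi> (f / \<Delta> * C \<phi>)) * z_monom \<phi>)" .
  have "f = rf_const (inverse (of_nat N)) * (rf_const (of_nat N) * f)"
    using N0 by (simp add: mult.assoc[symmetric] rf_const_mult[symmetric])
  also have "\<dots> = (\<Sum>\<phi>\<in>box v. r \<phi> * z_monom \<phi>)"
    unfolding eq r_def by (subst sum_distrib_left) (simp only: mult.assoc)
  finally have "f = (\<Sum>\<phi>\<in>box v. r \<phi> * z_monom \<phi>)" .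
  moreover have "r \<phi> \<in> K0" for \<phi>
  proof (rule K0I)
    fix g \<tau> assume h: "(g, \<tau>) \<in> H"
    note a = H_aut[OF h]
    let ?u = "f / \<Delta> * C \<phi>"
    have zinv: "ma (g', id) (zvar i) = zvar i" if "(g', id) \<in> H" for g' i using H_zvar[OF that] by simp
    have uinv: "ma (g', id) ?u = ?u" if g': "(g', id) \<in> H" for g'
    proof -
      note a' = H_aut[OF g']
      have "ma (g', id) \<Delta> = \<Delta>"
        by (simp add: \<Delta>_def aut_prod[OF a'] aut_diff[OF a'] zinv[OF g'])
      moreover have "ma (g', id) (C \<phi>) = C \<phi>"
        unfolding C_def Q_def aut_prod[OF a'] coeff_aut[OF a' finite] by (simp add: zinv[OF g'])
      ultimately show ?thesis by (simp add: aut_mult[OF a'] aut_divide[OF a'] A[OF g'])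
    qed
    \<comment> \<open>The diagonal part of a group element can be moved to the right of \<open>\<pi>\<close>, where it acts trivially.\<close>
    have "ma (g, \<tau>) (perm_aut \<pi> ?u) = perm_aut (\<tau> \<circ> \<pi>) ?u" if "\<pi> \<in> S" for \<pi>
    proof -
      have b: "bij \<pi>" "bij \<tau>" using that H_bij[OF h] by (auto simp: S_def)
      have "(\<Prod>i\<in>UNIV. g (\<pi> i)) = (\<Prod>i\<in>UNIV. g i)" by (rule prod.reindex_bij_betw[OF b(1)])
      hence g': "(g \<circ> \<pi>, id) \<in> H" using h by (simp add: H_iff)
      have "ma (g, \<tau>) \<circ> perm_aut \<pi> = perm_aut (\<tau> \<circ> \<pi>) \<circ> ma (g \<circ> \<pi>, id)"
        using H_comp[OF h perm_in_H[OF b(1)]] H_comp[OF perm_in_H[OF bij_comp[OF b]] g'] by (simp add: comp_def)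
      from fun_cong[OF this, of ?u] show ?thesis by (simp only: o_apply uinv[OF g'])
    qed
    hence "(\<Sum>\<pi>\<in>S. ma (g, \<tau>) (perm_aut \<pi> ?u)) = (\<Sum>\<pi>\<in>S. perm_aut (\<tau> \<circ> \<pi>) ?u)" by (rule sum.cong[OF refl])
    also have "\<dots> = (\<Sum>\<pi>\<in>S. perm_aut \<pi> ?u)"
    proof (rule sum.reindex_bij_witness[of _ "\<lambda>\<pi>. inv_into UNIV \<tau> \<circ> \<pi>" "\<lambda>\<pi>. \<tau> \<circ> \<pi>"])
      note b = H_bij[OF h]
      show "inv_into UNIV \<tau> \<circ> (\<tau> \<circ> \<pi>) = \<pi>" for \<pi> using b by (simp add: fun_eq_iff bij_is_inj)
      show "\<tau> \<circ> (inv_into UNIV \<tau> \<circ> \<pi>) = \<pi>" for \<pi> using b by (simp add: fun_eq_iff bij_is_surj surj_f_inv_f)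
      show "\<tau> \<circ> \<pi> \<in> S" if "\<pi> \<in> S" for \<pi> using that b by (simp add: S_def bij_comp)
      show "inv_into UNIV \<tau> \<circ> \<pi> \<in> S" if "\<pi> \<in> S" for \<pi> using that bij_imp_bij_inv[OF b] by (simp add: S_def bij_comp)
    qed simp
    finally show "ma (g, \<tau>) (r \<phi>) = r \<phi>"
      unfolding r_def aut_mult[OF a] H_const[OF h] aut_sum[OF a] by simp
  qed
  ultimately show ?thesis by (intro exI[of _ r] conjI ballI)
qed

text \<open>
  The coefficients over the field are integral: the expansion is also a staircase expansion with
  respect to an order of the variables compatible with \<open>v\<close>, and the one over \<open>\<Gamma>\<close> is the same by uniqueness.
\<close>
theorem expansion:
  assumes f: "f \<in> diag_inv" and stab: "\<And>\<pi>. bij \<pi> \<Longrightarrow> v \<circ> \<pi> = v \<Longrightarrow> perm_aut \<pi> f = f"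
  shows "\<exists>r. (\<forall>\<phi>\<in>box v. r \<phi> \<in> Gam) \<and> f = (\<Sum>\<phi>\<in>box v. r \<phi> * z_monom \<phi>)"
proof -
  obtain r where r: "\<And>\<phi>. \<phi> \<in> box v \<Longrightarrow> r \<phi> \<in> K0" "f = (\<Sum>\<phi>\<in>box v. r \<phi> * z_monom \<phi>)"
    using expansion_over_K0[of f v] f stab by (auto simp: diag_inv_def)
  obtain s where s: "\<And>\<phi>. \<phi> \<in> stair (sorted_enum v) \<Longrightarrow> s \<phi> \<in> Gam" "f = (\<Sum>\<phi>\<in>stair (sorted_enum v). s \<phi> * z_monom \<phi>)"
    using stair_expansion[OF sorted_enum(1,2) f, of v] Gam_gen_subset by blast
  define r' where "r' \<phi> = (if \<phi> \<in> box v then r \<phi> else 0)" for \<phi>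
  have "(\<Sum>\<phi>\<in>stair (sorted_enum v). r' \<phi> * z_monom \<phi>) = f"
    unfolding r(2) by (rule sum.mono_neutral_cong_right[OF finite_stair box_stair]) (auto simp: r'_def)
  hence 0: "(\<Sum>\<phi>\<in>stair (sorted_enum v). (s \<phi> - r' \<phi>) * z_monom \<phi>) = 0"
    using s(2) by (simp add: left_diff_distrib sum_subtractf)
  have "s \<phi> - r' \<phi> \<in> K0" if "\<phi> \<in> stair (sorted_enum v)" for \<phi>
    using s(1)[OF that] r(1)[of \<phi>] subr_diff[OF subr_K0] subr_0[OF subr_K0] by (auto simp: r'_def Gam_eq)
  from stair_unique[OF sorted_enum(1,2) this 0] have "s \<phi> = r \<phi>" if "\<phi> \<in> box v" for \<phi>
    using that box_stair[of v] by (auto simp: r'_def)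
  hence "r \<phi> \<in> Gam" if "\<phi> \<in> box v" for \<phi> using that s(1) box_stair[of v] by (metis subsetD)
  thus ?thesis using r(2) by (intro exI[of _ r] conjI ballI)
qed

section \<open>Invariants of the skew group ring\<close>

abbreviation "skew_inv \<equiv> skew_invariants Gal M"

text \<open>The image of the invariants of the quantum torus, by \<open>embedded_torus_inv\<close>.\<close>
definition torus_inv :: "('n, 'k) skew set" where
  "torus_inv = laurent_skew \<inter> skew_inv"

lemma H_normalizes: "h \<in> H \<Longrightarrow> a \<in> M \<Longrightarrow> ma h \<circ> a \<circ> ivf (ma h) \<in> M"
  using monomial_aut_normalizes[of "fst h" "snd h" a] H_nonzero H_bij by (metis prod.collapse)

lemma Gal_normalizes: "\<sigma> \<in> Gal \<Longrightarrow> a \<in> M \<Longrightarrow> \<sigma> \<circ> a \<circ> ivf \<sigma> \<in> M"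
  using H_normalizes by (auto simp: Gal_def)

text \<open>
  Conjugation permutes the shifts, so that invariance becomes equivariance of the family of
  coefficients.
\<close>
lemma act_sh:
  assumes "(g, \<pi>) \<in> H"
  shows "skew_act (ma (g, \<pi>)) f (sh v) = ma (g, \<pi>) (f (sh (v \<circ> \<pi>)))"
proof -
  note b = H_bij[OF assms]
  have h: "is_aut (ma (g, \<pi>))" by (rule H_aut[OF assms])
  have "ma (g, \<pi>) \<circ> sh (v \<circ> \<pi>) \<circ> ivf (ma (g, \<pi>)) = sh (v \<circ> \<pi> \<circ> ivf \<pi>)"
    by (rule conj_sh[OF _ b]) (rule H_nonzero[OF assms])
  also have "v \<circ> \<pi> \<circ> ivf \<pi> = v" using b by (simp add: fun_eq_iff bij_is_surj surj_f_inv_f)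
  finally have e: "ma (g, \<pi>) \<circ> sh (v \<circ> \<pi>) \<circ> ivf (ma (g, \<pi>)) = sh v" .
  have "ivf (ma (g, \<pi>)) \<circ> sh v \<circ> ma (g, \<pi>) = sh (v \<circ> \<pi>)"
    unfolding e[symmetric] by (rule ext) (simp add: aut_ivf_left[OF h])
  thus ?thesis by (simp add: skew_act_def)
qed

lemma lpolys_0: "(0 :: ('n, 'k) ratfun) \<in> lpolys" by (rule subr_0[OF subr_lpolys])

lemma off_M: "f \<in> carrier R \<Longrightarrow> a \<notin> M \<Longrightarrow> f a = 0" unfolding carrier_iff by blast

lemma skew_inv_I:
  assumes "f \<in> carrier R" "\<And>g \<pi> v. (g, \<pi>) \<in> H \<Longrightarrow> ma (g, \<pi>) (f (sh (v \<circ> \<pi>))) = f (sh v)"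
  shows "f \<in> skew_inv"
  unfolding skew_invariants_def
proof (intro CollectI conjI ballI)
  fix \<sigma> assume "\<sigma> \<in> Gal"
  then obtain g \<pi> where h: "(g, \<pi>) \<in> H" "\<sigma> = ma (g, \<pi>)" by (auto simp: Gal_def)
  have c: "skew_act \<sigma> f \<in> carrier R"
    unfolding h(2) by (rule act_closed[OF H_aut[OF h(1)] H_normalizes[OF h(1)] assms(1)])
  show "skew_act \<sigma> f = f"
  proof
    fix a
    show "skew_act \<sigma> f a = f a"
    proof (cases "a \<in> M")
      case True
      then obtain v where "a = sh v" by (auto simp: M_eq)
      thus ?thesis using act_sh[OF h(1), of f v] assms(2)[OF h(1), of v] by (simp add: h(2))
    next
      case False
      thus ?thesis using off_M[OF c] off_M[OF assms(1)] by simp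
    qed
  qed
qed (rule assms(1))

lemma skew_inv_carrier: "f \<in> skew_inv \<Longrightarrow> f \<in> carrier R" by (simp add: skew_invariants_def)

lemma skew_inv_D:
  assumes "f \<in> skew_inv" "(g, \<pi>) \<in> H"
  shows "ma (g, \<pi>) (f (sh (v \<circ> \<pi>))) = f (sh v)"
proof -
  have "skew_act (ma (g, \<pi>)) f = f" using assms by (auto simp: skew_invariants_def Gal_def)
  thus ?thesis using act_sh[OF assms(2), of f v] by simp
qed

lemma submod_skew_inv: "submod fscale K0 skew_inv"
proof (unfold submod_def, intro conjI ballI)
  show "0 \<in> skew_inv" by (rule skew_inv_I) (simp_all add: R_zero aut_0[OF H_aut])
  show "f + f' \<in> skew_inv" if "f \<in> skew_inv" "f' \<in> skew_inv" for f f'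
    by (rule skew_inv_I) (use that in \<open>simp_all add: R_add skew_inv_carrier aut_add[OF H_aut] skew_inv_D\<close>)
  show "fscale c f \<in> skew_inv" if "c \<in> K0" "f \<in> skew_inv" for c f
    by (rule skew_inv_I) (use that in \<open>simp_all add: R_fscale skew_inv_carrier aut_mult[OF H_aut] skew_inv_D K0D\<close>)
qed

lemma submod_laurent_skew: "submod fscale lpolys laurent_skew"
  unfolding submod_def laurent_skew_def
  by (auto simp: R_zero R_add R_fscale intro: subr_0[OF subr_lpolys] subr_add[OF subr_lpolys] subr_mult[OF subr_lpolys])

lemma submod_torus_inv: "submod fscale Gam torus_inv"
  using submod_skew_inv submod_laurent_skew by (auto simp: submod_def torus_inv_def Gam_eq)

lemma torus_inv_carrier: "f \<in> torus_inv \<Longrightarrow> f \<in> carrier R" by (simp add: torus_inv_def skew_inv_carrier)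

lemma torus_inv_lpolys: "f \<in> torus_inv \<Longrightarrow> f a \<in> lpolys" by (simp add: torus_inv_def laurent_skew_def)

lemma laurent_skew_mult:
  assumes "f \<in> laurent_skew" "g \<in> laurent_skew"
  shows "f \<otimes>\<^bsub>R\<^esub> g \<in> laurent_skew"
proof -
  have c: "f \<in> carrier R" "g \<in> carrier R" using assms by (auto simp: laurent_skew_def)
  have "f a * a (g b) \<in> lpolys" for a b
  proof (cases "a \<in> M")
    case True
    then obtain v where "a = sh v" by (auto simp: M_eq)
    thus ?thesis using assms sh_lpolys by (auto simp: laurent_skew_def intro: lpolys_mult)
  next
    case False
    hence "f a = 0" using c by (auto simp: carrier_iff)
    thus ?thesis using lpolys_0 by simp
  qed
  thus ?thesis unfolding laurent_skew_def using R_mult[OF c] by (simp add: mult_eq'[OF c] lpolys_sum)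
qed

lemma skew_inv_mult:
  assumes "f \<in> skew_inv" "g \<in> skew_inv"
  shows "f \<otimes>\<^bsub>R\<^esub> g \<in> skew_inv"
  using assms act_mult[OF Gal_aut Gal_normalizes] R_mult by (simp add: skew_invariants_def)

lemma skew_const_skew_inv: "l \<in> K0 \<Longrightarrow> skew_const l \<in> skew_inv"
  unfolding skew_invariants_def
proof (intro CollectI conjI ballI R_monom M_id)
  fix \<sigma> assume l: "l \<in> K0" and s: "\<sigma> \<in> Gal"
  have "\<sigma> l = l" using l s by (simp add: K0_def)
  moreover have "\<sigma> \<circ> id \<circ> ivf \<sigma> = id" using aut_ivf_comp[OF Gal_aut[OF s]] by simp
  ultimately show "skew_act \<sigma> (skew_const l) = skew_const l"
    by (simp only: act_monom[OF Gal_aut[OF s]])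
qed

lemma skew_monom_laurent_skew: "l \<in> lpolys \<Longrightarrow> skew_monom l (sh v) \<in> laurent_skew"
proof -
  assume l: "l \<in> lpolys"
  have "skew_monom l (sh v) a \<in> lpolys" for a
    using l by (auto simp: skew_monom_def intro: subr_0[OF subr_lpolys])
  thus ?thesis using R_monom[OF sh_in_M] by (simp add: laurent_skew_def)
qed

lemma skew_const_torus_inv: "l \<in> Gam \<Longrightarrow> skew_const l \<in> torus_inv"
  using skew_const_skew_inv[of l] skew_monom_laurent_skew[of l "\<lambda>_. 0"] by (simp add: torus_inv_def Gam_eq sh_0)

lemma subring_torus_inv: "subring torus_inv R"
proof -
  interpret ring R by (rule ring_R)
  show ?thesis
  proof (rule subringI)
    show "torus_inv \<subseteq> carrier R" using torus_inv_carrier by blast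
    show "\<one>\<^bsub>R\<^esub> \<in> torus_inv" using skew_const_torus_inv[OF subr_1[OF subr_Gam]] by (simp add: one_eq)
    show "\<ominus>\<^bsub>R\<^esub> f \<in> torus_inv" if "f \<in> torus_inv" for f
    proof -
      have "fscale (- 1) f \<in> torus_inv"
        using submod_scale[OF submod_torus_inv _ that] subr_uminus[OF subr_Gam subr_1[OF subr_Gam]] by blast
      also have "fscale (- 1) f = - f" by (simp add: fun_eq_iff)
      finally show ?thesis by (simp only: a_inv_eq[OF torus_inv_carrier[OF that]])
    qed
    show "f \<otimes>\<^bsub>R\<^esub> g \<in> torus_inv" if "f \<in> torus_inv" "g \<in> torus_inv" for f g
      using that laurent_skew_mult skew_inv_mult by (simp add: torus_inv_def)
    show "f \<oplus>\<^bsub>R\<^esub> g \<in> torus_inv" if "f \<in> torus_inv" "g \<in> torus_inv" for f g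
      using submod_add[OF submod_torus_inv that] by (simp add: add_eq)
  qed
qed

section \<open>The basis of orbit sums\<close>

definition orb :: "('n \<Rightarrow> int) \<times> ('n \<Rightarrow> nat) \<Rightarrow> (('n \<Rightarrow> int) \<times> ('n \<Rightarrow> nat)) set" where
  "orb = (\<lambda>(v, \<phi>). {(v \<circ> \<pi>, \<phi> \<circ> \<pi>) | \<pi>. bij \<pi>})"

definition vec :: "(('n, 'k) ratfun \<Rightarrow> ('n, 'k) ratfun) \<Rightarrow> 'n \<Rightarrow> int" where "vec = inv_into UNIV sh"

text \<open>The orbit sum of an orbit of pairs \<open>(v, \<phi>)\<close>: the sum of all \<open>z\<^sup>\<phi> y\<^sup>v\<close> in it.\<close>
definition beta :: "(('n \<Rightarrow> int) \<times> ('n \<Rightarrow> nat)) set \<Rightarrow> ('n, 'k) skew" where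
  "beta O' = (\<lambda>a. if a \<in> M then (\<Sum>\<phi> | (vec a, \<phi>) \<in> O'. z_monom \<phi>) else 0)"

definition Orbs :: "(('n \<Rightarrow> int) \<times> ('n \<Rightarrow> nat)) set set" where
  "Orbs = orb ` (SIGMA v:UNIV. box v)"

lemma vec_sh: "vec (sh v) = v" unfolding vec_def by (rule inv_into_f_f) (auto simp: inj_def sh_eq_iff)

lemma beta_sh: "beta O' (sh v) = (\<Sum>\<phi> | (v, \<phi>) \<in> O'. z_monom \<phi>)" by (simp add: beta_def sh_in_M vec_sh)

lemma orb_self: "x \<in> orb x"
  unfolding orb_def by (cases x) (auto intro!: exI[of _ id])

lemma orb_perm:
  assumes "bij \<pi>"
  shows "orb (v \<circ> \<pi>, \<phi> \<circ> \<pi>) = orb (v, \<phi>)"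
proof
  show "orb (v \<circ> \<pi>, \<phi> \<circ> \<pi>) \<subseteq> orb (v, \<phi>)"
    using bij_comp[OF _ assms] by (auto simp: orb_def comp_assoc)
  have "v \<circ> \<tau> = v \<circ> \<pi> \<circ> (inv_into UNIV \<pi> \<circ> \<tau>)" "\<phi> \<circ> \<tau> = \<phi> \<circ> \<pi> \<circ> (inv_into UNIV \<pi> \<circ> \<tau>)" for \<tau>
    using assms by (simp_all add: fun_eq_iff bij_is_surj surj_f_inv_f)
  moreover have "bij (inv_into UNIV \<pi> \<circ> \<tau>)" if "bij \<tau>" for \<tau>
    by (rule bij_comp[OF that bij_imp_bij_inv[OF assms]])
  ultimately show "orb (v, \<phi>) \<subseteq> orb (v \<circ> \<pi>, \<phi> \<circ> \<pi>)" unfolding orb_def by fastforce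
qed

lemma orb_eq:
  assumes "y \<in> orb x"
  shows "orb y = orb x"
proof -
  obtain v \<phi> where x: "x = (v, \<phi>)" by fastforce
  obtain \<pi> where "bij \<pi>" "y = (v \<circ> \<pi>, \<phi> \<circ> \<pi>)" using assms by (auto simp: orb_def x)
  thus ?thesis using orb_perm x by simp
qed

lemma Orbs_eq:
  assumes "O' \<in> Orbs" "x \<in> O'"
  shows "O' = orb x"
proof -
  obtain y where y: "O' = orb y" using assms(1) unfolding Orbs_def by blast
  show ?thesis using orb_eq[of x y] assms(2) unfolding y by simp
qed

lemma Orbs_box: "O' \<in> Orbs \<Longrightarrow> (v, \<phi>) \<in> O' \<Longrightarrow> \<phi> \<in> box v"
  by (auto simp: Orbs_def orb_def box_perm)

lemma Orbs_perm: "O' \<in> Orbs \<Longrightarrow> bij \<pi> \<Longrightarrow> (v \<circ> \<pi>, \<phi> \<circ> \<pi>) \<in> O' \<longleftrightarrow> (v, \<phi>) \<in> O'"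
  using Orbs_eq orb_perm orb_self by metis

lemma orb_Orbs: "\<phi> \<in> box v \<Longrightarrow> orb (v, \<phi>) \<in> Orbs" by (auto simp: Orbs_def)

lemma finite_orb: "finite (orb x)"
proof -
  have "orb x = (\<lambda>\<pi>. (fst x \<circ> \<pi>, snd x \<circ> \<pi>)) ` {\<pi>. bij \<pi>}" by (cases x) (auto simp: orb_def)
  thus ?thesis using finite_subset[OF subset_UNIV, of "{\<pi> :: 'n \<Rightarrow> 'n. bij \<pi>}"] by simp
qed

lemma z_monom_lpolys: "z_monom \<phi> \<in> lpolys"
  unfolding z_monom_def by (intro subr_prod[OF subr_lpolys] subr_power[OF subr_lpolys] zvar_lpolys)

lemma H_z_monom:
  assumes "(g, \<pi>) \<in> H"
  shows "ma (g, \<pi>) (z_monom (\<phi> \<circ> \<pi>)) = z_monom \<phi>"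
proof -
  note a = H_aut[OF assms]
  have "ma (g, \<pi>) (z_monom (\<phi> \<circ> \<pi>)) = (\<Prod>j\<in>UNIV. zvar (\<pi> j) ^ \<phi> (\<pi> j))"
    by (simp add: z_monom_def aut_prod[OF a] aut_power[OF a] H_zvar[OF assms])
  also have "\<dots> = z_monom \<phi>" unfolding z_monom_def by (rule prod.reindex_bij_betw[OF H_bij[OF assms]])
  finally show ?thesis .
qed

lemma comp_perm_inj: "bij \<pi> \<Longrightarrow> \<phi> \<circ> \<pi> = \<psi> \<circ> \<pi> \<longleftrightarrow> \<phi> = \<psi>"
  by (metis bij_is_surj fun.map_comp o_inv_o_cancel surj_iff comp_assoc comp_id)

lemma comp_perm_surj: "bij \<pi> \<Longrightarrow> \<exists>\<psi>. \<phi> = \<psi> \<circ> \<pi>"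
  by (rule exI[of _ "\<phi> \<circ> inv_into UNIV \<pi>"]) (simp add: fun_eq_iff bij_is_inj)

lemma beta_torus_inv:
  assumes O': "O' \<in> Orbs"
  shows "beta O' \<in> torus_inv"
proof -
  obtain x where x: "O' = orb x" using O' by (auto simp: Orbs_def)
  have fin: "finite O'" unfolding x by (rule finite_orb)
  have c: "beta O' \<in> carrier R"
  proof (rule carrier_supset[of "sh ` fst ` O'"])
    show "finite (sh ` fst ` O')" using fin by simp
    show "sh ` fst ` O' \<subseteq> M" using sh_in_M by blast
    show "supp (beta O') \<subseteq> sh ` fst ` O'"
    proof
      fix a assume a: "a \<in> supp (beta O')"
      hence "a \<in> M" by (auto simp: beta_def split: if_splits)
      then obtain v where v: "a = sh v" by (auto simp: M_eq)
      have "{\<phi>. (v, \<phi>) \<in> O'} \<noteq> {}"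
      proof
        assume e: "{\<phi>. (v, \<phi>) \<in> O'} = {}"
        have "beta O' (sh v) = 0" unfolding beta_sh e by simp
        thus False using a v by simp
      qed
      then obtain \<phi> where "(v, \<phi>) \<in> O'" by blast
      hence "v \<in> fst ` O'" by (rule image_eqI[rotated]) simp
      thus "a \<in> sh ` fst ` O'" unfolding v by (rule imageI)
    qed
  qed
  have "beta O' a \<in> lpolys" for a
    unfolding beta_def by (auto intro: lpolys_sum z_monom_lpolys lpolys_0)
  moreover have "beta O' \<in> skew_inv"
  proof (rule skew_inv_I[OF c])
    fix g \<pi> v assume h: "(g, \<pi>) \<in> H"
    note b = H_bij[OF h]
    have "{\<phi>. (v \<circ> \<pi>, \<phi>) \<in> O'} = (\<lambda>\<phi>. \<phi> \<circ> \<pi>) ` {\<phi>. (v, \<phi>) \<in> O'}"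
    proof
      show "(\<lambda>\<phi>. \<phi> \<circ> \<pi>) ` {\<phi>. (v, \<phi>) \<in> O'} \<subseteq> {\<phi>. (v \<circ> \<pi>, \<phi>) \<in> O'}" using Orbs_perm[OF O' b] by auto
      show "{\<phi>. (v \<circ> \<pi>, \<phi>) \<in> O'} \<subseteq> (\<lambda>\<phi>. \<phi> \<circ> \<pi>) ` {\<phi>. (v, \<phi>) \<in> O'}"
      proof
        fix \<phi> assume "\<phi> \<in> {\<phi>. (v \<circ> \<pi>, \<phi>) \<in> O'}"
        moreover obtain \<psi> where "\<phi> = \<psi> \<circ> \<pi>" using comp_perm_surj[OF b] by blast
        ultimately show "\<phi> \<in> (\<lambda>\<phi>. \<phi> \<circ> \<pi>) ` {\<phi>. (v, \<phi>) \<in> O'}" using Orbs_perm[OF O' b] by auto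
      qed
    qed
    hence "beta O' (sh (v \<circ> \<pi>)) = (\<Sum>\<phi> | (v, \<phi>) \<in> O'. z_monom (\<phi> \<circ> \<pi>))"
      unfolding beta_sh by (simp add: sum.reindex inj_on_def comp_perm_inj[OF b])
    thus "ma (g, \<pi>) (beta O' (sh (v \<circ> \<pi>))) = beta O' (sh v)"
      by (simp add: aut_sum[OF H_aut[OF h]] H_z_monom[OF h] beta_sh)
  qed
  ultimately show ?thesis using c by (simp add: torus_inv_def laurent_skew_def)
qed

lemma torus_inv_coeff_diag_inv: "f \<in> torus_inv \<Longrightarrow> f (sh v) \<in> diag_inv"
  unfolding diag_inv_def using torus_inv_lpolys[of f] skew_inv_D[of f _ id v] by (simp add: torus_inv_def)

text \<open>
  The permuted expansion of the coefficient at \<open>v \<circ> \<pi>\<close> is an expansion of the coefficient at \<open>v\<close>, with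
  exponents in the right box; uniqueness makes the coordinates constant on orbits.
\<close>
lemma torus_inv_coefficients:
  assumes f: "f \<in> torus_inv"
  shows "\<exists>r. (\<forall>v. \<forall>\<phi>\<in>box v. r v \<phi> \<in> Gam) \<and> (\<forall>v. f (sh v) = (\<Sum>\<phi>\<in>box v. r v \<phi> * z_monom \<phi>)) \<and>
    (\<forall>v. \<forall>\<phi>\<in>box v. \<forall>\<pi>. bij \<pi> \<longrightarrow> r (v \<circ> \<pi>) (\<phi> \<circ> \<pi>) = r v \<phi>)"
proof -
  have SIf: "f \<in> skew_inv" using f by (simp add: torus_inv_def)
  have "\<exists>r. (\<forall>\<phi>\<in>box v. r \<phi> \<in> Gam) \<and> f (sh v) = (\<Sum>\<phi>\<in>box v. r \<phi> * z_monom \<phi>)" for v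
  proof (rule expansion[OF torus_inv_coeff_diag_inv[OF f]])
    fix \<pi> :: "'n \<Rightarrow> 'n" assume "bij \<pi>" "v \<circ> \<pi> = v"
    thus "perm_aut \<pi> (f (sh v)) = f (sh v)" using skew_inv_D[OF SIf perm_in_H, of \<pi> v] by simp
  qed
  then obtain r where r: "\<And>v \<phi>. \<phi> \<in> box v \<Longrightarrow> r v \<phi> \<in> Gam" "\<And>v. f (sh v) = (\<Sum>\<phi>\<in>box v. r v \<phi> * z_monom \<phi>)"
    by metis
  have "r (v \<circ> \<pi>) (\<phi> \<circ> \<pi>) = r v \<phi>" if \<phi>: "\<phi> \<in> box v" and b: "bij \<pi>" for v \<phi> \<pi>
  proof -
    note a = perm_aut_aut[OF b]
    have "box (v \<circ> \<pi>) = (\<lambda>\<phi>. \<phi> \<circ> \<pi>) ` box v"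
    proof
      show "(\<lambda>\<phi>. \<phi> \<circ> \<pi>) ` box v \<subseteq> box (v \<circ> \<pi>)" using box_perm[OF b] by auto
      show "box (v \<circ> \<pi>) \<subseteq> (\<lambda>\<phi>. \<phi> \<circ> \<pi>) ` box v"
      proof
        fix \<phi> assume "\<phi> \<in> box (v \<circ> \<pi>)"
        moreover obtain \<psi> where "\<phi> = \<psi> \<circ> \<pi>" using comp_perm_surj[OF b] by blast
        ultimately show "\<phi> \<in> (\<lambda>\<phi>. \<phi> \<circ> \<pi>) ` box v" using box_perm[OF b] by auto
      qed
    qed
    hence "f (sh (v \<circ> \<pi>)) = (\<Sum>\<phi>\<in>box v. r (v \<circ> \<pi>) (\<phi> \<circ> \<pi>) * z_monom (\<phi> \<circ> \<pi>))"
      unfolding r(2)[of "v \<circ> \<pi>"] by (simp add: sum.reindex inj_on_def comp_perm_inj[OF b])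
    hence "perm_aut \<pi> (f (sh (v \<circ> \<pi>))) = (\<Sum>\<phi>\<in>box v. perm_aut \<pi> (r (v \<circ> \<pi>) (\<phi> \<circ> \<pi>)) * z_monom \<phi>)"
      by (simp add: aut_sum[OF a] aut_mult[OF a] H_z_monom[OF perm_in_H[OF b]])
    also have "\<dots> = (\<Sum>\<phi>\<in>box v. r (v \<circ> \<pi>) (\<phi> \<circ> \<pi>) * z_monom \<phi>)"
      using r(1) box_perm[OF b] by (intro sum.cong refl arg_cong2[of _ _ _ _ "(*)"] perm_aut_K0[OF b]) (auto simp: Gam_eq)
    finally have "(\<Sum>\<phi>\<in>box v. (r (v \<circ> \<pi>) (\<phi> \<circ> \<pi>) - r v \<phi>) * z_monom \<phi>) = 0"
      using skew_inv_D[OF SIf perm_in_H[OF b], of v] r(2)[of v] by (simp add: left_diff_distrib sum_subtractf)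
    from expansion_unique[OF _ this \<phi>] show ?thesis
      using r(1) box_perm[OF b] subr_diff[OF subr_K0] by (auto simp: Gam_eq)
  qed
  thus ?thesis using r by blast
qed

text \<open>
  The coordinate at an orbit does not depend on the representative. The bound \<open>V\<close> on the support is
  kept, because the order condition and the finite generation both need finitely many basis elements.
\<close>
lemma torus_inv_span:
  assumes f: "f \<in> torus_inv" and V: "finite V" "\<And>v. f (sh v) \<noteq> 0 \<Longrightarrow> v \<in> V"
  shows "f \<in> lin fscale Gam (beta ` orb ` (SIGMA v:V. box v))"
proof -
  obtain r where r: "\<And>v \<phi>. \<phi> \<in> box v \<Longrightarrow> r v \<phi> \<in> Gam" "\<And>v. f (sh v) = (\<Sum>\<phi>\<in>box v. r v \<phi> * z_monom \<phi>)"
    "\<And>v \<phi> \<pi>. \<phi> \<in> box v \<Longrightarrow> bij \<pi> \<Longrightarrow> r (v \<circ> \<pi>) (\<phi> \<circ> \<pi>) = r v \<phi>"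
    using torus_inv_coefficients[OF f] by blast
  define F where "F = orb ` (SIGMA v:V. box v)"
  have fin: "finite F" unfolding F_def using V(1) finite_box by (intro finite_imageI finite_SigmaI)
  have FO: "F \<subseteq> Orbs" unfolding F_def Orbs_def by blast
  \<comment> \<open>The common coordinate on an orbit, read off at any representative.\<close>
  define \<gamma> where "\<gamma> O' = (let x = (SOME x. x \<in> O') in r (fst x) (snd x))" for O'
  have \<gamma>: "\<gamma> O' = r v \<phi>" if O': "O' \<in> Orbs" and x: "(v, \<phi>) \<in> O'" for O' v \<phi>
  proof -
    have "(SOME x. x \<in> O') \<in> O'" using x by (rule someI)
    hence "(SOME x. x \<in> O') \<in> orb (v, \<phi>)" using Orbs_eq[OF O' x] by simp
    then obtain \<pi> where "bij \<pi>" "(SOME x. x \<in> O') = (v \<circ> \<pi>, \<phi> \<circ> \<pi>)" by (auto simp: orb_def)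
    thus ?thesis using r(3)[OF Orbs_box[OF O' x]] by (simp add: \<gamma>_def)
  qed
  have \<gamma>_Gam: "\<gamma> O' \<in> Gam" if O': "O' \<in> F" for O'
  proof -
    obtain v \<phi> where "\<phi> \<in> box v" "O' = orb (v, \<phi>)" using O' unfolding F_def by blast
    thus ?thesis using \<gamma>[of O' v \<phi>] orb_self[of "(v, \<phi>)"] orb_Orbs r(1) by simp
  qed
  have "f = (\<Sum>O'\<in>F. fscale (\<gamma> O') (beta O'))"
  proof
    fix a
    show "f a = (\<Sum>O'\<in>F. fscale (\<gamma> O') (beta O')) a"
    proof (cases "a \<in> M")
      case False
      thus ?thesis using torus_inv_carrier[OF f] by (auto simp: carrier_iff sum_fun_apply beta_def)
    next
      case True
      then obtain u where u: "a = sh u" by (auto simp: M_eq)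
      have "(\<Sum>O'\<in>F. fscale (\<gamma> O') (beta O')) a = (\<Sum>O'\<in>F. \<Sum>\<phi> | (u, \<phi>) \<in> O'. \<gamma> O' * z_monom \<phi>)"
        by (simp add: sum_fun_apply u beta_sh sum_distrib_left)
      also have "\<dots> = (\<Sum>O'\<in>F. \<Sum>\<phi>\<in>box u. if O' = orb (u, \<phi>) then r u \<phi> * z_monom \<phi> else 0)"
      proof (rule sum.cong[OF refl])
        fix O' assume "O' \<in> F"
        hence O': "O' \<in> Orbs" using FO by blast
        have iff: "(u, \<phi>) \<in> O' \<longleftrightarrow> O' = orb (u, \<phi>)" for \<phi> using Orbs_eq[OF O'] orb_self by blast
        have "(\<Sum>\<phi> | (u, \<phi>) \<in> O'. \<gamma> O' * z_monom \<phi>) = (\<Sum>\<phi> | (u, \<phi>) \<in> O'. r u \<phi> * z_monom \<phi>)"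
          using \<gamma>[OF O'] by (intro sum.cong) auto
        also have "\<dots> = (\<Sum>\<phi>\<in>box u. if O' = orb (u, \<phi>) then r u \<phi> * z_monom \<phi> else 0)"
          using Orbs_box[OF O'] iff by (intro sum.mono_neutral_cong_left finite_box) auto
        finally show "(\<Sum>\<phi> | (u, \<phi>) \<in> O'. \<gamma> O' * z_monom \<phi>) = (\<Sum>\<phi>\<in>box u. if O' = orb (u, \<phi>) then r u \<phi> * z_monom \<phi> else 0)" .
      qed
      also have "\<dots> = (\<Sum>\<phi>\<in>box u. \<Sum>O'\<in>F. if O' = orb (u, \<phi>) then r u \<phi> * z_monom \<phi> else 0)" by (rule sum.swap)
      also have "\<dots> = (\<Sum>\<phi>\<in>box u. r u \<phi> * z_monom \<phi>)"
      proof (rule sum.cong[OF refl])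
        fix \<phi> assume \<phi>: "\<phi> \<in> box u"
        have "r u \<phi> = 0" if "orb (u, \<phi>) \<notin> F"
        proof -
          have "u \<notin> V" using that \<phi> by (auto simp: F_def)
          hence "(\<Sum>\<phi>\<in>box u. r u \<phi> * z_monom \<phi>) = 0" using V(2)[of u] r(2)[of u] by auto
          from expansion_unique[OF _ this \<phi>] show ?thesis using r(1) by (auto simp: Gam_eq)
        qed
        thus "(\<Sum>O'\<in>F. if O' = orb (u, \<phi>) then r u \<phi> * z_monom \<phi> else 0) = r u \<phi> * z_monom \<phi>"
          using fin by simp
      qed
      finally show ?thesis using r(2)[of u] u by simp
    qed
  qed
  moreover have "(\<Sum>O'\<in>F. fscale (\<gamma> O') (beta O')) \<in> lin fscale Gam (beta ` F)"
  proof -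
    note sub = submod_lin[OF module_fscale subr_Gam, of "beta ` F"]
    have "beta ` F \<subseteq> lin fscale Gam (beta ` F)" using fin by (intro lin_incl[OF module_fscale subr_Gam]) simp
    thus ?thesis using \<gamma>_Gam by (intro submod_sum[OF sub] submod_scale[OF sub]) auto
  qed
  ultimately show ?thesis by (simp only: F_def)
qed

lemma supp_finite: "f \<in> carrier R \<Longrightarrow> finite {v. f (sh v) \<noteq> 0}"
proof -
  assume f: "f \<in> carrier R"
  have "sh ` {v. f (sh v) \<noteq> 0} \<subseteq> supp f" by auto
  hence "finite (sh ` {v. f (sh v) \<noteq> 0})" using f finite_subset by (auto simp: carrier_iff)
  thus ?thesis by (rule finite_imageD) (auto simp: inj_on_def sh_eq_iff)
qed

text \<open>
  Evaluated at \<open>v\<close>, distinct orbits contribute distinct monomials \<open>z\<^sup>\<phi>\<close> of the box at \<open>v\<close>, so that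
  the uniqueness of the expansion applies.
\<close>
lemma beta_independent:
  assumes "finite F" "F \<subseteq> beta ` Orbs" "\<And>b. b \<in> F \<Longrightarrow> c b \<in> Gam" "(\<Sum>b\<in>F. fscale (c b) b) = 0" "b0 \<in> F"
  shows "c b0 = 0"
proof -
  have "\<forall>b\<in>F. \<exists>O'. O' \<in> Orbs \<and> b = beta O'" using assms(2) by blast
  then obtain ob where ob: "\<And>b. b \<in> F \<Longrightarrow> ob b \<in> Orbs" "\<And>b. b \<in> F \<Longrightarrow> b = beta (ob b)" by metis
  obtain u \<phi>0 where u: "\<phi>0 \<in> box u" "ob b0 = orb (u, \<phi>0)" using ob(1)[OF assms(5)] by (auto simp: Orbs_def)
  have iff: "(u, \<phi>) \<in> ob b \<longleftrightarrow> ob b = orb (u, \<phi>)" if "b \<in> F" for b \<phi> using Orbs_eq[OF ob(1)[OF that]] orb_self by blast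
  define s where "s \<phi> = (\<Sum>b\<in>F. if (u, \<phi>) \<in> ob b then c b else 0)" for \<phi>
  have "0 = (\<Sum>b\<in>F. fscale (c b) b) (sh u)" by (simp add: assms(4))
  also have "\<dots> = (\<Sum>b\<in>F. c b * beta (ob b) (sh u))" using ob(2) by (simp add: sum_fun_apply)
  also have "\<dots> = (\<Sum>b\<in>F. \<Sum>\<phi>\<in>box u. if (u, \<phi>) \<in> ob b then c b * z_monom \<phi> else 0)"
  proof (rule sum.cong[OF refl])
    fix b assume "b \<in> F"
    show "c b * beta (ob b) (sh u) = (\<Sum>\<phi>\<in>box u. if (u, \<phi>) \<in> ob b then c b * z_monom \<phi> else 0)"
      unfolding beta_sh sum_distrib_left using Orbs_box[OF ob(1)[OF \<open>b \<in> F\<close>]]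
      by (intro sum.mono_neutral_cong_left finite_box) auto
  qed
  also have "\<dots> = (\<Sum>\<phi>\<in>box u. \<Sum>b\<in>F. if (u, \<phi>) \<in> ob b then c b * z_monom \<phi> else 0)" by (rule sum.swap)
  also have "\<dots> = (\<Sum>\<phi>\<in>box u. s \<phi> * z_monom \<phi>)"
    unfolding s_def sum_distrib_right by (intro sum.cong refl) auto
  finally have 0: "(\<Sum>\<phi>\<in>box u. s \<phi> * z_monom \<phi>) = 0" by simp
  have "s \<phi> \<in> K0" for \<phi>
    unfolding s_def using assms(3) subr_0[OF subr_K0] by (intro subr_sum[OF subr_K0]) (auto simp: Gam_eq)
  from expansion_unique[OF this 0 u(1)] have "s \<phi>0 = 0" .
  moreover have "s \<phi>0 = (\<Sum>b\<in>F. if b = b0 then c b else 0)"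
    unfolding s_def
  proof (rule sum.cong[OF refl])
    fix b assume b: "b \<in> F"
    have "(u, \<phi>0) \<in> ob b \<longleftrightarrow> b = b0" using iff[OF b, of \<phi>0] u(2) ob(2)[OF b] ob(2)[OF assms(5)] by metis
    thus "(if (u, \<phi>0) \<in> ob b then c b else 0) = (if b = b0 then c b else 0)" by simp
  qed
  ultimately show ?thesis using assms(1,5) by simp
qed

lemma lspan_beta: "lspan Gam (beta ` Orbs) = torus_inv"
proof
  show "lspan Gam (beta ` Orbs) \<subseteq> torus_inv" using beta_torus_inv by (intro lspan_least submod_torus_inv) blast
  show "torus_inv \<subseteq> lspan Gam (beta ` Orbs)"
  proof
    fix f assume f: "f \<in> torus_inv"
    let ?V = "{v. f (sh v) \<noteq> 0}" and ?F = "beta ` orb ` (SIGMA v:{v. f (sh v) \<noteq> 0}. box v)"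
    have V: "finite ?V" by (rule supp_finite[OF torus_inv_carrier[OF f]])
    have "f \<in> lin fscale Gam ?F" by (rule torus_inv_span[OF f V]) simp
    moreover have "finite ?F" using V finite_box by (intro finite_imageI finite_SigmaI)
    moreover have "?F \<subseteq> beta ` Orbs" unfolding Orbs_def by blast
    ultimately show "f \<in> lspan Gam (beta ` Orbs)" unfolding lspan_def by blast
  qed
qed

section \<open>Galois data\<close>

lemma subring_eq: "subring S (ring_of_type_algebra :: ('n, 'k) ratfun ring) \<longleftrightarrow> subr S"
  by (rule subring_type_iff)

lemma subfield_type:
  assumes "subr (S :: ('n, 'k) ratfun set)" "\<And>x. x \<in> S \<Longrightarrow> inverse x \<in> S"
  shows "subfield S ring_of_type_algebra"
proof -
  let ?L = "ring_of_type_algebra :: ('n, 'k) ratfun ring"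
  interpret field ?L by (rule field_from_type_algebra)
  show ?thesis
  proof (rule subfieldI')
    show "subring S ?L" using assms(1) by (simp add: subring_eq)
    fix x assume x: "x \<in> S - {\<zero>\<^bsub>?L\<^esub>}"
    hence "inv\<^bsub>?L\<^esub> x = inverse x" by (intro comm_inv_char) auto
    thus "inv\<^bsub>?L\<^esub> x \<in> S" using assms(2) x by simp
  qed
qed

lemma subfield_K0: "subfield K0 ring_of_type_algebra"
  by (rule subfield_type[OF subr_K0 K0_inverse])

lemma xm_remainder:
  "\<exists>\<rho>. (\<forall>i. \<rho> i < m) \<and> (\<exists>u. xm v = xm (\<lambda>i. int (\<rho> i)) * (\<Prod>i\<in>UNIV. zvar i powi u i))"
proof -
  define \<rho> where "\<rho> i = nat (v i mod int m)" for i
  have \<rho>: "\<rho> i < m" for i using m_pos by (simp add: \<rho>_def nat_less_iff)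
  have "v = (\<lambda>i. int (\<rho> i) + int m * (v i div int m))" using m_pos by (simp add: \<rho>_def fun_eq_iff)
  hence "xm v = (xm (\<lambda>i. int (\<rho> i)) * xm (\<lambda>i. int m * (v i div int m)) :: ('n, 'k) ratfun)"
    by (metis xm_add)
  also have "xm (\<lambda>i. int m * (v i div int m)) = (\<Prod>i\<in>UNIV. zvar i powi (v i div int m))"
    unfolding xm_def zvar_def by (intro prod.cong refl) (simp add: power_int_mult)
  finally have "xm v = xm (\<lambda>i. int (\<rho> i)) * (\<Prod>i\<in>UNIV. zvar i powi (v i div int m))" .
  thus ?thesis using \<rho> by (intro exI[of _ \<rho>] exI[of _ "\<lambda>i. v i div int m"] conjI allI)
qed

text \<open>
  Modulo powers of the \<open>z\<^sub>i\<close> there are finitely many Laurent monomials, the \<open>z\<^sub>i\<close> are integral over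
  \<open>\<Gamma>\<close>, and denominators can be taken in \<open>\<Gamma>\<close>. Spanning is stated
  through the subspaces that contain \<open>B\<close>, which compares easily with other notions of span.
\<close>
lemma finite_spanning:
  "\<exists>B :: ('n, 'k) ratfun set. finite B \<and> (\<forall>N. submod (*) K0 N \<longrightarrow> B \<subseteq> N \<longrightarrow> N = UNIV)"
proof -
  obtain xs :: "'n list" where xs: "distinct xs" "set xs = UNIV" using exists_enum by blast
  define P where "P = {\<rho> :: 'n \<Rightarrow> nat. \<forall>i. (i \<in> UNIV \<longrightarrow> \<rho> i \<in> {..<m}) \<and> (i \<notin> UNIV \<longrightarrow> \<rho> i = 0)}"
  define B where "B = (\<lambda>(\<rho>, \<phi>). xm (\<lambda>i. int (\<rho> i)) * z_monom \<phi>) ` (P \<times> stair xs)"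
  have "finite P" unfolding P_def by (intro finite_set_of_finite_funs) auto
  hence fin: "finite B" unfolding B_def using finite_stair by blast
  have "N = UNIV" if N: "submod (*) K0 N" and B: "B \<subseteq> N" for N
  proof -
    note S = subr_adjoin[OF subr_Gam_gen, of "range zvar"]
    have mono: "xm v \<in> N" for v
    proof -
      obtain \<rho> u where \<rho>: "\<forall>i. \<rho> i < m" "xm v = xm (\<lambda>i. int (\<rho> i)) * (\<Prod>i\<in>UNIV. zvar i powi u i)"
        using xm_remainder by blast
      have "(\<Prod>i\<in>UNIV. zvar i powi u i) \<in> adjoin Gam_gen (zvar ` set xs)"
        unfolding xs(2) by (intro subr_prod[OF S] zvar_powi_adjoin)
      moreover have "coeff (\<Prod>i\<in>set xs. [:- zvar i, 1:]) k \<in> Gam_gen" for k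
        unfolding xs(2) zpoly_def[symmetric] Gam_gen_def by (rule adjoin.gen) simp
      ultimately obtain r where r: "\<forall>\<phi>\<in>stair xs. r \<phi> \<in> Gam_gen" "(\<Prod>i\<in>UNIV. zvar i powi u i) = (\<Sum>\<phi>\<in>stair xs. r \<phi> * z_monom \<phi>)"
        using stair_span[OF xs(1) subr_Gam_gen, of zvar] unfolding z_monom_def xs(2) by blast
      have "xm v = (\<Sum>\<phi>\<in>stair xs. r \<phi> * (xm (\<lambda>i. int (\<rho> i)) * z_monom \<phi>))"
        unfolding \<rho>(2) r(2) sum_distrib_left by (simp only: mult_ac)
      also have "\<dots> \<in> N"
      proof (rule submod_sum[OF N], rule submod_scale[OF N])
        fix \<phi> assume \<phi>: "\<phi> \<in> stair xs"
        show "r \<phi> \<in> K0" using r(1) \<phi> Gam_gen_subset by (auto simp: Gam_eq)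
        have "(\<rho>, \<phi>) \<in> P \<times> stair xs" using \<rho>(1) \<phi> by (simp add: P_def)
        hence "xm (\<lambda>i. int (\<rho> i)) * z_monom \<phi> \<in> B" unfolding B_def by (intro image_eqI[where x = "(\<rho>, \<phi>)"]) simp_all
        thus "xm (\<lambda>i. int (\<rho> i)) * z_monom \<phi> \<in> N" using B by blast
      qed
      finally show ?thesis .
    qed
    have "f \<in> N" for f
    proof -
      obtain u D where u: "u \<in> lpolys" "D \<in> Gam" "D \<noteq> 0" "f = u / D" using ratfun_quotient by blast
      obtain V c where V: "u = (\<Sum>v\<in>V. rf_const (c v) * xm v)" using u(1) by (auto simp: lpolys_def)
      have "u \<in> N" unfolding V by (intro submod_sum[OF N] submod_scale[OF N] mono K0_const)
      moreover have "inverse D \<in> K0" using u(2) K0_inverse by (simp add: Gam_eq)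
      ultimately have "inverse D * u \<in> N" by (rule submod_scale[OF N, rotated])
      thus ?thesis by (simp add: u(4) divide_inverse mult.commute)
    qed
    thus ?thesis by blast
  qed
  thus ?thesis using fin by (intro exI[of _ B]) blast
qed

lemma finite_dimension_K0: "ring.finite_dimension ring_of_type_algebra K0 (UNIV :: ('n, 'k) ratfun set)"
proof -
  let ?L = "ring_of_type_algebra :: ('n, 'k) ratfun ring"
  interpret ring ?L by (rule ring_from_type_algebra)
  obtain B :: "('n, 'k) ratfun set" where B: "finite B" "\<And>N. submod (*) K0 N \<Longrightarrow> B \<subseteq> N \<Longrightarrow> N = UNIV"
    using finite_spanning by blast
  obtain Us where Us: "set Us = B" using finite_list[OF B(1)] by blast
  have c: "set Us \<subseteq> carrier ?L" by simp
  have sub: "submod (*) K0 (Span K0 Us)" for Us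
  proof -
    have c: "set Us \<subseteq> carrier ?L" by simp
    show ?thesis unfolding submod_def
      using Span_subgroup_props(2,3)[OF subfield_K0 c] Span_smult_closed[OF subfield_K0 c] by simp
  qed
  have "set Us \<subseteq> Span K0 Us" for Us
  proof (induction Us)
    case (Cons u Us)
    have "\<exists>k\<in>K0. \<exists>w\<in>Span K0 Us. u = k \<otimes>\<^bsub>?L\<^esub> u \<oplus>\<^bsub>?L\<^esub> w"
    proof (intro bexI)
      show "u = 1 \<otimes>\<^bsub>?L\<^esub> u \<oplus>\<^bsub>?L\<^esub> 0" by simp
    qed (rule submod_0[OF sub], rule subr_1[OF subr_K0])
    hence "u \<in> Span K0 (u # Us)" using line_extension_mem_iff[of u K0 u "Span K0 Us"] by simp
    moreover have "Span K0 Us \<subseteq> Span K0 (u # Us)" by (rule mono_Span[OF subfield_K0]) simp_all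
    ultimately show ?case using Cons by auto
  qed simp
  hence "Span K0 Us = UNIV" using B(2)[OF sub, of Us] Us by blast
  thus ?thesis using Span_finite_dimension[OF subfield_K0 c] by simp
qed

text \<open>
  A shift that is trivial on the fixed field belongs to the finite group. There it would multiply \<open>z\<^sub>i\<close> by
  a power of \<open>q\<close> while permuting the \<open>z\<^sub>i\<close>; as \<open>q\<close> is not a root of unity, it is trivial.
\<close>
lemma sh_K0_faithful:
  assumes "\<And>x. x \<in> K0 \<Longrightarrow> sh v x = sh w x"
  shows "v = w"
proof -
  let ?u = "\<lambda>i. - w i + v i"
  have "sh ?u x = x" if "x \<in> K0" for x
  proof -
    have "sh ?u x = sh (\<lambda>i. - w i) (sh v x)" using sh_add[of "\<lambda>i. - w i" v] by (metis comp_apply)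
    also have "\<dots> = sh (\<lambda>i. - w i + w i) x" using assms[OF that] sh_add[of "\<lambda>i. - w i" w] by (metis comp_apply)
    finally show ?thesis by (simp add: sh_0)
  qed
  hence "sh ?u \<in> Aut_over K0" using sh_aut by (simp add: Aut_over_iff)
  then obtain g \<pi> where h: "(g, \<pi>) \<in> H" "sh ?u = ma (g, \<pi>)" unfolding Aut_over_K0 Gal_def by auto
  have "?u i = 0" for i
  proof -
    have "sh ?u (zvar i) = rf_const (q powi (?u i * int m)) * zvar i"
      by (simp add: zvar_def aut_power[OF sh_aut] sh_var power_mult_distrib rf_const_power[symmetric] power_int_mult)
    hence eq: "rf_const (q powi (?u i * int m)) * zvar i = zvar (\<pi> i)" using H_zvar[OF h(1)] h(2) by simp
    have "\<pi> i = i"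
    proof (rule ccontr)
      assume ne: "\<pi> i \<noteq> i"
      let ?e = "\<lambda>i j. if j = i then int m else 0"
      have e: "?e i \<noteq> ?e (\<pi> i)" using ne m_pos by (auto simp: fun_eq_iff split: if_splits intro!: exI[of _ i])
      have "(\<Sum>v\<in>{?e i, ?e (\<pi> i)}. rf_const (if v = ?e i then q powi (?u i * int m) else - 1) * xm v) = (0 :: ('n, 'k) ratfun)"
        using e eq by (simp add: zvar_xm[symmetric] rf_const_uminus)
      from xm_independent[OF _ this, of "?e i"] show False using q_nonzero by simp
    qed
    hence "rf_const (q powi (?u i * int m)) = (rf_const 1 :: ('n, 'k) ratfun)" using eq by simp
    hence "q powi (?u i * int m) = 1" by (simp only: rf_const_eq_iff)
    thus ?thesis using m_pos by (simp add: q_powi_eq_1_iff)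
  qed
  thus ?thesis by (simp add: fun_eq_iff)
qed

lemma Galois_data: "Galois_data rf_consts Gam Gal M"
  unfolding Galois_data_def
proof (intro conjI ballI)
  show "subfield rf_consts (ring_of_type_algebra :: ('n, 'k) ratfun ring)"
    by (rule subfield_type[OF subr_consts]) (auto simp: rf_const_inverse[symmetric])
  show "subring Gam ring_of_type_algebra" using subr_Gam by (simp add: subring_eq)
  show "rf_consts \<subseteq> Gam" using Gam_const by blast
  show "finite_Galois (fractions Gam)"
    unfolding finite_Galois_def fractions_Gam Aut_over_K0
    using subfield_K0 finite_dimension_K0 by (simp add: K0_def)
  show "Gal = Aut_over (fractions Gam)" by (simp add: fractions_Gam Aut_over_K0)
  show "M \<subseteq> Aut_over rf_consts" by (auto simp: M_eq Aut_over_iff sh_aut sh_const)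
  show "id \<in> M" by (rule M_id)
  show "a \<circ> b \<in> M" if "a \<in> M" "b \<in> M" for a b using that by (rule M_comp)
  show "(\<forall>x\<in>fractions Gam. a x = b x) \<longrightarrow> a = b" if ab: "a \<in> M" "b \<in> M" for a b
  proof
    assume *: "\<forall>x\<in>fractions Gam. a x = b x"
    obtain v w where "a = sh v" "b = sh w" using ab by (auto simp: M_eq)
    thus "a = b" using sh_K0_faithful[of v w] * by (simp add: fractions_Gam)
  qed
  show "\<sigma> \<circ> a \<circ> ivf \<sigma> \<in> M" if "\<sigma> \<in> Gal" "a \<in> M" for \<sigma> a using that by (rule Gal_normalizes)
qed

section \<open>The order condition on the left\<close>

lemma common_denominator:
  assumes "finite A"
  shows "\<exists>N\<in>Gam. N \<noteq> 0 \<and> (\<forall>a\<in>A. N * f a \<in> lpolys)"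
  using assms
proof (induction A rule: finite_induct)
  case empty
  show ?case using subr_1[OF subr_Gam] by (intro bexI[of _ 1]) auto
next
  case (insert a A)
  then obtain N where N: "N \<in> Gam" "N \<noteq> 0" "\<forall>a\<in>A. N * f a \<in> lpolys" by blast
  obtain u D where u: "u \<in> lpolys" "D \<in> Gam" "D \<noteq> 0" "f a = u / D" using ratfun_quotient by blast
  have l: "N \<in> lpolys" "D \<in> lpolys" using N u by (auto simp: Gam_eq)
  have e: "D * N * f a = N * u" using u by simp
  have "D * N * f a \<in> lpolys" unfolding e by (rule lpolys_mult[OF l(1) u(1)])
  moreover have "D * N * f b \<in> lpolys" if "b \<in> A" for b
    using lpolys_mult[OF l(2)] N(3) that by (simp add: mult.assoc)
  ultimately show ?case using N u subr_mult[OF subr_Gam u(2) N(1)] by (intro bexI[of _ "D * N"]) auto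
qed

lemma lspan_K0_torus_inv: "lspan K0 torus_inv = skew_inv"
proof
  show "lspan K0 torus_inv \<subseteq> skew_inv" by (rule lspan_least[OF submod_skew_inv]) (auto simp: torus_inv_def)
  show "skew_inv \<subseteq> lspan K0 torus_inv"
  proof
    fix f assume f: "f \<in> skew_inv"
    have fin: "finite (supp f)" using skew_inv_carrier[OF f] by (simp add: carrier_iff)
    obtain N where N: "N \<in> Gam" "N \<noteq> 0" "\<forall>a\<in>supp f. N * f a \<in> lpolys" using common_denominator[OF fin, of f] by blast
    have NK: "N \<in> K0" using N(1) by (simp add: Gam_eq)
    have "fscale N f a \<in> lpolys" for a using N(3) lpolys_0 by (cases "f a = 0") auto
    hence "fscale N f \<in> torus_inv"
      using submod_scale[OF submod_skew_inv NK f] skew_inv_carrier unfolding torus_inv_def laurent_skew_def by blast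
    hence "fscale N f \<in> lspan K0 torus_inv" using lspan_incl[OF subr_K0] by blast
    hence "fscale (inverse N) (fscale N f) \<in> lspan K0 torus_inv"
      by (rule submod_scale[OF submod_lspan[OF subr_K0] K0_inverse[OF NK]])
    moreover have "fscale (inverse N) (fscale N f) = f" using N(2) by (simp add: fun_eq_iff)
    ultimately show "f \<in> lspan K0 torus_inv" by simp
  qed
qed

text \<open>
  The elements of the subspace have their support in that of the finitely many generators, hence its
  integral elements lie in the \<open>\<Gamma>\<close>-module spanned by finitely many basis elements, which is Noetherian.
\<close>
lemma left_order:
  assumes "finite E" "E \<subseteq> skew_inv"
  shows "\<exists>F. finite F \<and> F \<subseteq> lspan K0 E \<inter> torus_inv \<and> lspan K0 E \<inter> torus_inv = lspan Gam F"
proof -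
  define V where "V = (\<Union>e\<in>E. {v. e (sh v) \<noteq> 0})"
  have V: "finite V" unfolding V_def using assms supp_finite skew_inv_carrier by blast
  define B where "B = beta ` orb ` (SIGMA v:V. box v)"
  have B: "finite B" unfolding B_def using V finite_box by (intro finite_imageI finite_SigmaI)
  have "submod fscale K0 (lspan K0 E)" by (rule submod_lspan[OF subr_K0])
  hence sub: "submod fscale Gam (lspan K0 E \<inter> torus_inv)" using submod_torus_inv by (auto simp: submod_def Gam_eq)
  have supp: "f (sh v) = 0" if "f \<in> lspan K0 E" "v \<notin> V" for f v
  proof -
    have "submod fscale K0 {f. f (sh v) = 0}" by (simp add: submod_def)
    moreover have "E \<subseteq> {f. f (sh v) = 0}" using that(2) by (auto simp: V_def)
    ultimately show ?thesis using lspan_least that(1) by blast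
  qed
  have "lspan K0 E \<inter> torus_inv \<subseteq> lin fscale Gam B"
  proof
    fix f assume f: "f \<in> lspan K0 E \<inter> torus_inv"
    show "f \<in> lin fscale Gam B" unfolding B_def by (rule torus_inv_span[OF _ V]) (use f supp in auto)
  qed
  from fg_submod[OF module_fscale subr_Gam noeth_Gam B sub this]
  obtain F where F: "finite F" "F \<subseteq> lspan K0 E \<inter> torus_inv" "lspan K0 E \<inter> torus_inv \<subseteq> lin fscale Gam F" by (auto simp: fg_def)
  have "lin fscale Gam F \<subseteq> lspan K0 E \<inter> torus_inv" by (rule lin_least[OF sub F(2)])
  hence "lspan K0 E \<inter> torus_inv = lspan Gam F" using F lspan_finite[OF subr_Gam F(1)] by blast
  thus ?thesis using F by blast
qed

section \<open>The order condition on the right\<close>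

text \<open>The group acts by automorphisms that commute with \<open>iota\<close>.\<close>
lemma iota_skew_inv: "f \<in> skew_inv \<Longrightarrow> iota f \<in> skew_inv"
proof (rule skew_inv_I)
  assume f: "f \<in> skew_inv"
  show "iota f \<in> carrier R" by (rule iota_closed[OF skew_inv_carrier[OF f]])
  fix g \<pi> v assume h: "(g, \<pi>) \<in> H"
  have i: "iota f (sh w) = sh w (f (sh (\<lambda>i. - w i)))" for w by (simp add: iota_def sh_in_M sh_uminus)
  have a: "is_aut (ma (g, \<pi>))" by (rule H_aut[OF h])
  have "ma (g, \<pi>) \<circ> sh (v \<circ> \<pi>) \<circ> ivf (ma (g, \<pi>)) = sh (v \<circ> \<pi> \<circ> ivf \<pi>)"
    by (rule conj_sh[OF _ H_bij[OF h]]) (rule H_nonzero[OF h])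
  also have "v \<circ> \<pi> \<circ> ivf \<pi> = v" using H_bij[OF h] by (simp add: fun_eq_iff bij_is_surj surj_f_inv_f)
  finally have c: "ma (g, \<pi>) \<circ> sh (v \<circ> \<pi>) \<circ> ivf (ma (g, \<pi>)) = sh v" .
  have comm: "ma (g, \<pi>) (sh (v \<circ> \<pi>) x) = sh v (ma (g, \<pi>) x)" for x
    using fun_cong[OF c, of "ma (g, \<pi>) x"] by (simp add: aut_ivf_left[OF a])
  have "ma (g, \<pi>) (f (sh (\<lambda>i. - (v \<circ> \<pi>) i))) = f (sh (\<lambda>i. - v i))"
    using skew_inv_D[OF f h, of "\<lambda>i. - v i"] by (simp add: o_def)
  thus "ma (g, \<pi>) (iota f (sh (v \<circ> \<pi>))) = iota f (sh v)" unfolding i comm by simp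
qed

lemma iota_laurent_skew: "f \<in> laurent_skew \<Longrightarrow> iota f \<in> laurent_skew"
proof -
  assume f: "f \<in> laurent_skew"
  have "iota f a \<in> lpolys" for a
  proof (cases "a \<in> M")
    case True
    then obtain v where v: "a = sh v" by (auto simp: M_eq)
    show ?thesis using f sh_lpolys[of "f (ivf a)" v] True by (simp add: iota_def laurent_skew_def v)
  next
    case False
    thus ?thesis using lpolys_0 by (simp add: iota_def)
  qed
  thus ?thesis using iota_closed f by (simp add: laurent_skew_def)
qed

lemma iota_image:
  assumes "\<And>f. f \<in> A \<Longrightarrow> iota f \<in> A" "A \<subseteq> carrier R"
  shows "iota ` A = A"
proof
  show "A \<subseteq> iota ` A"
  proof
    fix f assume "f \<in> A"
    thus "f \<in> iota ` A" using assms iota_iota[of f] by (intro image_eqI[of _ _ "iota f"]) auto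
  qed
qed (use assms in blast)

lemma iota_image_twice:
  assumes "A \<subseteq> carrier R"
  shows "iota ` iota ` A = A"
proof -
  have "iota ` iota ` A = (\<lambda>f. f) ` A"
    unfolding image_image by (rule image_cong[OF refl]) (use assms iota_iota in blast)
  thus ?thesis by simp
qed

lemma iota_image_skew_inv: "iota ` skew_inv = skew_inv" using iota_skew_inv skew_inv_carrier by (intro iota_image) auto
lemma iota_image_torus_inv: "iota ` torus_inv = torus_inv" using iota_skew_inv iota_laurent_skew torus_inv_carrier by (intro iota_image) (auto simp: torus_inv_def)

lemma iota_inj: "inj_on iota (carrier R)" by (rule inj_on_inverseI[of _ iota]) (rule iota_iota)

lemma right_order:
  assumes "finite E" "E \<subseteq> skew_inv"
  shows "\<exists>F. finite F \<and> F \<subseteq> right_span R (skew_const ` K0) E \<inter> torus_inv \<and>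
    right_span R (skew_const ` K0) E \<inter> torus_inv = right_span R (skew_const ` Gam) F"
proof -
  have EC: "E \<subseteq> carrier R" using assms(2) skew_inv_carrier by blast
  have "iota ` E \<subseteq> skew_inv" using assms(2) iota_skew_inv by blast
  then obtain F where F: "finite F" "F \<subseteq> lspan K0 (iota ` E) \<inter> torus_inv" "lspan K0 (iota ` E) \<inter> torus_inv = lspan Gam F"
    using left_order[of "iota ` E"] assms(1) by blast
  have "lspan K0 (iota ` E) \<subseteq> skew_inv" by (rule lspan_least[OF submod_skew_inv]) fact
  hence lc: "lspan K0 (iota ` E) \<subseteq> carrier R" using skew_inv_carrier by blast
  have UC: "torus_inv \<subseteq> carrier R" using torus_inv_carrier by blast
  have FC: "F \<subseteq> carrier R" using F(2) UC by blast
  have eq: "right_span R (skew_const ` K0) E \<inter> torus_inv = iota ` (lspan K0 (iota ` E) \<inter> torus_inv)"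
    unfolding right_span_eq[OF subr_K0 EC] inj_on_image_Int[OF iota_inj lc UC] iota_image_torus_inv ..
  have iF: "iota ` iota ` F = F" by (rule iota_image_twice[OF FC])
  have "right_span R (skew_const ` Gam) (iota ` F) = iota ` lspan Gam F"
  proof -
    have "iota ` F \<subseteq> carrier R" using FC iota_closed by blast
    from right_span_eq[OF subr_Gam this] show ?thesis unfolding iF .
  qed
  hence "right_span R (skew_const ` K0) E \<inter> torus_inv = right_span R (skew_const ` Gam) (iota ` F)"
    unfolding eq F(3) by simp
  moreover have "iota ` F \<subseteq> right_span R (skew_const ` K0) E \<inter> torus_inv" unfolding eq using F(2) by blast
  ultimately show ?thesis using F(1) by blast
qed

lemma right_span_K0_torus_inv: "right_span R (skew_const ` K0) torus_inv = skew_inv"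
  using right_span_eq[OF subr_K0, of torus_inv] torus_inv_carrier by (simp add: iota_image_torus_inv lspan_K0_torus_inv iota_image_skew_inv subset_iff)

section \<open>Left and right freeness\<close>

lemma skew_monom_0: "skew_monom 0 a = 0" by (rule ext) (simp add: skew_monom_def)

theorem left_free_torus_inv: "left_free R (skew_const ` Gam) torus_inv"
  unfolding left_free_def
proof (intro exI conjI allI impI)
  show "beta ` Orbs \<subseteq> torus_inv" using beta_torus_inv by blast
  hence C: "beta ` Orbs \<subseteq> carrier R" using torus_inv_carrier by blast
  show "left_span R (skew_const ` Gam) (beta ` Orbs) = torus_inv"
    by (simp add: left_span_eq[OF subr_Gam C] lspan_beta)
  fix F c
  assume *: "finite F \<and> F \<subseteq> beta ` Orbs \<and> c \<in> F \<rightarrow> skew_const ` Gam \<and> (\<Oplus>\<^bsub>R\<^esub>b\<in>F. c b \<otimes>\<^bsub>R\<^esub> b) = \<zero>\<^bsub>R\<^esub>"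
  have "\<forall>b\<in>F. \<exists>l. l \<in> Gam \<and> c b = skew_const l" using * by blast
  then obtain d where d: "\<And>b. b \<in> F \<Longrightarrow> d b \<in> Gam" "\<And>b. b \<in> F \<Longrightarrow> c b = skew_const (d b)" by metis
  have FC: "b \<in> carrier R" if "b \<in> F" for b using * C that by blast
  have "(\<Oplus>\<^bsub>R\<^esub>b\<in>F. c b \<otimes>\<^bsub>R\<^esub> b) = (\<Sum>b\<in>F. c b \<otimes>\<^bsub>R\<^esub> b)"
    by (rule finsum_eq) (simp add: d(2) R_mult R_monom M_id FC)
  also have "\<dots> = (\<Sum>b\<in>F. fscale (d b) b)" by (rule sum.cong[OF refl]) (simp add: d(2) const_mult FC)
  finally have "(\<Sum>b\<in>F. fscale (d b) b) = 0" using * by (simp add: zero_eq)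
  hence d0: "d b = 0" if "b \<in> F" for b
    using beta_independent[of F d b] * d(1) that by blast
  show "\<forall>b\<in>F. c b = \<zero>\<^bsub>R\<^esub>"
  proof
    fix b assume b: "b \<in> F"
    show "c b = \<zero>\<^bsub>R\<^esub>" unfolding d(2)[OF b] d0[OF b] zero_eq by (rule skew_monom_0)
  qed
qed

text \<open>The image of the left basis under \<open>iota\<close> is a right basis.\<close>
theorem right_free_torus_inv: "right_free R (skew_const ` Gam) torus_inv"
  unfolding right_free_def
proof (intro exI conjI allI impI)
  have bC: "beta ` Orbs \<subseteq> carrier R" using beta_torus_inv torus_inv_carrier by blast
  have "iota ` beta ` Orbs \<subseteq> iota ` torus_inv" using beta_torus_inv by blast
  thus sub: "iota ` beta ` Orbs \<subseteq> torus_inv" unfolding iota_image_torus_inv .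
  hence C: "iota ` beta ` Orbs \<subseteq> carrier R" using torus_inv_carrier by blast
  have ii: "iota ` iota ` beta ` Orbs = beta ` Orbs" by (rule iota_image_twice[OF bC])
  show "right_span R (skew_const ` Gam) (iota ` beta ` Orbs) = torus_inv"
    unfolding right_span_eq[OF subr_Gam C] ii lspan_beta by (rule iota_image_torus_inv)
  fix F c
  assume *: "finite F \<and> F \<subseteq> iota ` beta ` Orbs \<and> c \<in> F \<rightarrow> skew_const ` Gam \<and> (\<Oplus>\<^bsub>R\<^esub>b\<in>F. b \<otimes>\<^bsub>R\<^esub> c b) = \<zero>\<^bsub>R\<^esub>"
  have "\<forall>b\<in>F. \<exists>l. l \<in> Gam \<and> c b = skew_const l" using * by blast
  then obtain d where d: "\<And>b. b \<in> F \<Longrightarrow> d b \<in> Gam" "\<And>b. b \<in> F \<Longrightarrow> c b = skew_const (d b)" by metis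
  have FC: "b \<in> carrier R" if "b \<in> F" for b using * C that by blast
  have "(\<Oplus>\<^bsub>R\<^esub>b\<in>F. b \<otimes>\<^bsub>R\<^esub> c b) = (\<Sum>b\<in>F. b \<otimes>\<^bsub>R\<^esub> c b)"
    by (rule finsum_eq) (simp add: d(2) R_mult R_monom M_id FC)
  hence "iota (\<Sum>b\<in>F. b \<otimes>\<^bsub>R\<^esub> c b) = 0" using * by (simp add: zero_eq iota_0)
  hence "0 = (\<Sum>b\<in>F. iota (b \<otimes>\<^bsub>R\<^esub> c b))" by (simp only: iota_sum)
  also have "\<dots> = (\<Sum>b\<in>F. fscale (d b) (iota b))"
    by (rule sum.cong[OF refl]) (simp add: d(2) iota_mult R_monom M_id FC iota_const const_mult iota_closed)
  also have "\<dots> = (\<Sum>b\<in>iota ` F. fscale (d (iota b)) b)"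
  proof -
    have "inj_on iota F" using FC by (intro inj_on_subset[OF iota_inj]) blast
    thus ?thesis using FC iota_iota by (simp add: sum.reindex)
  qed
  finally have 0: "(\<Sum>b\<in>iota ` F. fscale (d (iota b)) b) = 0" by simp
  have d0: "d b = 0" if b: "b \<in> F" for b
  proof -
    have "d (iota (iota b)) = 0"
    proof (rule beta_independent[OF _ _ _ 0, of "iota b"])
      show "finite (iota ` F)" using * by simp
      show "iota ` F \<subseteq> beta ` Orbs" using * ii by blast
      show "d (iota b) \<in> Gam" if b': "b \<in> iota ` F" for b
      proof -
        obtain b'' where "b'' \<in> F" "b = iota b''" using b' by blast
        thus ?thesis using d(1) iota_iota FC by simp
      qed
    qed (use b in simp)
    thus ?thesis using iota_iota[OF FC[OF b]] by simp
  qed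
  show "\<forall>b\<in>F. c b = \<zero>\<^bsub>R\<^esub>"
  proof
    fix b assume b: "b \<in> F"
    show "c b = \<zero>\<^bsub>R\<^esub>" unfolding d(2)[OF b] d0[OF b] zero_eq by (rule skew_monom_0)
  qed
qed

section \<open>Finite generation by averaging over the group\<close>

text \<open>The average over the group: a projection onto the invariants that is linear over them.\<close>
definition reynolds :: "('n, 'k) skew \<Rightarrow> ('n, 'k) skew" where
  "reynolds f = fscale (rf_const (inverse (of_nat (card Gal)))) (\<Sum>\<sigma>\<in>Gal. skew_act \<sigma> f)"

lemma card_Gal: "of_nat (card Gal) \<noteq> (0 :: 'k)"
  using Gal_finite Gal_id by auto

lemma of_nat_ratfun: "of_nat N = (rf_const (of_nat N) :: ('n, 'k) ratfun)"
  by (induction N) (simp_all add: rf_const_add)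

lemma reynolds_fix:
  assumes "f \<in> skew_inv" shows "reynolds f = f"
proof
  fix a
  have "(\<Sum>\<sigma>\<in>Gal. skew_act \<sigma> f) = (\<Sum>\<sigma>\<in>Gal. f)"
    by (rule sum.cong[OF refl]) (use assms in \<open>simp add: skew_invariants_def\<close>)
  hence "reynolds f a = rf_const (inverse (of_nat (card Gal))) * (of_nat (card Gal) * f a)"
    by (simp add: reynolds_def sum_fun_apply)
  also have "\<dots> = f a"
    unfolding of_nat_ratfun mult.assoc[symmetric] rf_const_mult[symmetric] using card_Gal by simp
  finally show "reynolds f a = f a" .
qed

lemma act_Gal_closed: "\<sigma> \<in> Gal \<Longrightarrow> f \<in> carrier R \<Longrightarrow> skew_act \<sigma> f \<in> carrier R"
  by (rule act_closed[OF Gal_aut Gal_normalizes])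

lemma act_fscale: "is_aut \<sigma> \<Longrightarrow> skew_act \<sigma> (fscale c f) = fscale (\<sigma> c) (skew_act \<sigma> f)"
  by (rule ext) (simp add: skew_act_def aut_mult)

lemma reynolds_skew_inv:
  assumes f: "f \<in> carrier R"
  shows "reynolds f \<in> skew_inv"
  unfolding skew_invariants_def
proof (intro CollectI conjI ballI)
  show "reynolds f \<in> carrier R" unfolding reynolds_def by (intro R_fscale R_sum act_Gal_closed f)
  fix \<tau> assume \<tau>: "\<tau> \<in> Gal"
  note t = Gal_aut[OF \<tau>]
  have "skew_act \<tau> (\<Sum>\<sigma>\<in>Gal. skew_act \<sigma> f) = (\<Sum>\<sigma>\<in>Gal. skew_act (\<tau> \<circ> \<sigma>) f)"
    unfolding act_sum[OF t] by (rule sum.cong[OF refl]) (rule act_comp[OF t Gal_aut])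
  also have "\<dots> = (\<Sum>\<sigma>\<in>Gal. skew_act \<sigma> f)"
  proof (rule sum.reindex_bij_witness[of _ "\<lambda>\<sigma>. ivf \<tau> \<circ> \<sigma>" "\<lambda>\<sigma>. \<tau> \<circ> \<sigma>"])
    show "ivf \<tau> \<circ> (\<tau> \<circ> \<sigma>) = \<sigma>" for \<sigma> by (rule ext) (simp add: aut_ivf_left[OF t])
    show "\<tau> \<circ> (ivf \<tau> \<circ> \<sigma>) = \<sigma>" for \<sigma> by (rule ext) (simp add: aut_ivf_right[OF t])
  qed (use \<tau> Gal_comp Gal_inv in auto)
  finally have s: "skew_act \<tau> (\<Sum>\<sigma>\<in>Gal. skew_act \<sigma> f) = (\<Sum>\<sigma>\<in>Gal. skew_act \<sigma> f)" .
  have "\<tau> (rf_const (inverse (of_nat (card Gal)))) = rf_const (inverse (of_nat (card Gal)))"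
    using \<tau> K0_const[of "inverse (of_nat (card Gal))"] unfolding K0_def by blast
  thus "skew_act \<tau> (reynolds f) = reynolds f"
    unfolding reynolds_def act_fscale[OF t] s by simp
qed

lemma act_Gal_laurent_skew: "\<sigma> \<in> Gal \<Longrightarrow> f \<in> laurent_skew \<Longrightarrow> skew_act \<sigma> f \<in> laurent_skew"
proof -
  assume "\<sigma> \<in> Gal" and f: "f \<in> laurent_skew"
  then obtain g \<pi> where h: "(g, \<pi>) \<in> H" "\<sigma> = ma (g, \<pi>)" by (auto simp: Gal_def)
  show ?thesis unfolding h(2) by (rule act_laurent_skew[OF _ H_bij[OF h(1)] f]) (rule H_nonzero[OF h(1)])
qed

lemma reynolds_torus_inv:
  assumes f: "f \<in> laurent_skew" shows "reynolds f \<in> torus_inv"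
proof -
  have "reynolds f \<in> laurent_skew" unfolding reynolds_def
    by (rule submod_scale[OF submod_laurent_skew lpolys_const], rule submod_sum[OF submod_laurent_skew], rule act_Gal_laurent_skew[OF _ f])
  moreover have "reynolds f \<in> skew_inv" by (rule reynolds_skew_inv) (use f in \<open>simp add: laurent_skew_def\<close>)
  ultimately show ?thesis by (simp add: torus_inv_def)
qed

lemma reynolds_add: "reynolds (f + g) = reynolds f + reynolds g"
proof -
  have "(\<Sum>\<sigma>\<in>Gal. skew_act \<sigma> (f + g)) = (\<Sum>\<sigma>\<in>Gal. skew_act \<sigma> f) + (\<Sum>\<sigma>\<in>Gal. skew_act \<sigma> g)"
    unfolding sum.distrib[symmetric] by (rule sum.cong[OF refl]) (rule act_add[OF Gal_aut])
  thus ?thesis unfolding reynolds_def by (simp only:) (rule ext, simp add: distrib_left)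
qed

lemma reynolds_sum: "reynolds (sum f A) = (\<Sum>i\<in>A. reynolds (f i))"
proof -
  interpret additive reynolds by unfold_locales (rule reynolds_add)
  show ?thesis by (rule sum)
qed

lemma sum_mult_left:
  assumes "finite A" "\<And>i. i \<in> A \<Longrightarrow> F i \<in> carrier R" "e \<in> carrier R"
  shows "sum F A \<otimes>\<^bsub>R\<^esub> e = (\<Sum>i\<in>A. F i \<otimes>\<^bsub>R\<^esub> e)"
proof -
  interpret ring R by (rule ring_R)
  have "(\<Oplus>\<^bsub>R\<^esub>i\<in>A. F i) \<otimes>\<^bsub>R\<^esub> e = (\<Oplus>\<^bsub>R\<^esub>i\<in>A. F i \<otimes>\<^bsub>R\<^esub> e)"
    by (rule finsum_ldistr[OF assms(1,3)]) (use assms(2) in auto)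
  moreover have "(\<Oplus>\<^bsub>R\<^esub>i\<in>A. F i) = sum F A" by (rule finsum_eq) (rule assms(2))
  moreover have "(\<Oplus>\<^bsub>R\<^esub>i\<in>A. F i \<otimes>\<^bsub>R\<^esub> e) = (\<Sum>i\<in>A. F i \<otimes>\<^bsub>R\<^esub> e)"
    by (rule finsum_eq) (intro R_mult assms)
  ultimately show ?thesis by simp
qed

lemma sum_mult_right:
  assumes "finite A" "\<And>i. i \<in> A \<Longrightarrow> F i \<in> carrier R" "e \<in> carrier R"
  shows "e \<otimes>\<^bsub>R\<^esub> sum F A = (\<Sum>i\<in>A. e \<otimes>\<^bsub>R\<^esub> F i)"
proof -
  interpret ring R by (rule ring_R)
  have "e \<otimes>\<^bsub>R\<^esub> (\<Oplus>\<^bsub>R\<^esub>i\<in>A. F i) = (\<Oplus>\<^bsub>R\<^esub>i\<in>A. e \<otimes>\<^bsub>R\<^esub> F i)"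
    by (rule finsum_rdistr[OF assms(1,3)]) (use assms(2) in auto)
  moreover have "(\<Oplus>\<^bsub>R\<^esub>i\<in>A. F i) = sum F A" by (rule finsum_eq) (rule assms(2))
  moreover have "(\<Oplus>\<^bsub>R\<^esub>i\<in>A. e \<otimes>\<^bsub>R\<^esub> F i) = (\<Sum>i\<in>A. e \<otimes>\<^bsub>R\<^esub> F i)"
    by (rule finsum_eq) (intro R_mult assms)
  ultimately show ?thesis by simp
qed

lemma reynolds_mult:
  assumes s: "s \<in> carrier R" and e: "e \<in> skew_inv"
  shows "reynolds (s \<otimes>\<^bsub>R\<^esub> e) = reynolds s \<otimes>\<^bsub>R\<^esub> e"
proof -
  have ec: "e \<in> carrier R" by (rule skew_inv_carrier[OF e])
  have "(\<Sum>\<sigma>\<in>Gal. skew_act \<sigma> (s \<otimes>\<^bsub>R\<^esub> e)) = (\<Sum>\<sigma>\<in>Gal. skew_act \<sigma> s \<otimes>\<^bsub>R\<^esub> e)"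
  proof (rule sum.cong[OF refl])
    fix \<sigma> assume \<sigma>: "\<sigma> \<in> Gal"
    have "skew_act \<sigma> e = e" using e \<sigma> by (simp add: skew_invariants_def)
    thus "skew_act \<sigma> (s \<otimes>\<^bsub>R\<^esub> e) = skew_act \<sigma> s \<otimes>\<^bsub>R\<^esub> e"
      using act_mult[OF Gal_aut[OF \<sigma>] Gal_normalizes[OF \<sigma>] s ec] by simp
  qed
  also have "\<dots> = (\<Sum>\<sigma>\<in>Gal. skew_act \<sigma> s) \<otimes>\<^bsub>R\<^esub> e"
    by (rule sum_mult_left[symmetric]) (use Gal_finite act_Gal_closed s ec in auto)
  finally show ?thesis unfolding reynolds_def
    by (simp only: fscale_mult_left[OF R_sum[OF act_Gal_closed[OF _ s]] ec])
qed

text \<open>Only nonnegative exponents of \<open>y\<close> occur, of total degree at most \<open>N\<close>.\<close>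
definition y_degree_le :: "int \<Rightarrow> ('n, 'k) skew \<Rightarrow> bool" where
  "y_degree_le N f \<longleftrightarrow> (\<forall>v. f (sh v) \<noteq> 0 \<longrightarrow> (\<forall>i. 0 \<le> v i) \<and> (\<Sum>i\<in>UNIV. v i) \<le> N)"

lemma reynolds_y_degree_le:
  assumes "y_degree_le N f" shows "y_degree_le N (reynolds f)"
  unfolding y_degree_le_def
proof (intro allI impI)
  fix v assume "reynolds f (sh v) \<noteq> 0"
  hence "(\<Sum>\<sigma>\<in>Gal. skew_act \<sigma> f (sh v)) \<noteq> 0" by (auto simp: reynolds_def sum_fun_apply)
  then obtain \<sigma> where "\<sigma> \<in> Gal" "skew_act \<sigma> f (sh v) \<noteq> 0" by (meson sum.not_neutral_contains_not_neutral)
  then obtain g \<pi> where h: "(g, \<pi>) \<in> H" "ma (g, \<pi>) (f (sh (v \<circ> \<pi>))) \<noteq> 0"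
    using act_sh by (auto simp: Gal_def)
  hence "f (sh (v \<circ> \<pi>)) \<noteq> 0" using aut_0[OF H_aut[OF h(1)]] by auto
  hence *: "\<forall>i. 0 \<le> (v \<circ> \<pi>) i" "(\<Sum>i\<in>UNIV. (v \<circ> \<pi>) i) \<le> N" using assms unfolding y_degree_le_def by blast+
  have "(\<Sum>i\<in>UNIV. (v \<circ> \<pi>) i) = (\<Sum>i\<in>UNIV. v i)"
    unfolding o_def by (rule sum.reindex_bij_betw[OF H_bij[OF h(1)]])
  moreover have "0 \<le> v i" for i using *(1) bij_is_surj[OF H_bij[OF h(1)]] by (metis comp_apply surjD)
  ultimately show "(\<forall>i. 0 \<le> v i) \<and> (\<Sum>i\<in>UNIV. v i) \<le> N" using *(2) by simp
qed

definition char_vec :: "'n set \<Rightarrow> 'n \<Rightarrow> int" where "char_vec I = (\<lambda>j. if j \<in> I then 1 else 0)"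

text \<open>The \<open>k\<close>-th elementary symmetric function of \<open>y\<^sub>1, \<dots>, y\<^sub>n\<close>.\<close>
definition esym :: "nat \<Rightarrow> ('n, 'k) skew" where
  "esym k = (\<Sum>I | card I = k. skew_monom 1 (sh (char_vec I)))"

lemma act_y:
  assumes "(g, \<pi>) \<in> H"
  shows "skew_act (ma (g, \<pi>)) (skew_monom 1 (sh v)) = skew_monom 1 (sh (v \<circ> ivf \<pi>))"
proof -
  have a: "is_aut (ma (g, \<pi>))" by (rule H_aut[OF assms])
  have c: "ma (g, \<pi>) \<circ> sh v \<circ> ivf (ma (g, \<pi>)) = sh (v \<circ> ivf \<pi>)"
    by (rule conj_sh[OF _ H_bij[OF assms]]) (rule H_nonzero[OF assms])
  show ?thesis unfolding act_monom[OF a] c aut_1[OF a] ..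
qed

lemma skew_invariantsI:
  assumes "f \<in> carrier R" "\<And>g \<pi>. (g, \<pi>) \<in> H \<Longrightarrow> skew_act (ma (g, \<pi>)) f = f"
  shows "f \<in> skew_inv"
  using assms by (auto simp: skew_invariants_def Gal_def)

lemma one_lpolys: "(1 :: ('n, 'k) ratfun) \<in> lpolys" by (rule subr_1[OF subr_lpolys])

lemma y_const_torus_inv: "skew_monom 1 (sh (\<lambda>_. c)) \<in> torus_inv"
proof -
  have l: "skew_monom 1 (sh (\<lambda>_. c)) \<in> laurent_skew" by (rule skew_monom_laurent_skew[OF one_lpolys])
  have "skew_monom 1 (sh (\<lambda>_. c)) \<in> skew_inv"
  proof (rule skew_invariantsI)
    show "skew_monom 1 (sh (\<lambda>_. c)) \<in> carrier R" by (rule R_monom[OF sh_in_M])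
    show "skew_act (ma (g, \<pi>)) (skew_monom 1 (sh (\<lambda>_. c))) = skew_monom 1 (sh (\<lambda>_. c))" if "(g, \<pi>) \<in> H" for g \<pi>
      unfolding act_y[OF that] by (simp add: o_def)
  qed
  thus ?thesis using l by (simp add: torus_inv_def)
qed

lemma esym_torus_inv: "esym k \<in> torus_inv"
proof -
  have l: "esym k \<in> laurent_skew" unfolding esym_def
    by (rule submod_sum[OF submod_laurent_skew], rule skew_monom_laurent_skew[OF one_lpolys])
  moreover have "esym k \<in> skew_inv"
  proof (rule skew_invariantsI)
    show "esym k \<in> carrier R" using l by (simp add: laurent_skew_def)
    fix g \<pi> assume h: "(g, \<pi>) \<in> H"
    note b = H_bij[OF h]
    have "skew_act (ma (g, \<pi>)) (esym k) = (\<Sum>I | card I = k. skew_monom 1 (sh (char_vec I \<circ> ivf \<pi>)))"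
      unfolding esym_def act_sum[OF H_aut[OF h]] act_y[OF h] ..
    also have "\<dots> = (\<Sum>I | card I = k. skew_monom 1 (sh (char_vec I)))"
    proof (rule sum.reindex_bij_witness[of _ "\<lambda>I. ivf \<pi> ` I" "\<lambda>I. \<pi> ` I"])
      have b': "bij (ivf \<pi>)" by (rule bij_imp_bij_inv[OF b])
      fix I :: "'n set"
      show "ivf \<pi> ` \<pi> ` I = I" using b by (simp add: bij_is_inj image_comp)
      show "\<pi> ` ivf \<pi> ` I = I" using b by (metis bij_is_surj image_f_inv_f)
      show "\<pi> ` I \<in> {I. card I = k}" if "I \<in> {I. card I = k}"
        using that b by (simp add: card_image inj_on_subset[OF bij_is_inj])
      show "ivf \<pi> ` I \<in> {I. card I = k}" if "I \<in> {I. card I = k}"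
        using that b' by (simp add: card_image inj_on_subset[OF bij_is_inj])
      have "char_vec (\<pi> ` I) = char_vec I \<circ> ivf \<pi>"
      proof
        fix j
        have "j \<in> \<pi> ` I \<longleftrightarrow> ivf \<pi> j \<in> I" using b by (metis bij_inv_eq_iff imageE imageI)
        thus "char_vec (\<pi> ` I) j = (char_vec I \<circ> ivf \<pi>) j" by (simp add: char_vec_def)
      qed
      thus "skew_monom 1 (sh (char_vec (\<pi> ` I))) = skew_monom 1 (sh (char_vec I \<circ> ivf \<pi>))" by simp
    qed
    finally show "skew_act (ma (g, \<pi>)) (esym k) = esym k" by (simp only: esym_def)
  qed
  ultimately show ?thesis by (simp add: torus_inv_def)
qed

lemma monom_uminus: "skew_monom (- l) a = - skew_monom l a"
  by (rule ext) (simp add: skew_monom_def)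

definition lowered :: "('n \<Rightarrow> int) \<Rightarrow> 'n \<Rightarrow> nat \<Rightarrow> 'n \<Rightarrow> int" where
  "lowered v i k = (\<lambda>j. v j - (if j = i then int k else 0))"

text \<open>
  The relation \<open>\<Sum> (-1)\<^sup>k y\<^sub>i\<^bsup>n-k\<^esup> e\<^sub>k(y) = \<Prod>\<^sub>j (y\<^sub>i - y\<^sub>j) = 0\<close>, multiplied by \<open>l y\<^sup>v y\<^sub>i\<^bsup>-n\<^esup>\<close>. On the level of
  the subsets \<open>I\<close> that index the terms, the terms of \<open>I\<close> and \<open>I \<union> {i}\<close> cancel for \<open>i \<notin> I\<close>.
\<close>
lemma monomial_reduction:
  "skew_monom l (sh v) = (\<Sum>k\<in>{1..card (UNIV :: 'n set)}. skew_monom (- ((- 1) ^ k * l)) (sh (lowered v i k)) \<otimes>\<^bsub>R\<^esub> esym k)"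
proof -
  define t where "t I = skew_monom ((- 1) ^ card I * l) (sh (\<lambda>j. lowered v i (card I) j + char_vec I j))" for I
  have cancel: "t (insert i I) = - t I" if "i \<notin> I" for I
  proof -
    have "(\<lambda>j. lowered v i (card (insert i I)) j + char_vec (insert i I) j) = (\<lambda>j. lowered v i (card I) j + char_vec I j)"
      using that by (auto simp: lowered_def char_vec_def fun_eq_iff)
    thus ?thesis using that by (simp add: t_def monom_uminus)
  qed
  have split: "UNIV = {I :: 'n set. i \<notin> I} \<union> insert i ` {I. i \<notin> I}"
  proof -
    have "I \<in> insert i ` {I. i \<notin> I}" if "i \<in> I" for I
      using that by (intro image_eqI[of _ _ "I - {i}"]) auto
    thus ?thesis by blast
  qed
  have inj: "inj_on (insert i) {I. i \<notin> I}" by (auto simp: inj_on_def)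
  have "(\<Sum>I\<in>UNIV. t I) = (\<Sum>I | i \<notin> I. t I) + (\<Sum>I | i \<notin> I. t (insert i I))"
    by (subst split, subst sum.union_disjoint) (auto simp: sum.reindex[OF inj])
  also have "(\<Sum>I | i \<notin> I. t (insert i I)) = (\<Sum>I | i \<notin> I. - t I)"
    by (rule sum.cong[OF refl]) (rule cancel, simp)
  also have "(\<Sum>I | i \<notin> I. t I) + (\<Sum>I | i \<notin> I. - t I) = 0" by (simp add: sum_negf)
  finally have total: "(\<Sum>I\<in>UNIV. t I) = 0" .
  have "(\<Sum>I\<in>UNIV. t I) = t {} + (\<Sum>I\<in>UNIV - {{}}. t I)" by (rule sum.remove) auto
  moreover have "t {} = skew_monom l (sh v)" by (simp add: t_def lowered_def char_vec_def cong: if_cong)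
  ultimately have 1: "skew_monom l (sh v) = - (\<Sum>I\<in>UNIV - {{}}. t I)"
    using total by (simp add: eq_neg_iff_add_eq_0)
  have prod: "skew_monom (- ((- 1) ^ k * l)) (sh (lowered v i k)) \<otimes>\<^bsub>R\<^esub> esym k = - (\<Sum>I | card I = k. t I)" for k
  proof -
    have "skew_monom (- ((- 1) ^ k * l)) (sh (lowered v i k)) \<otimes>\<^bsub>R\<^esub> esym k =
      (\<Sum>I | card I = k. skew_monom (- ((- 1) ^ k * l)) (sh (lowered v i k)) \<otimes>\<^bsub>R\<^esub> skew_monom 1 (sh (char_vec I)))"
      unfolding esym_def by (rule sum_mult_right) (simp_all add: R_monom sh_in_M)
    also have "\<dots> = (\<Sum>I | card I = k. - t I)"
    proof (rule sum.cong[OF refl])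
      fix I :: "'n set" assume "I \<in> {I. card I = k}"
      thus "skew_monom (- ((- 1) ^ k * l)) (sh (lowered v i k)) \<otimes>\<^bsub>R\<^esub> skew_monom 1 (sh (char_vec I)) = - t I"
        unfolding monom_mult_monom[OF sh_in_M sh_in_M] sh_add aut_1[OF sh_aut] t_def
        by (simp add: monom_uminus)
    qed
    finally show ?thesis by (simp add: sum_negf)
  qed
  have "(\<Sum>k\<in>{1..card (UNIV :: 'n set)}. \<Sum>I | card I = k. t I) = (\<Sum>k\<in>{1..card (UNIV :: 'n set)}. \<Sum>I | I \<in> UNIV - {{}} \<and> card I = k. t I)"
    by (intro sum.cong refl) auto
  also have "\<dots> = (\<Sum>I\<in>UNIV - {{}}. t I)"
    by (rule sum.group) (auto simp: card_mono Suc_le_eq card_gt_0_iff)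
  finally show ?thesis unfolding prod sum_negf 1 by simp
qed

text \<open>
  By \<open>high_index\<close>, a monomial in the \<open>y\<^sub>i\<close> without a factor \<open>y\<^sub>i\<^sup>n\<close> has degree at most \<open>n(n-1)\<close>; these are the
  basis elements for exponents up to that bound.
\<close>
definition small_betas :: "('n, 'k) skew set" where
  "small_betas = beta ` orb ` (SIGMA v:{v. \<forall>i. (i \<in> UNIV \<longrightarrow> v i \<in> {0..int (card (UNIV :: 'n set) * (card (UNIV :: 'n set) - 1))}) \<and> (i \<notin> UNIV \<longrightarrow> v i = 0)}. box v)"

definition gens :: "('n, 'k) skew set" where
  "gens = small_betas \<union> esym ` {1..card (UNIV :: 'n set)} \<union> {skew_monom 1 (sh (\<lambda>_. - 1))}"

abbreviation "generated \<equiv> generate_ring R (skew_const ` Gam \<union> gens)"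

lemma finite_cube: "finite {v :: 'n \<Rightarrow> int. \<forall>i. (i \<in> UNIV \<longrightarrow> v i \<in> {0..B}) \<and> (i \<notin> UNIV \<longrightarrow> v i = 0)}"
  by (intro finite_set_of_finite_funs) auto

lemma finite_gens: "finite gens"
  unfolding gens_def small_betas_def using finite_cube finite_box by (intro finite_UnI finite_imageI finite_SigmaI) auto

lemma gens_torus_inv: "gens \<subseteq> torus_inv"
proof -
  have "small_betas \<subseteq> torus_inv" unfolding small_betas_def using beta_torus_inv orb_Orbs by blast
  thus ?thesis using esym_torus_inv y_const_torus_inv by (auto simp: gens_def)
qed

lemma generated_torus_inv: "generated \<subseteq> torus_inv"
proof -
  interpret ring R by (rule ring_R)
  show ?thesis
    by (rule generate_ring_min_subring1[OF _ subring_torus_inv]) (use torus_inv_carrier gens_torus_inv skew_const_torus_inv in auto)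
qed

lemma generated_add: "f \<in> generated \<Longrightarrow> g \<in> generated \<Longrightarrow> f + g \<in> generated"
  using generate_ring.eng_add[of f R _ g] by (simp add: add_eq)

lemma generated_zero: "0 \<in> generated"
proof -
  interpret ring R by (rule ring_R)
  show ?thesis using zero_in_generate by (simp add: zero_eq)
qed

lemma generated_scale: "c \<in> Gam \<Longrightarrow> f \<in> generated \<Longrightarrow> fscale c f \<in> generated"
proof -
  assume c: "c \<in> Gam" and f: "f \<in> generated"
  have "skew_const c \<otimes>\<^bsub>R\<^esub> f \<in> generated"
    by (rule generate_ring.eng_mult[OF generate_ring.incl f]) (use c in blast)
  moreover have "f \<in> carrier R" using f generated_torus_inv torus_inv_carrier by blast
  ultimately show ?thesis by (simp add: const_mult)
qed

lemma submod_generated: "submod fscale Gam generated"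
  unfolding submod_def using generated_add generated_zero generated_scale by blast

lemma high_index:
  assumes "(\<Sum>i\<in>UNIV. v i) > int (card (UNIV :: 'n set) * (card (UNIV :: 'n set) - 1))"
  shows "\<exists>i :: 'n. v i \<ge> int (card (UNIV :: 'n set))"
proof (rule ccontr)
  assume "\<not> ?thesis"
  hence "v i < int (card (UNIV :: 'n set))" for i by (simp add: not_le)
  moreover have "card (UNIV :: 'n set) \<noteq> 0" by simp
  ultimately have "v i \<le> int (card (UNIV :: 'n set) - 1)" for i
    by (metis of_nat_diff One_nat_def Suc_leI gr0I of_nat_1 zle_diff1_eq)
  hence "(\<Sum>i\<in>UNIV. v i) \<le> (\<Sum>i\<in>(UNIV :: 'n set). int (card (UNIV :: 'n set) - 1))" by (intro sum_mono)
  thus False using assms by simp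
qed

text \<open>
  Induction on the degree. Up to degree \<open>n(n-1)\<close> the basis elements in \<open>gens\<close> span. In higher degree every
  monomial of top degree contains some \<open>y\<^sub>i\<^sup>n\<close>, and \<open>monomial_reduction\<close> writes the top part as
  \<open>\<Sum> s\<^sub>k e\<^sub>k(y)\<close> with \<open>s\<^sub>k\<close> of smaller degree, but not invariant. The average of the equation over the group
  leaves \<open>f\<close> and the \<open>e\<^sub>k(y)\<close> in place and makes the \<open>s\<^sub>k\<close> invariant.
\<close>
lemma positive_part_generated:
  "f \<in> torus_inv \<Longrightarrow> y_degree_le (int N) f \<Longrightarrow> f \<in> generated"
proof (induction N arbitrary: f rule: less_induct)
  case (less N)
  show ?case
  proof (cases "N \<le> card (UNIV :: 'n set) * (card (UNIV :: 'n set) - 1)")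
    case True
    let ?V = "{v :: 'n \<Rightarrow> int. \<forall>i. (i \<in> UNIV \<longrightarrow> v i \<in> {0..int (card (UNIV :: 'n set) * (card (UNIV :: 'n set) - 1))}) \<and> (i \<notin> UNIV \<longrightarrow> v i = 0)}"
    have "f \<in> lin fscale Gam small_betas" unfolding small_betas_def
    proof (rule torus_inv_span[OF less.prems(1) finite_cube])
      fix v assume "f (sh v) \<noteq> 0"
      hence v: "\<forall>i. 0 \<le> v i" "(\<Sum>i\<in>UNIV. v i) \<le> int N" using less.prems(2) unfolding y_degree_le_def by blast+
      have "v i \<le> int (card (UNIV :: 'n set) * (card (UNIV :: 'n set) - 1))" for i
      proof -
        have "v i \<le> (\<Sum>i\<in>UNIV. v i)" using v(1) by (intro member_le_sum) auto
        thus ?thesis using v(2) True by linarith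
      qed
      thus "v \<in> ?V" using v(1) by simp
    qed
    moreover have "small_betas \<subseteq> generated" by (auto simp: gens_def intro: generate_ring.incl)
    ultimately show ?thesis using lin_least[OF submod_generated] by blast
  next
    case False
    \<comment> \<open>The exponents of top degree, each of them with an index at which it can be lowered.\<close>
    define Top where "Top = {v. f (sh v) \<noteq> 0 \<and> (\<Sum>i\<in>UNIV. v i) = int N}"
    have finT: "finite Top" by (rule finite_subset[OF _ supp_finite[OF torus_inv_carrier[OF less.prems(1)]]]) (auto simp: Top_def)
    have "int (card (UNIV :: 'n set) * (card (UNIV :: 'n set) - 1)) < int N" using False by linarith
    hence "\<forall>v\<in>Top. \<exists>i. v i \<ge> int (card (UNIV :: 'n set))"
      unfolding Top_def by (intro ballI high_index) (simp del: of_nat_mult)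
    then obtain iv where iv: "\<And>v. v \<in> Top \<Longrightarrow> v (iv v) \<ge> int (card (UNIV :: 'n set))" by metis
    \<comment> \<open>The factor of \<open>e\<^sub>k(y)\<close> in the top part, and the part of lower degree.\<close>
    define s where "s k = (\<Sum>v\<in>Top. skew_monom (- ((- 1) ^ k * f (sh v))) (sh (lowered v (iv v) k)))" for k
    define fl where "fl = f - (\<Sum>v\<in>Top. skew_monom (f (sh v)) (sh v))"
    have f_lp: "f a \<in> lpolys" for a by (rule torus_inv_lpolys[OF less.prems(1)])
    have sign: "- ((- 1) ^ k * f a) \<in> lpolys" for k a
      by (intro subr_uminus[OF subr_lpolys] subr_mult[OF subr_lpolys] subr_power[OF subr_lpolys] f_lp one_lpolys)
    have s_laurent_skew: "s k \<in> laurent_skew" for k unfolding s_def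
      by (rule submod_sum[OF submod_laurent_skew], rule skew_monom_laurent_skew[OF sign])
    have top_laurent_skew: "(\<Sum>v\<in>Top. skew_monom (f (sh v)) (sh v)) \<in> laurent_skew"
      by (rule submod_sum[OF submod_laurent_skew], rule skew_monom_laurent_skew[OF f_lp])
    have fl_laurent_skew: "fl \<in> laurent_skew" unfolding fl_def
      by (rule submod_diff[OF module_fscale subr_lpolys submod_laurent_skew _ top_laurent_skew]) (use less.prems(1) in \<open>simp add: torus_inv_def\<close>)
    have LSC: "g \<in> carrier R" if "g \<in> laurent_skew" for g using that by (simp add: laurent_skew_def)
    have eC: "esym k \<in> carrier R" for k by (rule torus_inv_carrier[OF esym_torus_inv])
    have "(\<Sum>v\<in>Top. skew_monom (f (sh v)) (sh v)) =
      (\<Sum>v\<in>Top. \<Sum>k\<in>{1..card (UNIV :: 'n set)}. skew_monom (- ((- 1) ^ k * f (sh v))) (sh (lowered v (iv v) k)) \<otimes>\<^bsub>R\<^esub> esym k)"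
      by (rule sum.cong[OF refl]) (rule monomial_reduction)
    also have "\<dots> = (\<Sum>k\<in>{1..card (UNIV :: 'n set)}. \<Sum>v\<in>Top. skew_monom (- ((- 1) ^ k * f (sh v))) (sh (lowered v (iv v) k)) \<otimes>\<^bsub>R\<^esub> esym k)"
      by (rule sum.swap)
    also have "\<dots> = (\<Sum>k\<in>{1..card (UNIV :: 'n set)}. s k \<otimes>\<^bsub>R\<^esub> esym k)"
      unfolding s_def by (rule sum.cong[OF refl], rule sum_mult_left[symmetric, OF finT R_monom[OF sh_in_M] eC])
    finally have "f = fl + (\<Sum>k\<in>{1..card (UNIV :: 'n set)}. s k \<otimes>\<^bsub>R\<^esub> esym k)" by (simp only: fl_def diff_add_cancel)
    hence "reynolds f = reynolds fl + (\<Sum>k\<in>{1..card (UNIV :: 'n set)}. reynolds (s k \<otimes>\<^bsub>R\<^esub> esym k))" by (metis reynolds_add reynolds_sum)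
    also have "reynolds f = f" using less.prems(1) by (intro reynolds_fix) (simp add: torus_inv_def)
    also have "(\<Sum>k\<in>{1..card (UNIV :: 'n set)}. reynolds (s k \<otimes>\<^bsub>R\<^esub> esym k)) = (\<Sum>k\<in>{1..card (UNIV :: 'n set)}. reynolds (s k) \<otimes>\<^bsub>R\<^esub> esym k)"
      by (rule sum.cong[OF refl], rule reynolds_mult[OF LSC[OF s_laurent_skew]]) (use esym_torus_inv in \<open>simp add: torus_inv_def\<close>)
    finally have eq: "f = reynolds fl + (\<Sum>k\<in>{1..card (UNIV :: 'n set)}. reynolds (s k) \<otimes>\<^bsub>R\<^esub> esym k)" .
    have N: "N - 1 < N" "int (N - 1) = int N - 1" using False by auto
    have "y_degree_le (int (N - 1)) fl"
      unfolding y_degree_le_def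
    proof (intro allI impI)
      fix v assume v: "fl (sh v) \<noteq> 0"
      have e: "fl (sh v) = f (sh v) - (if v \<in> Top then f (sh v) else 0)"
        using finT by (simp add: fl_def sum_fun_apply skew_monom_def sh_eq_iff)
      have "v \<notin> Top" "f (sh v) \<noteq> 0" using v unfolding e by (auto split: if_splits)
      moreover from this(2) have "\<forall>i. 0 \<le> v i" "(\<Sum>i\<in>UNIV. v i) \<le> int N" using less.prems(2) unfolding y_degree_le_def by blast+
      ultimately show "(\<forall>i. 0 \<le> v i) \<and> (\<Sum>i\<in>UNIV. v i) \<le> int (N - 1)" unfolding N(2) by (simp add: Top_def)
    qed
    hence "reynolds fl \<in> generated" by (intro less.IH[OF N(1)] reynolds_torus_inv fl_laurent_skew reynolds_y_degree_le)
    moreover have "reynolds (s k) \<otimes>\<^bsub>R\<^esub> esym k \<in> generated" if k: "k \<in> {1..card (UNIV :: 'n set)}" for k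
    proof (rule generate_ring.eng_mult)
      show "esym k \<in> generated" using k by (auto simp: gens_def intro: generate_ring.incl)
      have "y_degree_le (int (N - 1)) (s k)"
        unfolding y_degree_le_def
      proof (intro allI impI)
        fix u assume "s k (sh u) \<noteq> 0"
        hence "(\<Sum>v\<in>Top. skew_monom (- ((- 1) ^ k * f (sh v))) (sh (lowered v (iv v) k)) (sh u)) \<noteq> 0"
          by (simp add: s_def sum_fun_apply)
        then obtain v where v: "v \<in> Top" "skew_monom (- ((- 1) ^ k * f (sh v))) (sh (lowered v (iv v) k)) (sh u) \<noteq> 0"
          by (meson sum.not_neutral_contains_not_neutral)
        have u: "u = lowered v (iv v) k" using v(2) by (auto simp: skew_monom_def sh_eq_iff split: if_splits)
        have nonneg: "\<forall>i. 0 \<le> v i" using v(1) less.prems(2) unfolding y_degree_le_def Top_def by blast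
        have "0 \<le> u i" for i using nonneg iv[OF v(1)] k by (auto simp: u lowered_def)
        moreover have "(\<Sum>i\<in>UNIV. u i) = int N - int k"
          using v(1) by (simp add: u lowered_def sum_subtractf Top_def)
        ultimately show "(\<forall>i. 0 \<le> u i) \<and> (\<Sum>i\<in>UNIV. u i) \<le> int (N - 1)" unfolding N(2) using k by simp
      qed
      thus "reynolds (s k) \<in> generated" by (intro less.IH[OF N(1)] reynolds_torus_inv s_laurent_skew reynolds_y_degree_le)
    qed
    hence "(\<Sum>k\<in>{1..card (UNIV :: 'n set)}. reynolds (s k) \<otimes>\<^bsub>R\<^esub> esym k) \<in> generated" by (rule submod_sum[OF submod_generated])
    ultimately have "reynolds fl + (\<Sum>k\<in>{1..card (UNIV :: 'n set)}. reynolds (s k) \<otimes>\<^bsub>R\<^esub> esym k) \<in> generated" by (rule generated_add)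
    thus ?thesis by (subst eq)
  qed
qed

lemma y_inverse_power: "skew_monom 1 (sh (\<lambda>_. - int N)) \<in> generated"
proof (induction N)
  case 0
  have "\<one>\<^bsub>R\<^esub> \<in> generated" by (rule generate_ring.one)
  thus ?case unfolding one_eq by (simp only: sh_0 of_nat_0 minus_zero)
next
  case (Suc N)
  have "skew_monom 1 (sh (\<lambda>_. - 1)) \<in> generated" by (auto simp: gens_def intro: generate_ring.incl)
  from generate_ring.eng_mult[OF this Suc] show ?case
    by (simp add: monom_mult_monom sh_in_M sh_add aut_1[OF sh_aut])
qed

text \<open>
  Multiplication by a large power of the invariant \<open>y\<^sub>1 \<cdots> y\<^sub>n\<close> makes the exponents nonnegative, and the
  inverse of \<open>y\<^sub>1 \<cdots> y\<^sub>n\<close> is one of the generators.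
\<close>
lemma torus_inv_generated: "torus_inv = generated"
proof
  show "torus_inv \<subseteq> generated"
  proof
    fix f assume f: "f \<in> torus_inv"
    note c = torus_inv_carrier[OF f]
    define S where "S = {v. f (sh v) \<noteq> 0}"
    have finS: "finite S" unfolding S_def by (rule supp_finite[OF c])
    define N where "N = nat (\<Sum>v\<in>S. \<Sum>i\<in>UNIV. \<bar>v i\<bar>)"
    have N: "v i + int N \<ge> 0" "(\<Sum>i\<in>UNIV. v i) \<le> int N" if v: "v \<in> S" for v i
    proof -
      have 1: "\<bar>v i\<bar> \<le> (\<Sum>i\<in>UNIV. \<bar>v i\<bar>)" by (rule member_le_sum) auto
      have 2: "(\<Sum>i\<in>UNIV. \<bar>v i\<bar>) \<le> (\<Sum>v\<in>S. \<Sum>i\<in>UNIV. \<bar>v i\<bar>)"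
        using finS v by (intro member_le_sum) (auto intro: sum_nonneg)
      have 3: "(\<Sum>i\<in>UNIV. v i) \<le> (\<Sum>i\<in>UNIV. \<bar>v i\<bar>)" by (intro sum_mono) simp
      have 4: "0 \<le> (\<Sum>v\<in>S. \<Sum>i\<in>UNIV. \<bar>v i\<bar>)" by (intro sum_nonneg) simp
      show "v i + int N \<ge> 0" "(\<Sum>i\<in>UNIV. v i) \<le> int N" using 1 2 3 4 by (simp_all add: N_def)
    qed
    define g where "g = f \<otimes>\<^bsub>R\<^esub> skew_monom 1 (sh (\<lambda>_. int N))"
    have g: "g \<in> torus_inv" unfolding g_def by (rule subringE(6)[OF subring_torus_inv f y_const_torus_inv])
    have letter_value: "g (sh v) = f (sh (\<lambda>i. v i - int N))" for v
      unfolding g_def R_mult_monom[OF c sh_in_M] sh_uminus sh_add by (simp add: aut_1[OF sh_aut])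
    have "y_degree_le (int (N + card (UNIV :: 'n set) * N)) g"
      unfolding y_degree_le_def
    proof (intro allI impI)
      fix v assume "g (sh v) \<noteq> 0"
      hence *: "(\<lambda>i. v i - int N) \<in> S" by (simp add: letter_value S_def)
      have "0 \<le> v i" for i using N(1)[OF *, of i] by simp
      moreover have "(\<Sum>i\<in>UNIV. v i - int N) \<le> int N" by (rule N(2)[OF *])
      ultimately show "(\<forall>i. 0 \<le> v i) \<and> (\<Sum>i\<in>UNIV. v i) \<le> int (N + card (UNIV :: 'n set) * N)"
        by (simp add: sum_subtractf)
    qed
    from positive_part_generated[OF g this] have "g \<in> generated" .
    hence "g \<otimes>\<^bsub>R\<^esub> skew_monom 1 (sh (\<lambda>_. - int N)) \<in> generated" using y_inverse_power by (rule generate_ring.eng_mult)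
    moreover have "g \<otimes>\<^bsub>R\<^esub> skew_monom 1 (sh (\<lambda>_. - int N)) = f"
    proof -
      interpret ring R by (rule ring_R)
      have "g \<otimes>\<^bsub>R\<^esub> skew_monom 1 (sh (\<lambda>_. - int N)) = f \<otimes>\<^bsub>R\<^esub> \<one>\<^bsub>R\<^esub>"
        unfolding g_def R_assoc[OF c R_monom[OF sh_in_M] R_monom[OF sh_in_M]]
          monom_mult_monom[OF sh_in_M sh_in_M] sh_add aut_1[OF sh_aut] one_eq by (simp add: sh_0)
      also have "\<dots> = f" by (rule r_one[OF c])
      finally show ?thesis .
    qed
    ultimately show "f \<in> generated" by simp
  qed
qed (rule generated_torus_inv)

section \<open>The Galois order\<close>

lemma Galois_ring: "Galois_ring rf_consts Gam Gal M torus_inv"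
  unfolding Galois_ring_def fractions_Gam
proof (intro conjI)
  have UC: "torus_inv \<subseteq> carrier R" using torus_inv_carrier by blast
  show "Galois_data rf_consts Gam Gal M" by (rule Galois_data)
  show "subring torus_inv R" by (rule subring_torus_inv)
  show "skew_const ` Gam \<subseteq> torus_inv" using skew_const_torus_inv by blast
  show "torus_inv \<subseteq> skew_inv" by (simp add: torus_inv_def)
  show "\<exists>F. finite F \<and> F \<subseteq> torus_inv \<and> torus_inv = generate_ring R (skew_const ` Gam \<union> F)"
    using finite_gens gens_torus_inv torus_inv_generated by blast
  show "left_span R (skew_const ` K0) torus_inv = skew_inv" by (simp add: left_span_eq[OF subr_K0 UC] lspan_K0_torus_inv)
  show "right_span R (skew_const ` K0) torus_inv = skew_inv" by (rule right_span_K0_torus_inv)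
qed

theorem Galois_order: "Galois_order rf_consts Gam Gal M torus_inv"
  unfolding Galois_order_def left_Galois_order_def right_Galois_order_def fractions_Gam Let_def
proof (intro conjI Galois_ring allI impI)
  fix E assume E: "finite E \<and> E \<subseteq> skew_inv"
  hence EC: "E \<subseteq> carrier R" using skew_inv_carrier by blast
  obtain F where F: "finite F" "F \<subseteq> lspan K0 E \<inter> torus_inv" "lspan K0 E \<inter> torus_inv = lspan Gam F"
    using left_order[of E] E by blast
  hence FC: "F \<subseteq> carrier R" using torus_inv_carrier by blast
  show "\<exists>F. finite F \<and> F \<subseteq> left_span R (skew_const ` K0) E \<inter> torus_inv \<and>
      left_span R (skew_const ` K0) E \<inter> torus_inv = left_span R (skew_const ` Gam) F"
    unfolding left_span_eq[OF subr_K0 EC] using F left_span_eq[OF subr_Gam FC] by (intro exI[of _ F]) simp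
next
  fix E assume "finite E \<and> E \<subseteq> skew_inv"
  thus "\<exists>F. finite F \<and> F \<subseteq> right_span R (skew_const ` K0) E \<inter> torus_inv \<and>
      right_span R (skew_const ` K0) E \<inter> torus_inv = right_span R (skew_const ` Gam) F"
    using right_order[of E] by blast
qed

lemma embedded_torus_inv: "torus_embedding q ` torus_invariants q H = torus_inv"
proof -
  have "torus_embedding q ` torus_invariants q H = {f \<in> laurent_skew. \<forall>h\<in>H. skew_act (ma h) f = f}"
    by (rule embedded_invariants) (auto simp: H_nonzero H_bij)
  also have "\<dots> = torus_inv" by (auto simp: torus_inv_def skew_invariants_def Gal_def laurent_skew_def)
  finally show ?thesis .
qed

end

theorem theorem2:
  fixes q :: "'k::{alg_closed_field, field_char_0}" and m p :: nat
    and G :: "(('n::{finite, linorder} \<Rightarrow> 'k) \<times> ('n \<Rightarrow> 'n)) monoid"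
    and \<Gamma> :: "('n, 'k) ratfun set"
    and U :: "((('n, 'k) ratfun \<Rightarrow> ('n, 'k) ratfun) \<Rightarrow> ('n, 'k) ratfun) set"
  assumes "q \<noteq> 0" and "\<And>j::nat. j > 0 \<Longrightarrow> q ^ j \<noteq> 1"
    and "m \<ge> 1" and "p > 0" and "p dvd m"
    and "G = Gmp m p"
    and "\<Gamma> = laurent_invariants (carrier G)"
    and "U = torus_embedding q ` torus_invariants q (carrier G)"
  shows "Galois_order rf_consts \<Gamma> (monomial_aut ` carrier G) (q_shifts q) U \<and>
         left_free (skew_ring (q_shifts q)) (skew_const ` \<Gamma>) U \<and>
         right_free (skew_ring (q_shifts q)) (skew_const ` \<Gamma>) U"
proof -
  interpret gmp q "TYPE('n)" m p
    by unfold_locales (use assms in auto)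
  have "\<Gamma> = Gam" "monomial_aut ` carrier G = Gal" "U = torus_inv"
    unfolding assms(6-8) Gam_def Gal_def embedded_torus_inv by (rule refl)+
  thus ?thesis using Galois_order left_free_torus_inv right_free_torus_inv by simp
qed

end
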